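(* Let $k$ be a field, $A$ a finite dimensional $k$-algebra, and $\mathrm{mod}\text{-}A$ the category of all finitely generated right $A$-modules. Let $\mathcal{C}$ be a skeleton of $\mathrm{mod}\text{-}A$, and set $\Gamma:=\mathcal{C}_0\times\mathcal{C}_0$. The following statements are equivalent: (1) $A$ is representation-finite. (2) $R_{\mathcal{C}}$ is a right (resp. left) $\Gamma_0$-artinian ring. (3) $\mathrm{rad}^{\mathrm{gr}}(R_{\mathcal{C}})$ is nilpotent. (4) $\mathrm{rad}^{\mathrm{gr}}(R_{\mathcal{C}})$ is right (resp. left) objectwise nilpotent. (5) $\bigcap_{n\in\mathbb{N}}\big(\mathrm{rad}^{\mathrm{gr}}(R_{\mathcal{C}})\big)^n=0$.
   Context: $A$ is unital and associative; it is representation-finite if there are only finitely many isomorphism classes of indecomposable finitely generated right $A$-modules. A skeleton of $\mathrm{mod}\text{-}A$ is a (small) full subcategory containing exactly one object from each isomorphism class; $\mathcal{C}_0$ is its set of objects and $\mathcal{C}(X,Y)=\mathrm{Hom}_A(X,Y)$. $\Gamma=\mathcal{C}_0\times\mathcal{C}_0$ is the groupoid with $(Z,Y)(Y,X)=(Z,X)$ (other products undefined); its set of identities is $\Gamma_0=\{(X,X):X\in\mathcal{C}_0\}$. The ring $R_{\mathcal{C}}:=\bigoplus_{X,Y\in\mathcal{C}_0}\mathcal{C}(X,Y)$ has multiplication determined by $g\cdot g'=g\circ g'$ when the composition is possible and $0$ otherwise; it is $\Gamma$-graded by $(R_{\mathcal{C}})_{(Y,X)}=\mathcal{C}(X,Y)$.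 For $e=(X,X)$, $1_e=\mathrm{id}_X$. A one- or two-sided ideal $U$ of $R_{\mathcal{C}}$ is graded if $U=\bigoplus_\gamma (U\cap (R_{\mathcal{C}})_\gamma)$. Write $R=R_{\mathcal{C}}$. $R$ is right (resp. left) $\Gamma_0$-artinian if for every $e\in\Gamma_0$ there is no infinite strictly decreasing chain of graded right ideals contained in $1_eR$ (resp. graded left ideals contained in $R1_e$). $\mathrm{rad}^{\mathrm{gr}}(R)$ is the intersection of all gr-maximal graded right ideals of $R$ (those maximal among proper graded right ideals); it is a graded two-sided ideal. A graded ideal $U$ is nilpotent if $U^n=0$ for some positive integer $n$, and right (resp. left) objectwise nilpotent if for each $e\in\Gamma_0$ there is a positive integer $n_e$ with $1_eU^{n_e}=0$ (resp. $U^{n_e}1_e=0$). The intersection in (5) is over $n\ge1$. "Right (resp. left)" means that the equivalence holds both for the right versions and for the left versions. *)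

theory Defs
  imports "HOL-Algebra.Module" "HOL-Algebra.Product_Groups" "HOL-Algebra.Ideal_Product"
begin

section \<open>Finite dimensional algebras and right modules\<close>

text \<open>The algebra is not assumed commutative (so the locale \<open>algebra\<close> of the library does not
  apply), and it may be zero.\<close>

locale fin_dim_algebra = K?: field K + A?: ring A + module K A
  for K :: "('k, 'x) ring_scheme" (structure)
    and A :: "('k, 'a, 'y) module_scheme" (structure) +
  assumes smult_mult_left: "\<lbrakk>c \<in> carrier K; x \<in> carrier A; y \<in> carrier A\<rbrakk>
      \<Longrightarrow> (c \<odot>\<^bsub>A\<^esub> x) \<otimes>\<^bsub>A\<^esub> y = c \<odot>\<^bsub>A\<^esub> (x \<otimes>\<^bsub>A\<^esub> y)"
    and smult_mult_right: "\<lbrakk>c \<in> carrier K; x \<in> carrier A; y \<in> carrier A\<rbrakk>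
      \<Longrightarrow> x \<otimes>\<^bsub>A\<^esub> (c \<odot>\<^bsub>A\<^esub> y) = c \<odot>\<^bsub>A\<^esub> (x \<otimes>\<^bsub>A\<^esub> y)"
    and finite_dim: "\<exists>B. finite B \<and> B \<subseteq> carrier A \<and>
      (\<forall>x \<in> carrier A. \<exists>c \<in> B \<rightarrow> carrier K. x = (\<Oplus>\<^bsub>A\<^esub>b\<in>B. c b \<odot>\<^bsub>A\<^esub> b))"

text \<open>Right modules use the module records of the library, with \<open>a \<odot>\<^bsub>M\<^esub> x\<close> read as \<open>x \<cdot> a\<close>; hence the
  order of the factors in \<open>smult_assoc\<close>. The multiplicative fields of \<open>M\<close> are meaningless.\<close>

locale right_module = A?: ring A + M?: abelian_group M
  for A :: "('a, 'r) ring_scheme" (structure)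
    and M :: "('a, 'm, 'z) module_scheme" (structure) +
  assumes smult_closed: "\<lbrakk>a \<in> carrier A; x \<in> carrier M\<rbrakk> \<Longrightarrow> a \<odot>\<^bsub>M\<^esub> x \<in> carrier M"
    and smult_add_ring: "\<lbrakk>a \<in> carrier A; b \<in> carrier A; x \<in> carrier M\<rbrakk>
      \<Longrightarrow> (a \<oplus>\<^bsub>A\<^esub> b) \<odot>\<^bsub>M\<^esub> x = a \<odot>\<^bsub>M\<^esub> x \<oplus>\<^bsub>M\<^esub> b \<odot>\<^bsub>M\<^esub> x"
    and smult_add_module: "\<lbrakk>a \<in> carrier A; x \<in> carrier M; y \<in> carrier M\<rbrakk>
      \<Longrightarrow> a \<odot>\<^bsub>M\<^esub> (x \<oplus>\<^bsub>M\<^esub> y) = a \<odot>\<^bsub>M\<^esub> x \<oplus>\<^bsub>M\<^esub> a \<odot>\<^bsub>M\<^esub> y"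
    and smult_assoc: "\<lbrakk>a \<in> carrier A; b \<in> carrier A; x \<in> carrier M\<rbrakk>
      \<Longrightarrow> (a \<otimes>\<^bsub>A\<^esub> b) \<odot>\<^bsub>M\<^esub> x = b \<odot>\<^bsub>M\<^esub> (a \<odot>\<^bsub>M\<^esub> x)"
    and smult_one: "x \<in> carrier M \<Longrightarrow> \<one>\<^bsub>A\<^esub> \<odot>\<^bsub>M\<^esub> x = x"

definition fg_right_module :: "('a, 'r) ring_scheme \<Rightarrow> ('a, 'm, 'z) module_scheme \<Rightarrow> bool" where
  "fg_right_module A M \<longleftrightarrow> right_module A M \<and>
     (\<exists>S. finite S \<and> S \<subseteq> carrier M \<and>
       (\<forall>x \<in> carrier M. \<exists>a \<in> S \<rightarrow> carrier A. x = (\<Oplus>\<^bsub>M\<^esub>s\<in>S. a s \<odot>\<^bsub>M\<^esub> s)))"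

text \<open>The library predicate \<open>submodule\<close> does not depend on the side of the action.\<close>

definition indecomposable :: "('a, 'r) ring_scheme \<Rightarrow> ('a, 'm, 'z) module_scheme \<Rightarrow> bool" where
  "indecomposable A M \<longleftrightarrow> carrier M \<noteq> {\<zero>\<^bsub>M\<^esub>} \<and>
     \<not> (\<exists>U V. submodule U A M \<and> submodule V A M \<and> U \<noteq> {\<zero>\<^bsub>M\<^esub>} \<and> V \<noteq> {\<zero>\<^bsub>M\<^esub>} \<and>
            U \<inter> V = {\<zero>\<^bsub>M\<^esub>} \<and> U <+>\<^bsub>M\<^esub> V = carrier M)"

text \<open>Homomorphisms are extensional functions, so that equality of functions is equality of
  homomorphisms.\<close>

definition mod_hom :: "('a, 'r) ring_scheme \<Rightarrow> ('a, 'm, 'y) module_scheme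
    \<Rightarrow> ('a, 'n, 'z) module_scheme \<Rightarrow> ('m \<Rightarrow> 'n) set" where
  "mod_hom A M N = {f \<in> carrier M \<rightarrow>\<^sub>E carrier N.
     (\<forall>x \<in> carrier M. \<forall>y \<in> carrier M. f (x \<oplus>\<^bsub>M\<^esub> y) = f x \<oplus>\<^bsub>N\<^esub> f y) \<and>
     (\<forall>a \<in> carrier A. \<forall>x \<in> carrier M. f (a \<odot>\<^bsub>M\<^esub> x) = a \<odot>\<^bsub>N\<^esub> f x)}"

definition mod_iso :: "('a, 'r) ring_scheme \<Rightarrow> ('a, 'm, 'y) module_scheme
    \<Rightarrow> ('a, 'n, 'z) module_scheme \<Rightarrow> bool" where
  "mod_iso A M N \<longleftrightarrow> (\<exists>f \<in> mod_hom A M N. bij_betw f (carrier M) (carrier N))"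

definition hom_group :: "('a, 'r) ring_scheme \<Rightarrow> ('a, 'm) module \<Rightarrow> ('a, 'm) module
    \<Rightarrow> ('m \<Rightarrow> 'm) monoid" where
  "hom_group A M N = \<lparr>carrier = mod_hom A M N,
     monoid.mult = (\<lambda>f g. \<lambda>x\<in>carrier M. f x \<oplus>\<^bsub>N\<^esub> g x),
     one = (\<lambda>x\<in>carrier M. \<zero>\<^bsub>N\<^esub>)\<rparr>"

text \<open>HOL cannot quantify over the modules of all types inside a definition. Modules whose elements
  are sets of sequences in \<open>A\<close> suffice: they include a copy of every quotient of some \<open>A\<^sup>n\<close>.
  See \<open>fg_universe\<close> below.\<close>

type_synonym 'a fg_mod = "('a, (nat \<Rightarrow> 'a) set) module"

definition indecs :: "('a, 'r) ring_scheme \<Rightarrow> 'a fg_mod set" where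
  "indecs A = {M. fg_right_module A M \<and> indecomposable A M}"

definition representation_finite :: "('a, 'r) ring_scheme \<Rightarrow> bool" where
  "representation_finite A \<longleftrightarrow>
     finite (indecs A // {(M, N). M \<in> indecs A \<and> N \<in> indecs A \<and> mod_iso A M N})"

text \<open>The set of objects of a skeleton of mod-\<open>A\<close>; as the subcategory is full, its morphisms are
  all module homomorphisms. The elements of the objects may have any type \<open>'m\<close>.\<close>

definition is_skeleton :: "('a, 'r) ring_scheme \<Rightarrow> ('a, 'm) module set \<Rightarrow> bool" where
  "is_skeleton A \<C> \<longleftrightarrow> (\<forall>X \<in> \<C>. fg_right_module A X) \<and>
     (\<forall>M :: 'a fg_mod. fg_right_module A M \<longrightarrow> (\<exists>X \<in> \<C>. mod_iso A M X)) \<and>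
     (\<forall>X \<in> \<C>. \<forall>Y \<in> \<C>. mod_iso A X Y \<longrightarrow> X = Y)"

lemma transport_right_module:
  fixes M :: "('a, 'm, 'z) module_scheme" and h :: "'m \<Rightarrow> 'n"
  assumes M: "right_module A M" and inj: "inj_on h (carrier M)"
  shows "\<exists>N :: ('a, 'n) module. right_module A N \<and>
    (\<exists>f \<in> mod_hom A M N. bij_betw f (carrier M) (carrier N))"
proof -
  interpret M: right_module A M by fact
  define g where "g = inv_into (carrier M) h"
  define N :: "('a, 'n) module" where
    "N = \<lparr>carrier = h ` carrier M, monoid.mult = undefined, one = undefined, zero = h \<zero>\<^bsub>M\<^esub>,
      add = (\<lambda>x y. h (g x \<oplus>\<^bsub>M\<^esub> g y)), smult = (\<lambda>a x. h (a \<odot>\<^bsub>M\<^esub> g x))\<rparr>"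
  have gh[simp]: "g (h x) = x" if "x \<in> carrier M" for x
    using that inj by (simp add: g_def)
  note [simp] = M.smult_closed
  have N_simps[simp]: "carrier N = h ` carrier M" "\<zero>\<^bsub>N\<^esub> = h \<zero>\<^bsub>M\<^esub>"
    "x \<oplus>\<^bsub>N\<^esub> y = h (g x \<oplus>\<^bsub>M\<^esub> g y)" "a \<odot>\<^bsub>N\<^esub> x = h (a \<odot>\<^bsub>M\<^esub> g x)" for a x y
    by (simp_all add: N_def)
  have N: "abelian_group N"
  proof (rule abelian_groupI)
    fix x assume "x \<in> carrier N"
    then obtain y where "y \<in> carrier M" "x = h y" by auto
    then show "\<exists>y\<in>carrier N. y \<oplus>\<^bsub>N\<^esub> x = \<zero>\<^bsub>N\<^esub>"
      by (intro bexI[of _ "h (\<ominus>\<^bsub>M\<^esub> y)"]) (simp_all add: M.M.l_neg)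
  qed (auto simp: M.M.a_ac)
  have "right_module_axioms A N"
    by unfold_locales
      (auto simp: M.smult_add_ring M.smult_add_module M.smult_assoc M.smult_one)
  with N have "right_module A N"
    by (intro right_module.intro M.A.ring_axioms)
  moreover have "restrict h (carrier M) \<in> mod_hom A M N"
    by (simp add: mod_hom_def)
  moreover have "bij_betw (restrict h (carrier M)) (carrier M) (carrier N)"
    using inj by (simp add: bij_betw_def inj_on_def)
  ultimately show ?thesis by blast
qed

lemma mod_hom_finsum:
  assumes M: "right_module A M" and N: "right_module A N" and f: "f \<in> mod_hom A M N"
    and "finite S" and u: "u \<in> S \<rightarrow> carrier M"
  shows "f (finsum M u S) = finsum N (\<lambda>s. f (u s)) S"
  using \<open>finite S\<close> u
proof (induction S)
  interpret M: right_module A M by fact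
  interpret N: right_module A N by fact
  have fM: "f x \<in> carrier N" if "x \<in> carrier M" for x
    using f that by (auto simp: mod_hom_def)
  {
    case empty
    have "f \<zero>\<^bsub>M\<^esub> \<oplus>\<^bsub>N\<^esub> f \<zero>\<^bsub>M\<^esub> = f (\<zero>\<^bsub>M\<^esub> \<oplus>\<^bsub>M\<^esub> \<zero>\<^bsub>M\<^esub>)"
      using f by (simp only: mod_hom_def mem_Collect_eq M.zero_closed)
    then have "f \<zero>\<^bsub>M\<^esub> = \<zero>\<^bsub>N\<^esub>"
      using fM[of "\<zero>\<^bsub>M\<^esub>"] by (simp add: N.add.l_cancel_one)
    then show ?case by simp
  next
    case (insert s S)
    then have "(\<lambda>s. f (u s)) \<in> insert s S \<rightarrow> carrier N" using fM by auto
    with insert show ?case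
      using f by (auto simp: M.finsum_insert N.finsum_insert mod_hom_def Pi_iff)
  }
qed

lemma fg_right_module_iso:
  assumes M: "fg_right_module A M" and N: "right_module A N" and f: "f \<in> mod_hom A M N"
    and bij: "bij_betw f (carrier M) (carrier N)"
  shows "fg_right_module A N"
proof -
  obtain S where S: "finite S" "S \<subseteq> carrier M"
    and gen: "\<And>x. x \<in> carrier M \<Longrightarrow> \<exists>a \<in> S \<rightarrow> carrier A. x = (\<Oplus>\<^bsub>M\<^esub>s\<in>S. a s \<odot>\<^bsub>M\<^esub> s)"
    and M': "right_module A M"
    using M unfolding fg_right_module_def by blast
  interpret M: right_module A M by fact
  interpret N: right_module A N by fact
  have injS: "inj_on f S" using bij S by (auto simp: bij_betw_def inj_on_subset)
  have fS: "f ` S \<subseteq> carrier N" using bij S by (auto simp: bij_betw_def)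
  have "\<exists>a \<in> f ` S \<rightarrow> carrier A. y = (\<Oplus>\<^bsub>N\<^esub>t\<in>f ` S. a t \<odot>\<^bsub>N\<^esub> t)" if "y \<in> carrier N" for y
  proof -
    obtain x where x: "x \<in> carrier M" "y = f x" using \<open>y \<in> carrier N\<close> bij by (auto simp: bij_betw_def)
    obtain a where a: "a \<in> S \<rightarrow> carrier A" "x = (\<Oplus>\<^bsub>M\<^esub>s\<in>S. a s \<odot>\<^bsub>M\<^esub> s)" using gen[OF x(1)] by blast
    let ?b = "a \<circ> inv_into S f"
    have "y = (\<Oplus>\<^bsub>N\<^esub>s\<in>S. f (a s \<odot>\<^bsub>M\<^esub> s))"
      unfolding x(2) a(2) using S a
      by (intro mod_hom_finsum[OF M' N f]) (auto intro!: M.smult_closed)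
    also have "\<dots> = (\<Oplus>\<^bsub>N\<^esub>s\<in>S. ?b (f s) \<odot>\<^bsub>N\<^esub> f s)"
      using S a fS f injS
      by (intro N.finsum_cong') (auto simp: mod_hom_def Pi_iff subset_iff intro!: N.smult_closed)
    also have "\<dots> = (\<Oplus>\<^bsub>N\<^esub>t\<in>f ` S. ?b t \<odot>\<^bsub>N\<^esub> t)"
      using S a fS injS
      by (intro N.finsum_reindex[symmetric]) (auto intro!: N.smult_closed)
    finally show ?thesis
      using a injS by (intro bexI[of _ ?b]) auto
  qed
  then show ?thesis
    unfolding fg_right_module_def using N S fS by blast
qed

lemma fg_universe:
  fixes M :: "('a, 'm, 'z) module_scheme"
  assumes "fg_right_module A M"
  shows "\<exists>N :: 'a fg_mod. fg_right_module A N \<and> mod_iso A M N"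
proof -
  obtain S where S: "finite S" "S \<subseteq> carrier M"
    and gen: "\<And>x. x \<in> carrier M \<Longrightarrow> \<exists>a \<in> S \<rightarrow> carrier A. x = (\<Oplus>\<^bsub>M\<^esub>s\<in>S. a s \<odot>\<^bsub>M\<^esub> s)"
    and M: "right_module A M"
    using assms unfolding fg_right_module_def by blast
  interpret M: right_module A M by fact
  obtain e :: "'m \<Rightarrow> nat" where e: "inj_on e S"
    using finite_imp_inj_to_nat_seg[OF S(1)] by auto
  define ev where "ev w = (\<Oplus>\<^bsub>M\<^esub>s\<in>S. w (e s) \<odot>\<^bsub>M\<^esub> s)" for w :: "nat \<Rightarrow> 'a"
  define h where "h x = {w. ev w = x}" for x
  have ev: "\<exists>w. ev w = x" if x: "x \<in> carrier M" for x
  proof -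
    obtain a where a: "a \<in> S \<rightarrow> carrier A" and xa: "x = (\<Oplus>\<^bsub>M\<^esub>s\<in>S. a s \<odot>\<^bsub>M\<^esub> s)"
      using gen[OF x] by blast
    have "ev (a \<circ> inv_into S e) = (\<Oplus>\<^bsub>M\<^esub>s\<in>S. a s \<odot>\<^bsub>M\<^esub> s)"
      unfolding ev_def
    proof (rule M.M.finsum_cong'[OF refl])
      show "(\<lambda>s. a s \<odot>\<^bsub>M\<^esub> s) \<in> S \<rightarrow> carrier M"
        using a S(2) by (intro Pi_I M.smult_closed) auto
      show "(a \<circ> inv_into S e) (e s) \<odot>\<^bsub>M\<^esub> s = a s \<odot>\<^bsub>M\<^esub> s" if "s \<in> S" for s
        using inv_into_f_f[OF e that] by simp
    qed
    then show ?thesis using xa by metis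
  qed
  have inj: "inj_on h (carrier M)"
  proof (rule inj_onI)
    fix x y assume x: "x \<in> carrier M" and eq: "h x = h y"
    obtain w where w: "ev w = x" using ev[OF x] by blast
    then have "w \<in> h y" unfolding eq[symmetric] by (simp add: h_def)
    with w show "x = y" by (simp add: h_def)
  qed
  obtain N :: "'a fg_mod" and f where N: "right_module A N" and f: "f \<in> mod_hom A M N"
    and bij: "bij_betw f (carrier M) (carrier N)"
    using transport_right_module[OF M inj] by blast
  have "fg_right_module A N"
    by (rule fg_right_module_iso[OF assms N f bij])
  moreover have "mod_iso A M N"
    unfolding mod_iso_def by (rule bexI[where x = f, OF _ f]) (rule bij)
  ultimately show ?thesis by (intro exI conjI)
qed


section \<open>Graded rings with local units\<close>

text \<open>Groupoid gradings: \<open>degrees\<close> is the groupoid, \<open>idents\<close> its set of identities, \<open>grade \<gamma>\<close> the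
  homogeneous component of degree \<open>\<gamma>\<close>, and \<open>local_unit e\<close> the element \<open>1\<^sub>e\<close>. These rings need not be
  unital, and their field \<open>one\<close> is never used.\<close>

record ('r, 'g) graded_ring = "'r ring" +
  degrees :: "'g set"
  idents :: "'g set"
  grade :: "'g \<Rightarrow> 'r set"
  local_unit :: "'g \<Rightarrow> 'r"

text \<open>\<open>U = \<Oplus>\<^sub>\<gamma> (U \<inter> R\<^sub>\<gamma>)\<close>; directness is inherited from \<open>R = \<Oplus>\<^sub>\<gamma> R\<^sub>\<gamma>\<close>.\<close>

definition graded_subset :: "('r, 'g) graded_ring \<Rightarrow> 'r set \<Rightarrow> bool" where
  "graded_subset R U \<longleftrightarrow>
     U = {finsum R u F | u F. finite F \<and> F \<subseteq> degrees R \<and> (\<forall>\<gamma> \<in> F. u \<gamma> \<in> U \<inter> grade R \<gamma>)}"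

definition graded_right_ideal :: "('r, 'g) graded_ring \<Rightarrow> 'r set \<Rightarrow> bool" where
  "graded_right_ideal R U \<longleftrightarrow> additive_subgroup U R \<and>
     (\<forall>u \<in> U. \<forall>r \<in> carrier R. u \<otimes>\<^bsub>R\<^esub> r \<in> U) \<and> graded_subset R U"

definition graded_left_ideal :: "('r, 'g) graded_ring \<Rightarrow> 'r set \<Rightarrow> bool" where
  "graded_left_ideal R U \<longleftrightarrow> additive_subgroup U R \<and>
     (\<forall>u \<in> U. \<forall>r \<in> carrier R. r \<otimes>\<^bsub>R\<^esub> u \<in> U) \<and> graded_subset R U"

definition right_artinian :: "('r, 'g) graded_ring \<Rightarrow> bool" where
  "right_artinian R \<longleftrightarrow> (\<forall>e \<in> idents R. \<not> (\<exists>U :: nat \<Rightarrow> 'r set.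
     (\<forall>n. graded_right_ideal R (U n) \<and> U n \<subseteq> {local_unit R e \<otimes>\<^bsub>R\<^esub> r | r. r \<in> carrier R}) \<and>
     (\<forall>n. U (Suc n) \<subset> U n)))"

definition left_artinian :: "('r, 'g) graded_ring \<Rightarrow> bool" where
  "left_artinian R \<longleftrightarrow> (\<forall>e \<in> idents R. \<not> (\<exists>U :: nat \<Rightarrow> 'r set.
     (\<forall>n. graded_left_ideal R (U n) \<and> U n \<subseteq> {r \<otimes>\<^bsub>R\<^esub> local_unit R e | r. r \<in> carrier R}) \<and>
     (\<forall>n. U (Suc n) \<subset> U n)))"

definition gr_maximal_right_ideal :: "('r, 'g) graded_ring \<Rightarrow> 'r set \<Rightarrow> bool" where
  "gr_maximal_right_ideal R U \<longleftrightarrow> graded_right_ideal R U \<and> U \<noteq> carrier R \<and>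
     (\<forall>V. graded_right_ideal R V \<and> V \<noteq> carrier R \<and> U \<subseteq> V \<longrightarrow> V = U)"

text \<open>The intersection of the empty family is \<open>R\<close>; this matters only for \<open>R = 0\<close>.\<close>

definition rad_gr :: "('r, 'g) graded_ring \<Rightarrow> 'r set" where
  "rad_gr R = carrier R \<inter> \<Inter> {U. gr_maximal_right_ideal R U}"

text \<open>Only positive exponents are used. \<open>ideal_prod\<close> consists of the nonempty finite sums of products
  and makes no use of a unit.\<close>

fun ideal_power :: "('r, 'z) ring_scheme \<Rightarrow> 'r set \<Rightarrow> nat \<Rightarrow> 'r set" where
  "ideal_power R U 0 = carrier R"
| "ideal_power R U (Suc 0) = U"
| "ideal_power R U (Suc (Suc n)) = ideal_prod R (ideal_power R U (Suc n)) U"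

definition nilpotent_ideal :: "('r, 'z) ring_scheme \<Rightarrow> 'r set \<Rightarrow> bool" where
  "nilpotent_ideal R U \<longleftrightarrow> (\<exists>n \<ge> 1. ideal_power R U n = {\<zero>\<^bsub>R\<^esub>})"

definition right_objectwise_nilpotent :: "('r, 'g) graded_ring \<Rightarrow> 'r set \<Rightarrow> bool" where
  "right_objectwise_nilpotent R U \<longleftrightarrow> (\<forall>e \<in> idents R. \<exists>n \<ge> 1.
     {local_unit R e \<otimes>\<^bsub>R\<^esub> u | u. u \<in> ideal_power R U n} = {\<zero>\<^bsub>R\<^esub>})"

definition left_objectwise_nilpotent :: "('r, 'g) graded_ring \<Rightarrow> 'r set \<Rightarrow> bool" where
  "left_objectwise_nilpotent R U \<longleftrightarrow> (\<forall>e \<in> idents R. \<exists>n \<ge> 1.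
     {u \<otimes>\<^bsub>R\<^esub> local_unit R e | u. u \<in> ideal_power R U n} = {\<zero>\<^bsub>R\<^esub>})"


section \<open>The ring of a skeleton\<close>

text \<open>The element of \<open>\<Oplus>\<^bsub>X,Y\<^esub> \<C>(X, Y)\<close> with the single component \<open>f : X \<rightarrow> Y\<close> at \<open>(Y, X)\<close>.\<close>

definition homogeneous :: "('a, 'r) ring_scheme \<Rightarrow> ('a, 'm) module set
    \<Rightarrow> ('a, 'm) module \<times> ('a, 'm) module \<Rightarrow> ('m \<Rightarrow> 'm)
    \<Rightarrow> ('a, 'm) module \<times> ('a, 'm) module \<Rightarrow> ('m \<Rightarrow> 'm)" where
  "homogeneous A \<C> \<gamma> f =
     (\<lambda>\<delta> \<in> \<C> \<times> \<C>. if \<delta> = \<gamma> then f else \<one>\<^bsub>hom_group A (snd \<delta>) (fst \<delta>)\<^esub>)"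

text \<open>The direct sum of the additive groups \<open>\<C>(X, Y)\<close>, whose component at \<open>(Y, X)\<close> is \<open>\<C>(X, Y)\<close>. The
  product has \<open>(Z, X)\<close>-component \<open>\<Sum>\<^sub>Y f\<^bsub>(Z,Y)\<^esub> \<circ> g\<^bsub>(Y,X)\<^esub>\<close>. As \<open>finprod\<close> is trivial over infinite index
  sets, the sum is restricted to the finitely many \<open>Y\<close> for which both factors are nonzero.\<close>

definition skeleton_ring :: "('a, 'r) ring_scheme \<Rightarrow> ('a, 'm) module set
    \<Rightarrow> (('a, 'm) module \<times> ('a, 'm) module \<Rightarrow> ('m \<Rightarrow> 'm), ('a, 'm) module \<times> ('a, 'm) module)
        graded_ring" where
  "skeleton_ring A \<C> =
    (let S = sum_group (\<C> \<times> \<C>) (\<lambda>(Y, X). hom_group A X Y) in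
     \<lparr>carrier = carrier S,
      monoid.mult = (\<lambda>f g. restrict (\<lambda>(Z, X).
        finprod (hom_group A X Z) (\<lambda>Y. compose (carrier X) (f (Z, Y)) (g (Y, X)))
          {Y \<in> \<C>. f (Z, Y) \<noteq> \<one>\<^bsub>hom_group A Y Z\<^esub> \<and> g (Y, X) \<noteq> \<one>\<^bsub>hom_group A X Y\<^esub>}) (\<C> \<times> \<C>)),
      one = undefined,
      zero = \<one>\<^bsub>S\<^esub>,
      add = monoid.mult S,
      degrees = \<C> \<times> \<C>,
      idents = {(X, X) | X. X \<in> \<C>},
      grade = (\<lambda>(Y, X). {homogeneous A \<C> (Y, X) f | f. f \<in> mod_hom A X Y}),
      local_unit = (\<lambda>(X, _). homogeneous A \<C> (X, X) (\<lambda>x \<in> carrier X. x))\<rparr>)"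

lemma hom_group_comm_group:
  assumes "right_module A M" "right_module A N"
  shows "comm_group (hom_group A M N)"
proof -
  interpret M: right_module A M by fact
  interpret N: right_module A N by fact
  have fN: "f x \<in> carrier N" if "f \<in> mod_hom A M N" "x \<in> carrier M" for f x
    using that by (auto simp: mod_hom_def)
  have smult_zero: "a \<odot>\<^bsub>N\<^esub> \<zero>\<^bsub>N\<^esub> = \<zero>\<^bsub>N\<^esub>" if "a \<in> carrier A" for a
    using N.smult_add_module[OF that, of "\<zero>\<^bsub>N\<^esub>" "\<zero>\<^bsub>N\<^esub>"] N.smult_closed[OF that, of "\<zero>\<^bsub>N\<^esub>"]
    by (simp add: N.M.add.l_cancel_one)
  show ?thesis
  proof (rule comm_groupI)
    show "\<one>\<^bsub>hom_group A M N\<^esub> \<in> carrier (hom_group A M N)"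
      by (simp add: hom_group_def mod_hom_def smult_zero M.smult_closed)
  next
    fix f g assume fg: "f \<in> carrier (hom_group A M N)" "g \<in> carrier (hom_group A M N)"
    then have "f \<in> mod_hom A M N" "g \<in> mod_hom A M N" by (simp_all add: hom_group_def)
    note fN[OF this(1)] fN[OF this(2)]
    with fg show "f \<otimes>\<^bsub>hom_group A M N\<^esub> g \<in> carrier (hom_group A M N)"
      by (simp add: hom_group_def mod_hom_def M.smult_closed N.smult_add_module N.M.a_ac)
    from \<open>\<And>x. x \<in> carrier M \<Longrightarrow> f x \<in> carrier N\<close> \<open>\<And>x. x \<in> carrier M \<Longrightarrow> g x \<in> carrier N\<close>
    show "f \<otimes>\<^bsub>hom_group A M N\<^esub> g = g \<otimes>\<^bsub>hom_group A M N\<^esub> f"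
      by (auto simp: hom_group_def N.M.a_comm intro!: restrict_ext)
  next
    fix f g h assume "f \<in> carrier (hom_group A M N)" "g \<in> carrier (hom_group A M N)"
      "h \<in> carrier (hom_group A M N)"
    then show "f \<otimes>\<^bsub>hom_group A M N\<^esub> g \<otimes>\<^bsub>hom_group A M N\<^esub> h =
        f \<otimes>\<^bsub>hom_group A M N\<^esub> (g \<otimes>\<^bsub>hom_group A M N\<^esub> h)"
      by (auto simp: hom_group_def fN N.M.a_assoc intro!: restrict_ext)
  next
    fix f assume f: "f \<in> carrier (hom_group A M N)"
    then have f': "f \<in> mod_hom A M N" "f \<in> extensional (carrier M)"
      by (auto simp: hom_group_def mod_hom_def PiE_def)
    show "\<one>\<^bsub>hom_group A M N\<^esub> \<otimes>\<^bsub>hom_group A M N\<^esub> f = f"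
      using f' by (auto simp: hom_group_def fN intro!: extensionalityI[of _ "carrier M"])
    have smult_neg: "a \<odot>\<^bsub>N\<^esub> (\<ominus>\<^bsub>N\<^esub> y) = \<ominus>\<^bsub>N\<^esub> (a \<odot>\<^bsub>N\<^esub> y)" if "a \<in> carrier A" "y \<in> carrier N" for a y
    proof (rule N.M.minus_equality[symmetric])
      show "a \<odot>\<^bsub>N\<^esub> (\<ominus>\<^bsub>N\<^esub> y) \<oplus>\<^bsub>N\<^esub> a \<odot>\<^bsub>N\<^esub> y = \<zero>\<^bsub>N\<^esub>"
        using that by (simp add: N.smult_add_module[symmetric] N.M.l_neg smult_zero)
    qed (use that in \<open>simp_all add: N.smult_closed\<close>)
    have "(\<lambda>x\<in>carrier M. \<ominus>\<^bsub>N\<^esub> f x) \<in> mod_hom A M N"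
      using f'(1) fN[OF f'(1)] by (simp add: mod_hom_def M.smult_closed smult_neg N.M.minus_add)
    moreover have "(\<lambda>x\<in>carrier M. \<ominus>\<^bsub>N\<^esub> f x) \<otimes>\<^bsub>hom_group A M N\<^esub> f = \<one>\<^bsub>hom_group A M N\<^esub>"
      using fN[OF f'(1)] by (auto simp: hom_group_def N.M.l_neg intro!: restrict_ext)
    ultimately show "\<exists>g \<in> carrier (hom_group A M N). g \<otimes>\<^bsub>hom_group A M N\<^esub> f = \<one>\<^bsub>hom_group A M N\<^esub>"
      by (intro bexI) (simp_all add: hom_group_def)
  qed
qed

lemma mod_hom_zero:
  assumes "right_module A M" "right_module A N" "f \<in> mod_hom A M N"
  shows "f \<zero>\<^bsub>M\<^esub> = \<zero>\<^bsub>N\<^esub>"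
  using mod_hom_finsum[OF assms, of "{}" "\<lambda>_. \<zero>\<^bsub>M\<^esub>"] assms(1,2)
  by (simp add: right_module_def abelian_group_def abelian_monoid.finsum_empty)

lemma compose_zero_left:
  assumes "f \<in> mod_hom A X Y"
  shows "compose (carrier X) \<one>\<^bsub>hom_group A Y Z\<^esub> f = \<one>\<^bsub>hom_group A X Z\<^esub>"
  using assms by (auto simp: compose_def hom_group_def mod_hom_def intro!: restrict_ext)

lemma compose_zero_right:
  assumes "right_module A Y" "right_module A Z" "g \<in> mod_hom A Y Z"
  shows "compose (carrier X) g \<one>\<^bsub>hom_group A X Y\<^esub> = \<one>\<^bsub>hom_group A X Z\<^esub>"
  using mod_hom_zero[OF assms] by (auto simp: compose_def hom_group_def intro!: restrict_ext)

lemma compose_mod_hom: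
  assumes "right_module A X" "f \<in> mod_hom A X Y" "g \<in> mod_hom A Y Z"
  shows "compose (carrier X) g f \<in> mod_hom A X Z"
proof -
  interpret right_module A X by fact
  show ?thesis
    using assms(2,3) by (auto simp: compose_def mod_hom_def PiE_iff smult_closed)
qed

text \<open>The multiplication of \<open>skeleton_ring\<close> on homogeneous elements.\<close>

lemma mult_homogeneous:
  assumes mods: "\<forall>X \<in> \<C>. right_module A X"
    and \<C>: "X \<in> \<C>" "Y \<in> \<C>" "Y' \<in> \<C>" "Z \<in> \<C>"
    and f: "f \<in> mod_hom A X Y" and g: "g \<in> mod_hom A Y' Z"
  shows "homogeneous A \<C> (Z, Y') g \<otimes>\<^bsub>skeleton_ring A \<C>\<^esub> homogeneous A \<C> (Y, X) f =
    (if Y' = Y then homogeneous A \<C> (Z, X) (compose (carrier X) g f) else \<zero>\<^bsub>skeleton_ring A \<C>\<^esub>)"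
    (is "?l = ?r")
proof (rule extensionalityI)
  show "?l \<in> extensional (\<C> \<times> \<C>)"
    by (simp add: skeleton_ring_def Let_def)
  show "?r \<in> extensional (\<C> \<times> \<C>)"
    by (simp add: skeleton_ring_def Let_def homogeneous_def)
  fix \<delta> assume "\<delta> \<in> \<C> \<times> \<C>"
  then obtain Z1 X1 where \<delta>: "\<delta> = (Z1, X1)" "Z1 \<in> \<C>" "X1 \<in> \<C>" by blast
  interpret comm_group "hom_group A X1 Z1"
    using hom_group_comm_group mods \<delta> by blast
  let ?S = "{W \<in> \<C>. homogeneous A \<C> (Z, Y') g (Z1, W) \<noteq> \<one>\<^bsub>hom_group A W Z1\<^esub> \<and>
      homogeneous A \<C> (Y, X) f (W, X1) \<noteq> \<one>\<^bsub>hom_group A X1 W\<^esub>}"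
  let ?c = "\<lambda>W. compose (carrier X1) (homogeneous A \<C> (Z, Y') g (Z1, W)) (homogeneous A \<C> (Y, X) f (W, X1))"
  have l: "?l \<delta> = finprod (hom_group A X1 Z1) ?c ?S"
    using \<delta> by (simp add: skeleton_ring_def Let_def)
  have S: "?S = (if Z1 = Z \<and> Y' = Y \<and> X1 = X \<and> g \<noteq> \<one>\<^bsub>hom_group A Y Z\<^esub> \<and> f \<noteq> \<one>\<^bsub>hom_group A X Y\<^esub> then {Y} else {})"
    using \<delta> \<C> by (auto simp: homogeneous_def split: if_splits)
  have r: "?r \<delta> = (if Z1 = Z \<and> Y' = Y \<and> X1 = X then compose (carrier X) g f else \<one>\<^bsub>hom_group A X1 Z1\<^esub>)"
    using \<delta> by (auto simp: skeleton_ring_def Let_def homogeneous_def)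
  show "?l \<delta> = ?r \<delta>"
  proof (cases "Z1 = Z \<and> Y' = Y \<and> X1 = X")
    case False
    then have "?S = {}" unfolding S by auto
    with False show ?thesis unfolding l r by (simp only: finprod_empty if_False)
  next
    case True
    have mod: "right_module A X" "right_module A Y" "right_module A Z" using mods \<C> by auto
    have gY: "g \<in> mod_hom A Y Z" using g True by simp
    have c: "?c Y = compose (carrier X) g f"
      using True \<C> by (simp add: homogeneous_def)
    have cc: "compose (carrier X) g f \<in> carrier (hom_group A X1 Z1)"
      using compose_mod_hom[OF mod(1) f gY] True by (simp add: hom_group_def)
    show ?thesis
    proof (cases "g = \<one>\<^bsub>hom_group A Y Z\<^esub> \<or> f = \<one>\<^bsub>hom_group A X Y\<^esub>")
      case z: True
      then have "?S = {}" unfolding S by auto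
      then have "?l \<delta> = \<one>\<^bsub>hom_group A X1 Z1\<^esub>" unfolding l by (simp only: finprod_empty)
      moreover have "compose (carrier X) g f = \<one>\<^bsub>hom_group A X1 Z1\<^esub>"
        using z True compose_zero_left[OF f] compose_zero_right[OF mod(2,3) gY] by auto
      ultimately show ?thesis unfolding r using True by simp
    next
      case False
      with True have "?S = {Y}" unfolding S by simp
      then have "?l \<delta> = finprod (hom_group A X1 Z1) ?c {Y}" unfolding l by (simp only:)
      also have "\<dots> = ?c Y"
        using cc unfolding c[symmetric] by (subst finprod_insert) auto
      finally show ?thesis unfolding c r using True by simp
    qed
  qed
qed

end

theory Submission
  imports Defs
begin

text \<open>Write \<open>rad(X, Y)\<close> for the set of all \<open>f : X \<rightarrow> Y\<close> such that \<open>1 - f g\<close> is invertible for every \<open>g : Y \<rightarrow> X\<close>.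
  The graded radical of the ring of the skeleton is \<open>\<Oplus> rad(X, Y)\<close>, its powers consist componentwise of
  the sums of composites of radical morphisms, and its graded one-sided ideals are the families of
  subfunctors of the functors \<open>Hom(-, Y)\<close> and \<open>Hom(X, -)\<close>.

  The functors \<open>rad(-, C)\<close> and \<open>rad(C, -)\<close> are finitely generated. Indeed, the radical of \<open>End(C)\<close> is
  the set of all \<open>w\<close> with \<open>tr(w \<theta>) = 0\<close> for finitely many linear endomorphisms \<open>\<theta>\<close> of \<open>C\<close>, so
  \<open>h : X \<rightarrow> C\<close> is radical iff each \<open>\<theta> h\<close> is orthogonal under the trace form to \<open>Hom\<^sub>A(C, X)\<close>. This means
  that \<open>\<theta> h\<close> is a sum of commutators of linear maps \<open>\<gamma>\<^sub>t : X \<rightarrow> C\<close> with the actions of elements \<open>t\<close>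
  spanning \<open>A\<close>. The pairs of \<open>h\<close> and the \<open>\<gamma>\<^sub>t\<close> are the homomorphisms from \<open>X\<close> to one finitely generated
  module. The other side is similar.

  Hence the powers of the radical are finitely generated on each object, and by the argument of
  Nakayama's lemma a power which equals the next one vanishes. Let \<open>P = A\<close> and \<open>I = Hom\<^sub>K(A, K)\<close>, and
  suppose that \<open>rad\<^sup>n(P, I) = 0\<close>. Every module \<open>M \<noteq> 0\<close> has a nonzero composite \<open>P \<rightarrow> M \<rightarrow> I\<close>. If \<open>M\<close> is
  indecomposable, then factoring \<open>M \<rightarrow> I\<close> through the generators of the radical for as long as it is radical
  must stop before step \<open>n\<close>, and \<open>M\<close> is then a summand of one of finitely many modules. Conversely, if
  there are only finitely many indecomposables, then chains of subfunctors stabilise, since a subfunctor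
  is determined by its finite dimensional values on the indecomposables.\<close>

text \<open>The maps \<theta> are forced by arbitrary fields: the trace form of End(C) can be zero
  although End(C) is a field, as for a module with endomorphism ring K whose dimension is divisible
  by the characteristic. As the \<theta> are only K-linear, being radical turns into the solvability
  of an equation between K-linear maps. Such maps are represented by coinduced modules on one side
  and, through coordinates, by free modules on the other. The generators obtained in this way carry
  no minimality; they are radical, and every radical morphism factors through them.

  The pair P, I is chosen before any exponent, and this is where all conditions meet. Even the
  intersection condition, which concerns each Hom space by itself, yields a vanishing power on
  Hom(P, I), because that space is finite dimensional.

  The ring has local units only. Statements on graded ideals are therefore translated into families
  of subsets of Hom spaces, and the existence of gr-maximal right ideals is localised at a single
  identity morphism.\<close>

abbreviation add_at ("_ \<oplus>\<^sub>_ _" [65, 1000, 66] 65) where "x \<oplus>\<^sub>M y \<equiv> x \<oplus>\<^bsub>M\<^esub> y"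
abbreviation neg_at ("\<ominus>\<^sub>_ _" [1000, 81] 80) where "\<ominus>\<^sub>M x \<equiv> \<ominus>\<^bsub>M\<^esub> x"
abbreviation zero_at ("\<zero>\<^sub>_" [1000] 1000) where "\<zero>\<^sub>M \<equiv> \<zero>\<^bsub>M\<^esub>"
abbreviation one_at ("\<one>\<^sub>_" [1000] 1000) where "\<one>\<^sub>M \<equiv> \<one>\<^bsub>M\<^esub>"
abbreviation mult_at ("_ \<otimes>\<^sub>_ _" [70, 1000, 71] 70) where "x \<otimes>\<^sub>M y \<equiv> x \<otimes>\<^bsub>M\<^esub> y"
abbreviation smult_at ("_ \<odot>\<^sub>_ _" [70, 1000, 71] 70) where "a \<odot>\<^sub>M x \<equiv> a \<odot>\<^bsub>M\<^esub> x"

section \<open>Modules and homomorphisms\<close>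

context right_module
begin

declare smult_closed [simp]

lemma smult_zero [simp]:
  assumes "a \<in> carrier A" shows "a \<odot>\<^sub>M \<zero>\<^sub>M = \<zero>\<^sub>M"
  using smult_add_module[OF assms, of "\<zero>\<^sub>M" "\<zero>\<^sub>M"] assms by (simp add: M.add.l_cancel_one)

lemma zero_smult [simp]:
  assumes "x \<in> carrier M" shows "\<zero>\<^sub>A \<odot>\<^sub>M x = \<zero>\<^sub>M"
  using smult_add_ring[of "\<zero>\<^sub>A" "\<zero>\<^sub>A" x] assms by (simp add: M.add.l_cancel_one)

lemma smult_neg:
  assumes "a \<in> carrier A" "x \<in> carrier M" shows "a \<odot>\<^sub>M (\<ominus>\<^sub>M x) = \<ominus>\<^sub>M (a \<odot>\<^sub>M x)"
  using assms by (intro M.minus_equality[symmetric])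
    (simp_all add: smult_add_module[symmetric] M.l_neg)

lemma neg_smult:
  assumes "a \<in> carrier A" "x \<in> carrier M" shows "(\<ominus>\<^sub>A a) \<odot>\<^sub>M x = \<ominus>\<^sub>M (a \<odot>\<^sub>M x)"
  using assms by (intro M.minus_equality[symmetric])
    (simp_all add: smult_add_ring[symmetric] A.l_neg)

lemma smult_finsum:
  assumes "a \<in> carrier A" "finite S" "f \<in> S \<rightarrow> carrier M"
  shows "a \<odot>\<^sub>M finsum M f S = finsum M (\<lambda>s. a \<odot>\<^sub>M f s) S"
  using assms(2,3)
proof (induction S)
  case (insert s S)
  then have "\<forall>t \<in> insert s S. f t \<in> carrier M" by blast
  with insert assms(1) show ?case
    by (simp add: M.finsum_insert Pi_iff smult_add_module)
qed (use assms in simp)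

lemma finsum_smult:
  assumes "x \<in> carrier M" "finite S" "f \<in> S \<rightarrow> carrier A"
  shows "finsum A f S \<odot>\<^sub>M x = finsum M (\<lambda>s. f s \<odot>\<^sub>M x) S"
  using assms(2,3)
proof (induction S)
  case (insert s S)
  then have "\<forall>t \<in> insert s S. f t \<in> carrier A" by blast
  with insert assms(1) show ?case
    by (simp add: M.finsum_insert A.finsum_insert Pi_iff smult_add_ring)
qed (use assms in simp)

section \<open>Submodules and spanning sets\<close>

lemma right_submoduleI:
  assumes "N \<subseteq> carrier M" "\<zero>\<^sub>M \<in> N" "\<And>x y. x \<in> N \<Longrightarrow> y \<in> N \<Longrightarrow> x \<oplus>\<^sub>M y \<in> N"
    "\<And>a x. a \<in> carrier A \<Longrightarrow> x \<in> N \<Longrightarrow> a \<odot>\<^sub>M x \<in> N"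
  shows "submodule N A M"
proof -
  have "\<ominus>\<^sub>M x \<in> N" if "x \<in> N" for x
    using assms(4)[of "\<ominus>\<^sub>A \<one>\<^sub>A" x] that assms(1) by (simp add: neg_smult smult_one subset_iff)
  then show ?thesis
    using assms by (intro submodule.intro subgroup.intro submodule_axioms.intro)
      (auto simp: a_inv_def[symmetric])
qed

lemma submodule_subset: "submodule N A M \<Longrightarrow> N \<subseteq> carrier M"
  and submodule_zero: "submodule N A M \<Longrightarrow> \<zero>\<^sub>M \<in> N"
  and submodule_add: "submodule N A M \<Longrightarrow> x \<in> N \<Longrightarrow> y \<in> N \<Longrightarrow> x \<oplus>\<^sub>M y \<in> N"
  and submodule_smult: "submodule N A M \<Longrightarrow> a \<in> carrier A \<Longrightarrow> x \<in> N \<Longrightarrow> a \<odot>\<^sub>M x \<in> N"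
  and submodule_neg: "submodule N A M \<Longrightarrow> x \<in> N \<Longrightarrow> \<ominus>\<^sub>M x \<in> N"
  using subgroup.subset[of N "add_monoid M"] subgroup.one_closed[of N "add_monoid M"]
    subgroup.m_closed[of N "add_monoid M"] subgroup.m_inv_closed[of N "add_monoid M"]
  by (auto simp: submodule_def submodule_axioms_def a_inv_def)

lemma submodule_finsum:
  assumes "submodule N A M" "finite S" "f \<in> S \<rightarrow> N"
  shows "finsum M f S \<in> N"
  using assms(2,3)
proof (induction S)
  case (insert s S)
  then show ?case
    using submodule_subset[OF assms(1)] submodule_add[OF assms(1)]
    by (subst M.finsum_insert) (auto simp: Pi_iff)
qed (simp add: submodule_zero[OF assms(1)])

lemma submodule_module:
  assumes N: "submodule N A M" shows "right_module A (M\<lparr>carrier := N\<rparr>)"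
proof -
  note [simp] = submodule_zero[OF N] submodule_add[OF N] submodule_smult[OF N]
  have [simp]: "x \<in> carrier M" if "x \<in> N" for x using that submodule_subset[OF N] by auto
  have "abelian_group (M\<lparr>carrier := N\<rparr>)"
  proof (rule abelian_groupI)
    fix x assume "x \<in> carrier (M\<lparr>carrier := N\<rparr>)"
    then show "\<exists>y\<in>carrier (M\<lparr>carrier := N\<rparr>). y \<oplus>\<^bsub>M\<lparr>carrier := N\<rparr>\<^esub> x = \<zero>\<^bsub>M\<lparr>carrier := N\<rparr>\<^esub>"
      using submodule_neg[OF N] by (intro bexI[of _ "\<ominus>\<^sub>M x"]) (simp_all add: M.l_neg)
  qed (auto simp: M.a_ac)
  moreover have "right_module_axioms A (M\<lparr>carrier := N\<rparr>)"
    by unfold_locales (auto simp: smult_add_ring smult_add_module smult_assoc smult_one)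
  ultimately show ?thesis by (intro right_module.intro A.ring_axioms)
qed

lemma submodule_carrier: "submodule (carrier M) A M"
  by (rule right_submoduleI) auto

lemma submodule_Inter:
  assumes "\<And>N. N \<in> \<N> \<Longrightarrow> submodule N A M" "\<N> \<noteq> {}"
  shows "submodule (\<Inter>\<N>) A M"
  using assms by (intro right_submoduleI)
    (auto intro: submodule_zero submodule_add submodule_smult dest: submodule_subset)

lemma submodule_set_add:
  assumes "submodule U A M" "submodule V A M"
  shows "submodule (U <+>\<^bsub>M\<^esub> V) A M"
proof (rule right_submoduleI)
  note [simp] = submodule_zero[OF assms(1)] submodule_zero[OF assms(2)]
  have U: "x \<in> U \<Longrightarrow> x \<in> carrier M" and V: "x \<in> V \<Longrightarrow> x \<in> carrier M" for x
    using assms[THEN submodule_subset] by auto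
  show "U <+>\<^bsub>M\<^esub> V \<subseteq> carrier M" using U V by (auto simp: set_add_def')
  show "\<zero>\<^sub>M \<in> U <+>\<^bsub>M\<^esub> V"
    unfolding set_add_def' by (rule UN_I[of "\<zero>\<^sub>M"], simp, rule UN_I[of "\<zero>\<^sub>M"]) simp_all
  fix x y assume "x \<in> U <+>\<^bsub>M\<^esub> V" "y \<in> U <+>\<^bsub>M\<^esub> V"
  then obtain u v u' v' where *: "u \<in> U" "v \<in> V" "u' \<in> U" "v' \<in> V" "x = u \<oplus>\<^sub>M v" "y = u' \<oplus>\<^sub>M v'"
    by (auto simp: set_add_def')
  then have "x \<oplus>\<^sub>M y = (u \<oplus>\<^sub>M u') \<oplus>\<^sub>M (v \<oplus>\<^sub>M v')" using U V by (simp add: M.a_ac)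
  with * show "x \<oplus>\<^sub>M y \<in> U <+>\<^bsub>M\<^esub> V"
    using submodule_add[OF assms(1), of u u'] submodule_add[OF assms(2), of v v']
    unfolding set_add_def' by (intro UN_I[of "u \<oplus>\<^sub>M u'"] UN_I[of "v \<oplus>\<^sub>M v'"]) simp_all
next
  have U: "x \<in> U \<Longrightarrow> x \<in> carrier M" and V: "x \<in> V \<Longrightarrow> x \<in> carrier M" for x
    using assms[THEN submodule_subset] by auto
  fix a x assume a: "a \<in> carrier A" and "x \<in> U <+>\<^bsub>M\<^esub> V"
  then obtain u v where *: "u \<in> U" "v \<in> V" "x = u \<oplus>\<^sub>M v"
    by (auto simp: set_add_def')
  then have "a \<odot>\<^sub>M x = a \<odot>\<^sub>M u \<oplus>\<^sub>M a \<odot>\<^sub>M v"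
    using a U V by (simp add: smult_add_module)
  with a * show "a \<odot>\<^sub>M x \<in> U <+>\<^bsub>M\<^esub> V"
    using submodule_smult[OF assms(1) a, of u] submodule_smult[OF assms(2) a, of v]
    unfolding set_add_def' by (intro UN_I[of "a \<odot>\<^sub>M u"] UN_I[of "a \<odot>\<^sub>M v"]) simp_all
qed

text \<open>Generation is phrased through submodules instead of linear combinations: to prove a
  property of all elements it then suffices that it defines a submodule and holds on S.\<close>

definition spans :: "'m set \<Rightarrow> bool" where
  "spans S \<longleftrightarrow> S \<subseteq> carrier M \<and> (\<forall>N. submodule N A M \<longrightarrow> S \<subseteq> N \<longrightarrow> N = carrier M)"

lemma linear_combination_in_submodule:
  assumes "submodule N A M" "finite S" "S \<subseteq> N" "a \<in> S \<rightarrow> carrier A"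
  shows "(\<Oplus>\<^bsub>M\<^esub>s\<in>S. a s \<odot>\<^sub>M s) \<in> N"
  using assms by (intro submodule_finsum) (auto intro!: submodule_smult[OF assms(1)])

lemma submodule_linear_combinations:
  assumes S: "finite S" "S \<subseteq> carrier M"
  shows "submodule {(\<Oplus>\<^bsub>M\<^esub>s\<in>S. a s \<odot>\<^sub>M s) | a. a \<in> S \<rightarrow> carrier A} A M"
    and "S \<subseteq> {(\<Oplus>\<^bsub>M\<^esub>s\<in>S. a s \<odot>\<^sub>M s) | a. a \<in> S \<rightarrow> carrier A}"
proof -
  let ?N = "{(\<Oplus>\<^bsub>M\<^esub>s\<in>S. a s \<odot>\<^sub>M s) | a. a \<in> S \<rightarrow> carrier A}"
  have c: "(\<lambda>s. a s \<odot>\<^sub>M s) \<in> S \<rightarrow> carrier M" if "a \<in> S \<rightarrow> carrier A" for a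
    using that S by (auto intro!: smult_closed)
  show "submodule ?N A M"
  proof (rule right_submoduleI)
    show "?N \<subseteq> carrier M" using c by (auto intro!: M.finsum_closed)
    have "(\<Oplus>\<^bsub>M\<^esub>s\<in>S. \<zero>\<^sub>A \<odot>\<^sub>M s) = (\<Oplus>\<^bsub>M\<^esub>s\<in>S. \<zero>\<^sub>M)"
      using S by (intro M.finsum_cong') auto
    then show "\<zero>\<^sub>M \<in> ?N"
      by (intro CollectI exI[of _ "\<lambda>_. \<zero>\<^sub>A"]) (simp add: M.finsum_zero)
    fix x y assume "x \<in> ?N" "y \<in> ?N"
    then obtain a b where ab: "a \<in> S \<rightarrow> carrier A" "b \<in> S \<rightarrow> carrier A"
      "x = (\<Oplus>\<^bsub>M\<^esub>s\<in>S. a s \<odot>\<^sub>M s)" "y = (\<Oplus>\<^bsub>M\<^esub>s\<in>S. b s \<odot>\<^sub>M s)" by auto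
    then have "x \<oplus>\<^sub>M y = (\<Oplus>\<^bsub>M\<^esub>s\<in>S. a s \<odot>\<^sub>M s \<oplus>\<^sub>M b s \<odot>\<^sub>M s)"
      using c by (simp add: M.finsum_addf)
    also have "\<dots> = (\<Oplus>\<^bsub>M\<^esub>s\<in>S. (a s \<oplus>\<^sub>A b s) \<odot>\<^sub>M s)"
      using ab S by (intro M.finsum_cong') (auto simp: smult_add_ring Pi_iff subset_iff)
    finally show "x \<oplus>\<^sub>M y \<in> ?N"
      using ab by (intro CollectI exI[of _ "\<lambda>s. a s \<oplus>\<^sub>A b s"]) auto
  next
    fix r x assume r: "r \<in> carrier A" and "x \<in> ?N"
    then obtain a where a: "a \<in> S \<rightarrow> carrier A" "x = (\<Oplus>\<^bsub>M\<^esub>s\<in>S. a s \<odot>\<^sub>M s)" by auto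
    then have "r \<odot>\<^sub>M x = (\<Oplus>\<^bsub>M\<^esub>s\<in>S. r \<odot>\<^sub>M (a s \<odot>\<^sub>M s))"
      using r c S by (simp add: smult_finsum)
    also have "\<dots> = (\<Oplus>\<^bsub>M\<^esub>s\<in>S. (a s \<otimes>\<^sub>A r) \<odot>\<^sub>M s)"
      using a r S by (intro M.finsum_cong') (auto simp: smult_assoc Pi_iff subset_iff)
    finally show "r \<odot>\<^sub>M x \<in> ?N"
      using a r by (intro CollectI exI[of _ "\<lambda>s. a s \<otimes>\<^sub>A r"]) auto
  qed
  show "S \<subseteq> ?N"
  proof
    fix t assume t: "t \<in> S"
    have "(\<Oplus>\<^bsub>M\<^esub>s\<in>S. (if s = t then \<one>\<^sub>A else \<zero>\<^sub>A) \<odot>\<^sub>M s) = (\<Oplus>\<^bsub>M\<^esub>s\<in>S. if t = s then s else \<zero>\<^sub>M)"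
      using S by (intro M.finsum_cong') (auto simp: smult_one)
    also have "\<dots> = t"
      using t S M.finsum_singleton[of t S "\<lambda>s. s"] by auto
    finally show "t \<in> ?N"
      by (intro CollectI exI[of _ "\<lambda>s. if s = t then \<one>\<^sub>A else \<zero>\<^sub>A"]) auto
  qed
qed

text \<open>The linear combinations of a finite set S form the smallest submodule containing
  S.\<close>

lemma fg_iff_spans: "fg_right_module A M \<longleftrightarrow> (\<exists>S. finite S \<and> spans S)"
proof
  assume "fg_right_module A M"
  then obtain S where S: "finite S" "S \<subseteq> carrier M"
    "\<And>x. x \<in> carrier M \<Longrightarrow> \<exists>a \<in> S \<rightarrow> carrier A. x = (\<Oplus>\<^bsub>M\<^esub>s\<in>S. a s \<odot>\<^sub>M s)"
    unfolding fg_right_module_def by blast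
  have "spans S"
    unfolding spans_def
  proof (intro conjI allI impI S)
    fix N assume N: "submodule N A M" "S \<subseteq> N"
    have "carrier M \<subseteq> N"
    proof
      fix x assume "x \<in> carrier M"
      then obtain a where "a \<in> S \<rightarrow> carrier A" "x = (\<Oplus>\<^bsub>M\<^esub>s\<in>S. a s \<odot>\<^sub>M s)" using S by blast
      then show "x \<in> N" using linear_combination_in_submodule[OF N(1) S(1) N(2)] by blast
    qed
    then show "N = carrier M" using submodule_subset[OF N(1)] by blast
  qed
  with S show "\<exists>S. finite S \<and> spans S" by blast
next
  assume "\<exists>S. finite S \<and> spans S"
  then obtain S where S: "finite S" "S \<subseteq> carrier M" "\<And>N. submodule N A M \<Longrightarrow> S \<subseteq> N \<Longrightarrow> N = carrier M"
    unfolding spans_def by blast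
  from S(3)[OF submodule_linear_combinations[OF S(1,2)]]
  have "carrier M = {(\<Oplus>\<^bsub>M\<^esub>s\<in>S. a s \<odot>\<^sub>M s) | a. a \<in> S \<rightarrow> carrier A}" by simp
  then have "\<forall>x\<in>carrier M. \<exists>a \<in> S \<rightarrow> carrier A. x = (\<Oplus>\<^bsub>M\<^esub>s\<in>S. a s \<odot>\<^sub>M s)" by auto
  with S(1,2) show "fg_right_module A M"
    unfolding fg_right_module_def by (intro conjI right_module_axioms exI[of _ S])
qed

end

section \<open>Module homomorphisms, their kernels, images and inverses\<close>

lemma mod_homI:
  assumes "f \<in> carrier M \<rightarrow>\<^sub>E carrier N"
    "\<And>x y. x \<in> carrier M \<Longrightarrow> y \<in> carrier M \<Longrightarrow> f (x \<oplus>\<^sub>M y) = f x \<oplus>\<^sub>N f y"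
    "\<And>a x. a \<in> carrier A \<Longrightarrow> x \<in> carrier M \<Longrightarrow> f (a \<odot>\<^sub>M x) = a \<odot>\<^sub>N f x"
  shows "f \<in> mod_hom A M N"
  using assms by (auto simp: mod_hom_def)

lemma mod_hom_closed: "f \<in> mod_hom A M N \<Longrightarrow> x \<in> carrier M \<Longrightarrow> f x \<in> carrier N"
  and mod_hom_add: "f \<in> mod_hom A M N \<Longrightarrow> x \<in> carrier M \<Longrightarrow> y \<in> carrier M \<Longrightarrow> f (x \<oplus>\<^sub>M y) = f x \<oplus>\<^sub>N f y"
  and mod_hom_smult: "f \<in> mod_hom A M N \<Longrightarrow> a \<in> carrier A \<Longrightarrow> x \<in> carrier M \<Longrightarrow> f (a \<odot>\<^sub>M x) = a \<odot>\<^sub>N f x"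
  and mod_hom_extensional: "f \<in> mod_hom A M N \<Longrightarrow> f \<in> extensional (carrier M)"
  and mod_hom_PiE: "f \<in> mod_hom A M N \<Longrightarrow> f \<in> carrier M \<rightarrow>\<^sub>E carrier N"
  by (auto simp: mod_hom_def PiE_def)

lemma mod_hom_eqI:
  "f \<in> mod_hom A M N \<Longrightarrow> g \<in> mod_hom A M N \<Longrightarrow> (\<And>x. x \<in> carrier M \<Longrightarrow> f x = g x) \<Longrightarrow> f = g"
  by (auto intro: extensionalityI dest: mod_hom_extensional)

lemma mod_hom_neg:
  assumes "right_module A M" "right_module A N" "f \<in> mod_hom A M N" "x \<in> carrier M"
  shows "f (\<ominus>\<^sub>M x) = \<ominus>\<^sub>N f x"
proof -
  interpret M: right_module A M by fact
  interpret N: right_module A N by fact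
  have "f (\<ominus>\<^sub>M x) \<oplus>\<^sub>N f x = f (\<ominus>\<^sub>M x \<oplus>\<^sub>M x)"
    using assms(3,4) by (simp add: mod_hom_add)
  then show ?thesis
    using assms by (intro N.M.minus_equality[symmetric])
      (auto simp: M.M.l_neg mod_hom_zero intro: mod_hom_closed)
qed

text \<open>These agree with the operations of \<open>hom_group\<close>, but the modules may have different types.\<close>

definition hom_plus where
  "hom_plus M N f g = (\<lambda>x\<in>carrier M. f x \<oplus>\<^sub>N g x)"

definition hom_zero where
  "hom_zero M N = (\<lambda>x\<in>carrier M. \<zero>\<^sub>N)"

definition hom_id where
  "hom_id M = (\<lambda>x\<in>carrier M. x)"

abbreviation hom_comp where
  "hom_comp M g f \<equiv> compose (carrier M) g f"

lemma hom_id_in [simp]: "right_module A M \<Longrightarrow> hom_id M \<in> mod_hom A M M"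
  by (auto simp: hom_id_def mod_hom_def right_module.smult_closed right_module_def abelian_group_def
      abelian_monoid.a_closed)

lemma hom_zero_in [simp]:
  assumes "right_module A M" "right_module A N" shows "hom_zero M N \<in> mod_hom A M N"
proof -
  interpret M: right_module A M by fact
  interpret N: right_module A N by fact
  show ?thesis by (rule mod_homI) (auto simp: hom_zero_def)
qed

lemma hom_plus_in:
  assumes "right_module A M" "right_module A N" "f \<in> mod_hom A M N" "g \<in> mod_hom A M N"
  shows "hom_plus M N f g \<in> mod_hom A M N"
proof -
  interpret M: right_module A M by fact
  interpret N: right_module A N by fact
  note [simp] = mod_hom_closed[OF assms(3)] mod_hom_closed[OF assms(4)] mod_hom_add[OF assms(3)]
    mod_hom_add[OF assms(4)] mod_hom_smult[OF assms(3)] mod_hom_smult[OF assms(4)]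
  show ?thesis
    by (rule mod_homI) (auto simp: hom_plus_def N.M.a_ac N.smult_add_module)
qed

lemma hom_comp_in:
  assumes "right_module A X" "f \<in> mod_hom A X Y" "g \<in> mod_hom A Y Z"
  shows "hom_comp X g f \<in> mod_hom A X Z"
proof -
  interpret right_module A X by fact
  show ?thesis
    using assms(2,3) by (auto simp: compose_def mod_hom_def PiE_iff smult_closed)
qed

lemma hom_comp_id_left: "f \<in> mod_hom A X Y \<Longrightarrow> hom_comp X (hom_id Y) f = f"
  by (rule extensionalityI[of _ "carrier X"])
    (auto simp: compose_def hom_id_def mod_hom_closed dest: mod_hom_extensional)

lemma hom_comp_id_right: "f \<in> mod_hom A X Y \<Longrightarrow> hom_comp X f (hom_id X) = f"
  by (rule extensionalityI[of _ "carrier X"])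
    (auto simp: compose_def hom_id_def dest: mod_hom_extensional)

lemma hom_comp_apply: "x \<in> carrier X \<Longrightarrow> hom_comp X g f x = g (f x)"
  by (simp add: compose_def)

lemma hom_comp_assoc:
  "f \<in> mod_hom A X Y \<Longrightarrow> hom_comp X h (hom_comp X g f) = hom_comp X (hom_comp Y h g) f"
  by (auto simp: compose_def mod_hom_closed intro!: restrict_ext)

lemma inverse_in_mod_hom:
  assumes "right_module A M" "f \<in> mod_hom A M N" "bij_betw f (carrier M) (carrier N)"
  obtains g where "g \<in> mod_hom A N M" "bij_betw g (carrier N) (carrier M)"
    "\<And>x. x \<in> carrier M \<Longrightarrow> g (f x) = x" "\<And>y. y \<in> carrier N \<Longrightarrow> f (g y) = y"
proof -
  interpret M: right_module A M by fact
  let ?g = "\<lambda>y\<in>carrier N. inv_into (carrier M) f y"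
  have gf: "?g (f x) = x" if "x \<in> carrier M" for x
    using that assms(2,3) by (auto simp: bij_betw_def mod_hom_closed)
  have fg: "?g y \<in> carrier M" "f (?g y) = y" if "y \<in> carrier N" for y
    using that assms(3) by (auto simp: bij_betw_def inv_into_into f_inv_into_f)
  have "?g \<in> mod_hom A N M"
  proof (rule mod_homI)
    show "?g \<in> carrier N \<rightarrow>\<^sub>E carrier M" using fg(1) by auto
    fix x y assume xy: "x \<in> carrier N" "y \<in> carrier N"
    have "x \<oplus>\<^sub>N y = f (?g x \<oplus>\<^sub>M ?g y)"
      using fg[OF xy(1)] fg[OF xy(2)] mod_hom_add[OF assms(2), of "?g x" "?g y"] by simp
    then show "?g (x \<oplus>\<^sub>N y) = ?g x \<oplus>\<^sub>M ?g y"
      using gf[of "?g x \<oplus>\<^sub>M ?g y"] fg(1)[OF xy(1)] fg(1)[OF xy(2)] by simp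
  next
    fix a y assume ay: "a \<in> carrier A" "y \<in> carrier N"
    have "a \<odot>\<^sub>N y = f (a \<odot>\<^sub>M ?g y)"
      using fg[OF ay(2)] ay mod_hom_smult[OF assms(2), of a "?g y"] by simp
    then show "?g (a \<odot>\<^sub>N y) = a \<odot>\<^sub>M ?g y"
      using gf[of "a \<odot>\<^sub>M ?g y"] fg(1)[OF ay(2)] ay by simp
  qed
  moreover have "bij_betw ?g (carrier N) (carrier M)"
    using fg gf assms(2) by (intro bij_betwI[of _ _ _ f]) (auto simp: mod_hom_closed)
  ultimately show ?thesis using that[of ?g] gf fg by blast
qed

lemma mod_hom_kernel:
  assumes "right_module A M" "right_module A N" "f \<in> mod_hom A M N"
  shows "submodule {x \<in> carrier M. f x = \<zero>\<^sub>N} A M"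
proof -
  interpret M: right_module A M by fact
  interpret N: right_module A N by fact
  show ?thesis using assms
    by (intro M.right_submoduleI) (auto simp: mod_hom_zero mod_hom_add mod_hom_smult)
qed

lemma mod_hom_vimage:
  assumes "right_module A M" "right_module A N" "f \<in> mod_hom A M N" "submodule U A N"
  shows "submodule {x \<in> carrier M. f x \<in> U} A M"
proof -
  interpret M: right_module A M by fact
  interpret N: right_module A N by fact
  show ?thesis using assms
    by (intro M.right_submoduleI) (auto simp: mod_hom_zero mod_hom_add mod_hom_smult
      N.submodule_zero N.submodule_add N.submodule_smult)
qed

lemma mod_hom_image:
  assumes "right_module A M" "right_module A N" "f \<in> mod_hom A M N" "submodule U A M"
  shows "submodule (f ` U) A N"
proof -
  interpret M: right_module A M by fact
  interpret N: right_module A N by fact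
  have U: "U \<subseteq> carrier M" by (rule M.submodule_subset[OF assms(4)])
  show ?thesis
  proof (rule N.right_submoduleI)
    show "f ` U \<subseteq> carrier N" using U assms(3) by (auto simp: mod_hom_closed)
    show "\<zero>\<^sub>N \<in> f ` U"
      using M.submodule_zero[OF assms(4)] mod_hom_zero[OF assms(1-3)] by (metis imageI)
    fix x y assume "x \<in> f ` U" "y \<in> f ` U"
    then obtain u v where uv: "u \<in> U" "v \<in> U" "x = f u" "y = f v" by blast
    then have "x \<oplus>\<^sub>N y = f (u \<oplus>\<^sub>M v)" using subsetD[OF U] mod_hom_add[OF assms(3), of u v] by simp
    then show "x \<oplus>\<^sub>N y \<in> f ` U" using M.submodule_add[OF assms(4)] uv by simp
  next
    fix a x assume a: "a \<in> carrier A" and "x \<in> f ` U"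
    then obtain u where u: "u \<in> U" "x = f u" by blast
    then have "a \<odot>\<^sub>N x = f (a \<odot>\<^sub>M u)" using a subsetD[OF U] mod_hom_smult[OF assms(3), of a u] by simp
    then show "a \<odot>\<^sub>N x \<in> f ` U" using M.submodule_smult[OF assms(4)] a u by simp
  qed
qed

lemma mod_hom_inj_iff:
  assumes "right_module A M" "right_module A N" "f \<in> mod_hom A M N"
  shows "inj_on f (carrier M) \<longleftrightarrow> (\<forall>x\<in>carrier M. f x = \<zero>\<^sub>N \<longrightarrow> x = \<zero>\<^sub>M)"
proof -
  interpret M: right_module A M by fact
  interpret N: right_module A N by fact
  show ?thesis
  proof
    assume "inj_on f (carrier M)"
    then show "\<forall>x\<in>carrier M. f x = \<zero>\<^sub>N \<longrightarrow> x = \<zero>\<^sub>M"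
      using mod_hom_zero[OF assms] by (auto dest: inj_onD[of _ _ _ "\<zero>\<^sub>M"])
  next
    assume *: "\<forall>x\<in>carrier M. f x = \<zero>\<^sub>N \<longrightarrow> x = \<zero>\<^sub>M"
    show "inj_on f (carrier M)"
    proof (rule inj_onI)
      fix x y assume xy: "x \<in> carrier M" "y \<in> carrier M" "f x = f y"
      then have "f (x \<oplus>\<^sub>M \<ominus>\<^sub>M y) = \<zero>\<^sub>N"
        using assms by (simp add: mod_hom_add mod_hom_neg N.M.r_neg mod_hom_closed)
      then have "x \<oplus>\<^sub>M \<ominus>\<^sub>M y = \<zero>\<^sub>M" using * xy by auto
      then have "\<ominus>\<^sub>M (\<ominus>\<^sub>M y) = x" using xy by (intro M.M.minus_equality) simp_all
      then show "x = y" using xy by simp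
    qed
  qed
qed

section \<open>Quotients and products\<close>

lemma image_module:
  fixes M :: "('a, 'm, 'z) module_scheme" and r :: "'m \<Rightarrow> 'n"
  assumes M: "right_module A M" and U: "submodule U A M"
    and r: "\<And>x y. x \<in> carrier M \<Longrightarrow> y \<in> carrier M \<Longrightarrow> r x = r y \<longleftrightarrow> x \<oplus>\<^sub>M \<ominus>\<^sub>M y \<in> U"
  shows "\<exists>N :: ('a, 'n) module. right_module A N \<and> carrier N = r ` carrier M \<and>
    restrict r (carrier M) \<in> mod_hom A M N"
proof -
  interpret M: right_module A M by fact
  define g where "g = inv_into (carrier M) r"
  define N :: "('a, 'n) module" where
    "N = \<lparr>carrier = r ` carrier M, monoid.mult = undefined, one = undefined, zero = r \<zero>\<^sub>M,
      add = (\<lambda>x y. r (g x \<oplus>\<^sub>M g y)), smult = (\<lambda>a x. r (a \<odot>\<^sub>M g x))\<rparr>"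
  have g: "g (r x) \<in> carrier M" "g (r x) \<oplus>\<^sub>M \<ominus>\<^sub>M x \<in> U" if "x \<in> carrier M" for x
    using that r[of "g (r x)" x] by (auto simp: g_def inv_into_into f_inv_into_f)
  \<comment> \<open>Passing to the chosen representatives \<open>g (r x)\<close> and
    \<open>g (r y)\<close> changes the sum by an element of U, so the transported addition is well
    defined.\<close>
  have radd: "r (g (r x) \<oplus>\<^sub>M g (r y)) = r (x \<oplus>\<^sub>M y)" if "x \<in> carrier M" "y \<in> carrier M" for x y
  proof -
    have "(g (r x) \<oplus>\<^sub>M \<ominus>\<^sub>M x) \<oplus>\<^sub>M (g (r y) \<oplus>\<^sub>M \<ominus>\<^sub>M y) \<in> U"
      using g that M.submodule_add[OF U] by simp
    also have "(g (r x) \<oplus>\<^sub>M \<ominus>\<^sub>M x) \<oplus>\<^sub>M (g (r y) \<oplus>\<^sub>M \<ominus>\<^sub>M y) =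
        (g (r x) \<oplus>\<^sub>M g (r y)) \<oplus>\<^sub>M \<ominus>\<^sub>M (x \<oplus>\<^sub>M y)"
      using g that by (simp add: M.M.minus_add M.M.a_ac)
    finally show ?thesis using g that r by simp
  qed
  have rsm: "r (a \<odot>\<^sub>M g (r x)) = r (a \<odot>\<^sub>M x)" if "a \<in> carrier A" "x \<in> carrier M" for a x
  proof -
    have "a \<odot>\<^sub>M (g (r x) \<oplus>\<^sub>M \<ominus>\<^sub>M x) \<in> U"
      using g that M.submodule_smult[OF U] by simp
    also have "a \<odot>\<^sub>M (g (r x) \<oplus>\<^sub>M \<ominus>\<^sub>M x) = a \<odot>\<^sub>M g (r x) \<oplus>\<^sub>M \<ominus>\<^sub>M (a \<odot>\<^sub>M x)"
      using g that by (simp add: M.smult_add_module M.smult_neg)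
    finally show ?thesis using g that r by simp
  qed
  have N_simps[simp]: "carrier N = r ` carrier M" "\<zero>\<^sub>N = r \<zero>\<^sub>M"
    "x \<oplus>\<^sub>N y = r (g x \<oplus>\<^sub>M g y)" "a \<odot>\<^sub>N x = r (a \<odot>\<^sub>M g x)" for a x y
    by (simp_all add: N_def)
  have N: "abelian_group N"
  proof (rule abelian_groupI)
    fix x assume "x \<in> carrier N"
    then obtain y where "y \<in> carrier M" "x = r y" by auto
    then show "\<exists>y\<in>carrier N. y \<oplus>\<^sub>N x = \<zero>\<^sub>N"
      by (intro bexI[of _ "r (\<ominus>\<^sub>M y)"]) (simp_all add: M.M.l_neg radd)
  qed (auto simp: M.M.a_ac radd)
  have "right_module_axioms A N"
    by unfold_locales
      (auto simp: M.smult_add_ring M.smult_add_module M.smult_assoc M.smult_one radd rsm)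
  with N have "right_module A N"
    by (intro right_module.intro M.A.ring_axioms)
  moreover have "restrict r (carrier M) \<in> mod_hom A M N"
    by (simp add: mod_hom_def radd rsm)
  ultimately show ?thesis by (intro exI[of _ N]) simp
qed

lemma quotient_module:
  fixes M :: "('a, 'm, 'z) module_scheme"
  assumes M: "right_module A M" and U: "submodule U A M"
  obtains N :: "('a, 'm set) module" and p where "right_module A N" "p \<in> mod_hom A M N"
    "p ` carrier M = carrier N" "\<And>x. x \<in> carrier M \<Longrightarrow> p x = \<zero>\<^sub>N \<longleftrightarrow> x \<in> U"
proof -
  interpret M: right_module A M by fact
  \<comment> \<open>\<open>r x\<close> is the coset of x as a set, which realises the quotient on
    sets of elements of M.\<close>
  define r where "r x = {z \<in> carrier M. x \<oplus>\<^sub>M \<ominus>\<^sub>M z \<in> U}" for x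
  have r: "r x = r y \<longleftrightarrow> x \<oplus>\<^sub>M \<ominus>\<^sub>M y \<in> U" if xy: "x \<in> carrier M" "y \<in> carrier M" for x y
  proof
    assume "r x = r y"
    moreover have "y \<in> r y" using xy M.submodule_zero[OF U] by (simp add: r_def M.M.r_neg)
    ultimately show "x \<oplus>\<^sub>M \<ominus>\<^sub>M y \<in> U" by (auto simp: r_def)
  next
    have *: "r x \<subseteq> r y" if xy: "x \<in> carrier M" "y \<in> carrier M" "x \<oplus>\<^sub>M \<ominus>\<^sub>M y \<in> U" for x y
    proof
      fix z assume z: "z \<in> r x"
      then have "\<ominus>\<^sub>M (x \<oplus>\<^sub>M \<ominus>\<^sub>M y) \<oplus>\<^sub>M (x \<oplus>\<^sub>M \<ominus>\<^sub>M z) \<in> U"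
        using xy M.submodule_add[OF U M.submodule_neg[OF U]] by (simp add: r_def)
      also have "\<ominus>\<^sub>M (x \<oplus>\<^sub>M \<ominus>\<^sub>M y) \<oplus>\<^sub>M (x \<oplus>\<^sub>M \<ominus>\<^sub>M z) = y \<oplus>\<^sub>M \<ominus>\<^sub>M z"
        using xy z by (simp add: r_def M.M.minus_add M.M.a_ac M.M.r_neg1 M.M.r_neg2)
      finally show "z \<in> r y" using z by (simp add: r_def)
    qed
    assume d: "x \<oplus>\<^sub>M \<ominus>\<^sub>M y \<in> U"
    then have "\<ominus>\<^sub>M (x \<oplus>\<^sub>M \<ominus>\<^sub>M y) \<in> U" by (rule M.submodule_neg[OF U])
    then have "y \<oplus>\<^sub>M \<ominus>\<^sub>M x \<in> U" using xy by (simp add: M.M.minus_add M.M.a_comm)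
    with d show "r x = r y" using * xy by blast
  qed
  obtain N :: "('a, 'm set) module" where N: "right_module A N" "carrier N = r ` carrier M"
    "restrict r (carrier M) \<in> mod_hom A M N"
    using image_module[OF M U r] by blast
  have "restrict r (carrier M) x = \<zero>\<^sub>N \<longleftrightarrow> x \<in> U" if "x \<in> carrier M" for x
  proof -
    have "\<zero>\<^sub>N = r \<zero>\<^sub>M" using mod_hom_zero[OF M N(1,3)] by simp
    moreover have m0: "\<ominus>\<^sub>M \<zero>\<^sub>M = \<zero>\<^sub>M" by (intro M.M.minus_equality) simp_all
    have "r x = r \<zero>\<^sub>M \<longleftrightarrow> x \<in> U"
      using r[OF that M.M.zero_closed] unfolding m0 M.M.r_zero[OF that] .
    ultimately show ?thesis using that by simp
  qed
  then show ?thesis using that[OF N(1,3)] N(2) by auto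
qed

text \<open>The shape M \<times> N^J with one distinguished factor is the one that occurs in both
  almost split constructions. Extensional functions on J make componentwise equality the same as
  equality.\<close>

definition prod_module ::
  "('a, 'm, 'y) module_scheme \<Rightarrow> 'j set \<Rightarrow> ('a, 'n, 'z) module_scheme \<Rightarrow> ('a, 'm \<times> ('j \<Rightarrow> 'n)) module"
  where "prod_module M J N = \<lparr>carrier = carrier M \<times> (J \<rightarrow>\<^sub>E carrier N), monoid.mult = undefined,
    one = undefined, zero = (\<zero>\<^sub>M, \<lambda>j\<in>J. \<zero>\<^sub>N),
    add = (\<lambda>p q. (fst p \<oplus>\<^sub>M fst q, \<lambda>j\<in>J. snd p j \<oplus>\<^sub>N snd q j)),
    smult = (\<lambda>a p. (a \<odot>\<^sub>M fst p, \<lambda>j\<in>J. a \<odot>\<^sub>N snd p j))\<rparr>"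

lemma prod_module_simps [simp]:
  "carrier (prod_module M J N) = carrier M \<times> (J \<rightarrow>\<^sub>E carrier N)"
  "\<zero>\<^bsub>prod_module M J N\<^esub> = (\<zero>\<^sub>M, \<lambda>j\<in>J. \<zero>\<^sub>N)"
  "p \<oplus>\<^bsub>prod_module M J N\<^esub> q = (fst p \<oplus>\<^sub>M fst q, \<lambda>j\<in>J. snd p j \<oplus>\<^sub>N snd q j)"
  "a \<odot>\<^bsub>prod_module M J N\<^esub> p = (a \<odot>\<^sub>M fst p, \<lambda>j\<in>J. a \<odot>\<^sub>N snd p j)"
  by (simp_all add: prod_module_def)

lemma prod_module:
  assumes "right_module A M" "right_module A N"
  shows "right_module A (prod_module M J N)"
proof -
  interpret M: right_module A M by fact
  interpret N: right_module A N by fact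
  let ?P = "prod_module M J N"
  have N_in: "f j \<in> carrier N" if "f \<in> J \<rightarrow>\<^sub>E carrier N" "j \<in> J" for f j using that by auto
  have eqI: "(\<lambda>j\<in>J. g j) = f" if "f \<in> J \<rightarrow>\<^sub>E carrier N" "\<And>j. j \<in> J \<Longrightarrow> g j = f j" for f g
    using that by (intro extensionalityI[of _ J]) (auto simp: PiE_def)
  have "abelian_group ?P"
  proof (rule abelian_groupI)
    fix p assume p: "p \<in> carrier ?P"
    then show "\<zero>\<^bsub>?P\<^esub> \<oplus>\<^bsub>?P\<^esub> p = p"
      by (cases p) (simp add: eqI N_in)
    show "\<exists>q\<in>carrier ?P. q \<oplus>\<^bsub>?P\<^esub> p = \<zero>\<^bsub>?P\<^esub>"
      using p by (intro bexI[of _ "(\<ominus>\<^sub>M fst p, \<lambda>j\<in>J. \<ominus>\<^sub>N snd p j)"])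
        (auto simp: M.M.l_neg N.M.l_neg N_in intro!: restrict_ext)
  next
    fix p q r assume "p \<in> carrier ?P" "q \<in> carrier ?P" "r \<in> carrier ?P"
    then show "p \<oplus>\<^bsub>?P\<^esub> q \<oplus>\<^bsub>?P\<^esub> r = p \<oplus>\<^bsub>?P\<^esub> (q \<oplus>\<^bsub>?P\<^esub> r)"
      by (auto simp: M.M.a_assoc N.M.a_assoc N_in intro!: restrict_ext)
  next
    fix p q assume "p \<in> carrier ?P" "q \<in> carrier ?P"
    then show "p \<oplus>\<^bsub>?P\<^esub> q = q \<oplus>\<^bsub>?P\<^esub> p"
      by (auto simp: M.M.a_comm N.M.a_comm N_in intro!: restrict_ext)
  qed (auto simp: N_in)
  moreover have "right_module_axioms A ?P"
    by unfold_locales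
      (auto simp: N_in M.smult_add_ring M.smult_add_module M.smult_assoc M.smult_one eqI
        N.smult_add_ring N.smult_add_module N.smult_assoc N.smult_one intro!: restrict_ext)
  ultimately show ?thesis by (intro right_module.intro M.A.ring_axioms)
qed

section \<open>Linear algebra\<close>

text \<open>The action multiplies from the right, in keeping with the reading of the scalar product
  of a and x as x a. Over a field this module is the codomain of linear functionals.\<close>

definition regular :: "('a, 'r) ring_scheme \<Rightarrow> ('a, 'a) module" where
  "regular A = \<lparr>carrier = carrier A, monoid.mult = undefined, one = undefined, zero = \<zero>\<^sub>A,
    add = add A, smult = (\<lambda>a x. x \<otimes>\<^sub>A a)\<rparr>"

lemma regular_simps [simp]:
  "carrier (regular A) = carrier A" "\<zero>\<^bsub>regular A\<^esub> = \<zero>\<^sub>A"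
  "x \<oplus>\<^bsub>regular A\<^esub> y = x \<oplus>\<^sub>A y" "a \<odot>\<^bsub>regular A\<^esub> x = x \<otimes>\<^sub>A a"
  by (simp_all add: regular_def)

lemma regular_module: "ring A \<Longrightarrow> right_module A (regular A)"
proof -
  assume "ring A"
  then interpret ring A .
  have "abelian_group (regular A)"
  proof (rule abelian_groupI)
    fix x assume "x \<in> carrier (regular A)"
    then show "\<exists>y\<in>carrier (regular A). y \<oplus>\<^bsub>regular A\<^esub> x = \<zero>\<^bsub>regular A\<^esub>"
      by (intro bexI[of _ "\<ominus>\<^sub>A x"]) (simp_all add: l_neg)
  qed (auto simp: a_ac)
  moreover have "right_module_axioms A (regular A)"
    by unfold_locales (auto simp: l_distr r_distr m_assoc)
  ultimately show ?thesis by (intro right_module.intro ring_axioms)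
qed

definition hom_space :: "('k, 'r) ring_scheme \<Rightarrow> ('k, 'v, 'y) module_scheme
    \<Rightarrow> ('k, 'w, 'z) module_scheme \<Rightarrow> ('k, 'v \<Rightarrow> 'w) module" where
  "hom_space K V W = \<lparr>carrier = mod_hom K V W, monoid.mult = undefined, one = undefined,
    zero = hom_zero V W, add = hom_plus V W, smult = (\<lambda>c f. \<lambda>v\<in>carrier V. c \<odot>\<^sub>W f v)\<rparr>"

lemma hom_space_simps [simp]:
  "carrier (hom_space K V W) = mod_hom K V W" "\<zero>\<^bsub>hom_space K V W\<^esub> = hom_zero V W"
  "f \<oplus>\<^bsub>hom_space K V W\<^esub> g = hom_plus V W f g"
  "c \<odot>\<^bsub>hom_space K V W\<^esub> f = (\<lambda>v\<in>carrier V. c \<odot>\<^sub>W f v)"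
  by (simp_all add: hom_space_def)

text \<open>Commutativity of K is what makes scalar multiples of linear maps linear again.\<close>

lemma hom_space_module:
  assumes "cring K" "right_module K V" "right_module K W"
  shows "right_module K (hom_space K V W)"
proof -
  interpret K: cring K by fact
  interpret V: right_module K V by fact
  interpret W: right_module K W by fact
  let ?H = "hom_space K V W"
  note cl = mod_hom_closed[of _ K V W]
  have ext: "f = g" if "f \<in> mod_hom K V W" "g \<in> mod_hom K V W" "\<And>x. x \<in> carrier V \<Longrightarrow> f x = g x" for f g
    using that by (rule mod_hom_eqI)
  have comm: "a \<odot>\<^sub>W (b \<odot>\<^sub>W w) = b \<odot>\<^sub>W (a \<odot>\<^sub>W w)"
    if "a \<in> carrier K" "b \<in> carrier K" "w \<in> carrier W" for a b w
    using that W.smult_assoc[of a b w] W.smult_assoc[of b a w] K.m_comm[of a b] by simp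
  have sm: "(\<lambda>v\<in>carrier V. c \<odot>\<^sub>W f v) \<in> mod_hom K V W" if "c \<in> carrier K" "f \<in> mod_hom K V W" for c f
    using that cl[OF that(2)]
    by (intro mod_homI) (auto simp: mod_hom_add[OF that(2)] mod_hom_smult[OF that(2)] W.smult_add_module comm)
  note pl = hom_plus_in[OF assms(2,3)]
  have H: "abelian_group ?H"
  proof (rule abelian_groupI)
    fix f assume f: "f \<in> carrier ?H"
    show "\<zero>\<^bsub>?H\<^esub> \<oplus>\<^bsub>?H\<^esub> f = f"
      using f assms by (intro ext) (auto simp: pl, auto simp: hom_plus_def hom_zero_def cl)
    have n: "(\<lambda>v\<in>carrier V. (\<ominus>\<^sub>K \<one>\<^sub>K) \<odot>\<^sub>W f v) \<in> mod_hom K V W" using f by (intro sm) auto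
    show "\<exists>g\<in>carrier ?H. g \<oplus>\<^bsub>?H\<^esub> f = \<zero>\<^bsub>?H\<^esub>"
      using n f by (intro bexI[OF _ n[folded hom_space_simps]])
        (auto simp: hom_plus_def hom_zero_def cl W.neg_smult W.smult_one W.M.l_neg intro!: restrict_ext)
  next
    fix f g h assume "f \<in> carrier ?H" "g \<in> carrier ?H" "h \<in> carrier ?H"
    then show "f \<oplus>\<^bsub>?H\<^esub> g \<oplus>\<^bsub>?H\<^esub> h = f \<oplus>\<^bsub>?H\<^esub> (g \<oplus>\<^bsub>?H\<^esub> h)"
      by (auto simp: hom_plus_def cl W.M.a_assoc intro!: restrict_ext)
  next
    fix f g assume "f \<in> carrier ?H" "g \<in> carrier ?H"
    then show "f \<oplus>\<^bsub>?H\<^esub> g = g \<oplus>\<^bsub>?H\<^esub> f"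
      by (auto simp: hom_plus_def cl W.M.a_comm intro!: restrict_ext)
  qed (use assms in \<open>auto simp: pl\<close>)
  have "right_module_axioms K ?H"
  proof
    fix a f assume "a \<in> carrier K" "f \<in> carrier ?H"
    then show "a \<odot>\<^bsub>?H\<^esub> f \<in> carrier ?H" using sm by simp
  next
    fix f assume f: "f \<in> carrier ?H"
    then have "\<one>\<^sub>K \<odot>\<^bsub>?H\<^esub> f \<in> mod_hom K V W" using sm by simp
    then show "\<one>\<^sub>K \<odot>\<^bsub>?H\<^esub> f = f"
      using f by (intro ext) (auto simp: W.smult_one cl)
  qed (auto simp: hom_plus_def cl W.smult_add_ring W.smult_add_module W.smult_assoc intro!: restrict_ext)
  with H show ?thesis by (intro right_module.intro K.ring_axioms)
qed

section \<open>Separating functionals and frames\<close>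

lemma (in right_module) submodule_cyclic:
  assumes "x \<in> carrier M" shows "submodule {a \<odot>\<^sub>M x | a. a \<in> carrier A} A M"
proof (rule right_submoduleI)
  show "{a \<odot>\<^sub>M x | a. a \<in> carrier A} \<subseteq> carrier M" using assms by auto
  show "\<zero>\<^sub>M \<in> {a \<odot>\<^sub>M x | a. a \<in> carrier A}"
    using assms by (intro CollectI exI[of _ "\<zero>\<^sub>A"]) simp
next
  fix y z assume "y \<in> {a \<odot>\<^sub>M x | a. a \<in> carrier A}" "z \<in> {a \<odot>\<^sub>M x | a. a \<in> carrier A}"
  then obtain a b where "a \<in> carrier A" "b \<in> carrier A" "y = a \<odot>\<^sub>M x" "z = b \<odot>\<^sub>M x" by blast
  then show "y \<oplus>\<^sub>M z \<in> {a \<odot>\<^sub>M x | a. a \<in> carrier A}"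
    using assms by (intro CollectI exI[of _ "a \<oplus>\<^sub>A b"]) (simp add: smult_add_ring)
next
  fix b y assume b: "b \<in> carrier A" and "y \<in> {a \<odot>\<^sub>M x | a. a \<in> carrier A}"
  then obtain a where "a \<in> carrier A" "y = a \<odot>\<^sub>M x" by blast
  then show "b \<odot>\<^sub>M y \<in> {a \<odot>\<^sub>M x | a. a \<in> carrier A}"
    using assms b by (intro CollectI exI[of _ "a \<otimes>\<^sub>A b"]) (simp add: smult_assoc)
qed

lemma (in right_module) submodule_chain_Union:
  assumes "\<C> \<noteq> {}" "\<And>U. U \<in> \<C> \<Longrightarrow> submodule U A M" "\<And>U V. U \<in> \<C> \<Longrightarrow> V \<in> \<C> \<Longrightarrow> U \<subseteq> V \<or> V \<subseteq> U"
  shows "submodule (\<Union>\<C>) A M"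
proof (rule right_submoduleI)
  show "\<Union>\<C> \<subseteq> carrier M" using assms(2) submodule_subset by blast
  show "\<zero>\<^sub>M \<in> \<Union>\<C>" using assms(1,2) submodule_zero by blast
next
  fix x y assume "x \<in> \<Union>\<C>" "y \<in> \<Union>\<C>"
  then obtain U V where UV: "U \<in> \<C>" "V \<in> \<C>" "x \<in> U" "y \<in> V" by blast
  then show "x \<oplus>\<^sub>M y \<in> \<Union>\<C>"
    using assms(3)[OF UV(1,2)] submodule_add[OF assms(2)[OF UV(1)], of x y]
      submodule_add[OF assms(2)[OF UV(2)], of x y] by blast
next
  fix a x assume "a \<in> carrier A" "x \<in> \<Union>\<C>"
  then show "a \<odot>\<^sub>M x \<in> \<Union>\<C>" using submodule_smult[OF assms(2)] by blast
qed

locale vspace = F?: field K + V?: right_module K V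
  for K :: "('k, 'r) ring_scheme" (structure) and V :: "('k, 'v, 'z) module_scheme" (structure)
begin

lemma regular_vspace: "right_module K (regular K)"
  by (rule regular_module) (rule F.ring_axioms)

text \<open>A subspace U that is maximal among those containing W and missing v is a complement of
  the line through v, so L can be taken as the coefficient of v. Zorn's lemma makes this work in
  every dimension.\<close>

lemma separation:
  assumes W: "submodule W K V" and v: "v \<in> carrier V" "v \<notin> W"
  obtains L where "L \<in> mod_hom K V (regular K)" "\<And>w. w \<in> W \<Longrightarrow> L w = \<zero>\<^sub>K" "L v = \<one>\<^sub>K"
proof -
  let ?\<A> = "{U. submodule U K V \<and> W \<subseteq> U \<and> v \<notin> U}"
  have "\<exists>U\<in>?\<A>. \<forall>X\<in>?\<A>. U \<subseteq> X \<longrightarrow> X = U"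
  proof (rule subset_Zorn_nonempty)
    show "?\<A> \<noteq> {}" using W v by blast
    fix \<C> assume \<C>: "\<C> \<noteq> {}" "subset.chain ?\<A> \<C>"
    have *: "submodule U K V" "W \<subseteq> U" "v \<notin> U" if "U \<in> \<C>" for U
      using \<C>(2) that unfolding subset_chain_def by blast+
    have "submodule (\<Union>\<C>) K V"
    proof (rule submodule_chain_Union[OF \<C>(1) *(1)])
      show "U \<subseteq> U' \<or> U' \<subseteq> U" if "U \<in> \<C>" "U' \<in> \<C>" for U U'
        using \<C>(2) that unfolding subset_chain_def by blast
    qed
    moreover have "W \<subseteq> \<Union>\<C>" using *(2) \<C>(1) by blast
    moreover have "v \<notin> \<Union>\<C>" using *(3) by blast
    ultimately show "\<Union>\<C> \<in> ?\<A>" by simp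
  qed
  then obtain U where UA: "U \<in> ?\<A>" "\<forall>X\<in>?\<A>. U \<subseteq> X \<longrightarrow> X = U" by (elim bexE)
  then have U: "submodule U K V" "W \<subseteq> U" "v \<notin> U" by simp_all
  have max: "X = U" if "submodule X K V" "U \<subseteq> X" "v \<notin> X" for X
    using UA(2)[rule_format, of X] that U(2) by simp
  have UV: "u \<in> carrier V" if "u \<in> U" for u using that submodule_subset[OF U(1)] by auto
  have dec: "\<exists>u\<in>U. \<exists>c\<in>carrier K. x = u \<oplus>\<^sub>V c \<odot>\<^sub>V v" if x: "x \<in> carrier V" for x
  proof (cases "x \<in> U")
    case True
    then show ?thesis using v UV by (intro bexI[of _ x] bexI[of _ "\<zero>\<^sub>K"]) auto
  next
    case False
    \<comment> \<open>By maximality of U, adjoining x brings in v. The coefficient of x in the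
      resulting relation is nonzero because v is outside U, and the relation can be solved for
      x.\<close>
    let ?X = "U <+>\<^bsub>V\<^esub> {c \<odot>\<^sub>V x | c. c \<in> carrier K}"
    have mem: "u \<oplus>\<^sub>V c \<odot>\<^sub>V x \<in> ?X" if "u \<in> U" "c \<in> carrier K" for u c
      using that by (auto simp: set_add_def')
    have "submodule ?X K V" by (intro submodule_set_add U submodule_cyclic x)
    moreover have "U \<subseteq> ?X" using mem[of _ "\<zero>\<^sub>K"] x UV by auto
    moreover have "x \<in> ?X" using mem[OF submodule_zero[OF U(1)], of "\<one>\<^sub>K"] x by (simp add: smult_one)
    ultimately have "v \<in> ?X" using max False by blast
    then obtain u c where uc: "u \<in> U" "c \<in> carrier K" "v = u \<oplus>\<^sub>V c \<odot>\<^sub>V x"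
      by (auto simp: set_add_def')
    have "c \<noteq> \<zero>\<^sub>K" using uc UV x U(3) by auto
    then have ic: "inv\<^bsub>K\<^esub> c \<in> carrier K" "c \<otimes>\<^sub>K inv\<^bsub>K\<^esub> c = \<one>\<^sub>K"
      using uc(2) by (auto simp: field_Units)
    have "inv\<^bsub>K\<^esub> c \<odot>\<^sub>V v = inv\<^bsub>K\<^esub> c \<odot>\<^sub>V u \<oplus>\<^sub>V x"
      using uc ic x UV by (simp add: smult_add_module smult_assoc[symmetric] smult_one)
    then have "x = \<ominus>\<^sub>V (inv\<^bsub>K\<^esub> c \<odot>\<^sub>V u) \<oplus>\<^sub>V inv\<^bsub>K\<^esub> c \<odot>\<^sub>V v"
      using ic uc UV x by (simp add: V.M.r_neg1)
    then show ?thesis using submodule_neg[OF U(1)] submodule_smult[OF U(1)] ic uc by blast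
  qed
  have uniq: "c = c'" if *: "u \<in> U" "u' \<in> U" "c \<in> carrier K" "c' \<in> carrier K"
    "u \<oplus>\<^sub>V c \<odot>\<^sub>V v = u' \<oplus>\<^sub>V c' \<odot>\<^sub>V v" for u u' c c'
  proof (rule ccontr)
    assume "c \<noteq> c'"
    let ?d = "c \<oplus>\<^sub>K \<ominus>\<^sub>K c'"
    have "?d \<noteq> \<zero>\<^sub>K"
    proof
      assume "?d = \<zero>\<^sub>K"
      then have "\<ominus>\<^sub>K (\<ominus>\<^sub>K c') = c" using * by (intro F.minus_equality) simp_all
      with \<open>c \<noteq> c'\<close> * show False by simp
    qed
    then have d: "inv\<^bsub>K\<^esub> ?d \<in> carrier K" "?d \<otimes>\<^sub>K inv\<^bsub>K\<^esub> ?d = \<one>\<^sub>K" "?d \<in> carrier K"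
      using * by (auto simp: field_Units)
    have "?d \<odot>\<^sub>V v = c \<odot>\<^sub>V v \<oplus>\<^sub>V \<ominus>\<^sub>V (c' \<odot>\<^sub>V v)"
      using * v by (simp add: smult_add_ring neg_smult)
    also have "c \<odot>\<^sub>V v = \<ominus>\<^sub>V u \<oplus>\<^sub>V (u' \<oplus>\<^sub>V c' \<odot>\<^sub>V v)"
      using * v UV by (simp add: V.M.r_neg1 flip: *(5))
    also have "\<ominus>\<^sub>V u \<oplus>\<^sub>V (u' \<oplus>\<^sub>V c' \<odot>\<^sub>V v) \<oplus>\<^sub>V \<ominus>\<^sub>V (c' \<odot>\<^sub>V v) = \<ominus>\<^sub>V u \<oplus>\<^sub>V u'"
      using * v UV by (simp add: V.M.a_assoc V.M.r_neg)
    finally have "?d \<odot>\<^sub>V v \<in> U"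
      using * submodule_add[OF U(1) submodule_neg[OF U(1)]] by simp
    then have "inv\<^bsub>K\<^esub> ?d \<odot>\<^sub>V (?d \<odot>\<^sub>V v) \<in> U" using d submodule_smult[OF U(1)] by blast
    moreover have "inv\<^bsub>K\<^esub> ?d \<odot>\<^sub>V (?d \<odot>\<^sub>V v) = v"
      unfolding smult_assoc[OF d(3,1) v(1), symmetric] d(2) by (rule smult_one[OF v(1)])
    ultimately show False using U(3) by simp
  qed
  define L where "L = (\<lambda>x\<in>carrier V. THE c. c \<in> carrier K \<and> (\<exists>u\<in>U. x = u \<oplus>\<^sub>V c \<odot>\<^sub>V v))"
  have L: "L (u \<oplus>\<^sub>V c \<odot>\<^sub>V v) = c" if "u \<in> U" "c \<in> carrier K" for u c
  proof -
    have "(THE c'. c' \<in> carrier K \<and> (\<exists>u'\<in>U. u \<oplus>\<^sub>V c \<odot>\<^sub>V v = u' \<oplus>\<^sub>V c' \<odot>\<^sub>V v)) = c"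
      using that uniq by (intro the_equality) blast+
    then show ?thesis using that v UV by (simp add: L_def)
  qed
  have "L \<in> mod_hom K V (regular K)"
  proof (rule mod_homI)
    show "L \<in> carrier V \<rightarrow>\<^sub>E carrier (regular K)"
    proof (rule PiE_I)
      fix x assume "x \<in> carrier V"
      then show "L x \<in> carrier (regular K)" using dec[of x] L by auto
    qed (simp add: L_def)
  next
    fix x y assume "x \<in> carrier V" "y \<in> carrier V"
    then obtain u c u' c' where *: "u \<in> U" "c \<in> carrier K" "x = u \<oplus>\<^sub>V c \<odot>\<^sub>V v"
      "u' \<in> U" "c' \<in> carrier K" "y = u' \<oplus>\<^sub>V c' \<odot>\<^sub>V v" using dec by metis
    have "x \<oplus>\<^sub>V y = (u \<oplus>\<^sub>V u') \<oplus>\<^sub>V (c \<oplus>\<^sub>K c') \<odot>\<^sub>V v"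
      using * UV v by (simp add: smult_add_ring V.M.a_ac)
    then show "L (x \<oplus>\<^sub>V y) = L x \<oplus>\<^bsub>regular K\<^esub> L y"
      using L[of "u \<oplus>\<^sub>V u'" "c \<oplus>\<^sub>K c'"] * L submodule_add[OF U(1)] by simp
  next
    fix a x assume a: "a \<in> carrier K" and "x \<in> carrier V"
    then obtain u c where *: "u \<in> U" "c \<in> carrier K" "x = u \<oplus>\<^sub>V c \<odot>\<^sub>V v" using dec by metis
    have "a \<odot>\<^sub>V x = a \<odot>\<^sub>V u \<oplus>\<^sub>V (c \<otimes>\<^sub>K a) \<odot>\<^sub>V v"
      using * UV v a by (simp add: smult_add_module smult_assoc)
    then show "L (a \<odot>\<^sub>V x) = a \<odot>\<^bsub>regular K\<^esub> L x"
      using L[of "a \<odot>\<^sub>V u" "c \<otimes>\<^sub>K a"] * L a submodule_smult[OF U(1)] by simp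
  qed
  moreover have "L w = \<zero>\<^sub>K" if "w \<in> W" for w
    using L[of w "\<zero>\<^sub>K"] that U(2) UV v by auto
  moreover have "L v = \<one>\<^sub>K"
    using L[OF submodule_zero[OF U(1)], of "\<one>\<^sub>K"] v by (simp add: smult_one)
  ultimately show ?thesis using that by blast
qed

text \<open>A finite dual basis in the sense of projective modules: the elements of E span and the
  \<open>\<mu> e\<close> act as coordinates, although E may be linearly dependent. Traces and
  expansions of linear maps rest on the reconstruction formula alone.\<close>

definition frame :: "'v set \<Rightarrow> ('v \<Rightarrow> 'v \<Rightarrow> 'k) \<Rightarrow> bool" where
  "frame E \<mu> \<longleftrightarrow> finite E \<and> E \<subseteq> carrier V \<and> (\<forall>e\<in>E. \<mu> e \<in> mod_hom K V (regular K)) \<and>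
    (\<forall>v\<in>carrier V. v = (\<Oplus>\<^bsub>V\<^esub>e\<in>E. \<mu> e v \<odot>\<^sub>V e))"

text \<open>The vectors reproduced by a partial system of coordinates form a subspace. In
  \<open>exists_frame\<close> it is enlarged as long as a generator lies outside it.\<close>

lemma frame_sum_submodule:
  assumes "finite E" "E \<subseteq> carrier V" and \<mu>: "\<And>e. e \<in> E \<Longrightarrow> \<mu> e \<in> mod_hom K V (regular K)"
  shows "submodule {v \<in> carrier V. v = (\<Oplus>\<^bsub>V\<^esub>e\<in>E. \<mu> e v \<odot>\<^sub>V e)} K V"
proof (rule right_submoduleI)
  have cl: "\<mu> e v \<in> carrier K" if "e \<in> E" "v \<in> carrier V" for e v
    using mod_hom_closed[OF \<mu>] that by simp
  have E: "e \<in> carrier V" if "e \<in> E" for e using assms that by auto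
  have z: "\<mu> e \<zero>\<^sub>V = \<zero>\<^sub>K" if "e \<in> E" for e
    using mod_hom_zero[OF V.right_module_axioms regular_vspace \<mu>[OF that]] by simp
  have "(\<Oplus>\<^bsub>V\<^esub>e\<in>E. \<mu> e \<zero>\<^sub>V \<odot>\<^sub>V e) = (\<Oplus>\<^bsub>V\<^esub>e\<in>E. \<zero>\<^sub>V)"
    by (intro V.M.finsum_cong') (auto simp: z E)
  then show "\<zero>\<^sub>V \<in> {v \<in> carrier V. v = (\<Oplus>\<^bsub>V\<^esub>e\<in>E. \<mu> e v \<odot>\<^sub>V e)}"
    by (simp add: V.M.finsum_zero)
  {
    fix x y assume "x \<in> {v \<in> carrier V. v = (\<Oplus>\<^bsub>V\<^esub>e\<in>E. \<mu> e v \<odot>\<^sub>V e)}"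
      "y \<in> {v \<in> carrier V. v = (\<Oplus>\<^bsub>V\<^esub>e\<in>E. \<mu> e v \<odot>\<^sub>V e)}"
    then have xy: "x \<in> carrier V" "y \<in> carrier V" "(\<Oplus>\<^bsub>V\<^esub>e\<in>E. \<mu> e x \<odot>\<^sub>V e) = x" "(\<Oplus>\<^bsub>V\<^esub>e\<in>E. \<mu> e y \<odot>\<^sub>V e) = y"
      by auto
    have "(\<Oplus>\<^bsub>V\<^esub>e\<in>E. \<mu> e (x \<oplus>\<^sub>V y) \<odot>\<^sub>V e) = (\<Oplus>\<^bsub>V\<^esub>e\<in>E. \<mu> e x \<odot>\<^sub>V e \<oplus>\<^sub>V \<mu> e y \<odot>\<^sub>V e)"
      using xy(1,2) by (intro V.M.finsum_cong') (auto simp: E cl mod_hom_add[OF \<mu>] smult_add_ring)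
    also have "\<dots> = x \<oplus>\<^sub>V y"
      using xy(1,2) by (subst V.M.finsum_addf) (auto simp: E cl xy(3,4))
    finally show "x \<oplus>\<^sub>V y \<in> {v \<in> carrier V. v = (\<Oplus>\<^bsub>V\<^esub>e\<in>E. \<mu> e v \<odot>\<^sub>V e)}"
      using xy(1,2) by simp
  }
  {
    fix a x assume a: "a \<in> carrier K" and "x \<in> {v \<in> carrier V. v = (\<Oplus>\<^bsub>V\<^esub>e\<in>E. \<mu> e v \<odot>\<^sub>V e)}"
    then have x: "x \<in> carrier V" "(\<Oplus>\<^bsub>V\<^esub>e\<in>E. \<mu> e x \<odot>\<^sub>V e) = x" by auto
    have "(\<Oplus>\<^bsub>V\<^esub>e\<in>E. \<mu> e (a \<odot>\<^sub>V x) \<odot>\<^sub>V e) = (\<Oplus>\<^bsub>V\<^esub>e\<in>E. a \<odot>\<^sub>V (\<mu> e x \<odot>\<^sub>V e))"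
      using x a by (intro V.M.finsum_cong') (auto simp: E cl mod_hom_smult[OF \<mu>] smult_assoc)
    also have "\<dots> = a \<odot>\<^sub>V x"
      using x(1) a by (subst smult_finsum[symmetric]) (auto simp: E cl x(2) assms)
    finally show "a \<odot>\<^sub>V x \<in> {v \<in> carrier V. v = (\<Oplus>\<^bsub>V\<^esub>e\<in>E. \<mu> e v \<odot>\<^sub>V e)}"
      using x(1) a by simp
  }
qed auto

text \<open>Generators are treated one at a time. If s is not reproduced by the coordinates found so
  far, a functional L that vanishes on all reproduced vectors and has L s = 1 serves as the
  coordinate of s.\<close>

lemma exists_frame:
  assumes "fg_right_module K V" obtains E \<mu> where "frame E \<mu>"
proof -
  obtain S where S: "finite S" "spans S" using assms fg_iff_spans by blast
  have "S \<subseteq> carrier V" using S(2) by (simp add: spans_def)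
  with S(1) have "\<exists>E \<mu>. finite E \<and> E \<subseteq> S \<and> (\<forall>e\<in>E. \<mu> e \<in> mod_hom K V (regular K)) \<and>
    S \<subseteq> {v \<in> carrier V. v = (\<Oplus>\<^bsub>V\<^esub>e\<in>E. \<mu> e v \<odot>\<^sub>V e)}"
  proof (induction S)
    case empty
    then show ?case by auto
  next
    case (insert s S)
    then obtain E \<mu> where E: "finite E" "E \<subseteq> S" "\<And>e. e \<in> E \<Longrightarrow> \<mu> e \<in> mod_hom K V (regular K)"
      and SW: "S \<subseteq> {v \<in> carrier V. v = (\<Oplus>\<^bsub>V\<^esub>e\<in>E. \<mu> e v \<odot>\<^sub>V e)}" (is "_ \<subseteq> ?W") by blast
    have EV: "E \<subseteq> carrier V" and s: "s \<in> carrier V" using E insert by auto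
    show ?case
    proof (cases "s \<in> ?W")
      case True
      with E SW show ?thesis by (intro exI[of _ E] exI[of _ \<mu>]) auto
    next
      case False
      obtain L where L: "L \<in> mod_hom K V (regular K)" "\<And>w. w \<in> ?W \<Longrightarrow> L w = \<zero>\<^sub>K" "L s = \<one>\<^sub>K"
        using separation[OF frame_sum_submodule[OF E(1) EV E(3)] s False] by blast
      have sE: "s \<notin> E" using insert E by auto
      interpret H: right_module K "hom_space K V (regular K)"
        by (intro hom_space_module F.cring_axioms V.right_module_axioms regular_vspace)
      \<comment> \<open>Subtracting \<open>\<mu> e s\<close> times L makes the old coordinates
        vanish at s and leaves them unchanged on the vectors that were already reproduced.\<close>
      define \<nu> where "\<nu> e = (if e = s then L else
        \<mu> e \<oplus>\<^bsub>hom_space K V (regular K)\<^esub> (\<ominus>\<^sub>K \<mu> e s) \<odot>\<^bsub>hom_space K V (regular K)\<^esub> L)" for e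
      have cl: "\<mu> e v \<in> carrier K" if "e \<in> E" "v \<in> carrier V" for e v
        using mod_hom_closed[OF E(3)] that by simp
      have Lcl: "L v \<in> carrier K" if "v \<in> carrier V" for v
        using mod_hom_closed[OF L(1)] that by simp
      have \<nu>: "\<nu> e \<in> mod_hom K V (regular K)" if "e \<in> insert s E" for e
      proof (cases "e = s")
        case False
        with that have e: "e \<in> E" by simp
        have "\<nu> e \<in> carrier (hom_space K V (regular K))"
          unfolding \<nu>_def using False E(3)[OF e] L(1) cl[OF e s]
          by (simp only: if_False) (intro H.M.a_closed H.smult_closed, auto)
        then show ?thesis by simp
      qed (simp add: \<nu>_def L)
      have \<nu>v: "\<nu> e v = \<mu> e v \<oplus>\<^sub>K (L v \<otimes>\<^sub>K (\<ominus>\<^sub>K \<mu> e s))" if "e \<in> E" "v \<in> carrier V" for e v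
        using that sE by (auto simp: \<nu>_def hom_plus_def)
      have ins: "(\<Oplus>\<^bsub>V\<^esub>e\<in>insert s E. \<nu> e v \<odot>\<^sub>V e) = L v \<odot>\<^sub>V s \<oplus>\<^sub>V (\<Oplus>\<^bsub>V\<^esub>e\<in>E. \<nu> e v \<odot>\<^sub>V e)"
        if v: "v \<in> carrier V" for v
      proof -
        have "\<nu> e v \<in> carrier K" if "e \<in> insert s E" for e
          using mod_hom_closed[OF \<nu>[OF that] v] by simp
        then have "(\<lambda>e. \<nu> e v \<odot>\<^sub>V e) \<in> E \<rightarrow> carrier V" "\<nu> s v \<odot>\<^sub>V s \<in> carrier V"
          using EV s by auto
        with E(1) sE have "(\<Oplus>\<^bsub>V\<^esub>e\<in>insert s E. \<nu> e v \<odot>\<^sub>V e) = \<nu> s v \<odot>\<^sub>V s \<oplus>\<^sub>V (\<Oplus>\<^bsub>V\<^esub>e\<in>E. \<nu> e v \<odot>\<^sub>V e)"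
          by (intro V.M.finsum_insert)
        then show ?thesis by (simp add: \<nu>_def)
      qed
      have "v = (\<Oplus>\<^bsub>V\<^esub>e\<in>insert s E. \<nu> e v \<odot>\<^sub>V e)" if v: "v \<in> insert s S" for v
      proof (cases "v = s")
        case True
        have "(\<Oplus>\<^bsub>V\<^esub>e\<in>E. \<nu> e s \<odot>\<^sub>V e) = (\<Oplus>\<^bsub>V\<^esub>e\<in>E. \<zero>\<^sub>V)"
          using EV by (intro V.M.finsum_cong') (auto simp: \<nu>v s L(3) cl F.r_neg)
        then show ?thesis unfolding True ins[OF s] using s by (simp add: L(3) smult_one V.M.finsum_zero)
      next
        case False
        then have vW: "v \<in> ?W" "v \<in> carrier V" using v SW by auto
        have "(\<Oplus>\<^bsub>V\<^esub>e\<in>E. \<nu> e v \<odot>\<^sub>V e) = (\<Oplus>\<^bsub>V\<^esub>e\<in>E. \<mu> e v \<odot>\<^sub>V e)"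
          using EV by (intro V.M.finsum_cong') (auto simp: \<nu>v vW L(2)[OF vW(1)] cl s)
        also have "\<dots> = v" using vW(1) by auto
        finally show ?thesis unfolding ins[OF vW(2)] L(2)[OF vW(1)] using vW(2) s by simp
      qed
      then show ?thesis
        using E \<nu> insert.prems by (intro exI[of _ "insert s E"] exI[of _ \<nu>]) auto
    qed
  qed
  then obtain E \<mu> where E: "finite E" "E \<subseteq> S" "\<And>e. e \<in> E \<Longrightarrow> \<mu> e \<in> mod_hom K V (regular K)"
    "S \<subseteq> {v \<in> carrier V. v = (\<Oplus>\<^bsub>V\<^esub>e\<in>E. \<mu> e v \<odot>\<^sub>V e)}" by blast
  have EV: "E \<subseteq> carrier V" using E \<open>S \<subseteq> carrier V\<close> by auto
  have "{v \<in> carrier V. v = (\<Oplus>\<^bsub>V\<^esub>e\<in>E. \<mu> e v \<odot>\<^sub>V e)} = carrier V"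
    using S(2) frame_sum_submodule[of E \<mu>, OF E(1) EV E(3)] E(4) unfolding spans_def by blast
  then have "frame E \<mu>" unfolding frame_def using E EV by auto
  then show ?thesis by (rule that)
qed

end

section \<open>Finite dimension and rank\<close>

definition fdim :: "('k, 'r) ring_scheme \<Rightarrow> ('k, 'v, 'z) module_scheme \<Rightarrow> bool" where
  "fdim K V \<longleftrightarrow> (\<exists>\<Phi>. finite \<Phi> \<and> \<Phi> \<subseteq> mod_hom K V (regular K) \<and>
    (\<forall>v\<in>carrier V. (\<forall>\<phi>\<in>\<Phi>. \<phi> v = \<zero>\<^sub>K) \<longrightarrow> v = \<zero>\<^sub>V))"

text \<open>A substitute for finite length: a strictly monotone function with natural values on the
  submodules. It bounds ascending and descending chains, and it can be pulled back along injective
  maps.\<close>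

definition has_rank :: "('a, 'r) ring_scheme \<Rightarrow> ('a, 'm, 'z) module_scheme \<Rightarrow> bool" where
  "has_rank A M \<longleftrightarrow> (\<exists>d :: 'm set \<Rightarrow> nat. \<forall>U V. submodule U A M \<longrightarrow> submodule V A M \<longrightarrow> U \<subset> V \<longrightarrow> d U < d V)"

text \<open>The coordinate functionals of a frame have zero as their only common zero. Functionals,
  unlike generators, restrict directly to subspaces, which is why \<open>fdim\<close> is built on
  them.\<close>

lemma (in vspace) fg_fdim: "fg_right_module K V \<Longrightarrow> fdim K V"
proof -
  assume "fg_right_module K V"
  then obtain E \<mu> where f: "frame E \<mu>" by (rule exists_frame)
  have "v = \<zero>\<^sub>V" if v: "v \<in> carrier V" "\<forall>\<phi>\<in>\<mu> ` E. \<phi> v = \<zero>\<^sub>K" for v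
  proof -
    have "v = (\<Oplus>\<^bsub>V\<^esub>e\<in>E. \<mu> e v \<odot>\<^sub>V e)" using f v(1) by (simp add: frame_def)
    also have "\<dots> = (\<Oplus>\<^bsub>V\<^esub>e\<in>E. \<zero>\<^sub>V)" using f v by (intro V.M.finsum_cong') (auto simp: frame_def)
    finally show ?thesis by (simp add: V.M.finsum_zero)
  qed
  with f show ?thesis unfolding fdim_def frame_def by (intro exI[of _ "\<mu> ` E"]) auto
qed

text \<open>The rank of a subspace is its number of pivots with respect to a separating family of
  functionals.\<close>

lemma (in vspace) fdim_has_rank: "fdim K V \<Longrightarrow> has_rank K V"
proof -
  assume "fdim K V"
  then obtain \<Phi> where \<Phi>: "finite \<Phi>" "\<Phi> \<subseteq> mod_hom K V (regular K)"
    "\<And>v. v \<in> carrier V \<Longrightarrow> \<forall>\<phi>\<in>\<Phi>. \<phi> v = \<zero>\<^sub>K \<Longrightarrow> v = \<zero>\<^sub>V" unfolding fdim_def by blast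
  obtain n and f :: "nat \<Rightarrow> _" where nf: "\<Phi> = f ` {i. i < n}"
    using \<Phi>(1) finite_imp_nat_seg_image_inj_on by metis
  have f: "f i \<in> mod_hom K V (regular K)" if "i < n" for i using that \<Phi>(2) nf by auto
  have fcl: "f i v \<in> carrier K" if "i < n" "v \<in> carrier V" for i v
    using mod_hom_closed[OF f] that by simp
  define piv where "piv W = {i. i < n \<and> (\<exists>w\<in>W. f i w \<noteq> \<zero>\<^sub>K \<and> (\<forall>j<i. f j w = \<zero>\<^sub>K))}" for W
  have "card (piv U) < card (piv W)" if U: "submodule U K V" and W: "submodule W K V" and UW: "U \<subset> W" for U W
  proof -
    have fin: "finite (piv X)" for X by (simp add: piv_def)
    have sub: "piv U \<subseteq> piv W" using UW by (auto simp: piv_def)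
    have WV: "w \<in> carrier V" if "w \<in> W" for w using that submodule_subset[OF W] by auto
    have "piv U \<noteq> piv W"
    proof
      assume eq: "piv U = piv W"
      \<comment> \<open>Gaussian elimination, by induction on the number k of functionals that may
        still be nonzero at w: a pivot of w is also a pivot of some u in U, and a multiple of u
        cancels it.\<close>
      have *: "k \<le> n \<Longrightarrow> w \<in> W \<Longrightarrow> \<forall>j<n - k. f j w = \<zero>\<^sub>K \<Longrightarrow> w \<in> U" for k w
      proof (induction k arbitrary: w)
        case 0
        then have "w = \<zero>\<^sub>V" using nf WV by (intro \<Phi>(3)) auto
        then show ?case using submodule_zero[OF U] by simp
      next
        case (Suc k)
        define i where "i = n - Suc k"
        have i: "i < n" "n - k = Suc i" using Suc.prems by (auto simp: i_def)
        show ?case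
        proof (cases "f i w = \<zero>\<^sub>K")
          case True
          then show ?thesis using Suc i by (auto simp: less_Suc_eq i_def)
        next
          case False
          then have "i \<in> piv W" using Suc i by (auto simp: piv_def i_def)
          then obtain u where u: "u \<in> U" "f i u \<noteq> \<zero>\<^sub>K" "\<forall>j<i. f j u = \<zero>\<^sub>K"
            unfolding eq[symmetric] by (auto simp: piv_def)
          have uW: "u \<in> W" using u UW by auto
          have iu: "inv\<^bsub>K\<^esub> f i u \<in> carrier K" "f i u \<otimes>\<^sub>K inv\<^bsub>K\<^esub> f i u = \<one>\<^sub>K"
            using u(2) fcl[OF i(1) WV[OF uW]] by (auto simp: field_Units)
          define c where "c = inv\<^bsub>K\<^esub> f i u \<otimes>\<^sub>K (\<ominus>\<^sub>K f i w)"
          have c: "c \<in> carrier K" "f i u \<otimes>\<^sub>K c = \<ominus>\<^sub>K f i w"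
            using iu fcl[OF i(1) WV[OF uW]] fcl[OF i(1) WV[OF Suc.prems(2)]]
            by (simp_all add: c_def F.m_assoc[symmetric])
          have cu: "c \<odot>\<^sub>V u \<in> U" using c u submodule_smult[OF U] by simp
          have "f j (w \<oplus>\<^sub>V c \<odot>\<^sub>V u) = \<zero>\<^sub>K" if j: "j < Suc i" for j
          proof -
            have jn: "j < n" using j i by simp
            have "f j (w \<oplus>\<^sub>V c \<odot>\<^sub>V u) = f j w \<oplus>\<^sub>K f j u \<otimes>\<^sub>K c"
              using f[OF jn] WV[OF uW] WV[OF Suc.prems(2)] c by (simp add: mod_hom_add mod_hom_smult)
            then show ?thesis
              using j u(3) Suc.prems(3) c fcl[OF jn WV[OF Suc.prems(2)]]
              by (cases "j = i") (auto simp: i_def F.r_neg)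
          qed
          moreover have "w \<oplus>\<^sub>V c \<odot>\<^sub>V u \<in> W"
            using Suc.prems submodule_add[OF W] cu UW by auto
          ultimately have "w \<oplus>\<^sub>V c \<odot>\<^sub>V u \<in> U"
            using Suc.IH[of "w \<oplus>\<^sub>V c \<odot>\<^sub>V u"] Suc.prems(1) i by simp
          then have "(w \<oplus>\<^sub>V c \<odot>\<^sub>V u) \<oplus>\<^sub>V \<ominus>\<^sub>V (c \<odot>\<^sub>V u) \<in> U"
            using submodule_add[OF U _ submodule_neg[OF U cu]] by blast
          then show ?thesis using WV[OF Suc.prems(2)] WV[OF uW] c by (simp add: V.M.a_assoc V.M.r_neg)
        qed
      qed
      have "W \<subseteq> U" using *[of n] by auto
      with UW show False by auto
    qed
    with sub show ?thesis by (intro psubset_card_mono fin) auto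
  qed
  then show ?thesis unfolding has_rank_def by (intro exI[of _ "\<lambda>W. card (piv W)"]) blast
qed

text \<open>A finite set whose span has the largest possible rank spans everything, since an element
  outside the span would increase the rank.\<close>

lemma has_rank_fg:
  assumes "right_module A M" "has_rank A M" shows "fg_right_module A M"
proof -
  interpret right_module A M by fact
  obtain d :: "_ \<Rightarrow> nat" where d: "\<And>U V. submodule U A M \<Longrightarrow> submodule V A M \<Longrightarrow> U \<subset> V \<Longrightarrow> d U < d V"
    using assms(2) unfolding has_rank_def by blast
  define span where "span S = \<Inter>{N. submodule N A M \<and> S \<subseteq> N}" for S
  have span: "submodule (span S) A M" if "S \<subseteq> carrier M" for S
    unfolding span_def using that submodule_carrier by (intro submodule_Inter) blast+
  have sup: "S \<subseteq> span S" for S by (auto simp: span_def)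
  have "\<exists>S. (finite S \<and> S \<subseteq> carrier M) \<and> (\<forall>T. finite T \<and> T \<subseteq> carrier M \<longrightarrow> d (span T) \<le> d (span S))"
  proof (rule ex_has_greatest_nat[of _ "{}"])
    show "\<forall>T. finite T \<and> T \<subseteq> carrier M \<longrightarrow> d (span T) < Suc (d (carrier M))"
    proof (intro allI impI)
      fix T assume T: "finite T \<and> T \<subseteq> carrier M"
      then have "span T \<subseteq> carrier M" using submodule_subset span by blast
      then consider "span T = carrier M" | "span T \<subset> carrier M" by blast
      then have "d (span T) \<le> d (carrier M)"
      proof cases
        case 2
        then show ?thesis using d[of "span T" "carrier M"] span[of T] submodule_carrier T by simp
      qed simp
      then show "d (span T) < Suc (d (carrier M))" by simp
    qed
  qed simp
  then obtain S where S: "finite S" "S \<subseteq> carrier M"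
    and max: "\<And>T. finite T \<Longrightarrow> T \<subseteq> carrier M \<Longrightarrow> d (span T) \<le> d (span S)" by blast
  have "carrier M \<subseteq> span S"
  proof
    fix x assume x: "x \<in> carrier M"
    have "span S \<subseteq> span (insert x S)" by (auto simp: span_def)
    moreover have "\<not> span S \<subset> span (insert x S)"
      using d[of "span S" "span (insert x S)"] span S x max[of "insert x S"] by fastforce
    ultimately show "x \<in> span S" using sup[of "insert x S"] by blast
  qed
  then have "carrier M \<subseteq> N" if "submodule N A M" "S \<subseteq> N" for N
    using that unfolding span_def by blast
  then have "spans S" unfolding spans_def using S(2) submodule_subset by (simp add: subset_antisym)
  with S show ?thesis using fg_iff_spans by blast
qed

lemma has_rank_injective:
  assumes "right_module A M" "right_module A N" "f \<in> mod_hom A M N" "inj_on f (carrier M)" "has_rank A N"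
  shows "has_rank A M"
proof -
  interpret M: right_module A M by fact
  obtain d :: "_ \<Rightarrow> nat" where d: "\<And>U V. submodule U A N \<Longrightarrow> submodule V A N \<Longrightarrow> U \<subset> V \<Longrightarrow> d U < d V"
    using assms(5) unfolding has_rank_def by blast
  have "d (f ` U) < d (f ` V)" if *: "submodule U A M" "submodule V A M" "U \<subset> V" for U V
  proof (rule d)
    show "submodule (f ` U) A N" "submodule (f ` V) A N" using * mod_hom_image[OF assms(1-3)] by auto
    show "f ` U \<subset> f ` V"
      using *(3) inj_on_image_eq_iff[OF assms(4) M.submodule_subset[OF *(1)] M.submodule_subset[OF *(2)]]
      by blast
  qed
  then show ?thesis unfolding has_rank_def by (intro exI[of _ "\<lambda>U. d (f ` U)"]) blast
qed

lemma fdim_injective: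
  assumes "right_module K M" "f \<in> mod_hom K M N" "inj_on f (carrier M)" "fdim K N"
    "right_module K N"
  shows "fdim K M"
proof -
  obtain \<Phi> where \<Phi>: "finite \<Phi>" "\<Phi> \<subseteq> mod_hom K N (regular K)"
    "\<And>v. v \<in> carrier N \<Longrightarrow> \<forall>\<phi>\<in>\<Phi>. \<phi> v = \<zero>\<^sub>K \<Longrightarrow> v = \<zero>\<^sub>N" using assms(4) unfolding fdim_def by blast
  have "v = \<zero>\<^sub>M" if "v \<in> carrier M" "\<forall>\<phi>\<in>(\<lambda>\<phi>. hom_comp M \<phi> f) ` \<Phi>. \<phi> v = \<zero>\<^sub>K" for v
    using that \<Phi>(3)[of "f v"] assms by (auto simp: mod_hom_inj_iff hom_comp_apply mod_hom_closed)
  with \<Phi> assms(1,2) show ?thesis unfolding fdim_def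
    by (intro exI[of _ "(\<lambda>\<phi>. hom_comp M \<phi> f) ` \<Phi>"]) (auto intro: hom_comp_in)
qed

lemma decreasing_nat_sequence: "\<not> (\<forall>n. (d :: nat \<Rightarrow> nat) (Suc n) < d n)"
proof
  assume *: "\<forall>n. d (Suc n) < d n"
  have "d n + n \<le> d 0" for n
  proof (induction n)
    case (Suc n)
    then show ?case using *[rule_format, of n] by linarith
  qed simp
  from this[of "Suc (d 0)"] show False by simp
qed

text \<open>If the image were proper, injectivity would keep all inclusions between the images of
  successive powers of f strict, and their ranks would decrease forever.\<close>

lemma injective_imp_surjective:
  assumes "right_module A M" "has_rank A M" "f \<in> mod_hom A M M" "inj_on f (carrier M)"
  shows "f ` carrier M = carrier M"
proof (rule ccontr)
  interpret M: right_module A M by fact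
  assume "f ` carrier M \<noteq> carrier M"
  then have lt: "f ` carrier M \<subset> carrier M" using assms(3) by (auto simp: mod_hom_closed)
  obtain d :: "_ \<Rightarrow> nat" where d: "\<And>U V. submodule U A M \<Longrightarrow> submodule V A M \<Longrightarrow> U \<subset> V \<Longrightarrow> d U < d V"
    using assms(2) unfolding has_rank_def by blast
  define U where "U n = ((`) f ^^ n) (carrier M)" for n
  have U: "submodule (U n) A M" for n
    by (induction n) (auto simp: U_def M.submodule_carrier mod_hom_image[OF assms(1,1,3)])
  have "U (Suc n) \<subset> U n" for n
  proof (induction n)
    case (Suc n)
    then have "f ` U (Suc n) \<subset> f ` U n"
      using inj_on_image_eq_iff[OF assms(4) M.submodule_subset[OF U[of "Suc n"]] M.submodule_subset[OF U[of n]]]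
      by blast
    then show ?case by (simp add: U_def)
  qed (use lt in \<open>simp add: U_def\<close>)
  then have "\<forall>n. d (U (Suc n)) < d (U n)" using d U by blast
  then show False using decreasing_nat_sequence[of "\<lambda>n. d (U n)"] by blast
qed

section \<open>Functionals, annihilators and traces\<close>

lemma (in abelian_monoid) finsum_swap:
  assumes "finite S" "finite T" "\<And>s t. s \<in> S \<Longrightarrow> t \<in> T \<Longrightarrow> f s t \<in> carrier G"
  shows "(\<Oplus>s\<in>S. \<Oplus>t\<in>T. f s t) = (\<Oplus>t\<in>T. \<Oplus>s\<in>S. f s t)"
  using assms(1,3)
proof (induction S)
  case empty
  then show ?case by (simp add: finsum_zero)
next
  case (insert x S)
  have "(\<Oplus>s\<in>insert x S. \<Oplus>t\<in>T. f s t) = (\<Oplus>t\<in>T. f x t) \<oplus> (\<Oplus>s\<in>S. \<Oplus>t\<in>T. f s t)"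
    using insert by (intro finsum_insert) (auto intro!: finsum_closed)
  also have "(\<Oplus>s\<in>S. \<Oplus>t\<in>T. f s t) = (\<Oplus>t\<in>T. \<Oplus>s\<in>S. f s t)" using insert by auto
  also have "(\<Oplus>t\<in>T. f x t) \<oplus> (\<Oplus>t\<in>T. \<Oplus>s\<in>S. f s t) = (\<Oplus>t\<in>T. f x t \<oplus> (\<Oplus>s\<in>S. f s t))"
    using insert by (intro finsum_addf[symmetric]) (auto intro!: finsum_closed)
  also have "\<dots> = (\<Oplus>t\<in>T. \<Oplus>s\<in>insert x S. f s t)"
    using insert by (intro finsum_cong') (auto intro!: finsum_closed finsum_insert[symmetric])
  finally show ?case .
qed

text \<open>Finite sums depend only on carrier, zero and addition. This moves sums between a module
  and its restriction of scalars, and between K and its regular module.\<close>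

lemma finsum_same_addition:
  assumes "abelian_monoid G" "abelian_monoid H" "carrier G = carrier H" "\<zero>\<^sub>G = \<zero>\<^sub>H"
    "\<And>x y. x \<in> carrier G \<Longrightarrow> y \<in> carrier G \<Longrightarrow> x \<oplus>\<^sub>G y = x \<oplus>\<^sub>H y" "u \<in> S \<rightarrow> carrier G"
  shows "finsum G u S = finsum H u S"
proof -
  interpret G: abelian_monoid G by fact
  interpret H: abelian_monoid H by fact
  show ?thesis
  proof (cases "finite S")
    case True
    then show ?thesis using assms(6)
    proof (induction S)
      case (insert s S)
      then have "u \<in> S \<rightarrow> carrier G" "u s \<in> carrier G" "u \<in> S \<rightarrow> carrier H" "u s \<in> carrier H"
        using assms(3) by auto
      moreover from this have "finsum H u S \<in> carrier G"
        using H.finsum_closed[of u S] assms(3) by simp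
      ultimately show ?case using insert(1-3)
        by (simp add: G.finsum_insert H.finsum_insert assms(5) del: Pi_split_insert_domain)
    qed (simp add: assms(4))
  qed (simp add: assms(4) G.finsum_infinite H.finsum_infinite)
qed

context vspace
begin

lemma functional_closed:
  "\<phi> \<in> mod_hom K V (regular K) \<Longrightarrow> v \<in> carrier V \<Longrightarrow> \<phi> v \<in> carrier K"
  using mod_hom_closed[of \<phi> K V "regular K" v] by simp

lemma functional_smult:
  "\<phi> \<in> mod_hom K V (regular K) \<Longrightarrow> c \<in> carrier K \<Longrightarrow> v \<in> carrier V \<Longrightarrow> \<phi> (c \<odot>\<^sub>V v) = \<phi> v \<otimes>\<^sub>K c"
  using mod_hom_smult[of \<phi> K V "regular K" c v] by simp

lemma functional_finsum:
  assumes "\<phi> \<in> mod_hom K V (regular K)" "finite S" "u \<in> S \<rightarrow> carrier V"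
  shows "\<phi> (finsum V u S) = finsum K (\<lambda>s. \<phi> (u s)) S"
proof -
  interpret R: right_module K "regular K" by (rule regular_vspace)
  have "\<phi> (finsum V u S) = finsum (regular K) (\<lambda>s. \<phi> (u s)) S"
    by (rule mod_hom_finsum[OF V.right_module_axioms regular_vspace assms])
  also have "\<dots> = finsum K (\<lambda>s. \<phi> (u s)) S"
    using assms(3) functional_closed[OF assms(1)]
    by (intro finsum_same_addition R.M.abelian_monoid_axioms F.abelian_monoid_axioms) auto
  finally show ?thesis .
qed

lemma frameD:
  assumes "frame E \<mu>"
  shows "finite E" "E \<subseteq> carrier V" "\<And>e. e \<in> E \<Longrightarrow> \<mu> e \<in> mod_hom K V (regular K)"
    "\<And>v. v \<in> carrier V \<Longrightarrow> (\<Oplus>\<^bsub>V\<^esub>e\<in>E. \<mu> e v \<odot>\<^sub>V e) = v"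
    "\<And>e v. e \<in> E \<Longrightarrow> v \<in> carrier V \<Longrightarrow> \<mu> e v \<in> carrier K" "\<And>e. e \<in> E \<Longrightarrow> e \<in> carrier V"
proof -
  show "finite E" "E \<subseteq> carrier V" "\<And>e. e \<in> E \<Longrightarrow> \<mu> e \<in> mod_hom K V (regular K)"
    using assms by (simp_all add: frame_def)
  then show "\<And>e v. e \<in> E \<Longrightarrow> v \<in> carrier V \<Longrightarrow> \<mu> e v \<in> carrier K" "\<And>e. e \<in> E \<Longrightarrow> e \<in> carrier V"
    using functional_closed by auto
  show "(\<Oplus>\<^bsub>V\<^esub>e\<in>E. \<mu> e v \<odot>\<^sub>V e) = v" if "v \<in> carrier V" for v
    using assms that by (simp add: frame_def)
qed

lemma functionals_separate:
  assumes "x \<in> carrier V" "y \<in> carrier V" "\<And>\<phi>. \<phi> \<in> mod_hom K V (regular K) \<Longrightarrow> \<phi> x = \<phi> y"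
  shows "x = y"
proof (rule ccontr)
  assume "x \<noteq> y"
  then have ne: "x \<oplus>\<^sub>V \<ominus>\<^sub>V y \<noteq> \<zero>\<^sub>V"
    using assms(1,2) V.M.minus_equality[of x "\<ominus>\<^sub>V y"] by auto
  have "submodule {\<zero>\<^sub>V} K V" by (rule right_submoduleI) auto
  then obtain \<phi> where \<phi>: "\<phi> \<in> mod_hom K V (regular K)" "\<phi> (x \<oplus>\<^sub>V \<ominus>\<^sub>V y) = \<one>\<^sub>K"
    using separation[of "{\<zero>\<^sub>V}" "x \<oplus>\<^sub>V \<ominus>\<^sub>V y"] assms(1,2) ne by auto
  have "\<phi> (x \<oplus>\<^sub>V \<ominus>\<^sub>V y) \<oplus>\<^sub>K \<phi> y = \<phi> (x \<oplus>\<^sub>V \<ominus>\<^sub>V y \<oplus>\<^sub>V y)"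
    using mod_hom_add[OF \<phi>(1), of "x \<oplus>\<^sub>V \<ominus>\<^sub>V y" y] assms(1,2) by simp
  also have "x \<oplus>\<^sub>V \<ominus>\<^sub>V y \<oplus>\<^sub>V y = x" using assms(1,2) by (simp add: V.M.a_assoc V.M.l_neg)
  also have "\<phi> x = \<phi> y" by (rule assms(3)[OF \<phi>(1)])
  finally have "\<one>\<^sub>K = \<zero>\<^sub>K"
    unfolding \<phi>(2) using functional_closed[OF \<phi>(1) assms(2)] by (simp add: F.add.r_cancel_one)
  then show False by simp
qed

text \<open>Among the finite sets of functionals that vanish on W, one whose space of common zeros
  has least rank cuts out W: a zero outside W could be removed by adding a separating
  functional.\<close>

lemma finite_annihilator:
  assumes "has_rank K V" "submodule W K V"
  obtains \<Phi> where "finite \<Phi>" "\<Phi> \<subseteq> mod_hom K V (regular K)" "W = {v \<in> carrier V. \<forall>\<phi>\<in>\<Phi>. \<phi> v = \<zero>\<^sub>K}"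
proof -
  obtain d :: "_ \<Rightarrow> nat" where d: "\<And>U V'. submodule U K V \<Longrightarrow> submodule V' K V \<Longrightarrow> U \<subset> V' \<Longrightarrow> d U < d V'"
    using assms(1) unfolding has_rank_def by blast
  let ?Z = "\<lambda>\<Phi>. {v \<in> carrier V. \<forall>\<phi>\<in>\<Phi>. \<phi> v = \<zero>\<^sub>K}"
  let ?P = "\<lambda>\<Phi>. finite \<Phi> \<and> \<Phi> \<subseteq> mod_hom K V (regular K) \<and> W \<subseteq> ?Z \<Phi>"
  have sub: "submodule (?Z \<Phi>) K V" if \<Phi>: "\<Phi> \<subseteq> mod_hom K V (regular K)" for \<Phi>
  proof (rule right_submoduleI)
    have \<phi>: "\<phi> \<in> mod_hom K V (regular K)" if "\<phi> \<in> \<Phi>" for \<phi> using that \<Phi> by blast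
    show "\<zero>\<^sub>V \<in> ?Z \<Phi>"
      using mod_hom_zero[OF V.right_module_axioms regular_vspace \<phi>] by simp
    show "x \<oplus>\<^sub>V y \<in> ?Z \<Phi>" if "x \<in> ?Z \<Phi>" "y \<in> ?Z \<Phi>" for x y
    proof -
      have "\<phi> (x \<oplus>\<^sub>V y) = \<zero>\<^sub>K" if "\<phi> \<in> \<Phi>" for \<phi>
      proof -
        have "\<phi> x = \<zero>\<^sub>K" "\<phi> y = \<zero>\<^sub>K" "x \<in> carrier V" "y \<in> carrier V"
          using \<open>x \<in> ?Z \<Phi>\<close> \<open>y \<in> ?Z \<Phi>\<close> that by blast+
        then show ?thesis using mod_hom_add[OF \<phi>[OF that], of x y] by simp
      qed
      with that show ?thesis by simp
    qed
    show "a \<odot>\<^sub>V x \<in> ?Z \<Phi>" if "a \<in> carrier K" "x \<in> ?Z \<Phi>" for a x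
    proof -
      have "\<phi> (a \<odot>\<^sub>V x) = \<zero>\<^sub>K" if "\<phi> \<in> \<Phi>" for \<phi>
      proof -
        have "\<phi> x = \<zero>\<^sub>K" "x \<in> carrier V" using \<open>x \<in> ?Z \<Phi>\<close> that by blast+
        then show ?thesis using functional_smult[OF \<phi>[OF that] \<open>a \<in> carrier K\<close>, of x] \<open>a \<in> carrier K\<close> by simp
      qed
      with that show ?thesis by simp
    qed
  qed auto
  have "?P {}" using submodule_subset[OF assms(2)] by auto
  then obtain \<Phi> where \<Phi>: "?P \<Phi>" and min: "\<And>\<Psi>. ?P \<Psi> \<Longrightarrow> d (?Z \<Phi>) \<le> d (?Z \<Psi>)"
    using ex_has_least_nat[of ?P "{}" "\<lambda>\<Phi>. d (?Z \<Phi>)"] by blast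
  have "?Z \<Phi> \<subseteq> W"
  proof (rule ccontr)
    assume "\<not> ?Z \<Phi> \<subseteq> W"
    then obtain v where v: "v \<in> ?Z \<Phi>" "v \<notin> W" by blast
    then have "v \<in> carrier V" by simp
    then obtain L where L: "L \<in> mod_hom K V (regular K)" "\<And>w. w \<in> W \<Longrightarrow> L w = \<zero>\<^sub>K" "L v = \<one>\<^sub>K"
      using separation[OF assms(2) _ v(2)] by blast
    have P: "?P (insert L \<Phi>)" using \<Phi> L(1,2) submodule_subset[OF assms(2)] by auto
    have "v \<notin> ?Z (insert L \<Phi>)" using L(3) by simp
    then have "?Z (insert L \<Phi>) \<subset> ?Z \<Phi>" using v(1) by blast
    moreover have "submodule (?Z (insert L \<Phi>)) K V" by (rule sub) (use P in blast)
    moreover have "submodule (?Z \<Phi>) K V" by (rule sub) (use \<Phi> in blast)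
    ultimately have "d (?Z (insert L \<Phi>)) < d (?Z \<Phi>)" using d by simp
    with min[OF P] show False by simp
  qed
  then have "W = ?Z \<Phi>" using \<Phi> by blast
  moreover have "finite \<Phi>" "\<Phi> \<subseteq> mod_hom K V (regular K)" using \<Phi> by auto
  ultimately show ?thesis using that by blast
qed

text \<open>The frame is a fixed arbitrary choice. The argument is any function, evaluated on the
  frame only, so that composites can be written without restricting them to the carrier.\<close>

definition trace :: "('v \<Rightarrow> 'v) \<Rightarrow> 'k" where
  "trace w = (\<Oplus>\<^bsub>K\<^esub>e\<in>fst (SOME p. frame (fst p) (snd p)). snd (SOME p. frame (fst p) (snd p)) e (w e))"

lemma trace_frame:
  assumes "fg_right_module K V"
  obtains E \<mu> where "frame E \<mu>" "\<And>w. trace w = (\<Oplus>\<^bsub>K\<^esub>e\<in>E. \<mu> e (w e))"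
proof -
  obtain E \<mu> where "frame E \<mu>" using exists_frame[OF assms] by blast
  then have "\<exists>p. frame (fst p) (snd p)" by (intro exI[of _ "(E, \<mu>)"]) simp
  from someI_ex[OF this] show ?thesis using that unfolding trace_def by blast
qed

end

text \<open>Expanding \<open>p b\<close> in the frame of W and \<open>q c\<close> in the frame of V
  turns both traces into the double sum of the products of \<open>\<mu> b (q c)\<close> and
  \<open>\<nu> c (p b)\<close>.\<close>

lemma trace_cyclic:
  assumes "vspace K V" "vspace K W" "fg_right_module K V" "fg_right_module K W"
    and p: "p \<in> mod_hom K V W" and q: "q \<in> mod_hom K W V"
  shows "vspace.trace K V (\<lambda>x. q (p x)) = vspace.trace K W (\<lambda>x. p (q x))"
proof -
  interpret V: vspace K V by fact
  interpret W: vspace K W by fact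
  obtain E \<mu> where E: "V.frame E \<mu>" "\<And>w. V.trace w = (\<Oplus>\<^bsub>K\<^esub>e\<in>E. \<mu> e (w e))"
    using V.trace_frame[OF assms(3)] by blast
  obtain F \<nu> where F: "W.frame F \<nu>" "\<And>w. W.trace w = (\<Oplus>\<^bsub>K\<^esub>e\<in>F. \<nu> e (w e))"
    using W.trace_frame[OF assms(4)] by blast
  note e = V.frameD[OF E(1)]
  note f = W.frameD[OF F(1)]
  have pc: "p x \<in> carrier W" if "x \<in> carrier V" for x using mod_hom_closed[OF p that] .
  have qc: "q x \<in> carrier V" if "x \<in> carrier W" for x using mod_hom_closed[OF q that] .
  have 1: "\<mu> b (q (p b)) = (\<Oplus>\<^bsub>K\<^esub>c\<in>F. \<mu> b (q c) \<otimes>\<^sub>K \<nu> c (p b))" if b: "b \<in> E" for b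
  proof -
    have "\<mu> b (q (p b)) = \<mu> b (q (\<Oplus>\<^bsub>W\<^esub>c\<in>F. \<nu> c (p b) \<odot>\<^sub>W c))"
      using f(4)[OF pc[OF e(6)[OF b]]] by simp
    also have "q (\<Oplus>\<^bsub>W\<^esub>c\<in>F. \<nu> c (p b) \<odot>\<^sub>W c) = (\<Oplus>\<^bsub>V\<^esub>c\<in>F. q (\<nu> c (p b) \<odot>\<^sub>W c))"
      using f pc e(6)[OF b]
      by (intro mod_hom_finsum[OF W.V.right_module_axioms V.V.right_module_axioms q]) auto
    also have "\<mu> b \<dots> = (\<Oplus>\<^bsub>K\<^esub>c\<in>F. \<mu> b (q (\<nu> c (p b) \<odot>\<^sub>W c)))"
      using f pc e(6)[OF b] qc by (intro V.functional_finsum[OF e(3)[OF b]]) auto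
    also have "\<dots> = (\<Oplus>\<^bsub>K\<^esub>c\<in>F. \<mu> b (q c) \<otimes>\<^sub>K \<nu> c (p b))"
      using f(5,6) pc e(6)[OF b] qc e(5)[OF b] q
      by (intro V.F.finsum_cong') (auto simp: mod_hom_smult V.functional_smult[OF e(3)[OF b]])
    finally show ?thesis .
  qed
  have 2: "\<nu> c (p (q c)) = (\<Oplus>\<^bsub>K\<^esub>b\<in>E. \<nu> c (p b) \<otimes>\<^sub>K \<mu> b (q c))" if c: "c \<in> F" for c
  proof -
    have "\<nu> c (p (q c)) = \<nu> c (p (\<Oplus>\<^bsub>V\<^esub>b\<in>E. \<mu> b (q c) \<odot>\<^sub>V b))"
      using e(4)[OF qc[OF f(6)[OF c]]] by simp
    also have "p (\<Oplus>\<^bsub>V\<^esub>b\<in>E. \<mu> b (q c) \<odot>\<^sub>V b) = (\<Oplus>\<^bsub>W\<^esub>b\<in>E. p (\<mu> b (q c) \<odot>\<^sub>V b))"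
      using e qc f(6)[OF c]
      by (intro mod_hom_finsum[OF V.V.right_module_axioms W.V.right_module_axioms p]) auto
    also have "\<nu> c \<dots> = (\<Oplus>\<^bsub>K\<^esub>b\<in>E. \<nu> c (p (\<mu> b (q c) \<odot>\<^sub>V b)))"
      using e qc f(6)[OF c] pc by (intro W.functional_finsum[OF f(3)[OF c]]) auto
    also have "\<dots> = (\<Oplus>\<^bsub>K\<^esub>b\<in>E. \<nu> c (p b) \<otimes>\<^sub>K \<mu> b (q c))"
      using e(5,6) qc f(6)[OF c] pc f(5)[OF c] p
      by (intro V.F.finsum_cong') (auto simp: mod_hom_smult W.functional_smult[OF f(3)[OF c]])
    finally show ?thesis .
  qed
  have "V.trace (\<lambda>x. q (p x)) = (\<Oplus>\<^bsub>K\<^esub>b\<in>E. \<Oplus>\<^bsub>K\<^esub>c\<in>F. \<mu> b (q c) \<otimes>\<^sub>K \<nu> c (p b))"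
    unfolding E(2) using e(5,6) f(5,6) pc qc
    by (intro V.F.finsum_cong') (auto simp: 1 intro!: V.F.finsum_closed)
  also have "\<dots> = (\<Oplus>\<^bsub>K\<^esub>c\<in>F. \<Oplus>\<^bsub>K\<^esub>b\<in>E. \<mu> b (q c) \<otimes>\<^sub>K \<nu> c (p b))"
    using e(1,5,6) f(1,5,6) pc qc by (intro V.F.finsum_swap) auto
  also have "\<dots> = (\<Oplus>\<^bsub>K\<^esub>c\<in>F. \<Oplus>\<^bsub>K\<^esub>b\<in>E. \<nu> c (p b) \<otimes>\<^sub>K \<mu> b (q c))"
    using e(5,6) f(5,6) pc qc
    by (intro V.F.finsum_cong') (auto intro!: V.F.finsum_closed V.F.finsum_cong' simp: V.F.m_comm)
  also have "\<dots> = W.trace (\<lambda>x. p (q x))"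
    unfolding F(2) using e(5,6) f(5,6) pc qc
    by (intro V.F.finsum_cong') (auto simp: 2)
  finally show ?thesis .
qed

section \<open>The trace pairing between Hom(V, W) and Hom(W, V)\<close>

definition rank_one where
  "rank_one V W \<phi> w = (\<lambda>x\<in>carrier V. \<phi> x \<odot>\<^sub>W w)"

lemma rank_one_in:
  assumes "vspace K V" "vspace K W" "\<phi> \<in> mod_hom K V (regular K)" "w \<in> carrier W"
  shows "rank_one V W \<phi> w \<in> mod_hom K V W"
proof -
  interpret V: vspace K V by fact
  interpret W: vspace K W by fact
  note c = V.functional_closed[OF assms(3)]
  show ?thesis
    using assms(4) mod_hom_add[OF assms(3)] V.functional_smult[OF assms(3)]
    by (intro mod_homI) (auto simp: rank_one_def c W.smult_add_ring W.smult_assoc)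
qed

lemma hom_space_eval:
  assumes "vspace K V" "vspace K W" "x \<in> carrier V"
  shows "(\<lambda>h\<in>mod_hom K V W. h x) \<in> mod_hom K (hom_space K V W) W"
proof -
  interpret V: vspace K V by fact
  interpret W: vspace K W by fact
  interpret H: right_module K "hom_space K V W"
    by (intro hom_space_module V.F.cring_axioms V.V.right_module_axioms W.V.right_module_axioms)
  show ?thesis
    using assms(3) H.M.a_closed H.smult_closed
    by (intro mod_homI) (auto simp: mod_hom_closed, auto simp: hom_plus_def)
qed

lemma hom_space_finsum_apply:
  assumes "vspace K V" "vspace K W" "x \<in> carrier V" "finite S" "h \<in> S \<rightarrow> mod_hom K V W"
  shows "finsum (hom_space K V W) h S x = finsum W (\<lambda>s. h s x) S"
proof -
  interpret V: vspace K V by fact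
  interpret W: vspace K W by fact
  interpret H: right_module K "hom_space K V W"
    by (intro hom_space_module V.F.cring_axioms V.V.right_module_axioms W.V.right_module_axioms)
  let ?ev = "\<lambda>h\<in>mod_hom K V W. h x"
  have "?ev (finsum (hom_space K V W) h S) = finsum W (\<lambda>s. ?ev (h s)) S"
    using assms(4,5) by (intro mod_hom_finsum[OF H.right_module_axioms W.V.right_module_axioms
      hom_space_eval[OF assms(1-3)]]) auto
  also have "\<dots> = finsum W (\<lambda>s. h s x) S"
    using assms(3,5) by (intro W.V.M.finsum_cong') (auto simp: mod_hom_closed Pi_iff)
  finally show ?thesis
    using H.M.finsum_closed[of h S] assms(5) by simp
qed

text \<open>The trace pairing is perfect: every functional on Hom(V, W) has the form h \<mapsto>
  tr(v h). The map v is forced by the rank one maps x \<mapsto> \<phi>(x) w, on which tr(v h) is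
  \<phi>(v w). This second property is exported because it tests v pointwise.\<close>

lemma functional_on_hom_space:
  assumes vV: "vspace K V" and vW: "vspace K W" and fgV: "fg_right_module K V"
    and L: "L \<in> mod_hom K (hom_space K V W) (regular K)"
  obtains v where "v \<in> mod_hom K W V"
    "\<And>\<phi> w. \<phi> \<in> mod_hom K V (regular K) \<Longrightarrow> w \<in> carrier W \<Longrightarrow> \<phi> (v w) = L (rank_one V W \<phi> w)"
    "\<And>h. h \<in> mod_hom K V W \<Longrightarrow> L h = vspace.trace K V (\<lambda>x. v (h x))"
proof -
  interpret V: vspace K V by fact
  interpret W: vspace K W by fact
  interpret H: vspace K "hom_space K V W"
    by (intro vspace.intro V.F.field_axioms hom_space_module V.F.cring_axioms
        V.V.right_module_axioms W.V.right_module_axioms)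
  obtain F \<nu> where F: "V.frame F \<nu>" "\<And>w. V.trace w = (\<Oplus>\<^bsub>K\<^esub>e\<in>F. \<nu> e (w e))"
    using V.trace_frame[OF fgV] by blast
  note f = V.frameD[OF F(1)]
  have r1: "rank_one V W \<phi> w \<in> mod_hom K V W"
    if "\<phi> \<in> mod_hom K V (regular K)" "w \<in> carrier W" for \<phi> w
    by (rule rank_one_in[OF vV vW that])
  have Lc: "L h \<in> carrier K" if "h \<in> mod_hom K V W" for h
    using H.functional_closed[OF L] that by simp
  have Lr: "L (rank_one V W (\<nu> e) w) \<in> carrier K" if "e \<in> F" "w \<in> carrier W" for e w
    using that f r1 Lc by simp
  \<comment> \<open>The coordinate of \<open>v w\<close> at e has to be the value of L on the rank
    one map formed from \<open>\<nu> e\<close> and w.\<close>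
  define v where "v = (\<lambda>w\<in>carrier W. \<Oplus>\<^bsub>V\<^esub>e\<in>F. L (rank_one V W (\<nu> e) w) \<odot>\<^sub>V e)"
  have vexp: "v w = (\<Oplus>\<^bsub>V\<^esub>e\<in>F. L (rank_one V W (\<nu> e) w) \<odot>\<^sub>V e)" if "w \<in> carrier W" for w
    using that by (simp add: v_def)
  have vc: "v w \<in> carrier V" if "w \<in> carrier W" for w
    using that f(6) Lr by (auto simp: v_def intro!: V.V.M.finsum_closed)
  have r1_add: "rank_one V W \<phi> (w \<oplus>\<^sub>W w') = rank_one V W \<phi> w \<oplus>\<^bsub>hom_space K V W\<^esub> rank_one V W \<phi> w'"
    if "\<phi> \<in> mod_hom K V (regular K)" "w \<in> carrier W" "w' \<in> carrier W" for \<phi> w w'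
    using that V.functional_closed[OF that(1)]
    by (auto simp: rank_one_def hom_plus_def W.smult_add_module intro!: restrict_ext)
  have r1_smult: "rank_one V W \<phi> (c \<odot>\<^sub>W w) = c \<odot>\<^bsub>hom_space K V W\<^esub> rank_one V W \<phi> w"
    if "\<phi> \<in> mod_hom K V (regular K)" "w \<in> carrier W" "c \<in> carrier K" for \<phi> w c
    using that V.functional_closed[OF that(1)]
    by (auto simp: rank_one_def W.smult_assoc[symmetric] V.F.m_comm intro!: restrict_ext)
  have v: "v \<in> mod_hom K W V"
  proof (rule mod_homI)
    show "v \<in> carrier W \<rightarrow>\<^sub>E carrier V" using vc by (auto simp: v_def)
    fix w w' assume w: "w \<in> carrier W" "w' \<in> carrier W"
    have "v (w \<oplus>\<^sub>W w') = (\<Oplus>\<^bsub>V\<^esub>e\<in>F. L (rank_one V W (\<nu> e) w) \<odot>\<^sub>V e \<oplus>\<^sub>V L (rank_one V W (\<nu> e) w') \<odot>\<^sub>V e)"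
    proof -
      have "L (rank_one V W (\<nu> e) (w \<oplus>\<^sub>W w')) \<odot>\<^sub>V e =
          L (rank_one V W (\<nu> e) w) \<odot>\<^sub>V e \<oplus>\<^sub>V L (rank_one V W (\<nu> e) w') \<odot>\<^sub>V e" if e: "e \<in> F" for e
        unfolding r1_add[OF f(3)[OF e] w]
        using mod_hom_add[OF L, of "rank_one V W (\<nu> e) w" "rank_one V W (\<nu> e) w'"]
          r1[OF f(3)[OF e] w(1)] r1[OF f(3)[OF e] w(2)] Lr[OF e w(1)] Lr[OF e w(2)] f(6)[OF e]
        by (simp add: V.smult_add_ring)
      then show ?thesis
        unfolding vexp[OF W.V.M.a_closed[OF w]] using w f(6) Lr
        by (intro V.V.M.finsum_cong') auto
    qed
    also have "\<dots> = v w \<oplus>\<^sub>V v w'"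
      unfolding vexp[OF w(1)] vexp[OF w(2)] using w f(6) Lr by (intro V.V.M.finsum_addf) auto
    finally show "v (w \<oplus>\<^sub>W w') = v w \<oplus>\<^sub>V v w'" .
  next
    fix c w assume w: "c \<in> carrier K" "w \<in> carrier W"
    have "v (c \<odot>\<^sub>W w) = (\<Oplus>\<^bsub>V\<^esub>e\<in>F. c \<odot>\<^sub>V (L (rank_one V W (\<nu> e) w) \<odot>\<^sub>V e))"
    proof -
      have "L (rank_one V W (\<nu> e) (c \<odot>\<^sub>W w)) \<odot>\<^sub>V e = c \<odot>\<^sub>V (L (rank_one V W (\<nu> e) w) \<odot>\<^sub>V e)"
        if e: "e \<in> F" for e
        unfolding r1_smult[OF f(3)[OF e] w(2,1)]
        using H.functional_smult[OF L w(1), of "rank_one V W (\<nu> e) w"]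
          r1[OF f(3)[OF e] w(2)] Lr[OF e w(2)] f(6)[OF e] w(1)
        by (simp add: V.smult_assoc)
      then show ?thesis
        unfolding vexp[OF W.smult_closed[OF w]] using w f(6) Lr
        by (intro V.V.M.finsum_cong') auto
    qed
    also have "\<dots> = c \<odot>\<^sub>V v w"
      unfolding vexp[OF w(2)] using w f(1,6) Lr by (intro V.smult_finsum[symmetric]) auto
    finally show "v (c \<odot>\<^sub>W w) = c \<odot>\<^sub>V v w" .
  qed
  have v1: "\<phi> (v w) = L (rank_one V W \<phi> w)"
    if \<phi>: "\<phi> \<in> mod_hom K V (regular K)" and w: "w \<in> carrier W" for \<phi> w
  proof -
    note \<phi>c = V.functional_closed[OF \<phi>]
    \<comment> \<open>Every functional \<phi> is the combination of the coordinates with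
      coefficients \<open>\<phi> e\<close>, so the formula for \<phi> follows from the one for the
      frame.\<close>
    let ?h = "\<lambda>e. \<phi> e \<odot>\<^bsub>hom_space K V W\<^esub> rank_one V W (\<nu> e) w"
    have h: "?h e \<in> mod_hom K V W" if "e \<in> F" for e
      using H.smult_closed[of "\<phi> e" "rank_one V W (\<nu> e) w"] r1[OF f(3)[OF that] w] \<phi>c f(6)[OF that] by simp
    have "rank_one V W \<phi> w = finsum (hom_space K V W) ?h F"
    proof (rule mod_hom_eqI[of _ K V W])
      show "finsum (hom_space K V W) ?h F \<in> mod_hom K V W"
        using H.V.M.finsum_closed[of ?h F] h by (simp add: Pi_iff)
      fix x assume x: "x \<in> carrier V"
      have "\<phi> x = \<phi> (\<Oplus>\<^bsub>V\<^esub>e\<in>F. \<nu> e x \<odot>\<^sub>V e)" using f(4)[OF x] by simp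
      also have "\<dots> = (\<Oplus>\<^bsub>K\<^esub>e\<in>F. \<phi> (\<nu> e x \<odot>\<^sub>V e))"
        using f(1,5,6) x by (intro V.functional_finsum \<phi>) auto
      also have "\<dots> = (\<Oplus>\<^bsub>K\<^esub>e\<in>F. \<phi> e \<otimes>\<^sub>K \<nu> e x)"
        using f(5,6) x \<phi>c by (intro V.F.finsum_cong') (auto simp: V.functional_smult[OF \<phi>])
      finally have "\<phi> x \<odot>\<^sub>W w = (\<Oplus>\<^bsub>K\<^esub>e\<in>F. \<phi> e \<otimes>\<^sub>K \<nu> e x) \<odot>\<^sub>W w" by simp
      also have "\<dots> = (\<Oplus>\<^bsub>W\<^esub>e\<in>F. (\<phi> e \<otimes>\<^sub>K \<nu> e x) \<odot>\<^sub>W w)"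
        using f(1,5,6) x \<phi>c w by (intro W.finsum_smult) auto
      also have "\<dots> = (\<Oplus>\<^bsub>W\<^esub>e\<in>F. ?h e x)"
        using f(5,6) x \<phi>c w
        by (intro W.V.M.finsum_cong') (auto simp: rank_one_def V.F.m_comm[of "\<phi> _"] W.smult_assoc)
      also have "\<dots> = finsum (hom_space K V W) ?h F x"
        by (rule hom_space_finsum_apply[symmetric, OF vV vW x f(1)]) (rule Pi_I, rule h)
      finally show "rank_one V W \<phi> w x = finsum (hom_space K V W) ?h F x" using x by (simp add: rank_one_def)
    qed (rule r1[OF \<phi> w])
    then have "L (rank_one V W \<phi> w) = L (finsum (hom_space K V W) ?h F)" by simp
    also have "\<dots> = (\<Oplus>\<^bsub>K\<^esub>e\<in>F. L (?h e))"
      by (rule H.functional_finsum[OF L f(1)]) (rule Pi_I, unfold hom_space_simps(1), rule h)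
    also have "\<dots> = (\<Oplus>\<^bsub>K\<^esub>e\<in>F. L (rank_one V W (\<nu> e) w) \<otimes>\<^sub>K \<phi> e)"
      using f(3,6) w \<phi>c Lr r1
      by (intro V.F.finsum_cong') (auto simp: H.functional_smult[OF L] simp del: hom_space_simps(4))
    also have "\<dots> = (\<Oplus>\<^bsub>K\<^esub>e\<in>F. \<phi> (L (rank_one V W (\<nu> e) w) \<odot>\<^sub>V e))"
      using f(3,6) w \<phi>c Lr
      by (intro V.F.finsum_cong') (auto simp: V.functional_smult[OF \<phi>] V.F.m_comm)
    also have "\<dots> = \<phi> (v w)"
      unfolding vexp[OF w] using f(1,6) w Lr by (intro V.functional_finsum[OF \<phi>, symmetric]) auto
    finally show ?thesis ..
  qed
  have "L h = V.trace (\<lambda>x. v (h x))" if h: "h \<in> mod_hom K V W" for h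
  proof -
    note hc = mod_hom_closed[OF h]
    \<comment> \<open>h is the sum over e of the rank one maps x \<mapsto> \<nu> e(x) h(e), which
      reduces the trace formula to the rank one case.\<close>
    let ?h = "\<lambda>e. rank_one V W (\<nu> e) (h e)"
    have h': "?h e \<in> mod_hom K V W" if "e \<in> F" for e
      using that f hc r1 by simp
    have "h = finsum (hom_space K V W) ?h F"
    proof (rule mod_hom_eqI[of _ K V W, OF h])
      show "finsum (hom_space K V W) ?h F \<in> mod_hom K V W"
        using H.V.M.finsum_closed[of ?h F] h' by (simp add: Pi_iff)
      fix x assume x: "x \<in> carrier V"
      have "h x = h (\<Oplus>\<^bsub>V\<^esub>e\<in>F. \<nu> e x \<odot>\<^sub>V e)" using f(4)[OF x] by simp
      also have "\<dots> = (\<Oplus>\<^bsub>W\<^esub>e\<in>F. h (\<nu> e x \<odot>\<^sub>V e))"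
        using f(1,5,6) x
        by (intro mod_hom_finsum[OF V.V.right_module_axioms W.V.right_module_axioms h]) auto
      also have "\<dots> = (\<Oplus>\<^bsub>W\<^esub>e\<in>F. ?h e x)"
        using f(5,6) x hc by (intro W.V.M.finsum_cong') (auto simp: rank_one_def mod_hom_smult[OF h])
      also have "\<dots> = finsum (hom_space K V W) ?h F x"
        using h' f(1) x by (intro hom_space_finsum_apply[symmetric, OF vV vW]) auto
      finally show "h x = finsum (hom_space K V W) ?h F x" .
    qed
    then have "L h = L (finsum (hom_space K V W) ?h F)" by simp
    also have "\<dots> = (\<Oplus>\<^bsub>K\<^esub>e\<in>F. L (?h e))"
      using h' f(1) by (intro H.functional_finsum L) auto
    also have "\<dots> = (\<Oplus>\<^bsub>K\<^esub>e\<in>F. \<nu> e (v (h e)))"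
      using f(3,5,6) hc vc by (intro V.F.finsum_cong') (auto simp: v1[symmetric])
    finally show ?thesis by (simp add: F(2))
  qed
  then show ?thesis using that v v1 by blast
qed

text \<open>A linear map that vanishes on generators s of V is zero, so the functionals h \<mapsto>
  \<phi>(h s) separate when \<phi> runs through a separating family on W.\<close>

lemma hom_space_fdim:
  assumes vV: "vspace K V" and vW: "vspace K W" and "fg_right_module K V" "fdim K W"
  shows "fdim K (hom_space K V W)"
proof -
  interpret V: vspace K V by fact
  interpret W: vspace K W by fact
  obtain S where S: "finite S" "V.spans S" using assms(3) V.fg_iff_spans by blast
  obtain \<Phi> where \<Phi>: "finite \<Phi>" "\<Phi> \<subseteq> mod_hom K W (regular K)"
    "\<And>v. v \<in> carrier W \<Longrightarrow> \<forall>\<phi>\<in>\<Phi>. \<phi> v = \<zero>\<^sub>K \<Longrightarrow> v = \<zero>\<^sub>W" using assms(4) unfolding fdim_def by blast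
  interpret H: vspace K "hom_space K V W"
    by (intro vspace.intro V.F.field_axioms hom_space_module V.F.cring_axioms
        V.V.right_module_axioms W.V.right_module_axioms)
  have SV: "S \<subseteq> carrier V" using S(2) by (simp add: V.spans_def)
  define \<Psi> where "\<Psi> = (\<lambda>(\<phi>, s). hom_comp (hom_space K V W) \<phi> (\<lambda>h\<in>mod_hom K V W. h s)) ` (\<Phi> \<times> S)"
  have "\<Psi> \<subseteq> mod_hom K (hom_space K V W) (regular K)"
  proof -
    have "hom_comp (hom_space K V W) \<phi> (\<lambda>h\<in>mod_hom K V W. h s) \<in> mod_hom K (hom_space K V W) (regular K)"
      if "\<phi> \<in> \<Phi>" "s \<in> S" for \<phi> s
      using that \<Phi>(2) SV by (intro hom_comp_in[OF H.V.right_module_axioms hom_space_eval[OF vV vW]]) auto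
    then show ?thesis unfolding \<Psi>_def by (auto simp del: hom_space_simps)
  qed
  moreover have "finite \<Psi>" using S \<Phi> by (simp add: \<Psi>_def)
  moreover have "h = \<zero>\<^bsub>hom_space K V W\<^esub>" if h: "h \<in> carrier (hom_space K V W)" "\<forall>\<psi>\<in>\<Psi>. \<psi> h = \<zero>\<^sub>K" for h
  proof -
    have h': "h \<in> mod_hom K V W" using h by simp
    have "h s = \<zero>\<^sub>W" if s: "s \<in> S" for s
    proof (rule \<Phi>(3))
      show "h s \<in> carrier W" using mod_hom_closed[OF h'] s SV by auto
      show "\<forall>\<phi>\<in>\<Phi>. \<phi> (h s) = \<zero>\<^sub>K"
      proof
        fix \<phi> assume "\<phi> \<in> \<Phi>"
        then have "hom_comp (hom_space K V W) \<phi> (\<lambda>h\<in>mod_hom K V W. h s) \<in> \<Psi>"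
          unfolding \<Psi>_def using s by (intro image_eqI[of _ _ "(\<phi>, s)"]) auto
        with h(2) have "hom_comp (hom_space K V W) \<phi> (\<lambda>h\<in>mod_hom K V W. h s) h = \<zero>\<^sub>K" by blast
        then show "\<phi> (h s) = \<zero>\<^sub>K" using h' by (simp add: compose_def)
      qed
    qed
    then have "S \<subseteq> {x \<in> carrier V. h x = \<zero>\<^sub>W}" using SV by auto
    then have "{x \<in> carrier V. h x = \<zero>\<^sub>W} = carrier V"
      using S(2) mod_hom_kernel[OF V.V.right_module_axioms W.V.right_module_axioms h']
      unfolding V.spans_def by blast
    then have "h = hom_zero V W"
      using h' hom_zero_in[OF V.V.right_module_axioms W.V.right_module_axioms]
      by (intro mod_hom_eqI[of h K V W "hom_zero V W"]) (auto simp: hom_zero_def)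
    then show ?thesis by simp
  qed
  ultimately show ?thesis unfolding fdim_def by blast
qed

lemma (in right_module) spansD: "spans S \<Longrightarrow> submodule N A M \<Longrightarrow> S \<subseteq> N \<Longrightarrow> N = carrier M"
  by (simp add: spans_def)

context vspace
begin

lemma trace_finsum:
  assumes "fg_right_module K V" "finite T" "\<And>t x. t \<in> T \<Longrightarrow> x \<in> carrier V \<Longrightarrow> w t x \<in> carrier V"
  shows "trace (\<lambda>x. \<Oplus>\<^bsub>V\<^esub>t\<in>T. w t x) = (\<Oplus>\<^bsub>K\<^esub>t\<in>T. trace (w t))"
proof -
  obtain E \<mu> where E: "frame E \<mu>" and tr: "\<And>w. trace w = (\<Oplus>\<^bsub>K\<^esub>e\<in>E. \<mu> e (w e))"
    using trace_frame[OF assms(1)] by blast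
  note e = frameD[OF E]
  have "(\<Oplus>\<^bsub>K\<^esub>e\<in>E. \<mu> e (\<Oplus>\<^bsub>V\<^esub>t\<in>T. w t e)) = (\<Oplus>\<^bsub>K\<^esub>e\<in>E. \<Oplus>\<^bsub>K\<^esub>t\<in>T. \<mu> e (w t e))"
    using e assms by (intro F.finsum_cong') (auto intro!: functional_finsum F.finsum_closed)
  also have "\<dots> = (\<Oplus>\<^bsub>K\<^esub>t\<in>T. \<Oplus>\<^bsub>K\<^esub>e\<in>E. \<mu> e (w t e))"
    using e assms by (intro F.finsum_swap) auto
  finally show ?thesis by (simp add: tr)
qed

lemma trace_diff:
  assumes "fg_right_module K V" "\<And>x. x \<in> carrier V \<Longrightarrow> p x \<in> carrier V" "\<And>x. x \<in> carrier V \<Longrightarrow> q x \<in> carrier V"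
    "trace p = trace q"
  shows "trace (\<lambda>x. p x \<oplus>\<^sub>V \<ominus>\<^sub>V q x) = \<zero>\<^sub>K"
proof -
  obtain E \<mu> where E: "frame E \<mu>" and tr: "\<And>w. trace w = (\<Oplus>\<^bsub>K\<^esub>e\<in>E. \<mu> e (w e))"
    using trace_frame[OF assms(1)] by blast
  note e = frameD[OF E]
  have *: "\<mu> b (p b \<oplus>\<^sub>V \<ominus>\<^sub>V q b) \<oplus>\<^sub>K \<mu> b (q b) = \<mu> b (p b)" if b: "b \<in> E" for b
    using mod_hom_add[OF e(3)[OF b], of "p b \<oplus>\<^sub>V \<ominus>\<^sub>V q b" "q b"] assms(2,3)[OF e(6)[OF b]]
    by (simp add: V.M.a_assoc V.M.l_neg)
  have "trace (\<lambda>x. p x \<oplus>\<^sub>V \<ominus>\<^sub>V q x) \<oplus>\<^sub>K trace q =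
      (\<Oplus>\<^bsub>K\<^esub>b\<in>E. \<mu> b (p b \<oplus>\<^sub>V \<ominus>\<^sub>V q b) \<oplus>\<^sub>K \<mu> b (q b))"
    unfolding tr using e(5,6) assms(2,3) by (intro F.finsum_addf[symmetric]) auto
  also have "\<dots> = trace p"
    unfolding tr using e(5,6) assms(2,3) by (intro F.finsum_cong') (auto simp: *)
  also have "\<dots> = \<zero>\<^sub>K \<oplus>\<^sub>K trace q"
    using assms(4) e(5,6) assms(3) unfolding tr by (simp add: F.finsum_closed Pi_iff)
  finally show ?thesis
    using e(5,6) assms(2,3) unfolding tr by (subst (asm) F.add.right_cancel) (auto intro!: F.finsum_closed)
qed

lemma trace_cong:
  assumes "fg_right_module K V" "\<And>x. x \<in> carrier V \<Longrightarrow> p x = q x" "\<And>x. x \<in> carrier V \<Longrightarrow> q x \<in> carrier V"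
  shows "trace p = trace q"
proof -
  obtain E \<mu> where E: "frame E \<mu>" and tr: "\<And>w. trace w = (\<Oplus>\<^bsub>K\<^esub>e\<in>E. \<mu> e (w e))"
    using trace_frame[OF assms(1)] by blast
  note e = frameD[OF E]
  show ?thesis unfolding tr using e(5,6) assms(2,3) by (intro F.finsum_cong') auto
qed

end

section \<open>Restriction of scalars\<close>

definition scalars :: "('k, 'a, 'y) module_scheme \<Rightarrow> ('a, 'm, 'z) module_scheme \<Rightarrow> ('k, 'm) module" where
  "scalars A M = \<lparr>carrier = carrier M, monoid.mult = undefined, one = undefined, zero = \<zero>\<^sub>M,
    add = add M, smult = (\<lambda>c x. (c \<odot>\<^sub>A \<one>\<^sub>A) \<odot>\<^sub>M x)\<rparr>"

lemma scalars_simps [simp]: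
  "carrier (scalars A M) = carrier M" "\<zero>\<^bsub>scalars A M\<^esub> = \<zero>\<^sub>M"
  "x \<oplus>\<^bsub>scalars A M\<^esub> y = x \<oplus>\<^sub>M y" "c \<odot>\<^bsub>scalars A M\<^esub> x = (c \<odot>\<^sub>A \<one>\<^sub>A) \<odot>\<^sub>M x"
  by (simp_all add: scalars_def)

text \<open>The right action is (g a)(b) = g(a b). This is the coinduced module: A-homomorphisms
  from X to it correspond, by evaluation at 1, to K-linear maps X \<rightarrow> Q. For Q = K it is
  the dual of A.\<close>

definition coinduced :: "('k, 'x) ring_scheme \<Rightarrow> ('k, 'a, 'y) module_scheme \<Rightarrow> ('k, 'q, 'z) module_scheme
    \<Rightarrow> ('a, 'a \<Rightarrow> 'q) module" where
  "coinduced K A Q = \<lparr>carrier = mod_hom K A Q, monoid.mult = undefined, one = undefined,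
    zero = hom_zero A Q, add = hom_plus A Q, smult = (\<lambda>a g. \<lambda>b\<in>carrier A. g (a \<otimes>\<^sub>A b))\<rparr>"

lemma coinduced_simps [simp]:
  "carrier (coinduced K A Q) = mod_hom K A Q" "\<zero>\<^bsub>coinduced K A Q\<^esub> = hom_zero A Q"
  "f \<oplus>\<^bsub>coinduced K A Q\<^esub> g = hom_plus A Q f g"
  "a \<odot>\<^bsub>coinduced K A Q\<^esub> g = (\<lambda>b\<in>carrier A. g (a \<otimes>\<^sub>A b))"
  by (simp_all add: coinduced_def)

context fin_dim_algebra
begin

lemma A_right_module: "right_module K A"
proof -
  have "right_module_axioms K A"
    by unfold_locales (auto simp: smult_l_distr smult_r_distr smult_assoc1 K.m_comm
        simp flip: smult_assoc1)
  then show ?thesis by (intro right_module.intro K.ring_axioms A.abelian_group_axioms)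
qed

lemma A_vspace: "vspace K A"
  by (intro vspace.intro K.field_axioms A_right_module)

lemma A_fg: "fg_right_module K A"
  using finite_dim A_right_module unfolding fg_right_module_def by blast

lemma scalar_mult:
  assumes "c \<in> carrier K" "x \<in> carrier A"
  shows "(c \<odot>\<^sub>A \<one>\<^sub>A) \<otimes>\<^sub>A x = c \<odot>\<^sub>A x" "x \<otimes>\<^sub>A (c \<odot>\<^sub>A \<one>\<^sub>A) = c \<odot>\<^sub>A x"
  using assms smult_mult_left[of c "\<one>\<^sub>A" x] smult_mult_right[of c x "\<one>\<^sub>A"] by simp_all

lemma scalars_module:
  assumes "right_module A M" shows "right_module K (scalars A M)"
proof -
  interpret M: right_module A M by fact
  have "abelian_group (scalars A M)"
  proof (rule abelian_groupI)
    fix x assume "x \<in> carrier (scalars A M)"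
    then show "\<exists>y\<in>carrier (scalars A M). y \<oplus>\<^bsub>scalars A M\<^esub> x = \<zero>\<^bsub>scalars A M\<^esub>"
      by (intro bexI[of _ "\<ominus>\<^sub>M x"]) (simp_all add: M.M.l_neg)
  qed (auto simp: M.M.a_ac)
  moreover have "right_module_axioms K (scalars A M)"
  proof
    fix a b x assume "a \<in> carrier K" "b \<in> carrier K" "x \<in> carrier (scalars A M)"
    then show "(a \<otimes>\<^sub>K b) \<odot>\<^bsub>scalars A M\<^esub> x = b \<odot>\<^bsub>scalars A M\<^esub> (a \<odot>\<^bsub>scalars A M\<^esub> x)"
      using M.smult_assoc[of "a \<odot>\<^sub>A \<one>\<^sub>A" "b \<odot>\<^sub>A \<one>\<^sub>A" x] K.m_comm[of a b]
      by (simp add: scalar_mult smult_assoc1[of b a])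
  qed (auto simp: smult_l_distr M.smult_add_ring M.smult_add_module M.smult_one)
  ultimately show ?thesis by (intro right_module.intro K.ring_axioms)
qed

lemma scalars_vspace: "right_module A M \<Longrightarrow> vspace K (scalars A M)"
  by (intro vspace.intro K.field_axioms scalars_module)

lemma hom_scalars: "f \<in> mod_hom A M N \<Longrightarrow> f \<in> mod_hom K (scalars A M) (scalars A N)"
  by (intro mod_homI) (auto simp: mod_hom_add mod_hom_smult dest: mod_hom_PiE)

lemma submodule_scalars:
  assumes "right_module A M" "submodule N A M" shows "submodule N K (scalars A M)"
proof -
  interpret M: right_module A M by fact
  interpret S: right_module K "scalars A M" by (rule scalars_module[OF assms(1)])
  show ?thesis
    using M.submodule_subset[OF assms(2)] M.submodule_zero[OF assms(2)] M.submodule_add[OF assms(2)]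
      M.submodule_smult[OF assms(2)]
    by (intro S.right_submoduleI) auto
qed

lemma finsum_scalars:
  assumes "right_module A M" "u \<in> S \<rightarrow> carrier M"
  shows "finsum (scalars A M) u S = finsum M u S"
proof -
  interpret M: right_module A M by fact
  interpret S: right_module K "scalars A M" by (rule scalars_module[OF assms(1)])
  show ?thesis using assms(2)
    by (intro finsum_same_addition S.M.abelian_monoid_axioms M.M.abelian_monoid_axioms) auto
qed

lemma action_scalars:
  assumes "right_module A M" "a \<in> carrier A"
  shows "(\<lambda>x\<in>carrier M. a \<odot>\<^sub>M x) \<in> mod_hom K (scalars A M) (scalars A M)"
proof -
  interpret M: right_module A M by fact
  show ?thesis
  proof (rule mod_homI)
    fix c x assume c: "c \<in> carrier K" "x \<in> carrier (scalars A M)"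
    have "a \<odot>\<^sub>M ((c \<odot>\<^sub>A \<one>\<^sub>A) \<odot>\<^sub>M x) = (c \<odot>\<^sub>A \<one>\<^sub>A) \<odot>\<^sub>M (a \<odot>\<^sub>M x)"
      using M.smult_assoc[of "c \<odot>\<^sub>A \<one>\<^sub>A" a x] M.smult_assoc[of a "c \<odot>\<^sub>A \<one>\<^sub>A" x] c assms
      by (simp add: scalar_mult)
    then show "(\<lambda>x\<in>carrier M. a \<odot>\<^sub>M x) (c \<odot>\<^bsub>scalars A M\<^esub> x) =
        c \<odot>\<^bsub>scalars A M\<^esub> (\<lambda>x\<in>carrier M. a \<odot>\<^sub>M x) x"
      using c by simp
  qed (use assms in \<open>auto simp: M.smult_add_module\<close>)
qed

lemma smult_scalars_comm:
  assumes "right_module A M" "a \<in> carrier A" "c \<in> carrier K" "x \<in> carrier M"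
  shows "a \<odot>\<^sub>M ((c \<odot>\<^sub>A \<one>\<^sub>A) \<odot>\<^sub>M x) = (c \<odot>\<^sub>A \<one>\<^sub>A) \<odot>\<^sub>M (a \<odot>\<^sub>M x)"
proof -
  interpret M: right_module A M by fact
  show ?thesis
    using mod_hom_smult[OF action_scalars[OF assms(1,2)], of c x] assms by simp
qed

text \<open>The same map in two roles: A-linear from the regular module, and K-linear from the space
  underlying A.\<close>

lemma orbit_map:
  assumes "right_module A M" "x \<in> carrier M"
  shows "(\<lambda>a\<in>carrier A. a \<odot>\<^sub>M x) \<in> mod_hom A (regular A) M"
    and "(\<lambda>a\<in>carrier A. a \<odot>\<^sub>M x) \<in> mod_hom K A (scalars A M)"
proof -
  interpret M: right_module A M by fact
  show "(\<lambda>a\<in>carrier A. a \<odot>\<^sub>M x) \<in> mod_hom A (regular A) M"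
    using assms(2) by (intro mod_homI) (auto simp: M.smult_add_ring M.smult_assoc)
  show "(\<lambda>a\<in>carrier A. a \<odot>\<^sub>M x) \<in> mod_hom K A (scalars A M)"
  proof (rule mod_homI)
    fix c a assume c: "c \<in> carrier K" "a \<in> carrier A"
    have "(c \<odot>\<^sub>A a) \<odot>\<^sub>M x = (a \<otimes>\<^sub>A (c \<odot>\<^sub>A \<one>\<^sub>A)) \<odot>\<^sub>M x" using c by (simp add: scalar_mult)
    also have "\<dots> = (c \<odot>\<^sub>A \<one>\<^sub>A) \<odot>\<^sub>M (a \<odot>\<^sub>M x)"
      using c assms(2) by (intro M.smult_assoc) auto
    finally show "(\<lambda>a\<in>carrier A. a \<odot>\<^sub>M x) (c \<odot>\<^sub>A a) = c \<odot>\<^bsub>scalars A M\<^esub> (\<lambda>a\<in>carrier A. a \<odot>\<^sub>M x) a"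
      using c by simp
  qed (use assms(2) in \<open>auto simp: M.smult_add_ring\<close>)
qed

section \<open>Finite generation over the algebra and over the field\<close>

lemma fg_scalars:
  assumes "fg_right_module A M" shows "fg_right_module K (scalars A M)"
proof -
  interpret M: right_module A M using assms by (simp add: fg_right_module_def)
  interpret S: right_module K "scalars A M" by (rule scalars_module[OF M.right_module_axioms])
  interpret KA: right_module K A by (rule A_right_module)
  obtain T where T: "finite T" "KA.spans T" using A_fg KA.fg_iff_spans by blast
  obtain S where S: "finite S" "S \<subseteq> carrier M"
    "\<And>x. x \<in> carrier M \<Longrightarrow> \<exists>a \<in> S \<rightarrow> carrier A. x = (\<Oplus>\<^bsub>M\<^esub>s\<in>S. a s \<odot>\<^sub>M s)"
    using assms unfolding fg_right_module_def by blast
  have TA: "T \<subseteq> carrier A" using T(2) by (simp add: KA.spans_def)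
  let ?B = "(\<lambda>(t, s). t \<odot>\<^sub>M s) ` (T \<times> S)"
  have "S.spans ?B"
    unfolding S.spans_def
  proof (intro conjI allI impI)
    show "?B \<subseteq> carrier (scalars A M)" using TA S(2) by (auto intro!: M.smult_closed)
    fix N assume N: "submodule N K (scalars A M)" "?B \<subseteq> N"
    have aN: "a \<odot>\<^sub>M s \<in> N" if s: "s \<in> S" and a: "a \<in> carrier A" for s a
    proof -
      have sM: "s \<in> carrier M" using s S(2) by blast
      have "submodule {a \<in> carrier A. (\<lambda>a\<in>carrier A. a \<odot>\<^sub>M s) a \<in> N} K A"
        by (rule mod_hom_vimage[OF A_right_module S.right_module_axioms
          orbit_map(2)[OF M.right_module_axioms sM] N(1)])
      moreover have "T \<subseteq> {a \<in> carrier A. (\<lambda>a\<in>carrier A. a \<odot>\<^sub>M s) a \<in> N}"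
        using TA N(2) s by auto
      ultimately have "{a \<in> carrier A. (\<lambda>a\<in>carrier A. a \<odot>\<^sub>M s) a \<in> N} = carrier A"
        using T(2) unfolding KA.spans_def by blast
      then have "a \<in> {a \<in> carrier A. (\<lambda>a\<in>carrier A. a \<odot>\<^sub>M s) a \<in> N}" using a by blast
      then show ?thesis using a by simp
    qed
    have "x \<in> N" if x: "x \<in> carrier M" for x
    proof -
      obtain a where a: "a \<in> S \<rightarrow> carrier A" "x = (\<Oplus>\<^bsub>M\<^esub>s\<in>S. a s \<odot>\<^sub>M s)" using S(3)[OF x] by blast
      have "finsum (scalars A M) (\<lambda>s. a s \<odot>\<^sub>M s) S \<in> N"
        using a aN by (intro S.submodule_finsum[OF N(1) S(1)]) auto
      also have "finsum (scalars A M) (\<lambda>s. a s \<odot>\<^sub>M s) S = x"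
        unfolding a(2) using a S(2) by (intro finsum_scalars[OF M.right_module_axioms]) (auto intro!: M.smult_closed)
      finally show ?thesis .
    qed
    then show "N = carrier (scalars A M)" using S.submodule_subset[OF N(1)] by auto
  qed
  moreover have "finite ?B" using T S by simp
  ultimately show ?thesis using S.fg_iff_spans by blast
qed

lemma has_rank_scalars:
  assumes "right_module A M" "has_rank K (scalars A M)" shows "has_rank A M"
  using assms submodule_scalars[OF assms(1)] unfolding has_rank_def by (elim exE) blast

text \<open>Submodules over A are K-subspaces, so a rank over K is also a rank over A. Products and
  coinduced modules are recognised as finitely generated in this way.\<close>

lemma fdim_imp_fg:
  assumes "right_module A M" "fdim K (scalars A M)" shows "fg_right_module A M"
  by (intro has_rank_fg has_rank_scalars assms vspace.fdim_has_rank scalars_vspace)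

lemma fg_imp_fdim: "fg_right_module A M \<Longrightarrow> fdim K (scalars A M)"
  using vspace.fg_fdim[OF scalars_vspace fg_scalars] by (auto simp: fg_right_module_def)

lemma fg_has_rank: "fg_right_module A M \<Longrightarrow> has_rank A M"
  using has_rank_scalars vspace.fdim_has_rank[OF scalars_vspace fg_imp_fdim]
  by (auto simp: fg_right_module_def)

text \<open>The rank of the ambient module restricts to the submodule and plays the role of the
  noetherian property.\<close>

lemma fg_submodule:
  assumes "fg_right_module A M" "submodule N A M"
  shows "fg_right_module A (M\<lparr>carrier := N\<rparr>)"
proof -
  interpret M: right_module A M using assms by (simp add: fg_right_module_def)
  have N: "right_module A (M\<lparr>carrier := N\<rparr>)" by (rule M.submodule_module[OF assms(2)])
  have "(\<lambda>x\<in>N. x) \<in> mod_hom A (M\<lparr>carrier := N\<rparr>) M"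
    using M.submodule_subset[OF assms(2)] M.submodule_add[OF assms(2)] M.submodule_smult[OF assms(2)]
    by (intro mod_homI) auto
  then have "has_rank A (M\<lparr>carrier := N\<rparr>)"
    by (rule has_rank_injective[OF N M.right_module_axioms _ _ fg_has_rank[OF assms(1)]])
      (simp add: inj_on_def)
  then show ?thesis by (rule has_rank_fg[OF N])
qed

lemma fg_surjective_image:
  assumes "fg_right_module A M" "right_module A N" "p \<in> mod_hom A M N" "p ` carrier M = carrier N"
  shows "fg_right_module A N"
proof -
  interpret M: right_module A M using assms by (simp add: fg_right_module_def)
  interpret N: right_module A N by fact
  obtain S where S: "finite S" "M.spans S" using assms(1) M.fg_iff_spans by blast
  have "N.spans (p ` S)"
    unfolding N.spans_def
  proof (intro conjI allI impI)
    have SM: "S \<subseteq> carrier M" using S(2) by (simp add: M.spans_def)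
    then show "p ` S \<subseteq> carrier N" using assms(4) by blast
    fix U assume U: "submodule U A N" "p ` S \<subseteq> U"
    have "S \<subseteq> {x \<in> carrier M. p x \<in> U}" using SM U(2) by blast
    then have "{x \<in> carrier M. p x \<in> U} = carrier M"
      by (rule M.spansD[OF S(2) mod_hom_vimage[OF M.right_module_axioms assms(2,3) U(1)]])
    then have "p ` carrier M \<subseteq> U" by blast
    then show "U = carrier N" using N.submodule_subset[OF U(1)] assms(4) by simp
  qed
  with S show ?thesis using N.fg_iff_spans by blast
qed

lemma regular_fg: "fg_right_module A (regular A)"
proof -
  interpret R: right_module A "regular A" by (rule regular_module[OF A.ring_axioms])
  have "R.spans {\<one>\<^sub>A}"
    unfolding R.spans_def
  proof (intro conjI allI impI)
    fix N assume N: "submodule N A (regular A)" "{\<one>\<^sub>A} \<subseteq> N"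
    have "a \<in> N" if "a \<in> carrier A" for a
      using R.submodule_smult[OF N(1) that, of "\<one>\<^sub>A"] N(2) that by simp
    then show "N = carrier (regular A)" using R.submodule_subset[OF N(1)] by auto
  qed simp
  then show ?thesis using R.fg_iff_spans by blast
qed

text \<open>Separating functionals of the two factors, composed with the projections, separate the
  points of the product.\<close>

lemma prod_fg:
  assumes "fg_right_module A M" "fg_right_module A N" "finite J"
  shows "fg_right_module A (prod_module M J N)"
proof (rule fdim_imp_fg)
  have M: "right_module A M" and N: "right_module A N" using assms by (simp_all add: fg_right_module_def)
  show P: "right_module A (prod_module M J N)" by (rule prod_module[OF M N])
  let ?P = "scalars A (prod_module M J N)"
  obtain \<Phi> where \<Phi>: "finite \<Phi>" "\<Phi> \<subseteq> mod_hom K (scalars A M) (regular K)"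
    "\<And>v. v \<in> carrier M \<Longrightarrow> \<forall>\<phi>\<in>\<Phi>. \<phi> v = \<zero>\<^sub>K \<Longrightarrow> v = \<zero>\<^sub>M"
    using fg_imp_fdim[OF assms(1)] unfolding fdim_def by auto
  obtain \<Psi> where \<Psi>: "finite \<Psi>" "\<Psi> \<subseteq> mod_hom K (scalars A N) (regular K)"
    "\<And>v. v \<in> carrier N \<Longrightarrow> \<forall>\<phi>\<in>\<Psi>. \<phi> v = \<zero>\<^sub>K \<Longrightarrow> v = \<zero>\<^sub>N"
    using fg_imp_fdim[OF assms(2)] unfolding fdim_def by auto
  interpret P: right_module K ?P by (rule scalars_module[OF P])
  have 1: "(\<lambda>p\<in>carrier ?P. fst p) \<in> mod_hom K ?P (scalars A M)"
  proof (rule mod_homI)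
    fix x y assume "x \<in> carrier ?P" "y \<in> carrier ?P"
    then show "(\<lambda>p\<in>carrier ?P. fst p) (x \<oplus>\<^bsub>?P\<^esub> y) =
        (\<lambda>p\<in>carrier ?P. fst p) x \<oplus>\<^bsub>scalars A M\<^esub> (\<lambda>p\<in>carrier ?P. fst p) y"
      using P.M.a_closed[of x y] by simp
  next
    fix a x assume "a \<in> carrier K" "x \<in> carrier ?P"
    then show "(\<lambda>p\<in>carrier ?P. fst p) (a \<odot>\<^bsub>?P\<^esub> x) = a \<odot>\<^bsub>scalars A M\<^esub> (\<lambda>p\<in>carrier ?P. fst p) x"
      using P.smult_closed[of a x] by simp
  qed auto
  have 2: "(\<lambda>p\<in>carrier ?P. snd p j) \<in> mod_hom K ?P (scalars A N)" if "j \<in> J" for j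
  proof (rule mod_homI)
    fix x y assume "x \<in> carrier ?P" "y \<in> carrier ?P"
    then show "(\<lambda>p\<in>carrier ?P. snd p j) (x \<oplus>\<^bsub>?P\<^esub> y) =
        (\<lambda>p\<in>carrier ?P. snd p j) x \<oplus>\<^bsub>scalars A N\<^esub> (\<lambda>p\<in>carrier ?P. snd p j) y"
      using P.M.a_closed[of x y] \<open>j \<in> J\<close> by simp
  next
    fix a x assume "a \<in> carrier K" "x \<in> carrier ?P"
    then show "(\<lambda>p\<in>carrier ?P. snd p j) (a \<odot>\<^bsub>?P\<^esub> x) = a \<odot>\<^bsub>scalars A N\<^esub> (\<lambda>p\<in>carrier ?P. snd p j) x"
      using P.smult_closed[of a x] \<open>j \<in> J\<close> by simp
  qed (use \<open>j \<in> J\<close> in auto)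
  let ?\<pi> = "\<lambda>p\<in>carrier ?P. fst p" and ?\<rho> = "\<lambda>j. \<lambda>p\<in>carrier ?P. snd p j"
  define S where "S = (\<lambda>\<phi>. hom_comp ?P \<phi> ?\<pi>) ` \<Phi> \<union> (\<lambda>(\<phi>, j). hom_comp ?P \<phi> (?\<rho> j)) ` (\<Psi> \<times> J)"
  have "hom_comp ?P \<phi> ?\<pi> \<in> mod_hom K ?P (regular K)" if "\<phi> \<in> \<Phi>" for \<phi>
    by (rule hom_comp_in[OF P.right_module_axioms 1 subsetD[OF \<Phi>(2) that]])
  moreover have "hom_comp ?P \<phi> (?\<rho> j) \<in> mod_hom K ?P (regular K)" if "\<phi> \<in> \<Psi>" "j \<in> J" for \<phi> j
    by (rule hom_comp_in[OF P.right_module_axioms 2[OF that(2)] subsetD[OF \<Psi>(2) that(1)]])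
  ultimately have "S \<subseteq> mod_hom K ?P (regular K)"
    unfolding S_def by (auto simp del: scalars_simps prod_module_simps)
  moreover have "p = \<zero>\<^bsub>?P\<^esub>" if p: "p \<in> carrier ?P" "\<forall>\<phi>\<in>S. \<phi> p = \<zero>\<^sub>K" for p
  proof -
    have "\<phi> (fst p) = \<zero>\<^sub>K" if "\<phi> \<in> \<Phi>" for \<phi>
    proof -
      have "hom_comp ?P \<phi> ?\<pi> \<in> S" using that unfolding S_def by blast
      then have "hom_comp ?P \<phi> ?\<pi> p = \<zero>\<^sub>K" using p(2) by blast
      then show ?thesis using p(1) by (simp only: hom_comp_apply restrict_apply')
    qed
    then have 1: "fst p = \<zero>\<^sub>M" using p(1) by (intro \<Phi>(3)) auto
    have "\<phi> (snd p j) = \<zero>\<^sub>K" if "\<phi> \<in> \<Psi>" "j \<in> J" for \<phi> j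
    proof -
      have "hom_comp ?P \<phi> (?\<rho> j) \<in> S"
        unfolding S_def using that by (intro UnI2 image_eqI[of _ _ "(\<phi>, j)"]) simp_all
      then have "hom_comp ?P \<phi> (?\<rho> j) p = \<zero>\<^sub>K" using p(2) by blast
      then show ?thesis using p(1) by (simp only: hom_comp_apply restrict_apply')
    qed
    then have "snd p j = \<zero>\<^sub>N" if "j \<in> J" for j
      using p(1) that by (intro \<Psi>(3)) auto
    then have "snd p = (\<lambda>j\<in>J. \<zero>\<^sub>N)"
      using p(1) by (intro extensionalityI[of _ J]) (auto simp: PiE_def)
    with 1 show ?thesis by (simp add: prod_eq_iff)
  qed
  moreover have "finite S" unfolding S_def using \<Phi>(1) \<Psi>(1) assms(3) by simp
  ultimately show "fdim K ?P"
    unfolding fdim_def by (intro exI[of _ S]) simp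
qed

lemma coinduced_module:
  assumes "right_module K Q" shows "right_module A (coinduced K A Q)"
proof -
  interpret Q: right_module K Q by fact
  interpret H: right_module K "hom_space K A Q"
    by (rule hom_space_module[OF K.cring_axioms A_right_module assms])
  note cl = mod_hom_closed[of _ K A Q]
  have "abelian_group (coinduced K A Q)"
  proof (rule abelian_groupI)
    fix x assume "x \<in> carrier (coinduced K A Q)"
    then show "\<exists>y\<in>carrier (coinduced K A Q). y \<oplus>\<^bsub>coinduced K A Q\<^esub> x = \<zero>\<^bsub>coinduced K A Q\<^esub>"
      using H.M.l_neg[of x] H.M.a_inv_closed[of x] by (intro bexI[of _ "\<ominus>\<^bsub>hom_space K A Q\<^esub> x"]) simp_all
  qed (use H.M.a_closed H.M.a_assoc H.M.a_comm H.M.l_zero A_right_module assms in auto)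
  moreover have "right_module_axioms A (coinduced K A Q)"
  proof
    fix a g assume a: "a \<in> carrier A" and g: "g \<in> carrier (coinduced K A Q)"
    then show "a \<odot>\<^bsub>coinduced K A Q\<^esub> g \<in> carrier (coinduced K A Q)"
      by (auto intro!: mod_homI simp: cl A.r_distr smult_mult_right mod_hom_add[of g K A Q] mod_hom_smult[of g K A Q])
  next
    fix g assume g: "g \<in> carrier (coinduced K A Q)"
    then show "\<one>\<^sub>A \<odot>\<^bsub>coinduced K A Q\<^esub> g = g"
      by (auto intro!: extensionalityI[of _ "carrier A"] dest: mod_hom_extensional)
  next
    fix a b g assume "a \<in> carrier A" "b \<in> carrier A" "g \<in> carrier (coinduced K A Q)"
    then show "(a \<oplus>\<^sub>A b) \<odot>\<^bsub>coinduced K A Q\<^esub> g = a \<odot>\<^bsub>coinduced K A Q\<^esub> g \<oplus>\<^bsub>coinduced K A Q\<^esub> b \<odot>\<^bsub>coinduced K A Q\<^esub> g"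
      by (auto simp: hom_plus_def A.l_distr mod_hom_add[of g K A Q] intro!: restrict_ext)
  qed (auto simp: hom_plus_def A.m_assoc intro!: restrict_ext)
  ultimately show ?thesis by (intro right_module.intro A.ring_axioms)
qed

lemma coinduced_fg:
  assumes "vspace K Q" "fdim K Q" shows "fg_right_module A (coinduced K A Q)"
proof (rule fdim_imp_fg)
  interpret Q: vspace K Q by fact
  show C: "right_module A (coinduced K A Q)" by (rule coinduced_module) (rule Q.V.right_module_axioms)
  interpret S: right_module K "scalars A (coinduced K A Q)" by (rule scalars_module[OF C])
  have "(\<lambda>g\<in>mod_hom K A Q. g) \<in> mod_hom K (scalars A (coinduced K A Q)) (hom_space K A Q)"
  proof (rule mod_homI)
    fix c g assume c: "c \<in> carrier K" and g: "g \<in> carrier (scalars A (coinduced K A Q))"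
    then have "c \<odot>\<^bsub>scalars A (coinduced K A Q)\<^esub> g \<in> mod_hom K A Q" using S.smult_closed by auto
    \<comment> \<open>On the coinduced module a scalar acts through the argument, on the hom space
      through the value; the two agree because g is K-linear.\<close>
    moreover have "c \<odot>\<^bsub>scalars A (coinduced K A Q)\<^esub> g = (\<lambda>v\<in>carrier A. c \<odot>\<^sub>Q g v)"
      using c g by (auto simp: scalar_mult mod_hom_smult[of g K A Q] intro!: restrict_ext)
    ultimately show "(\<lambda>g\<in>mod_hom K A Q. g) (c \<odot>\<^bsub>scalars A (coinduced K A Q)\<^esub> g) =
        c \<odot>\<^bsub>hom_space K A Q\<^esub> (\<lambda>g\<in>mod_hom K A Q. g) g"
      using g by simp
  qed (use S.M.a_closed in auto)
  then show "fdim K (scalars A (coinduced K A Q))"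
    by (rule fdim_injective[OF S.right_module_axioms _ _ hom_space_fdim[OF A_vspace assms(1) A_fg assms(2)]])
      (auto simp: inj_on_def intro: hom_space_module K.cring_axioms A_right_module Q.V.right_module_axioms)
qed

subsection \<open>Commutator sums and the trace form\<close>

text \<open>Each summand compares \<open>\<gamma> t\<close> after and before the action of t. The
  action of t is in general only K-linear, so these commutators live among K-linear maps.\<close>

abbreviation comm_sum where
  "comm_sum X C T \<gamma> x \<equiv>
    (\<Oplus>\<^bsub>C\<^esub>t\<in>T. \<gamma> t (t \<odot>\<^sub>X x) \<oplus>\<^sub>C \<ominus>\<^sub>C (t \<odot>\<^sub>C \<gamma> t x))"

text \<open>An A-linear u commutes with the action of t, so u times a commutator is the commutator
  of u \<open>\<gamma> t\<close> with the action of t on X. Its trace vanishes by cyclicity.\<close>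

lemma trace_commutator:
  assumes X: "fg_right_module A X" and C: "fg_right_module A C" and T: "finite T" "T \<subseteq> carrier A"
    and \<gamma>: "\<And>t. t \<in> T \<Longrightarrow> \<gamma> t \<in> mod_hom K (scalars A X) (scalars A C)"
    and \<phi>: "\<And>x. x \<in> carrier X \<Longrightarrow> \<phi> x = (comm_sum X C T \<gamma> x)"
    and u: "u \<in> mod_hom A C X"
  shows "vspace.trace K (scalars A X) (\<lambda>x. u (\<phi> x)) = \<zero>\<^sub>K"
proof -
  interpret X: right_module A X using X by (simp add: fg_right_module_def)
  interpret C: right_module A C using C by (simp add: fg_right_module_def)
  interpret SX: vspace K "scalars A X" by (rule scalars_vspace[OF X.right_module_axioms])
  note fX = fg_scalars[OF X]
  have \<gamma>c: "\<gamma> t x \<in> carrier C" if "t \<in> T" "x \<in> carrier X" for t x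
    using mod_hom_closed[OF \<gamma>[OF that(1)]] that(2) by simp
  have uc: "u c \<in> carrier X" if "c \<in> carrier C" for c using mod_hom_closed[OF u that] .
  have tA: "t \<in> carrier A" if "t \<in> T" for t using T(2) that by blast
  define w where "w t x = u (\<gamma> t (t \<odot>\<^sub>X x)) \<oplus>\<^sub>X \<ominus>\<^sub>X (t \<odot>\<^sub>X u (\<gamma> t x))" for t x
  have wc: "w t x \<in> carrier X" if "t \<in> T" "x \<in> carrier X" for t x
    using that \<gamma>c uc tA by (simp add: w_def)
  have u\<phi>: "u (\<phi> x) = (\<Oplus>\<^bsub>scalars A X\<^esub>t\<in>T. w t x)" if x: "x \<in> carrier X" for x
  proof -
    have "u (\<phi> x) = (\<Oplus>\<^bsub>X\<^esub>t\<in>T. u (\<gamma> t (t \<odot>\<^sub>X x) \<oplus>\<^sub>C \<ominus>\<^sub>C (t \<odot>\<^sub>C \<gamma> t x)))"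
      unfolding \<phi>[OF x] using x \<gamma>c tA
      by (intro mod_hom_finsum[OF C.right_module_axioms X.right_module_axioms u T(1)]) auto
    also have "\<dots> = (\<Oplus>\<^bsub>X\<^esub>t\<in>T. w t x)"
      using x \<gamma>c tA wc uc
      by (intro X.M.finsum_cong') (auto simp: w_def mod_hom_add[OF u] mod_hom_smult[OF u]
        mod_hom_neg[OF C.right_module_axioms X.right_module_axioms u])
    also have "\<dots> = (\<Oplus>\<^bsub>scalars A X\<^esub>t\<in>T. w t x)"
      using wc x by (intro finsum_scalars[OF X.right_module_axioms, symmetric]) auto
    finally show ?thesis .
  qed
  have "SX.trace (w t) = \<zero>\<^sub>K" if t: "t \<in> T" for t
  proof -
    let ?a = "\<lambda>x\<in>carrier X. t \<odot>\<^sub>X x" and ?g = "hom_comp X u (\<gamma> t)"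
    have a: "?a \<in> mod_hom K (scalars A X) (scalars A X)"
      by (rule action_scalars[OF X.right_module_axioms tA[OF t]])
    have g: "?g \<in> mod_hom K (scalars A X) (scalars A X)"
      using hom_comp_in[OF SX.V.right_module_axioms \<gamma>[OF t] hom_scalars[OF u]] by simp
    have "SX.trace (\<lambda>x. u (\<gamma> t (t \<odot>\<^sub>X x))) = SX.trace (\<lambda>x. ?g (?a x))"
      using t tA \<gamma>c uc by (intro SX.trace_cong[OF fX]) (auto simp: hom_comp_apply)
    also have "\<dots> = SX.trace (\<lambda>x. ?a (?g x))"
      by (rule trace_cyclic[OF SX.vspace_axioms SX.vspace_axioms fX fX a g])
    also have "\<dots> = SX.trace (\<lambda>x. t \<odot>\<^sub>X u (\<gamma> t x))"
      using t tA \<gamma>c uc by (intro SX.trace_cong[OF fX]) (auto simp: hom_comp_apply)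
    finally have eq: "SX.trace (\<lambda>x. u (\<gamma> t (t \<odot>\<^sub>X x))) = SX.trace (\<lambda>x. t \<odot>\<^sub>X u (\<gamma> t x))" .
    have neg: "\<ominus>\<^bsub>scalars A X\<^esub> x = \<ominus>\<^sub>X x" if "x \<in> carrier X" for x
      using that by (intro SX.V.M.minus_equality) (auto simp: X.M.l_neg)
    have "SX.trace (w t) = SX.trace (\<lambda>x. u (\<gamma> t (t \<odot>\<^sub>X x)) \<oplus>\<^bsub>scalars A X\<^esub> \<ominus>\<^bsub>scalars A X\<^esub> (t \<odot>\<^sub>X u (\<gamma> t x)))"
      using t tA \<gamma>c uc by (intro SX.trace_cong[OF fX]) (auto simp: w_def neg)
    also have "\<dots> = \<zero>\<^sub>K"
      using t tA \<gamma>c uc by (intro SX.trace_diff[OF fX] eq) auto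
    finally show ?thesis .
  qed
  then have "(\<Oplus>\<^bsub>K\<^esub>t\<in>T. SX.trace (w t)) = (\<Oplus>\<^bsub>K\<^esub>t\<in>T. \<zero>\<^sub>K)"
    by (intro K.finsum_cong') auto
  moreover have "SX.trace (\<lambda>x. u (\<phi> x)) = SX.trace (\<lambda>x. \<Oplus>\<^bsub>scalars A X\<^esub>t\<in>T. w t x)"
    using u\<phi> wc by (intro SX.trace_cong[OF fX]) (auto intro!: SX.V.M.finsum_closed[unfolded scalars_simps])
  moreover have "\<dots> = (\<Oplus>\<^bsub>K\<^esub>t\<in>T. SX.trace (w t))"
    using wc by (intro SX.trace_finsum[OF fX T(1)]) auto
  ultimately show ?thesis by (simp add: K.finsum_zero)
qed

text \<open>The converse, by duality. If \<phi> were outside the space W of commutator sums, some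
  functional L with L \<phi> = 1 would vanish on W. It has the form h \<mapsto> tr(v h), and its
  vanishing on commutators says that v commutes with the action of T, so that v is A-linear.
  Orthogonality of \<phi> then gives L \<phi> = 0.\<close>

lemma orthogonal_imp_commutator:
  assumes X: "fg_right_module A X" and C: "fg_right_module A C"
    and T: "finite T" "right_module.spans K A T"
    and \<phi>: "\<phi> \<in> mod_hom K (scalars A X) (scalars A C)"
    and orth: "\<And>u. u \<in> mod_hom A C X \<Longrightarrow> vspace.trace K (scalars A X) (\<lambda>x. u (\<phi> x)) = \<zero>\<^sub>K"
  shows "\<exists>\<gamma>. (\<forall>t\<in>T. \<gamma> t \<in> mod_hom K (scalars A X) (scalars A C)) \<and>
    (\<forall>x\<in>carrier X. \<phi> x = (comm_sum X C T \<gamma> x))"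
proof -
  interpret X: right_module A X using X by (simp add: fg_right_module_def)
  interpret C: right_module A C using C by (simp add: fg_right_module_def)
  interpret SX: vspace K "scalars A X" by (rule scalars_vspace[OF X.right_module_axioms])
  interpret SC: vspace K "scalars A C" by (rule scalars_vspace[OF C.right_module_axioms])
  interpret KA: right_module K A by (rule A_right_module)
  let ?H = "hom_space K (scalars A X) (scalars A C)"
  interpret H: vspace K ?H
    by (intro vspace.intro K.field_axioms hom_space_module K.cring_axioms
        SX.V.right_module_axioms SC.V.right_module_axioms)
  have tA: "t \<in> carrier A" if "t \<in> T" for t using T(2) that by (auto simp: KA.spans_def)
  define \<Delta> where "\<Delta> \<gamma> x = (comm_sum X C T \<gamma> x)" for \<gamma> x
  define W where "W = {h \<in> carrier ?H. \<exists>\<gamma>. (\<forall>t\<in>T. \<gamma> t \<in> carrier ?H) \<and> (\<forall>x\<in>carrier X. h x = \<Delta> \<gamma> x)}"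
  have cl: "f x \<in> carrier C" if "f \<in> carrier ?H" "x \<in> carrier X" for f x
    using mod_hom_closed[of f K "scalars A X" "scalars A C" x] that by simp
  have plus: "(f \<oplus>\<^bsub>?H\<^esub> g) x = f x \<oplus>\<^sub>C g x" if "x \<in> carrier X" for f g x
    using that by (simp add: hom_plus_def)
  have smult: "(c \<odot>\<^bsub>?H\<^esub> f) x = (c \<odot>\<^sub>A \<one>\<^sub>A) \<odot>\<^sub>C f x" if "x \<in> carrier X" for f c x
    using that by simp
  have W: "submodule W K ?H"
  proof (rule H.right_submoduleI)
    show "W \<subseteq> carrier ?H" by (auto simp: W_def)
    have "\<Delta> (\<lambda>_. \<zero>\<^bsub>?H\<^esub>) x = (\<Oplus>\<^bsub>C\<^esub>t\<in>T. \<zero>\<^sub>C)" if "x \<in> carrier X" for x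
      unfolding \<Delta>_def using that tA by (intro C.M.finsum_cong') (auto simp: hom_zero_def C.M.r_neg)
    then have z: "\<zero>\<^bsub>?H\<^esub> x = \<Delta> (\<lambda>_. \<zero>\<^bsub>?H\<^esub>) x" if "x \<in> carrier X" for x
      using that by (simp add: C.M.finsum_zero hom_zero_def)
    show "\<zero>\<^bsub>?H\<^esub> \<in> W"
      unfolding W_def by (intro CollectI conjI exI[of _ "\<lambda>_. \<zero>\<^bsub>?H\<^esub>"] ballI H.V.M.zero_closed z)
  next
    fix f g assume "f \<in> W" "g \<in> W"
    then obtain \<gamma> \<delta> where fg: "f \<in> carrier ?H" "g \<in> carrier ?H" "\<forall>t\<in>T. \<gamma> t \<in> carrier ?H"
      "\<forall>t\<in>T. \<delta> t \<in> carrier ?H" "\<forall>x\<in>carrier X. f x = \<Delta> \<gamma> x" "\<forall>x\<in>carrier X. g x = \<Delta> \<delta> x"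
      unfolding W_def by blast
    have "(f \<oplus>\<^bsub>?H\<^esub> g) x = \<Delta> (\<lambda>t. \<gamma> t \<oplus>\<^bsub>?H\<^esub> \<delta> t) x" if x: "x \<in> carrier X" for x
    proof -
      have "(f \<oplus>\<^bsub>?H\<^esub> g) x = \<Delta> \<gamma> x \<oplus>\<^sub>C \<Delta> \<delta> x" using fg x by (simp add: plus[OF x] del: hom_space_simps)
      also have "\<dots> = (\<Oplus>\<^bsub>C\<^esub>t\<in>T. (\<gamma> t (t \<odot>\<^sub>X x) \<oplus>\<^sub>C \<ominus>\<^sub>C (t \<odot>\<^sub>C \<gamma> t x)) \<oplus>\<^sub>C
          (\<delta> t (t \<odot>\<^sub>X x) \<oplus>\<^sub>C \<ominus>\<^sub>C (t \<odot>\<^sub>C \<delta> t x)))"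
        unfolding \<Delta>_def using fg(3,4) x tA
        by (intro C.M.finsum_addf[symmetric]) (auto intro!: cl C.M.a_closed C.M.a_inv_closed C.smult_closed simp del: hom_space_simps)
      also have "\<dots> = \<Delta> (\<lambda>t. \<gamma> t \<oplus>\<^bsub>?H\<^esub> \<delta> t) x"
        unfolding \<Delta>_def
      proof (rule C.M.finsum_cong'[OF refl])
        fix t assume t: "t \<in> T"
        then have c: "\<gamma> t y \<in> carrier C" "\<delta> t y \<in> carrier C" if "y \<in> carrier X" for y
          using fg(3,4) cl that by auto
        note c = c[OF x] c[OF X.smult_closed[OF tA[OF t] x]]
        show "(\<gamma> t (t \<odot>\<^sub>X x) \<oplus>\<^sub>C \<ominus>\<^sub>C (t \<odot>\<^sub>C \<gamma> t x)) \<oplus>\<^sub>C (\<delta> t (t \<odot>\<^sub>X x) \<oplus>\<^sub>C \<ominus>\<^sub>C (t \<odot>\<^sub>C \<delta> t x)) =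
          (\<gamma> t \<oplus>\<^bsub>?H\<^esub> \<delta> t) (t \<odot>\<^sub>X x) \<oplus>\<^sub>C \<ominus>\<^sub>C (t \<odot>\<^sub>C (\<gamma> t \<oplus>\<^bsub>?H\<^esub> \<delta> t) x)"
          unfolding plus[OF x] plus[OF X.smult_closed[OF tA[OF t] x]]
          using c tA[OF t] by (simp add: C.smult_add_module C.M.minus_add C.M.a_ac)
      next
        show "(\<lambda>t. (\<gamma> t \<oplus>\<^bsub>?H\<^esub> \<delta> t) (t \<odot>\<^sub>X x) \<oplus>\<^sub>C \<ominus>\<^sub>C (t \<odot>\<^sub>C (\<gamma> t \<oplus>\<^bsub>?H\<^esub> \<delta> t) x)) \<in> T \<rightarrow> carrier C"
          using fg(3,4) x tA
          by (auto intro!: cl H.V.M.a_closed C.M.a_closed C.M.a_inv_closed C.smult_closed simp del: hom_space_simps)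
      qed
      finally show ?thesis .
    qed
    then show "f \<oplus>\<^bsub>?H\<^esub> g \<in> W"
      unfolding W_def using fg(1-4) H.V.M.a_closed
      by (intro CollectI conjI exI[of _ "\<lambda>t. \<gamma> t \<oplus>\<^bsub>?H\<^esub> \<delta> t"]) blast+
  next
    fix c f assume c: "c \<in> carrier K" and "f \<in> W"
    then obtain \<gamma> where f: "f \<in> carrier ?H" "\<forall>t\<in>T. \<gamma> t \<in> carrier ?H" "\<forall>x\<in>carrier X. f x = \<Delta> \<gamma> x"
      unfolding W_def by blast
    have c1: "c \<odot>\<^sub>A \<one>\<^sub>A \<in> carrier A" using c by simp
    have "(c \<odot>\<^bsub>?H\<^esub> f) x = \<Delta> (\<lambda>t. c \<odot>\<^bsub>?H\<^esub> \<gamma> t) x" if x: "x \<in> carrier X" for x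
    proof -
      have "(c \<odot>\<^bsub>?H\<^esub> f) x = (c \<odot>\<^sub>A \<one>\<^sub>A) \<odot>\<^sub>C \<Delta> \<gamma> x" using f x by (simp add: smult[OF x] del: hom_space_simps)
      also have "\<dots> = (\<Oplus>\<^bsub>C\<^esub>t\<in>T. (c \<odot>\<^sub>A \<one>\<^sub>A) \<odot>\<^sub>C (\<gamma> t (t \<odot>\<^sub>X x) \<oplus>\<^sub>C \<ominus>\<^sub>C (t \<odot>\<^sub>C \<gamma> t x)))"
        unfolding \<Delta>_def using f(2) x tA c1 T(1)
        by (intro C.smult_finsum) (auto intro!: cl C.M.a_closed C.M.a_inv_closed C.smult_closed simp del: hom_space_simps)
      also have "\<dots> = \<Delta> (\<lambda>t. c \<odot>\<^bsub>?H\<^esub> \<gamma> t) x"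
        unfolding \<Delta>_def
      proof (rule C.M.finsum_cong'[OF refl])
        fix t assume t: "t \<in> T"
        then have cc: "\<gamma> t y \<in> carrier C" if "y \<in> carrier X" for y
          using f(2) cl that by auto
        note cc = cc[OF x] cc[OF X.smult_closed[OF tA[OF t] x]]
        show "(c \<odot>\<^sub>A \<one>\<^sub>A) \<odot>\<^sub>C (\<gamma> t (t \<odot>\<^sub>X x) \<oplus>\<^sub>C \<ominus>\<^sub>C (t \<odot>\<^sub>C \<gamma> t x)) =
          (c \<odot>\<^bsub>?H\<^esub> \<gamma> t) (t \<odot>\<^sub>X x) \<oplus>\<^sub>C \<ominus>\<^sub>C (t \<odot>\<^sub>C (c \<odot>\<^bsub>?H\<^esub> \<gamma> t) x)"
          unfolding smult[OF x] smult[OF X.smult_closed[OF tA[OF t] x]]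
          using cc tA[OF t] c1
          by (simp add: C.smult_add_module C.smult_neg smult_scalars_comm[OF C.right_module_axioms _ c])
      next
        show "(\<lambda>t. (c \<odot>\<^bsub>?H\<^esub> \<gamma> t) (t \<odot>\<^sub>X x) \<oplus>\<^sub>C \<ominus>\<^sub>C (t \<odot>\<^sub>C (c \<odot>\<^bsub>?H\<^esub> \<gamma> t) x)) \<in> T \<rightarrow> carrier C"
          using f(2) x tA c
          by (auto intro!: cl H.smult_closed C.M.a_closed C.M.a_inv_closed C.smult_closed simp del: hom_space_simps)
      qed
      finally show ?thesis .
    qed
    then show "c \<odot>\<^bsub>?H\<^esub> f \<in> W"
      unfolding W_def using f(1,2) c H.smult_closed
      by (intro CollectI conjI exI[of _ "\<lambda>t. c \<odot>\<^bsub>?H\<^esub> \<gamma> t"]) blast+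
  qed
  have "\<phi> \<in> W"
  proof (rule ccontr)
    assume "\<phi> \<notin> W"
    then obtain L where L: "L \<in> mod_hom K ?H (regular K)" "\<And>w. w \<in> W \<Longrightarrow> L w = \<zero>\<^sub>K" "L \<phi> = \<one>\<^sub>K"
      using H.separation[OF W, of \<phi>] \<phi> by auto
    obtain v where v: "v \<in> mod_hom K (scalars A C) (scalars A X)"
      and v1: "\<And>\<nu> c. \<nu> \<in> mod_hom K (scalars A X) (regular K) \<Longrightarrow> c \<in> carrier (scalars A C) \<Longrightarrow>
        \<nu> (v c) = L (rank_one (scalars A X) (scalars A C) \<nu> c)"
      and vtr: "\<And>h. h \<in> mod_hom K (scalars A X) (scalars A C) \<Longrightarrow> L h = SX.trace (\<lambda>x. v (h x))"
      using functional_on_hom_space[OF SX.vspace_axioms SC.vspace_axioms fg_scalars[OF X] L(1)] by blast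
    let ?r = "rank_one (scalars A X) (scalars A C)"
    note r_in = rank_one_in[OF SX.vspace_axioms SC.vspace_axioms]
    have vT: "v (t \<odot>\<^sub>C c) = t \<odot>\<^sub>X v c" if t: "t \<in> T" and c: "c \<in> carrier C" for t c
    proof (rule SX.functionals_separate)
      have vc: "v c \<in> carrier X" using mod_hom_closed[OF v] c by simp
      have tc: "t \<odot>\<^sub>C c \<in> carrier C" using t c tA by simp
      show "v (t \<odot>\<^sub>C c) \<in> carrier (scalars A X)" "t \<odot>\<^sub>X v c \<in> carrier (scalars A X)"
        using mod_hom_closed[OF v, of "t \<odot>\<^sub>C c"] tc vc tA[OF t] by auto
      fix \<nu> assume \<nu>: "\<nu> \<in> mod_hom K (scalars A X) (regular K)"
      let ?\<nu>' = "hom_comp (scalars A X) \<nu> (\<lambda>x\<in>carrier X. t \<odot>\<^sub>X x)"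
      have \<nu>': "?\<nu>' \<in> mod_hom K (scalars A X) (regular K)"
        by (rule hom_comp_in[OF SX.V.right_module_axioms action_scalars[OF X.right_module_axioms tA[OF t]] \<nu>])
      have r1: "?r ?\<nu>' c \<in> carrier ?H" and r2: "?r \<nu> (t \<odot>\<^sub>C c) \<in> carrier ?H"
        and r3: "?r \<nu> c \<in> carrier ?H"
        using r_in[OF \<nu>', of c] r_in[OF \<nu>, of "t \<odot>\<^sub>C c"] r_in[OF \<nu>, of c] c tc by simp_all
      \<comment> \<open>This is the commutator of the rank one map x \<mapsto> \<nu>(x) c with the
        action of t. As L vanishes on it, L takes the same value on the rank one maps of \<nu> t and
        c and of \<nu> and t c, which is the relation wanted between v and t.\<close>
      let ?h = "?r ?\<nu>' c \<oplus>\<^bsub>?H\<^esub> \<ominus>\<^bsub>?H\<^esub> ?r \<nu> (t \<odot>\<^sub>C c)"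
      have "?h \<in> W"
        unfolding W_def
      proof (intro CollectI conjI ballI exI)
        show "?h \<in> carrier ?H" using r1 r2 by (intro H.V.M.a_closed H.V.M.a_inv_closed)
        let ?\<gamma> = "\<lambda>s. if s = t then ?r \<nu> c else \<zero>\<^bsub>?H\<^esub>"
        show "?\<gamma> s \<in> carrier ?H" for s using r3 H.V.M.zero_closed by presburger
        fix x assume x: "x \<in> carrier X"
        have \<nu>c: "\<nu> y \<in> carrier K" if "y \<in> carrier X" for y using SX.functional_closed[OF \<nu>] that by simp
        let ?k = "\<nu> (t \<odot>\<^sub>X x)" and ?l = "\<nu> x"
        have kl: "?k \<in> carrier K" "?l \<in> carrier K" using \<nu>c x tA[OF t] by auto
        have eval_neg: "(\<ominus>\<^bsub>?H\<^esub> f) x = \<ominus>\<^sub>C f x" if f: "f \<in> carrier ?H" for f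
        proof -
          have "(\<ominus>\<^bsub>?H\<^esub> f \<oplus>\<^bsub>?H\<^esub> f) x = \<zero>\<^bsub>?H\<^esub> x" using H.V.M.l_neg[OF f] by (rule arg_cong)
          then have "(\<ominus>\<^bsub>?H\<^esub> f) x \<oplus>\<^sub>C f x = \<zero>\<^sub>C"
            unfolding plus[OF x] using x by (simp add: hom_zero_def)
          then show ?thesis
            using cl[OF f x] cl[OF H.V.M.a_inv_closed[OF f] x] by (intro C.M.minus_equality[symmetric])
        qed
        have "?h x = (?k \<odot>\<^sub>A \<one>\<^sub>A) \<odot>\<^sub>C c \<oplus>\<^sub>C \<ominus>\<^sub>C ((?l \<odot>\<^sub>A \<one>\<^sub>A) \<odot>\<^sub>C (t \<odot>\<^sub>C c))"
          unfolding plus[OF x] eval_neg[OF r2] using x by (simp add: rank_one_def compose_def)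
        also have "\<dots> = (?k \<odot>\<^sub>A \<one>\<^sub>A) \<odot>\<^sub>C c \<oplus>\<^sub>C \<ominus>\<^sub>C (t \<odot>\<^sub>C ((?l \<odot>\<^sub>A \<one>\<^sub>A) \<odot>\<^sub>C c))"
          using smult_scalars_comm[OF C.right_module_axioms tA[OF t] kl(2) c] by simp
        also have "\<dots> = (\<Oplus>\<^bsub>C\<^esub>s\<in>T. if t = s then (\<lambda>s. (?k \<odot>\<^sub>A \<one>\<^sub>A) \<odot>\<^sub>C c \<oplus>\<^sub>C \<ominus>\<^sub>C (t \<odot>\<^sub>C ((?l \<odot>\<^sub>A \<one>\<^sub>A) \<odot>\<^sub>C c))) s else \<zero>\<^sub>C)"
          using kl c tA[OF t] t T(1) by (intro C.M.finsum_singleton[symmetric]) auto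
        also have "\<dots> = \<Delta> ?\<gamma> x"
          unfolding \<Delta>_def using kl c tA t x
          by (intro C.M.finsum_cong') (auto simp: rank_one_def hom_zero_def C.M.r_neg)
        finally show "?h x = \<Delta> ?\<gamma> x" .
      qed
      then have "L ?h = \<zero>\<^sub>K" by (rule L(2))
      moreover have "L (?r ?\<nu>' c) = L (?h \<oplus>\<^bsub>?H\<^esub> ?r \<nu> (t \<odot>\<^sub>C c))"
        using r1 r2 by (simp only: H.V.M.a_assoc H.V.M.a_inv_closed H.V.M.l_neg H.V.M.r_zero)
      moreover have "L (?h \<oplus>\<^bsub>?H\<^esub> ?r \<nu> (t \<odot>\<^sub>C c)) = L ?h \<oplus>\<^sub>K L (?r \<nu> (t \<odot>\<^sub>C c))"
        unfolding mod_hom_add[OF L(1) H.V.M.a_closed[OF r1 H.V.M.a_inv_closed[OF r2]] r2] by simp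
      ultimately have "L (?r ?\<nu>' c) = L (?r \<nu> (t \<odot>\<^sub>C c))"
        using H.functional_closed[OF L(1) r2] by simp
      then show "\<nu> (v (t \<odot>\<^sub>C c)) = \<nu> (t \<odot>\<^sub>X v c)"
        using v1[OF \<nu>, of "t \<odot>\<^sub>C c"] v1[OF \<nu>', of c] c tc vc by (simp add: compose_def)
    qed
    \<comment> \<open>For fixed c, the elements a for which v commutes with a at c form a K-subspace
      of A that contains the spanning set T.\<close>
    have vA: "v (a \<odot>\<^sub>C c) = a \<odot>\<^sub>X v c" if a: "a \<in> carrier A" and c: "c \<in> carrier C" for a c
    proof -
      have vc: "v c \<in> carrier X" using mod_hom_closed[OF v] c by simp
      let ?N = "{a \<in> carrier A. v (a \<odot>\<^sub>C c) = a \<odot>\<^sub>X v c}"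
      have "submodule ?N K A"
      proof (rule KA.right_submoduleI)
        show "?N \<subseteq> carrier A" by blast
        show "\<zero>\<^sub>A \<in> ?N"
          using mod_hom_zero[OF SC.V.right_module_axioms SX.V.right_module_axioms v] c vc by simp
        fix a b assume "a \<in> ?N" "b \<in> ?N"
        then show "a \<oplus>\<^sub>A b \<in> ?N"
          using c vc mod_hom_add[OF v, of "a \<odot>\<^sub>C c" "b \<odot>\<^sub>C c"]
          by (simp add: C.smult_add_ring X.smult_add_ring)
      next
        fix k a assume k: "k \<in> carrier K" and a: "a \<in> ?N"
        note oC = orbit_map(2)[OF C.right_module_axioms c] and oX = orbit_map(2)[OF X.right_module_axioms vc]
        have "(k \<odot>\<^sub>A a) \<odot>\<^sub>C c = (k \<odot>\<^sub>A \<one>\<^sub>A) \<odot>\<^sub>C (a \<odot>\<^sub>C c)"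
          using mod_hom_smult[OF oC k, of a] a k by simp
        moreover have "(k \<odot>\<^sub>A a) \<odot>\<^sub>X v c = (k \<odot>\<^sub>A \<one>\<^sub>A) \<odot>\<^sub>X (a \<odot>\<^sub>X v c)"
          using mod_hom_smult[OF oX k, of a] a k by simp
        ultimately show "k \<odot>\<^sub>A a \<in> ?N"
          using a k c mod_hom_smult[OF v k, of "a \<odot>\<^sub>C c"] by simp
      qed
      moreover have "T \<subseteq> ?N" using vT c tA by blast
      ultimately have "?N = carrier A" by (rule KA.spansD[OF T(2)])
      with a show ?thesis by blast
    qed
    have "v \<in> mod_hom A C X"
      using mod_hom_PiE[OF v] mod_hom_add[OF v] vA by (intro mod_homI) auto
    from orth[OF this] vtr[OF \<phi>] L(3) show False by simp
  qed
  then show ?thesis unfolding W_def \<Delta>_def by auto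
qed

end

section \<open>The radical\<close>

text \<open>Over a finite dimensional algebra, \<open>1 - f g\<close> is invertible iff it is injective, that is, iff
  \<open>f g\<close> has no nonzero fixed point.\<close>

definition rad_hom :: "('a, 'r) ring_scheme \<Rightarrow> ('a, 'm, 'y) module_scheme \<Rightarrow> ('a, 'n, 'z) module_scheme
    \<Rightarrow> ('m \<Rightarrow> 'n) set" where
  "rad_hom A X Y = {f \<in> mod_hom A X Y. \<forall>g \<in> mod_hom A Y X. \<forall>y \<in> carrier Y. f (g y) = y \<longrightarrow> y = \<zero>\<^sub>Y}"

lemma rad_hom_mod_hom: "f \<in> rad_hom A X Y \<Longrightarrow> f \<in> mod_hom A X Y"
  by (simp add: rad_hom_def)

lemma rad_homD: "f \<in> rad_hom A X Y \<Longrightarrow> g \<in> mod_hom A Y X \<Longrightarrow> y \<in> carrier Y \<Longrightarrow> f (g y) = y \<Longrightarrow> y = \<zero>\<^sub>Y"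
  by (simp add: rad_hom_def)

lemma rad_homI:
  "f \<in> mod_hom A X Y \<Longrightarrow> (\<And>g y. g \<in> mod_hom A Y X \<Longrightarrow> y \<in> carrier Y \<Longrightarrow> f (g y) = y \<Longrightarrow> y = \<zero>\<^sub>Y)
    \<Longrightarrow> f \<in> rad_hom A X Y"
  by (simp add: rad_hom_def)

lemma rad_hom_comp_right:
  assumes "right_module A Z" "right_module A Y" "f \<in> rad_hom A X Y" "k \<in> mod_hom A Z X"
  shows "hom_comp Z f k \<in> rad_hom A Z Y"
proof (rule rad_homI)
  show "hom_comp Z f k \<in> mod_hom A Z Y"
    by (rule hom_comp_in[OF assms(1,4) rad_hom_mod_hom[OF assms(3)]])
  fix g y assume g: "g \<in> mod_hom A Y Z" "y \<in> carrier Y" "hom_comp Z f k (g y) = y"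
  then have "f (hom_comp Y k g y) = y" by (simp add: hom_comp_apply mod_hom_closed)
  then show "y = \<zero>\<^sub>Y" using g assms by (intro rad_homD[OF assms(3) hom_comp_in]) auto
qed

text \<open>A fixed point z of h f g gives the fixed point f(g z) of f (g h), which is zero because
  f is radical; then z = h(f(g z)) is zero as well.\<close>

lemma rad_hom_comp_left:
  assumes "right_module A X" "right_module A Y" "right_module A Z" "f \<in> rad_hom A X Y" "h \<in> mod_hom A Y Z"
  shows "hom_comp X h f \<in> rad_hom A X Z"
proof (rule rad_homI)
  show "hom_comp X h f \<in> mod_hom A X Z"
    by (rule hom_comp_in[OF assms(1) rad_hom_mod_hom[OF assms(4)] assms(5)])
  fix g z assume g: "g \<in> mod_hom A Z X" "z \<in> carrier Z" "hom_comp X h f (g z) = z"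
  have gz: "g z \<in> carrier X" using g by (simp add: mod_hom_closed)
  have eq: "h (f (g z)) = z" using g gz by (simp add: hom_comp_apply)
  have fc: "f (g z) \<in> carrier Y" using gz mod_hom_closed[OF rad_hom_mod_hom[OF assms(4)]] by simp
  have "f (hom_comp Y g h (f (g z))) = f (g z)" using fc by (simp add: hom_comp_apply eq)
  then have "f (g z) = \<zero>\<^sub>Y"
    using fc by (intro rad_homD[OF assms(4) hom_comp_in[OF assms(2,5) g(1)]])
  then show "z = \<zero>\<^sub>Z" using eq mod_hom_zero[OF assms(2,3,5)] by simp
qed

lemma rad_hom_zero:
  assumes "right_module A X" "right_module A Y" shows "hom_zero X Y \<in> rad_hom A X Y"
  using assms by (intro rad_homI hom_zero_in) (auto simp: hom_zero_def mod_hom_closed)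

lemma hom_diff_in:
  assumes "right_module A M" "right_module A N" "f \<in> mod_hom A M N" "g \<in> mod_hom A M N"
  shows "(\<lambda>x\<in>carrier M. f x \<oplus>\<^sub>N \<ominus>\<^sub>N g x) \<in> mod_hom A M N"
proof -
  interpret M: right_module A M by fact
  interpret N: right_module A N by fact
  note [simp] = mod_hom_closed[OF assms(3)] mod_hom_closed[OF assms(4)] mod_hom_add[OF assms(3)]
    mod_hom_add[OF assms(4)] mod_hom_smult[OF assms(3)] mod_hom_smult[OF assms(4)]
  show ?thesis
    by (rule mod_homI) (auto simp: N.M.a_ac N.M.minus_add N.smult_add_module N.smult_neg)
qed

lemma (in abelian_group) diff_eq_zero_iff:
  "x \<in> carrier G \<Longrightarrow> y \<in> carrier G \<Longrightarrow> x \<oplus> \<ominus> y = \<zero> \<longleftrightarrow> x = y"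
  using minus_equality[of x "\<ominus> y"] r_neg by auto

section \<open>Sums of radical morphisms and the trace test\<close>

context fin_dim_algebra
begin

text \<open>Absence of nonzero fixed points is injectivity of 1 - f, and injective endomorphisms of
  modules with a rank are surjective.\<close>

lemma one_minus_bijective:
  assumes "fg_right_module A M" "f \<in> mod_hom A M M" "\<And>x. x \<in> carrier M \<Longrightarrow> f x = x \<Longrightarrow> x = \<zero>\<^sub>M"
  shows "(\<lambda>x\<in>carrier M. x \<oplus>\<^sub>M \<ominus>\<^sub>M f x) \<in> mod_hom A M M"
    and "bij_betw (\<lambda>x\<in>carrier M. x \<oplus>\<^sub>M \<ominus>\<^sub>M f x) (carrier M) (carrier M)"
proof -
  interpret M: right_module A M using assms(1) by (simp add: fg_right_module_def)
  let ?v = "\<lambda>x\<in>carrier M. x \<oplus>\<^sub>M \<ominus>\<^sub>M f x"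
  note fc = mod_hom_closed[OF assms(2)]
  have "(\<lambda>x\<in>carrier M. hom_id M x \<oplus>\<^sub>M \<ominus>\<^sub>M f x) \<in> mod_hom A M M"
    by (intro hom_diff_in hom_id_in M.right_module_axioms assms(2))
  moreover have "(\<lambda>x\<in>carrier M. hom_id M x \<oplus>\<^sub>M \<ominus>\<^sub>M f x) = ?v"
    by (rule restrict_ext) (simp add: hom_id_def)
  ultimately show v: "?v \<in> mod_hom A M M" by simp
  have "inj_on ?v (carrier M)"
    unfolding mod_hom_inj_iff[OF M.right_module_axioms M.right_module_axioms v]
  proof (intro ballI impI)
    fix x assume x: "x \<in> carrier M" "?v x = \<zero>\<^sub>M"
    then have "x = f x" using fc[OF x(1)] by (simp add: M.M.diff_eq_zero_iff)
    then show "x = \<zero>\<^sub>M" using assms(3)[OF x(1)] by simp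
  qed
  then show "bij_betw ?v (carrier M) (carrier M)"
    using injective_imp_surjective[OF M.right_module_axioms fg_has_rank[OF assms(1)] v] by (simp add: bij_betw_def)
qed

text \<open>If y is fixed by (f + f') g, then (1 - f g) y = f'(g y). With the inverse v' of 1 - f g,
  this element is fixed by f' (g v'). So it vanishes because f' is radical, and then y = 0.\<close>

lemma rad_hom_plus:
  assumes X: "right_module A X" and Y: "fg_right_module A Y" and f: "f \<in> rad_hom A X Y" and f': "f' \<in> rad_hom A X Y"
  shows "hom_plus X Y f f' \<in> rad_hom A X Y"
proof (rule rad_homI)
  interpret X: right_module A X by fact
  interpret Y: right_module A Y using Y by (simp add: fg_right_module_def)
  note fh = rad_hom_mod_hom[OF f] rad_hom_mod_hom[OF f']
  show "hom_plus X Y f f' \<in> mod_hom A X Y" by (rule hom_plus_in[OF X Y.right_module_axioms fh])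
  fix g y assume g: "g \<in> mod_hom A Y X" and y: "y \<in> carrier Y" and eq: "hom_plus X Y f f' (g y) = y"
  have gc: "g z \<in> carrier X" if "z \<in> carrier Y" for z using mod_hom_closed[OF g that] .
  have fc: "f z \<in> carrier Y" "f' z \<in> carrier Y" if "z \<in> carrier X" for z
    by (rule mod_hom_closed[OF fh(1) that], rule mod_hom_closed[OF fh(2) that])
  have fg: "hom_comp Y f g \<in> mod_hom A Y Y" by (rule hom_comp_in[OF Y.right_module_axioms g fh(1)])
  let ?v = "\<lambda>x\<in>carrier Y. x \<oplus>\<^sub>Y \<ominus>\<^sub>Y hom_comp Y f g x"
  have nofix: "x = \<zero>\<^sub>Y" if "x \<in> carrier Y" "hom_comp Y f g x = x" for x
    using that rad_homD[OF f g] by (simp add: hom_comp_apply)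
  have v: "?v \<in> mod_hom A Y Y" "bij_betw ?v (carrier Y) (carrier Y)"
    by (rule one_minus_bijective[OF Y fg], erule (1) nofix)+
  obtain v' where v': "v' \<in> mod_hom A Y Y" "\<And>x. x \<in> carrier Y \<Longrightarrow> v' (?v x) = x"
    by (rule inverse_in_mod_hom[OF Y.right_module_axioms v]) (rule that)
  have sum: "f (g y) \<oplus>\<^sub>Y f' (g y) = y" using eq gc[OF y] by (simp add: hom_plus_def)
  have "?v y = f' (g y)"
  proof -
    have "?v y = (f (g y) \<oplus>\<^sub>Y f' (g y)) \<oplus>\<^sub>Y \<ominus>\<^sub>Y f (g y)"
      using y sum by (simp add: hom_comp_apply)
    also have "\<dots> = f' (g y) \<oplus>\<^sub>Y (f (g y) \<oplus>\<^sub>Y \<ominus>\<^sub>Y f (g y))"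
      using fc[OF gc[OF y]] Y.M.a_comm[of "f (g y)" "f' (g y)"] by (simp add: Y.M.a_assoc)
    finally show ?thesis using fc[OF gc[OF y]] by (simp add: Y.M.r_neg)
  qed
  then have "f' (hom_comp Y g v' (?v y)) = ?v y"
    using v'(2)[OF y] mod_hom_closed[OF v(1) y] by (simp only: hom_comp_apply)
  then have "?v y = \<zero>\<^sub>Y"
    by (rule rad_homD[OF f' hom_comp_in[OF Y.right_module_axioms v'(1) g] mod_hom_closed[OF v(1) y]])
  then have "v' \<zero>\<^sub>Y = y" using v'(2)[OF y] by (simp only:)
  then show "y = \<zero>\<^sub>Y" using mod_hom_zero[OF Y.right_module_axioms Y.right_module_axioms v'(1)] by simp
qed

text \<open>Scalars act through central elements, hence by A-endomorphisms. A subgroup of a Hom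
  space that is stable under composition with endomorphisms is therefore a K-subspace.\<close>

lemma scalar_endo:
  assumes "right_module A X" "c \<in> carrier K"
  shows "(\<lambda>x\<in>carrier X. (c \<odot>\<^sub>A \<one>\<^sub>A) \<odot>\<^sub>X x) \<in> mod_hom A X X"
proof -
  interpret X: right_module A X by fact
  show ?thesis
    using assms(2) smult_scalars_comm[OF assms(1) _ assms(2)]
    by (intro mod_homI) (auto simp: X.smult_add_module)
qed

lemma rad_hom_submodule:
  assumes X: "right_module A X" and Y: "fg_right_module A Y"
  shows "submodule (rad_hom A X Y) K (hom_space K (scalars A X) (scalars A Y))"
proof -
  have Y': "right_module A Y" using Y by (simp add: fg_right_module_def)
  interpret H: right_module K "hom_space K (scalars A X) (scalars A Y)"
    by (intro hom_space_module K.cring_axioms scalars_module X Y')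
  show ?thesis
  proof (rule H.right_submoduleI)
    show "rad_hom A X Y \<subseteq> carrier (hom_space K (scalars A X) (scalars A Y))"
      using rad_hom_mod_hom hom_scalars by fastforce
    show "\<zero>\<^bsub>hom_space K (scalars A X) (scalars A Y)\<^esub> \<in> rad_hom A X Y"
      using rad_hom_zero[OF X Y'] by (simp add: hom_zero_def)
    fix f g assume "f \<in> rad_hom A X Y" "g \<in> rad_hom A X Y"
    then show "f \<oplus>\<^bsub>hom_space K (scalars A X) (scalars A Y)\<^esub> g \<in> rad_hom A X Y"
      using rad_hom_plus[OF X Y, of f g] by (simp add: hom_plus_def)
  next
    fix c f assume c: "c \<in> carrier K" and f: "f \<in> rad_hom A X Y"
    have "hom_comp X f (\<lambda>x\<in>carrier X. (c \<odot>\<^sub>A \<one>\<^sub>A) \<odot>\<^sub>X x) \<in> rad_hom A X Y"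
      by (rule rad_hom_comp_right[OF X Y' f scalar_endo[OF X c]])
    also have "hom_comp X f (\<lambda>x\<in>carrier X. (c \<odot>\<^sub>A \<one>\<^sub>A) \<odot>\<^sub>X x) =
        c \<odot>\<^bsub>hom_space K (scalars A X) (scalars A Y)\<^esub> f"
      using c mod_hom_smult[OF rad_hom_mod_hom[OF f]] by (auto simp: compose_def intro!: restrict_ext)
    finally show "c \<odot>\<^bsub>hom_space K (scalars A X) (scalars A Y)\<^esub> f \<in> rad_hom A X Y" .
  qed
qed

text \<open>The radical endomorphisms form a subspace of the finite dimensional space of K-linear
  endomorphisms of C. Finitely many functionals cut it out, and the trace pairing turns each of them
  into a map \<theta>, which is in general not A-linear.\<close>

lemma rad_endo_trace_test:
  assumes C: "fg_right_module A C"
  obtains \<Theta> where "finite \<Theta>" "\<Theta> \<subseteq> mod_hom K (scalars A C) (scalars A C)"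
    "\<And>w. w \<in> mod_hom A C C \<Longrightarrow> w \<in> rad_hom A C C \<longleftrightarrow>
      (\<forall>\<theta>\<in>\<Theta>. vspace.trace K (scalars A C) (\<lambda>x. w (\<theta> x)) = \<zero>\<^sub>K)"
proof -
  have C': "right_module A C" using C by (simp add: fg_right_module_def)
  let ?S = "scalars A C"
  let ?H = "hom_space K ?S ?S"
  interpret S: vspace K ?S by (rule scalars_vspace[OF C'])
  interpret H: vspace K ?H
    by (intro vspace.intro K.field_axioms hom_space_module K.cring_axioms S.V.right_module_axioms)
  have fg: "fg_right_module K ?S" by (rule fg_scalars[OF C])
  have "has_rank K ?H"
    by (intro H.fdim_has_rank hom_space_fdim S.vspace_axioms fg S.fg_fdim)
  then obtain \<Phi> where \<Phi>: "finite \<Phi>" "\<Phi> \<subseteq> mod_hom K ?H (regular K)"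
    "rad_hom A C C = {v \<in> carrier ?H. \<forall>\<phi>\<in>\<Phi>. \<phi> v = \<zero>\<^sub>K}"
    using H.finite_annihilator[OF _ rad_hom_submodule[OF C' C]] by blast
  have "\<exists>v. v \<in> mod_hom K ?S ?S \<and> (\<forall>h \<in> mod_hom K ?S ?S. \<phi> h = S.trace (\<lambda>x. h (v x)))" if "\<phi> \<in> \<Phi>" for \<phi>
  proof -
    have \<phi>: "\<phi> \<in> mod_hom K ?H (regular K)" using that \<Phi>(2) by blast
    obtain v where v: "v \<in> mod_hom K ?S ?S" "\<And>h. h \<in> mod_hom K ?S ?S \<Longrightarrow> \<phi> h = S.trace (\<lambda>x. v (h x))"
    proof (rule functional_on_hom_space[OF S.vspace_axioms S.vspace_axioms fg \<phi>])
      fix v assume "v \<in> mod_hom K ?S ?S" "\<And>h. h \<in> mod_hom K ?S ?S \<Longrightarrow> \<phi> h = S.trace (\<lambda>x. v (h x))"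
      then show thesis by (rule that)
    qed
    have "\<phi> h = S.trace (\<lambda>x. h (v x))" if "h \<in> mod_hom K ?S ?S" for h
      using v(2)[OF that] trace_cyclic[OF S.vspace_axioms S.vspace_axioms fg fg that v(1)] by simp
    with v(1) show ?thesis by blast
  qed
  then have "\<forall>\<phi>\<in>\<Phi>. \<exists>v. v \<in> mod_hom K ?S ?S \<and> (\<forall>h \<in> mod_hom K ?S ?S. \<phi> h = S.trace (\<lambda>x. h (v x)))" ..
  from bchoice[OF this] obtain \<theta> where \<theta>': "\<forall>\<phi>\<in>\<Phi>. \<theta> \<phi> \<in> mod_hom K ?S ?S \<and>
    (\<forall>h \<in> mod_hom K ?S ?S. \<phi> h = S.trace (\<lambda>x. h (\<theta> \<phi> x)))" ..
  then have \<theta>: "\<And>\<phi>. \<phi> \<in> \<Phi> \<Longrightarrow> \<theta> \<phi> \<in> mod_hom K ?S ?S"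
    "\<And>\<phi> h. \<phi> \<in> \<Phi> \<Longrightarrow> h \<in> mod_hom K ?S ?S \<Longrightarrow> \<phi> h = S.trace (\<lambda>x. h (\<theta> \<phi> x))" by blast+
  show ?thesis
  proof (rule that[of "\<theta> ` \<Phi>"])
    show "finite (\<theta> ` \<Phi>)" using \<Phi>(1) by simp
    show "\<theta> ` \<Phi> \<subseteq> mod_hom K ?S ?S" using \<theta>(1) by blast
    fix w assume "w \<in> mod_hom A C C"
    then have w: "w \<in> mod_hom K ?S ?S" by (rule hom_scalars)
    show "w \<in> rad_hom A C C \<longleftrightarrow> (\<forall>\<theta>'\<in>\<theta> ` \<Phi>. S.trace (\<lambda>x. w (\<theta>' x)) = \<zero>\<^sub>K)"
      unfolding \<Phi>(3) using w \<theta>(2)[OF _ w] by simp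
  qed
qed

lemma finite_spanning_set:
  obtains T where "finite T" "right_module.spans K A T" "T \<subseteq> carrier A"
proof -
  interpret KA: right_module K A by (rule A_right_module)
  show ?thesis using that A_fg KA.fg_iff_spans by (auto simp: KA.spans_def)
qed

section \<open>Almost split morphisms\<close>

text \<open>A homomorphism from X to C \<times> Hom_K(A, C)^J consists of some h : X \<rightarrow> C
  and K-linear maps \<gamma>(\<theta>, t) : X \<rightarrow> C. B is the submodule cut out by the
  equations that \<theta> h is the commutator sum of the \<gamma>(\<theta>, t), for every \<theta>,
  and b is the projection to C. Factoring through b is thus solvability of these equations, and the
  trace criterion identifies that with being radical.\<close>

lemma right_almost_split:
  fixes C :: "('a, 'c) module"
  assumes C: "fg_right_module A C"
  shows "\<exists>(B :: ('a, 'c \<times> (('c \<Rightarrow> 'c) \<times> 'a \<Rightarrow> 'a \<Rightarrow> 'c)) module) b. fg_right_module A B \<and> b \<in> rad_hom A B C \<and>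
    (\<forall>X :: ('a, 'm) module. fg_right_module A X \<longrightarrow>
      (\<forall>h \<in> rad_hom A X C. \<exists>k \<in> mod_hom A X B. h = hom_comp X b k))"
proof -
  interpret C: right_module A C using C by (simp add: fg_right_module_def)
  note C' = C.right_module_axioms
  let ?S = "scalars A C"
  interpret S: vspace K ?S by (rule scalars_vspace[OF C'])
  obtain \<Theta> where \<Theta>: "finite \<Theta>" "\<Theta> \<subseteq> mod_hom K ?S ?S"
    and \<Theta>rad: "\<And>w. w \<in> mod_hom A C C \<Longrightarrow> w \<in> rad_hom A C C \<longleftrightarrow> (\<forall>\<theta>\<in>\<Theta>. S.trace (\<lambda>x. w (\<theta> x)) = \<zero>\<^sub>K)"
    using rad_endo_trace_test[OF C] by blast
  obtain T where T: "finite T" "right_module.spans K A T" "T \<subseteq> carrier A" by (rule finite_spanning_set)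
  have tA: "t \<in> carrier A" if "t \<in> T" for t using that T(3) by blast
  have \<theta>: "\<theta> \<in> mod_hom K ?S ?S" if "\<theta> \<in> \<Theta>" for \<theta> using that \<Theta>(2) by blast
  have \<theta>c: "\<theta> x \<in> carrier C" if "\<theta> \<in> \<Theta>" "x \<in> carrier C" for \<theta> x
    using mod_hom_closed[OF \<theta>[OF that(1)]] that(2) by simp
  let ?Q = "coinduced K A ?S"
  let ?J = "\<Theta> \<times> T"
  let ?P = "prod_module C ?J ?Q"
  have Qm: "right_module A ?Q" by (rule coinduced_module[OF S.V.right_module_axioms])
  have Qfg: "fg_right_module A ?Q" by (rule coinduced_fg[OF S.vspace_axioms fg_imp_fdim[OF C]])
  interpret P: right_module A ?P by (rule prod_module[OF C' Qm])
  \<comment> \<open>The commutator sum at the point x a in terms of the image p of x. The component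
    of p at (\<theta>, t) is the function a \<mapsto> \<gamma>(x a), so acting by a and then by t
    means evaluating at the product of a and t.\<close>
  define D where "D \<theta> a p = (\<Oplus>\<^bsub>C\<^esub>t\<in>T. snd p (\<theta>, t) (a \<otimes>\<^sub>A t) \<oplus>\<^sub>C \<ominus>\<^sub>C (t \<odot>\<^sub>C snd p (\<theta>, t) a))"
    for \<theta> a and p :: "'c \<times> (('c \<Rightarrow> 'c) \<times> 'a \<Rightarrow> 'a \<Rightarrow> 'c)"
  \<comment> \<open>The equation itself is the condition at a = 1; quantifying over all a makes BB
    stable under the action.\<close>
  define BB where "BB = {p \<in> carrier ?P. \<forall>\<theta>\<in>\<Theta>. \<forall>a\<in>carrier A. \<theta> (a \<odot>\<^sub>C fst p) = D \<theta> a p}"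
  have gh: "snd p (\<theta>, t) \<in> mod_hom K A ?S" if "p \<in> carrier ?P" "\<theta> \<in> \<Theta>" "t \<in> T" for p \<theta> t
  proof -
    have "snd p \<in> ?J \<rightarrow>\<^sub>E mod_hom K A ?S" using that(1) by (cases p) simp
    then show ?thesis using that(2,3) by blast
  qed
  have gc: "snd p (\<theta>, t) a \<in> carrier C" if "p \<in> carrier ?P" "\<theta> \<in> \<Theta>" "t \<in> T" "a \<in> carrier A" for p \<theta> t a
    using mod_hom_closed[OF gh[OF that(1-3)] that(4)] by simp
  have fc: "fst p \<in> carrier C" if "p \<in> carrier ?P" for p using that by (cases p) simp
  have Dc: "snd p (\<theta>, t) (a \<otimes>\<^sub>A t) \<oplus>\<^sub>C \<ominus>\<^sub>C (t \<odot>\<^sub>C snd p (\<theta>, t) a) \<in> carrier C"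
    if "p \<in> carrier ?P" "\<theta> \<in> \<Theta>" "t \<in> T" "a \<in> carrier A" for p \<theta> t a
    using that gc tA by simp
  have sub: "submodule BB A ?P"
  proof (rule P.right_submoduleI)
    show "BB \<subseteq> carrier ?P" by (auto simp: BB_def)
    have "D \<theta> a \<zero>\<^bsub>?P\<^esub> = (\<Oplus>\<^bsub>C\<^esub>t\<in>T. \<zero>\<^sub>C)" if "\<theta> \<in> \<Theta>" "a \<in> carrier A" for \<theta> a
      unfolding D_def using that tA by (intro C.M.finsum_cong') (auto simp: hom_zero_def C.M.r_neg)
    then have "D \<theta> a \<zero>\<^bsub>?P\<^esub> = \<zero>\<^sub>C" if "\<theta> \<in> \<Theta>" "a \<in> carrier A" for \<theta> a
      using that by (simp add: C.M.finsum_zero)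
    then have z: "\<theta> (a \<odot>\<^sub>C fst \<zero>\<^bsub>?P\<^esub>) = D \<theta> a \<zero>\<^bsub>?P\<^esub>" if "\<theta> \<in> \<Theta>" "a \<in> carrier A" for \<theta> a
      using that mod_hom_zero[OF S.V.right_module_axioms S.V.right_module_axioms \<theta>[OF that(1)]] by simp
    show "\<zero>\<^bsub>?P\<^esub> \<in> BB"
      unfolding BB_def by (intro CollectI conjI ballI P.M.zero_closed z)
  next
    fix p q assume pq: "p \<in> BB" "q \<in> BB"
    then have P: "p \<in> carrier ?P" "q \<in> carrier ?P" by (auto simp: BB_def)
    have PQ: "p \<oplus>\<^bsub>?P\<^esub> q \<in> carrier ?P" using P by (rule P.M.a_closed)
    have "\<theta> (a \<odot>\<^sub>C fst (p \<oplus>\<^bsub>?P\<^esub> q)) = D \<theta> a (p \<oplus>\<^bsub>?P\<^esub> q)" if ta: "\<theta> \<in> \<Theta>" "a \<in> carrier A" for \<theta> a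
    proof -
      have "\<theta> (a \<odot>\<^sub>C fst (p \<oplus>\<^bsub>?P\<^esub> q)) = \<theta> (a \<odot>\<^sub>C fst p) \<oplus>\<^sub>C \<theta> (a \<odot>\<^sub>C fst q)"
        using ta fc[OF P(1)] fc[OF P(2)] mod_hom_add[OF \<theta>[OF ta(1)], of "a \<odot>\<^sub>C fst p" "a \<odot>\<^sub>C fst q"]
        by (simp add: C.smult_add_module)
      also have "\<dots> = D \<theta> a p \<oplus>\<^sub>C D \<theta> a q" using pq ta by (simp add: BB_def)
      also have "\<dots> = (\<Oplus>\<^bsub>C\<^esub>t\<in>T. (snd p (\<theta>, t) (a \<otimes>\<^sub>A t) \<oplus>\<^sub>C \<ominus>\<^sub>C (t \<odot>\<^sub>C snd p (\<theta>, t) a)) \<oplus>\<^sub>C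
          (snd q (\<theta>, t) (a \<otimes>\<^sub>A t) \<oplus>\<^sub>C \<ominus>\<^sub>C (t \<odot>\<^sub>C snd q (\<theta>, t) a)))"
        unfolding D_def by (rule C.M.finsum_addf[symmetric]) (rule Pi_I, rule Dc, (rule P ta | assumption)+)+
      also have "\<dots> = D \<theta> a (p \<oplus>\<^bsub>?P\<^esub> q)"
        unfolding D_def
      proof (rule C.M.finsum_cong'[OF refl])
        show "(\<lambda>t. snd (p \<oplus>\<^bsub>?P\<^esub> q) (\<theta>, t) (a \<otimes>\<^sub>A t) \<oplus>\<^sub>C \<ominus>\<^sub>C (t \<odot>\<^sub>C snd (p \<oplus>\<^bsub>?P\<^esub> q) (\<theta>, t) a)) \<in> T \<rightarrow> carrier C"
          by (rule Pi_I) (rule Dc[OF PQ ta(1) _ ta(2)])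
        fix t assume t: "t \<in> T"
        have "snd (p \<oplus>\<^bsub>?P\<^esub> q) (\<theta>, t) b = snd p (\<theta>, t) b \<oplus>\<^sub>C snd q (\<theta>, t) b" if "b \<in> carrier A" for b
          using that ta t by (simp add: hom_plus_def)
        then show "(snd p (\<theta>, t) (a \<otimes>\<^sub>A t) \<oplus>\<^sub>C \<ominus>\<^sub>C (t \<odot>\<^sub>C snd p (\<theta>, t) a)) \<oplus>\<^sub>C
          (snd q (\<theta>, t) (a \<otimes>\<^sub>A t) \<oplus>\<^sub>C \<ominus>\<^sub>C (t \<odot>\<^sub>C snd q (\<theta>, t) a)) =
          snd (p \<oplus>\<^bsub>?P\<^esub> q) (\<theta>, t) (a \<otimes>\<^sub>A t) \<oplus>\<^sub>C \<ominus>\<^sub>C (t \<odot>\<^sub>C snd (p \<oplus>\<^bsub>?P\<^esub> q) (\<theta>, t) a)"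
          using ta t tA gc[OF P(1) ta(1) t] gc[OF P(2) ta(1) t]
          by (simp add: C.smult_add_module C.M.minus_add C.M.a_ac del: prod_module_simps)
      qed
      finally show ?thesis .
    qed
    then show "p \<oplus>\<^bsub>?P\<^esub> q \<in> BB" unfolding BB_def by (intro CollectI conjI ballI PQ)
  next
    fix b p assume b: "b \<in> carrier A" and p: "p \<in> BB"
    then have P: "p \<in> carrier ?P" by (auto simp: BB_def)
    have PB: "b \<odot>\<^bsub>?P\<^esub> p \<in> carrier ?P" using b P by (rule P.smult_closed)
    have "\<theta> (a \<odot>\<^sub>C fst (b \<odot>\<^bsub>?P\<^esub> p)) = D \<theta> a (b \<odot>\<^bsub>?P\<^esub> p)" if ta: "\<theta> \<in> \<Theta>" "a \<in> carrier A" for \<theta> a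
    proof -
      have "\<theta> (a \<odot>\<^sub>C fst (b \<odot>\<^bsub>?P\<^esub> p)) = \<theta> ((b \<otimes>\<^sub>A a) \<odot>\<^sub>C fst p)"
        using ta b fc[OF P] by (simp add: C.smult_assoc)
      also have "\<dots> = D \<theta> (b \<otimes>\<^sub>A a) p" using p ta b by (simp add: BB_def)
      also have "\<dots> = D \<theta> a (b \<odot>\<^bsub>?P\<^esub> p)"
        unfolding D_def
      proof (rule C.M.finsum_cong'[OF refl])
        show "(\<lambda>t. snd (b \<odot>\<^bsub>?P\<^esub> p) (\<theta>, t) (a \<otimes>\<^sub>A t) \<oplus>\<^sub>C \<ominus>\<^sub>C (t \<odot>\<^sub>C snd (b \<odot>\<^bsub>?P\<^esub> p) (\<theta>, t) a)) \<in> T \<rightarrow> carrier C"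
          by (rule Pi_I) (rule Dc[OF PB ta(1) _ ta(2)])
        fix t assume t: "t \<in> T"
        have "snd (b \<odot>\<^bsub>?P\<^esub> p) (\<theta>, t) c = snd p (\<theta>, t) (b \<otimes>\<^sub>A c)" if "c \<in> carrier A" for c
          using that ta t by simp
        then show "snd p (\<theta>, t) ((b \<otimes>\<^sub>A a) \<otimes>\<^sub>A t) \<oplus>\<^sub>C \<ominus>\<^sub>C (t \<odot>\<^sub>C snd p (\<theta>, t) (b \<otimes>\<^sub>A a)) =
          snd (b \<odot>\<^bsub>?P\<^esub> p) (\<theta>, t) (a \<otimes>\<^sub>A t) \<oplus>\<^sub>C \<ominus>\<^sub>C (t \<odot>\<^sub>C snd (b \<odot>\<^bsub>?P\<^esub> p) (\<theta>, t) a)"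
          using ta b tA[OF t] by (simp add: A.m_assoc del: prod_module_simps)
      qed
      finally show ?thesis .
    qed
    then show "b \<odot>\<^bsub>?P\<^esub> p \<in> BB" unfolding BB_def by (intro CollectI conjI ballI PB)
  qed
  define B where "B = ?P\<lparr>carrier := BB\<rparr>"
  have Bfg: "fg_right_module A B"
    unfolding B_def by (rule fg_submodule[OF prod_fg[OF C Qfg] sub]) (use \<Theta>(1) T(1) in simp)
  have B': "right_module A B" using Bfg by (simp add: fg_right_module_def)
  interpret B: right_module A B by (rule B')
  have B_simps: "carrier B = BB" "x \<oplus>\<^sub>B y = x \<oplus>\<^bsub>?P\<^esub> y" "a \<odot>\<^sub>B x = a \<odot>\<^bsub>?P\<^esub> x" for a x y
    by (simp_all add: B_def)
  have BP: "p \<in> carrier ?P" if "p \<in> carrier B" for p using that by (simp add: B_simps BB_def)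
  define b where "b = (\<lambda>p\<in>carrier B. fst p)"
  have b: "b \<in> mod_hom A B C"
  proof (rule mod_homI)
    show "b \<in> carrier B \<rightarrow>\<^sub>E carrier C" using BP fc by (auto simp: b_def)
    fix p q assume "p \<in> carrier B" "q \<in> carrier B"
    then show "b (p \<oplus>\<^sub>B q) = b p \<oplus>\<^sub>C b q"
      using B.M.a_closed[of p q] unfolding b_def by (simp add: B_simps(2))
  next
    fix a p assume "a \<in> carrier A" "p \<in> carrier B"
    then show "b (a \<odot>\<^sub>B p) = a \<odot>\<^sub>C b p"
      using B.smult_closed[of a p] unfolding b_def by (simp add: B_simps(3))
  qed
  \<comment> \<open>The trace test concerns endomorphisms of C, so b is composed with an arbitrary g
    : C \<rightarrow> B.\<close>
  have brad: "hom_comp C b g \<in> rad_hom A C C" if g: "g \<in> mod_hom A C B" for g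
  proof -
    let ?w = "hom_comp C b g"
    have w: "?w \<in> mod_hom A C C" by (rule hom_comp_in[OF C' g b])
    have gB: "g x \<in> carrier B" "g x \<in> carrier ?P" if "x \<in> carrier C" for x
      using mod_hom_closed[OF g that] BP by auto
    have "S.trace (\<lambda>x. ?w (\<theta> x)) = \<zero>\<^sub>K" if th: "\<theta> \<in> \<Theta>" for \<theta>
    proof -
      \<comment> \<open>Evaluation at 1 turns the coinduced components of g back into K-linear
        maps.\<close>
      define \<gamma> where "\<gamma> t = (\<lambda>x\<in>carrier C. snd (g x) (\<theta>, t) \<one>\<^sub>A)" for t
      have snd_smult: "snd (g (a \<odot>\<^sub>C x)) (\<theta>, t) \<one>\<^sub>A = snd (g x) (\<theta>, t) a"
        if "a \<in> carrier A" "x \<in> carrier C" "t \<in> T" for a x t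
        using that th mod_hom_smult[OF g that(1,2)] by (simp add: B_simps(3))
      have \<gamma>: "\<gamma> t \<in> mod_hom K ?S ?S" if t: "t \<in> T" for t
      proof (rule mod_homI)
        show "\<gamma> t \<in> carrier ?S \<rightarrow>\<^sub>E carrier ?S" using gc[OF gB(2) th t] by (auto simp: \<gamma>_def)
        fix x y assume xy: "x \<in> carrier ?S" "y \<in> carrier ?S"
        then show "\<gamma> t (x \<oplus>\<^bsub>?S\<^esub> y) = \<gamma> t x \<oplus>\<^bsub>?S\<^esub> \<gamma> t y"
          using th t mod_hom_add[OF g, of x y] by (simp add: \<gamma>_def B_simps(2) hom_plus_def)
      next
        fix c x assume cx: "c \<in> carrier K" "x \<in> carrier ?S"
        then show "\<gamma> t (c \<odot>\<^bsub>?S\<^esub> x) = c \<odot>\<^bsub>?S\<^esub> \<gamma> t x"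
          using snd_smult[of "c \<odot>\<^sub>A \<one>\<^sub>A" x t] t mod_hom_smult[OF gh[OF gB(2) th t, of x], of c "\<one>\<^sub>A"]
          by (simp add: \<gamma>_def)
      qed
      have th_w: "\<theta> (?w x) = (comm_sum C C T \<gamma> x)" if x: "x \<in> carrier C" for x
      proof -
        have "\<theta> (\<one>\<^sub>A \<odot>\<^sub>C fst (g x)) = D \<theta> \<one>\<^sub>A (g x)" using gB(1)[OF x] th by (simp add: B_simps(1) BB_def)
        then have "\<theta> (?w x) = D \<theta> \<one>\<^sub>A (g x)"
          using x fc[OF gB(2)[OF x]] gB(1)[OF x] by (simp add: C.smult_one hom_comp_apply b_def)
        also have "\<dots> = (comm_sum C C T \<gamma> x)"
          unfolding D_def using x tA gc[OF gB(2) th]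
          by (intro C.M.finsum_cong') (auto simp: \<gamma>_def snd_smult)
        finally show ?thesis .
      qed
      have "S.trace (\<lambda>x. hom_id C (\<theta> (?w x))) = \<zero>\<^sub>K"
        by (rule trace_commutator[OF C C T(1,3) \<gamma> th_w hom_id_in[OF C']])
      moreover have "S.trace (\<lambda>x. hom_id C (\<theta> (?w x))) = S.trace (\<lambda>x. \<theta> (?w x))"
        using \<theta>c[OF th] mod_hom_closed[OF w] by (intro S.trace_cong[OF fg_scalars[OF C]]) (auto simp: hom_id_def)
      moreover have "S.trace (\<lambda>x. \<theta> (?w x)) = S.trace (\<lambda>x. ?w (\<theta> x))"
        by (rule trace_cyclic[OF S.vspace_axioms S.vspace_axioms fg_scalars[OF C] fg_scalars[OF C] hom_scalars[OF w] \<theta>[OF th]])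
      ultimately show ?thesis by simp
    qed
    then show ?thesis using \<Theta>rad[OF w] by blast
  qed
  have "b \<in> rad_hom A B C"
  proof (rule rad_homI[OF b])
    fix g y assume g: "g \<in> mod_hom A C B" and y: "y \<in> carrier C" "b (g y) = y"
    show "y = \<zero>\<^sub>C"
      by (rule rad_homD[OF brad[OF g] hom_id_in[OF C'] y(1)]) (use y in \<open>simp add: hom_id_def hom_comp_apply\<close>)
  qed
  moreover have "\<exists>k \<in> mod_hom A X B. h = hom_comp X b k"
    if X: "fg_right_module A X" and h: "h \<in> rad_hom A X C" for X :: "('a, 'm) module" and h
  proof -
    interpret X: right_module A X using X by (simp add: fg_right_module_def)
    note X' = X.right_module_axioms
    interpret SX: vspace K "scalars A X" by (rule scalars_vspace[OF X'])
    note hh = rad_hom_mod_hom[OF h]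
    have hc: "h x \<in> carrier C" if "x \<in> carrier X" for x using mod_hom_closed[OF hh that] .
    have "\<exists>\<gamma>. (\<forall>t\<in>T. \<gamma> t \<in> mod_hom K (scalars A X) ?S) \<and>
      (\<forall>x\<in>carrier X. \<theta> (h x) = (comm_sum X C T \<gamma> x))" if th: "\<theta> \<in> \<Theta>" for \<theta>
    proof -
      \<comment> \<open>Cyclicity moves the trace from X to C, where it becomes the trace of h u
        \<theta> with the radical endomorphism h u.\<close>
      have "SX.trace (\<lambda>x. u (hom_comp X \<theta> h x)) = \<zero>\<^sub>K" if u: "u \<in> mod_hom A C X" for u
      proof -
        have q: "hom_comp ?S u \<theta> \<in> mod_hom K ?S (scalars A X)"
          by (rule hom_comp_in[OF S.V.right_module_axioms \<theta>[OF th] hom_scalars[OF u]])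
        have uc: "u x \<in> carrier X" if "x \<in> carrier C" for x using mod_hom_closed[OF u that] .
        have hu: "hom_comp C h u \<in> rad_hom A C C" by (rule rad_hom_comp_right[OF C' C' h u])
        have "SX.trace (\<lambda>x. u (hom_comp X \<theta> h x)) = SX.trace (\<lambda>x. hom_comp ?S u \<theta> (h x))"
          using hc \<theta>c[OF th] uc by (intro SX.trace_cong[OF fg_scalars[OF X]]) (auto simp: hom_comp_apply compose_def)
        also have "\<dots> = S.trace (\<lambda>x. h (hom_comp ?S u \<theta> x))"
          by (rule trace_cyclic[OF SX.vspace_axioms S.vspace_axioms fg_scalars[OF X] fg_scalars[OF C] hom_scalars[OF hh] q])
        also have "\<dots> = S.trace (\<lambda>x. hom_comp C h u (\<theta> x))"
          using hc \<theta>c[OF th] uc by (intro S.trace_cong[OF fg_scalars[OF C]]) (auto simp: hom_comp_apply compose_def)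
        also have "\<dots> = \<zero>\<^sub>K" using \<Theta>rad[OF rad_hom_mod_hom[OF hu]] hu th by blast
        finally show ?thesis .
      qed
      moreover have "hom_comp X \<theta> h \<in> mod_hom K (scalars A X) ?S"
        using hom_comp_in[OF SX.V.right_module_axioms hom_scalars[OF hh] \<theta>[OF th]] by simp
      ultimately obtain \<gamma> where "\<forall>t\<in>T. \<gamma> t \<in> mod_hom K (scalars A X) ?S"
        "\<forall>x\<in>carrier X. hom_comp X \<theta> h x = (comm_sum X C T \<gamma> x)"
        using orthogonal_imp_commutator[OF X C T(1,2)] by blast
      then show ?thesis by (intro exI[of _ \<gamma>]) (simp add: hom_comp_apply)
    qed
    then have "\<forall>\<theta>\<in>\<Theta>. \<exists>\<gamma>. (\<forall>t\<in>T. \<gamma> t \<in> mod_hom K (scalars A X) ?S) \<and>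
      (\<forall>x\<in>carrier X. \<theta> (h x) = (comm_sum X C T \<gamma> x))" ..
    from bchoice[OF this] obtain \<gamma> where \<gamma>': "\<forall>\<theta>\<in>\<Theta>. (\<forall>t\<in>T. \<gamma> \<theta> t \<in> mod_hom K (scalars A X) ?S) \<and>
      (\<forall>x\<in>carrier X. \<theta> (h x) = (comm_sum X C T (\<gamma> \<theta>) x))" ..
    then have \<gamma>: "\<And>\<theta> t. \<theta> \<in> \<Theta> \<Longrightarrow> t \<in> T \<Longrightarrow> \<gamma> \<theta> t \<in> mod_hom K (scalars A X) ?S"
      "\<And>\<theta> x. \<theta> \<in> \<Theta> \<Longrightarrow> x \<in> carrier X \<Longrightarrow>
        \<theta> (h x) = (comm_sum X C T (\<gamma> \<theta>) x)"
      by blast+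
    have \<gamma>c: "\<gamma> \<theta> t x \<in> carrier C" if "\<theta> \<in> \<Theta>" "t \<in> T" "x \<in> carrier X" for \<theta> t x
      using mod_hom_closed[OF \<gamma>(1)[OF that(1,2)]] that(3) by simp
    have \<gamma>_add: "\<gamma> \<theta> t (x \<oplus>\<^sub>X y) = \<gamma> \<theta> t x \<oplus>\<^sub>C \<gamma> \<theta> t y"
      if "\<theta> \<in> \<Theta>" "t \<in> T" "x \<in> carrier X" "y \<in> carrier X" for \<theta> t x y
      using mod_hom_add[OF \<gamma>(1)[OF that(1,2)], of x y] that(3,4) by simp
    \<comment> \<open>The map to the product that corresponds to h and the \<gamma> under
      coinduction. The commutator equations say that its values lie in BB.\<close>
    define kk where "kk x = (h x, \<lambda>(\<theta>, t)\<in>?J. \<lambda>a\<in>carrier A. \<gamma> \<theta> t (a \<odot>\<^sub>X x))" for x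
    have kk_snd: "snd (kk x) (\<theta>, t) = (\<lambda>a\<in>carrier A. \<gamma> \<theta> t (a \<odot>\<^sub>X x))" if "\<theta> \<in> \<Theta>" "t \<in> T" for x \<theta> t
      using that by (simp add: kk_def)
    have kP: "kk x \<in> carrier ?P" if x: "x \<in> carrier X" for x
    proof -
      have "(\<lambda>a\<in>carrier A. \<gamma> \<theta> t (a \<odot>\<^sub>X x)) \<in> mod_hom K A ?S" if "\<theta> \<in> \<Theta>" "t \<in> T" for \<theta> t
      proof -
        have "hom_comp A (\<gamma> \<theta> t) (\<lambda>a\<in>carrier A. a \<odot>\<^sub>X x) \<in> mod_hom K A ?S"
          by (rule hom_comp_in[OF A_right_module orbit_map(2)[OF X' x] \<gamma>(1)[OF that]])
        also have "hom_comp A (\<gamma> \<theta> t) (\<lambda>a\<in>carrier A. a \<odot>\<^sub>X x) = (\<lambda>a\<in>carrier A. \<gamma> \<theta> t (a \<odot>\<^sub>X x))"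
          by (rule ext) (simp add: compose_def)
        finally show ?thesis .
      qed
      then show ?thesis using hc[OF x] by (auto simp: kk_def)
    qed
    have kB: "kk x \<in> carrier B" if x: "x \<in> carrier X" for x
    proof -
      have "\<theta> (a \<odot>\<^sub>C fst (kk x)) = D \<theta> a (kk x)" if ta: "\<theta> \<in> \<Theta>" "a \<in> carrier A" for \<theta> a
      proof -
        have ax: "a \<odot>\<^sub>X x \<in> carrier X" using ta x by simp
        have "\<theta> (a \<odot>\<^sub>C fst (kk x)) = \<theta> (h (a \<odot>\<^sub>X x))" using mod_hom_smult[OF hh ta(2) x] by (simp add: kk_def)
        also have "\<dots> = (comm_sum X C T (\<gamma> \<theta>) (a \<odot>\<^sub>X x))"
          by (rule \<gamma>(2)[OF ta(1) ax])
        also have "\<dots> = D \<theta> a (kk x)"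
          unfolding D_def
        proof (rule C.M.finsum_cong'[OF refl])
          show "(\<lambda>t. snd (kk x) (\<theta>, t) (a \<otimes>\<^sub>A t) \<oplus>\<^sub>C \<ominus>\<^sub>C (t \<odot>\<^sub>C snd (kk x) (\<theta>, t) a)) \<in> T \<rightarrow> carrier C"
            by (rule Pi_I) (rule Dc[OF kP[OF x] ta(1) _ ta(2)])
          fix t assume t: "t \<in> T"
          show "\<gamma> \<theta> t (t \<odot>\<^sub>X (a \<odot>\<^sub>X x)) \<oplus>\<^sub>C \<ominus>\<^sub>C (t \<odot>\<^sub>C \<gamma> \<theta> t (a \<odot>\<^sub>X x)) =
            snd (kk x) (\<theta>, t) (a \<otimes>\<^sub>A t) \<oplus>\<^sub>C \<ominus>\<^sub>C (t \<odot>\<^sub>C snd (kk x) (\<theta>, t) a)"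
            unfolding kk_snd[OF ta(1) t] using ta(2) tA[OF t] x by (simp add: X.smult_assoc)
        qed
        finally show ?thesis .
      qed
      then show ?thesis unfolding B_simps BB_def by (intro CollectI conjI ballI kP[OF x])
    qed
    define k where "k = (\<lambda>x\<in>carrier X. kk x)"
    have "k \<in> mod_hom A X B"
    proof (rule mod_homI)
      show "k \<in> carrier X \<rightarrow>\<^sub>E carrier B" using kB by (auto simp: k_def)
      fix x y assume xy: "x \<in> carrier X" "y \<in> carrier X"
      have "kk (x \<oplus>\<^sub>X y) = kk x \<oplus>\<^bsub>?P\<^esub> kk y"
        using xy by (auto simp: kk_def mod_hom_add[OF hh] \<gamma>_add X.smult_add_module hom_plus_def intro!: restrict_ext)
      then show "k (x \<oplus>\<^sub>X y) = k x \<oplus>\<^sub>B k y" using xy by (simp add: k_def B_simps(2) del: prod_module_simps)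
    next
      fix a x assume ax: "a \<in> carrier A" "x \<in> carrier X"
      have "kk (a \<odot>\<^sub>X x) = a \<odot>\<^bsub>?P\<^esub> kk x"
        using ax by (auto simp: kk_def mod_hom_smult[OF hh] X.smult_assoc intro!: restrict_ext)
      then show "k (a \<odot>\<^sub>X x) = a \<odot>\<^sub>B k x" using ax by (simp add: k_def B_simps(3) del: prod_module_simps)
    qed
    moreover have "h = hom_comp X b k"
      using kB by (intro extensionalityI[OF mod_hom_extensional[OF hh], of "hom_comp X b k"])
        (auto simp: compose_def k_def b_def kk_def)
    ultimately show ?thesis by blast
  qed
  ultimately show ?thesis using Bfg by blast
qed

end

section \<open>Morphisms out of quotients and out of products with free modules\<close>

lemma factor_through_surjection:
  assumes P: "right_module A P" and Q: "right_module A Q" and X: "right_module A X"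
    and p: "p \<in> mod_hom A P Q" "p ` carrier P = carrier Q" and F: "F \<in> mod_hom A P X"
    and ker: "\<And>z. z \<in> carrier P \<Longrightarrow> p z = \<zero>\<^sub>Q \<Longrightarrow> F z = \<zero>\<^sub>X"
  obtains k where "k \<in> mod_hom A Q X" "\<And>z. z \<in> carrier P \<Longrightarrow> k (p z) = F z"
proof -
  interpret P: right_module A P by fact
  interpret Q: right_module A Q by fact
  interpret X: right_module A X by fact
  have Fc: "F z \<in> carrier X" if "z \<in> carrier P" for z by (rule mod_hom_closed[OF F that])
  have pc: "p z \<in> carrier Q" if "z \<in> carrier P" for z by (rule mod_hom_closed[OF p(1) that])
  define s where "s q = inv_into (carrier P) p q" for q
  have s: "s q \<in> carrier P" "p (s q) = q" if "q \<in> carrier Q" for q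
    using that p(2) unfolding s_def by (auto simp: inv_into_into f_inv_into_f)
  have sF: "F (s (p z)) = F z" if z: "z \<in> carrier P" for z
  proof -
    let ?y = "s (p z)"
    have y: "?y \<in> carrier P" "p ?y = p z" using s[OF pc[OF z]] by auto
    have "p (?y \<oplus>\<^sub>P \<ominus>\<^sub>P z) = \<zero>\<^sub>Q"
      using y z pc[OF z] by (simp add: mod_hom_add[OF p(1)] mod_hom_neg[OF P Q p(1)] Q.M.r_neg)
    then have "F (?y \<oplus>\<^sub>P \<ominus>\<^sub>P z) = \<zero>\<^sub>X" using y z by (intro ker) simp_all
    then have "F ?y \<oplus>\<^sub>X \<ominus>\<^sub>X F z = \<zero>\<^sub>X"
      using y z by (simp add: mod_hom_add[OF F] mod_hom_neg[OF P X F])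
    then show ?thesis using X.M.diff_eq_zero_iff[OF Fc[OF y(1)] Fc[OF z]] by simp
  qed
  define k where "k = (\<lambda>q\<in>carrier Q. F (s q))"
  have kp: "k (p z) = F z" if "z \<in> carrier P" for z
    using sF[OF that] pc[OF that] by (simp add: k_def)
  have "k \<in> mod_hom A Q X"
  proof (rule mod_homI)
    show "k \<in> carrier Q \<rightarrow>\<^sub>E carrier X" using s Fc by (auto simp: k_def)
    fix x y assume xy: "x \<in> carrier Q" "y \<in> carrier Q"
    have "k (p (s x \<oplus>\<^sub>P s y)) = F (s x) \<oplus>\<^sub>X F (s y)"
      using s[OF xy(1)] s[OF xy(2)] by (simp add: kp mod_hom_add[OF F])
    then show "k (x \<oplus>\<^sub>Q y) = k x \<oplus>\<^sub>X k y"
      using s[OF xy(1)] s[OF xy(2)] xy by (simp add: mod_hom_add[OF p(1)] k_def)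
  next
    fix a x assume ax: "a \<in> carrier A" "x \<in> carrier Q"
    have "k (p (a \<odot>\<^sub>P s x)) = a \<odot>\<^sub>X F (s x)"
      using s[OF ax(2)] ax(1) by (simp add: kp mod_hom_smult[OF F])
    then show "k (a \<odot>\<^sub>Q x) = a \<odot>\<^sub>X k x"
      using s[OF ax(2)] ax by (simp add: mod_hom_smult[OF p(1)] k_def)
  qed
  then show ?thesis using kp by (rule that)
qed

lemma (in abelian_monoid) finsum_Times:
  assumes "finite S" "finite T" "\<And>s t. s \<in> S \<Longrightarrow> t \<in> T \<Longrightarrow> f (s, t) \<in> carrier G"
  shows "(\<Oplus>p\<in>S \<times> T. f p) = (\<Oplus>s\<in>S. \<Oplus>t\<in>T. f (s, t))"
  using assms(1,3)
proof (induction S)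
  case (insert x S)
  have "(\<Oplus>p\<in>insert x S \<times> T. f p) = (\<Oplus>p\<in>{x} \<times> T \<union> S \<times> T. f p)"
    by (rule arg_cong[of _ _ "finsum G f"]) auto
  also have "\<dots> = (\<Oplus>p\<in>{x} \<times> T. f p) \<oplus> (\<Oplus>p\<in>S \<times> T. f p)"
    using insert assms(2) by (intro finsum_Un_disjoint) auto
  also have "(\<Oplus>p\<in>{x} \<times> T. f p) = (\<Oplus>p\<in>Pair x ` T. f p)"
    by (rule arg_cong[of _ _ "finsum G f"]) auto
  also have "\<dots> = (\<Oplus>t\<in>T. f (x, t))"
    using insert by (intro finsum_reindex) (auto simp: inj_on_def)
  also have "(\<Oplus>p\<in>S \<times> T. f p) = (\<Oplus>s\<in>S. \<Oplus>t\<in>T. f (s, t))"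
    using insert by auto
  also have "(\<Oplus>t\<in>T. f (x, t)) \<oplus> (\<Oplus>s\<in>S. \<Oplus>t\<in>T. f (s, t)) = (\<Oplus>s\<in>insert x S. \<Oplus>t\<in>T. f (s, t))"
    using insert by (intro finsum_insert[symmetric]) (auto intro!: finsum_closed)
  finally show ?case .
qed simp

lemma (in abelian_group) finsum_neg:
  assumes "finite S" "f \<in> S \<rightarrow> carrier G"
  shows "(\<Oplus>s\<in>S. \<ominus> f s) = \<ominus> (\<Oplus>s\<in>S. f s)"
proof -
  have "(\<Oplus>s\<in>S. \<ominus> f s) \<oplus> (\<Oplus>s\<in>S. f s) = (\<Oplus>s\<in>S. \<ominus> f s \<oplus> f s)"
    using assms(2) by (intro finsum_addf[symmetric]) auto
  also have "\<dots> = (\<Oplus>s\<in>S. \<zero>)"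
    using assms(2) by (intro finsum_cong') (auto intro!: l_neg)
  finally show ?thesis
    using assms(2) by (intro minus_equality[symmetric]) (auto simp: finsum_zero intro!: finsum_closed)
qed

definition unit_vector where
  "unit_vector M J A j = (\<zero>\<^sub>M, \<lambda>i\<in>J. if i = j then \<one>\<^sub>A else \<zero>\<^sub>A)"

text \<open>Freeness of A^J: a homomorphism out of M \<times> A^J is determined by its restriction
  to M and by the images of the unit vectors.\<close>

lemma prod_regular_decomposition:
  assumes M: "right_module A M" and "finite J" and m: "m \<in> carrier M" and f: "f \<in> J \<rightarrow>\<^sub>E carrier A"
    and X: "right_module A X" and F: "F \<in> mod_hom A (prod_module M J (regular A)) X"
  shows "F (m, f) = F (m, \<lambda>j\<in>J. \<zero>\<^sub>A) \<oplus>\<^sub>X (\<Oplus>\<^bsub>X\<^esub>j\<in>J. f j \<odot>\<^sub>X F (unit_vector M J A j))"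
proof -
  interpret M: right_module A M by fact
  interpret X: right_module A X by fact
  have R: "right_module A (regular A)" by (rule regular_module[OF M.A.ring_axioms])
  interpret R: right_module A "regular A" by (rule R)
  let ?P = "prod_module M J (regular A)"
  interpret P: right_module A ?P by (rule prod_module[OF M R])
  let ?u = "\<lambda>j. f j \<odot>\<^bsub>?P\<^esub> unit_vector M J A j"
  have fj: "f j \<in> carrier A" if "j \<in> J" for j using f that by auto
  have uv: "unit_vector M J A j \<in> carrier ?P" if "j \<in> J" for j by (simp add: unit_vector_def)
  have u: "?u \<in> J \<rightarrow> carrier ?P" using fj uv by (intro Pi_I P.smult_closed)
  have fst: "(\<lambda>z\<in>carrier ?P. fst z) \<in> mod_hom A ?P M"
  proof (rule mod_homI)
    show "(\<lambda>z\<in>carrier ?P. fst z) (x \<oplus>\<^bsub>?P\<^esub> y) = (\<lambda>z\<in>carrier ?P. fst z) x \<oplus>\<^sub>M (\<lambda>z\<in>carrier ?P. fst z) y"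
      if "x \<in> carrier ?P" "y \<in> carrier ?P" for x y using P.M.a_closed[OF that] that by simp
    show "(\<lambda>z\<in>carrier ?P. fst z) (a \<odot>\<^bsub>?P\<^esub> x) = a \<odot>\<^sub>M (\<lambda>z\<in>carrier ?P. fst z) x"
      if "a \<in> carrier A" "x \<in> carrier ?P" for a x using P.smult_closed[OF that] that by simp
  qed auto
  have snd: "(\<lambda>z\<in>carrier ?P. snd z i) \<in> mod_hom A ?P (regular A)" if i: "i \<in> J" for i
  proof (rule mod_homI)
    show "(\<lambda>z\<in>carrier ?P. snd z i) (x \<oplus>\<^bsub>?P\<^esub> y) = (\<lambda>z\<in>carrier ?P. snd z i) x \<oplus>\<^bsub>regular A\<^esub> (\<lambda>z\<in>carrier ?P. snd z i) y"
      if "x \<in> carrier ?P" "y \<in> carrier ?P" for x y using P.M.a_closed[OF that] that i by simp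
    show "(\<lambda>z\<in>carrier ?P. snd z i) (a \<odot>\<^bsub>?P\<^esub> x) = a \<odot>\<^bsub>regular A\<^esub> (\<lambda>z\<in>carrier ?P. snd z i) x"
      if "a \<in> carrier A" "x \<in> carrier ?P" for a x using P.smult_closed[OF that] that i by simp
  qed (use i in auto)
  let ?s = "finsum ?P ?u J"
  have s: "?s \<in> carrier ?P" by (rule P.M.finsum_closed[OF u])
  have "fst ?s = (\<lambda>z\<in>carrier ?P. fst z) ?s" using s by simp
  also have "\<dots> = (\<Oplus>\<^bsub>M\<^esub>j\<in>J. (\<lambda>z\<in>carrier ?P. fst z) (?u j))"
    by (rule mod_hom_finsum[OF P.right_module_axioms M fst assms(2) u])
  also have "\<dots> = (\<Oplus>\<^bsub>M\<^esub>j\<in>J. \<zero>\<^sub>M)"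
  proof (rule M.M.finsum_cong'[OF refl])
    fix j assume j: "j \<in> J"
    then have "?u j \<in> carrier ?P" using u by blast
    then have "(\<lambda>z\<in>carrier ?P. fst z) (?u j) = fst (?u j)" by (simp only: restrict_apply')
    then show "(\<lambda>z\<in>carrier ?P. fst z) (?u j) = \<zero>\<^sub>M" using fj[OF j] by (simp add: unit_vector_def)
  qed simp
  finally have s1: "fst ?s = \<zero>\<^sub>M" by (simp add: M.M.finsum_zero)
  have s2: "snd ?s i = f i" if i: "i \<in> J" for i
  proof -
    have "snd ?s i = (\<lambda>z\<in>carrier ?P. snd z i) ?s" using s by simp
    also have "\<dots> = (\<Oplus>\<^bsub>regular A\<^esub>j\<in>J. (\<lambda>z\<in>carrier ?P. snd z i) (?u j))"
      by (rule mod_hom_finsum[OF P.right_module_axioms R snd[OF i] assms(2) u])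
    also have "\<dots> = (\<Oplus>\<^bsub>regular A\<^esub>j\<in>J. if i = j then f j else \<zero>\<^bsub>regular A\<^esub>)"
    proof (rule R.M.finsum_cong'[OF refl])
      fix j assume j: "j \<in> J"
      then have "?u j \<in> carrier ?P" using u by blast
      then have "(\<lambda>z\<in>carrier ?P. snd z i) (?u j) = snd (?u j) i" by (simp only: restrict_apply')
      then show "(\<lambda>z\<in>carrier ?P. snd z i) (?u j) = (if i = j then f j else \<zero>\<^bsub>regular A\<^esub>)"
        using fj[OF j] i by (simp add: unit_vector_def)
    qed (use fj in auto)
    also have "\<dots> = f i"
      using i assms(2) fj by (intro R.M.finsum_singleton) auto
    finally show ?thesis .
  qed
  have "snd ?s \<in> J \<rightarrow>\<^sub>E carrier A" using s by (cases ?s) simp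
  then have "snd ?s = f" using s2 f by (intro extensionalityI[of _ J]) (auto simp: PiE_def)
  with s1 have s_eq: "?s = (\<zero>\<^sub>M, f)" by (simp add: prod_eq_iff)
  have "(m, \<lambda>j\<in>J. \<zero>\<^sub>A) \<oplus>\<^bsub>?P\<^esub> (\<zero>\<^sub>M, f) = (m, f)"
    using m f fj by (auto intro!: extensionalityI[of _ J] simp: PiE_def)
  then have "F (m, f) = F ((m, \<lambda>j\<in>J. \<zero>\<^sub>A) \<oplus>\<^bsub>?P\<^esub> ?s)" by (simp only: s_eq)
  also have "\<dots> = F (m, \<lambda>j\<in>J. \<zero>\<^sub>A) \<oplus>\<^sub>X F ?s"
    using m s by (intro mod_hom_add[OF F]) simp_all
  also have "F ?s = (\<Oplus>\<^bsub>X\<^esub>j\<in>J. F (?u j))"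
    by (rule mod_hom_finsum[OF P.right_module_axioms X F assms(2) u])
  also have "\<dots> = (\<Oplus>\<^bsub>X\<^esub>j\<in>J. f j \<odot>\<^sub>X F (unit_vector M J A j))"
    using fj uv mod_hom_closed[OF F uv]
    by (intro X.M.finsum_cong') (auto simp: mod_hom_smult[OF F] simp del: prod_module_simps)
  finally show ?thesis .
qed

context fin_dim_algebra
begin

text \<open>Relations take the place of equations. A K-linear map \<gamma> : M \<rightarrow> X is
  given by its values on a frame E of M, so families of such maps come from homomorphisms out of A^J
  with J = \<Theta> \<times> T \<times> E. B is the quotient of M \<times> A^J by the submodule of
  relations which say that h \<theta> is the commutator sum of the \<gamma>(\<theta>, t), for every
  \<theta>.\<close>

lemma left_almost_split:
  fixes M :: "('a, 'c) module"
  assumes M: "fg_right_module A M"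
  shows "\<exists>(B :: ('a, ('c \<times> (('c \<Rightarrow> 'c) \<times> 'a \<times> 'c \<Rightarrow> 'a)) set) module) b. fg_right_module A B \<and> b \<in> rad_hom A M B \<and>
    (\<forall>X :: ('a, 'm) module. fg_right_module A X \<longrightarrow>
      (\<forall>h \<in> rad_hom A M X. \<exists>k \<in> mod_hom A B X. h = hom_comp M k b))"
proof -
  interpret M: right_module A M using M by (simp add: fg_right_module_def)
  note M' = M.right_module_axioms
  let ?S = "scalars A M"
  interpret S: vspace K ?S by (rule scalars_vspace[OF M'])
  obtain \<Theta> where \<Theta>: "finite \<Theta>" "\<Theta> \<subseteq> mod_hom K ?S ?S"
    and \<Theta>rad: "\<And>w. w \<in> mod_hom A M M \<Longrightarrow> w \<in> rad_hom A M M \<longleftrightarrow> (\<forall>\<theta>\<in>\<Theta>. S.trace (\<lambda>x. w (\<theta> x)) = \<zero>\<^sub>K)"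
    using rad_endo_trace_test[OF M] by blast
  obtain T where T: "finite T" "right_module.spans K A T" "T \<subseteq> carrier A" by (rule finite_spanning_set)
  obtain E \<mu> where E: "S.frame E \<mu>" using S.exists_frame[OF fg_scalars[OF M]] by blast
  note e = S.frameD[OF E, simplified]
  have tA: "t \<in> carrier A" if "t \<in> T" for t using that T(3) by blast
  have \<theta>: "\<theta> \<in> mod_hom K ?S ?S" if "\<theta> \<in> \<Theta>" for \<theta> using that \<Theta>(2) by blast
  have \<theta>c: "\<theta> x \<in> carrier M" if "\<theta> \<in> \<Theta>" "x \<in> carrier M" for \<theta> x
    using mod_hom_closed[OF \<theta>[OF that(1)]] that(2) by simp
  let ?J = "\<Theta> \<times> T \<times> E"
  have J: "finite ?J" using \<Theta>(1) T(1) e(1) by simp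
  let ?P = "prod_module M ?J (regular A)"
  have Pfg: "fg_right_module A ?P" by (rule prod_fg[OF M regular_fg J])
  interpret P: right_module A ?P using Pfg by (simp add: fg_right_module_def)
  note P' = P.right_module_axioms
  let ?z = "\<lambda>j\<in>?J. \<zero>\<^sub>A"
  \<comment> \<open>The free part of the relation for m. Applied to the images of the unit vectors,
    its coefficients produce t \<gamma>(m) - \<gamma>(t m) for each t, the negative of the
    commutator.\<close>
  define r where "r \<theta> m = (\<lambda>(\<theta>', t, e)\<in>?J. if \<theta>' = \<theta>
    then \<mu> e m \<odot>\<^sub>A t \<oplus>\<^sub>A \<ominus>\<^sub>A (\<mu> e (t \<odot>\<^sub>M m) \<odot>\<^sub>A \<one>\<^sub>A) else \<zero>\<^sub>A)" for \<theta> m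
  have rc: "r \<theta> m \<in> ?J \<rightarrow>\<^sub>E carrier A" if "m \<in> carrier M" for \<theta> m
    using that e tA by (auto simp: r_def)
  define N where "N = \<Inter>{N. submodule N A ?P \<and> (\<forall>\<theta>\<in>\<Theta>. \<forall>m\<in>carrier M. (\<theta> m, r \<theta> m) \<in> N)}"
  have rP: "(\<theta> m, r \<theta> m) \<in> carrier ?P" if "\<theta> \<in> \<Theta>" "m \<in> carrier M" for \<theta> m
    using rc[OF that(2)] \<theta>c[OF that] by simp
  have N: "submodule N A ?P"
    unfolding N_def
  proof (rule P.submodule_Inter)
    have "carrier ?P \<in> {N. submodule N A ?P \<and> (\<forall>\<theta>\<in>\<Theta>. \<forall>m\<in>carrier M. (\<theta> m, r \<theta> m) \<in> N)}"
      by (intro CollectI conjI ballI P.submodule_carrier rP)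
    then show "{N. submodule N A ?P \<and> (\<forall>\<theta>\<in>\<Theta>. \<forall>m\<in>carrier M. (\<theta> m, r \<theta> m) \<in> N)} \<noteq> {}" by blast
  qed simp
  have N_in: "(\<theta> m, r \<theta> m) \<in> N" if "\<theta> \<in> \<Theta>" "m \<in> carrier M" for \<theta> m
    using that unfolding N_def by blast
  have N_least: "N \<subseteq> U" if "submodule U A ?P" "\<And>\<theta> m. \<theta> \<in> \<Theta> \<Longrightarrow> m \<in> carrier M \<Longrightarrow> (\<theta> m, r \<theta> m) \<in> U" for U
    unfolding N_def using that by (intro Inter_lower CollectI conjI ballI)
  obtain B :: "('a, ('c \<times> (('c \<Rightarrow> 'c) \<times> 'a \<times> 'c \<Rightarrow> 'a)) set) module" and p
    where B': "right_module A B" and p: "p \<in> mod_hom A ?P B" "p ` carrier ?P = carrier B"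
    and ker: "\<And>x. x \<in> carrier ?P \<Longrightarrow> p x = \<zero>\<^sub>B \<longleftrightarrow> x \<in> N"
    by (rule quotient_module[OF P' N]) (rule that)
  interpret B: right_module A B by (rule B')
  have Bfg: "fg_right_module A B" by (rule fg_surjective_image[OF Pfg B' p])
  have uvP: "unit_vector M ?J A j \<in> carrier ?P" for j by (simp add: unit_vector_def)
  \<comment> \<open>For a homomorphism F out of the product, \<open>key\<close> evaluates F on a
    generator of N, \<open>key_zero\<close> says that the sum occurring there is the negative of the
    commutator sum, and \<open>\<gamma>_hom\<close> that the maps reconstructed from F are K-linear.
    The target X is kept general because the block serves both M and arbitrary modules.\<close>
  have key: "F (\<theta> m, r \<theta> m) = F (\<theta> m, ?z) \<oplus>\<^sub>X
      (\<Oplus>\<^bsub>X\<^esub>t\<in>T. t \<odot>\<^sub>X \<gamma> t m \<oplus>\<^sub>X \<ominus>\<^sub>X \<gamma> t (t \<odot>\<^sub>M m))" (is ?key)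
    and key_zero: "(\<Oplus>\<^bsub>X\<^esub>t\<in>T. t \<odot>\<^sub>X \<gamma> t m \<oplus>\<^sub>X \<ominus>\<^sub>X \<gamma> t (t \<odot>\<^sub>M m)) \<oplus>\<^sub>X
      (comm_sum M X T \<gamma> m) = \<zero>\<^sub>X" (is ?key_zero)
    and \<gamma>_hom: "t \<in> T \<Longrightarrow> \<gamma> t \<in> mod_hom K ?S (scalars A X)"
    if X: "right_module A X" and F: "F \<in> mod_hom A ?P X" and th: "\<theta> \<in> \<Theta>" and m: "m \<in> carrier M"
      and \<gamma>: "\<And>t. t \<in> T \<Longrightarrow> \<gamma> t = (\<lambda>x\<in>carrier M. \<Oplus>\<^bsub>X\<^esub>e\<in>E. (\<mu> e x \<odot>\<^sub>A \<one>\<^sub>A) \<odot>\<^sub>X F (unit_vector M ?J A (\<theta>, t, e)))"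
    for X :: "('a, 'd) module" and F \<theta> m \<gamma> t
  proof -
    interpret X: right_module A X by (rule X)
    interpret SX: right_module K "scalars A X" by (rule scalars_module[OF X])
    define y where "y t e = F (unit_vector M ?J A (\<theta>, t, e))" for t e
    have yc: "y t e \<in> carrier X" for t e unfolding y_def by (rule mod_hom_closed[OF F uvP])
    have \<gamma>': "\<gamma> t x = (\<Oplus>\<^bsub>X\<^esub>e\<in>E. (\<mu> e x \<odot>\<^sub>A \<one>\<^sub>A) \<odot>\<^sub>X y t e)" if "t \<in> T" "x \<in> carrier M" for t x
      using that by (simp add: \<gamma> y_def)
    have \<gamma>c: "\<gamma> t x \<in> carrier X" if "t \<in> T" "x \<in> carrier M" for t x
      unfolding \<gamma>'[OF that] using that e yc by (intro X.M.finsum_closed) auto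
    have tm: "t \<odot>\<^sub>M m \<in> carrier M" if "t \<in> T" for t using that tA m by simp
    let ?g = "\<lambda>t e. \<mu> e m \<odot>\<^sub>A t \<oplus>\<^sub>A \<ominus>\<^sub>A (\<mu> e (t \<odot>\<^sub>M m) \<odot>\<^sub>A \<one>\<^sub>A)"
    have gA: "?g t e \<in> carrier A" if "t \<in> T" "e \<in> E" for t e using that e tA m by simp
    have inner: "(\<Oplus>\<^bsub>X\<^esub>e\<in>E. ?g t e \<odot>\<^sub>X y t e) = t \<odot>\<^sub>X \<gamma> t m \<oplus>\<^sub>X \<ominus>\<^sub>X \<gamma> t (t \<odot>\<^sub>M m)" if t: "t \<in> T" for t
    proof -
      have c1: "(\<mu> b m \<odot>\<^sub>A \<one>\<^sub>A) \<odot>\<^sub>X y t b \<in> carrier X" if "b \<in> E" for b using that e yc m by simp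
      have c2: "(\<mu> b (t \<odot>\<^sub>M m) \<odot>\<^sub>A \<one>\<^sub>A) \<odot>\<^sub>X y t b \<in> carrier X" if "b \<in> E" for b using that e yc tm[OF t] by simp
      have "(\<Oplus>\<^bsub>X\<^esub>b\<in>E. ?g t b \<odot>\<^sub>X y t b) =
        (\<Oplus>\<^bsub>X\<^esub>b\<in>E. t \<odot>\<^sub>X ((\<mu> b m \<odot>\<^sub>A \<one>\<^sub>A) \<odot>\<^sub>X y t b) \<oplus>\<^sub>X \<ominus>\<^sub>X ((\<mu> b (t \<odot>\<^sub>M m) \<odot>\<^sub>A \<one>\<^sub>A) \<odot>\<^sub>X y t b))"
      proof (rule X.M.finsum_cong'[OF refl])
        show "(\<lambda>b. t \<odot>\<^sub>X ((\<mu> b m \<odot>\<^sub>A \<one>\<^sub>A) \<odot>\<^sub>X y t b) \<oplus>\<^sub>X \<ominus>\<^sub>X ((\<mu> b (t \<odot>\<^sub>M m) \<odot>\<^sub>A \<one>\<^sub>A) \<odot>\<^sub>X y t b)) \<in> E \<rightarrow> carrier X"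
          using c1 c2 tA[OF t] by auto
        fix b assume b: "b \<in> E"
        have \<mu>K: "\<mu> b m \<in> carrier K" "\<mu> b (t \<odot>\<^sub>M m) \<in> carrier K" using b e m tm[OF t] by auto
        have "t \<odot>\<^sub>X ((\<mu> b m \<odot>\<^sub>A \<one>\<^sub>A) \<odot>\<^sub>X y t b) = (\<mu> b m \<odot>\<^sub>A t) \<odot>\<^sub>X y t b"
          using \<mu>K tA[OF t] yc X.smult_assoc[of "\<mu> b m \<odot>\<^sub>A \<one>\<^sub>A" t "y t b"] by (simp add: scalar_mult)
        then show "?g t b \<odot>\<^sub>X y t b = t \<odot>\<^sub>X ((\<mu> b m \<odot>\<^sub>A \<one>\<^sub>A) \<odot>\<^sub>X y t b) \<oplus>\<^sub>X
            \<ominus>\<^sub>X ((\<mu> b (t \<odot>\<^sub>M m) \<odot>\<^sub>A \<one>\<^sub>A) \<odot>\<^sub>X y t b)"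
          using \<mu>K tA[OF t] yc by (simp add: X.smult_add_ring X.neg_smult)
      qed
      also have "\<dots> = (\<Oplus>\<^bsub>X\<^esub>b\<in>E. t \<odot>\<^sub>X ((\<mu> b m \<odot>\<^sub>A \<one>\<^sub>A) \<odot>\<^sub>X y t b)) \<oplus>\<^sub>X
          (\<Oplus>\<^bsub>X\<^esub>b\<in>E. \<ominus>\<^sub>X ((\<mu> b (t \<odot>\<^sub>M m) \<odot>\<^sub>A \<one>\<^sub>A) \<odot>\<^sub>X y t b))"
        using c1 c2 tA[OF t] by (intro X.M.finsum_addf) auto
      also have "\<dots> = t \<odot>\<^sub>X \<gamma> t m \<oplus>\<^sub>X \<ominus>\<^sub>X \<gamma> t (t \<odot>\<^sub>M m)"
        unfolding \<gamma>'[OF t m] \<gamma>'[OF t tm[OF t]]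
        using c1 c2 tA[OF t] e(1) by (subst X.smult_finsum, simp_all add: Pi_iff X.M.finsum_neg)
      finally show ?thesis .
    qed
    have inner_c: "t \<odot>\<^sub>X \<gamma> t m \<oplus>\<^sub>X \<ominus>\<^sub>X \<gamma> t (t \<odot>\<^sub>M m) \<in> carrier X"
      "\<gamma> t (t \<odot>\<^sub>M m) \<oplus>\<^sub>X \<ominus>\<^sub>X (t \<odot>\<^sub>X \<gamma> t m) \<in> carrier X" if "t \<in> T" for t
      using \<gamma>c[OF that m] \<gamma>c[OF that tm[OF that]] tA[OF that] by simp_all
    let ?R = "\<lambda>j. r \<theta> m j \<odot>\<^sub>X F (unit_vector M ?J A j)"
    have Rc: "?R j \<in> carrier X" if "j \<in> ?J" for j
      using PiE_mem[OF rc[OF m] that] mod_hom_closed[OF F uvP] by simp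
    have "F (\<theta> m, r \<theta> m) = F (\<theta> m, ?z) \<oplus>\<^sub>X (\<Oplus>\<^bsub>X\<^esub>j\<in>?J. ?R j)"
      by (rule prod_regular_decomposition[OF M' J \<theta>c[OF th m] rc[OF m] X F])
    also have "(\<Oplus>\<^bsub>X\<^esub>j\<in>?J. ?R j) = (\<Oplus>\<^bsub>X\<^esub>\<theta>'\<in>\<Theta>. \<Oplus>\<^bsub>X\<^esub>q\<in>T \<times> E. ?R (\<theta>', q))"
      using \<Theta>(1) T(1) e(1) by (intro X.M.finsum_Times Rc) auto
    \<comment> \<open>The coefficients of \<open>r \<theta> m\<close> vanish outside the block of
      \<theta>.\<close>
    also have "\<dots> = (\<Oplus>\<^bsub>X\<^esub>\<theta>'\<in>\<Theta>. if \<theta> = \<theta>' then (\<Oplus>\<^bsub>X\<^esub>q\<in>T \<times> E. ?R (\<theta>, q)) else \<zero>\<^sub>X)"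
    proof (rule X.M.finsum_cong'[OF refl])
      have c: "(\<Oplus>\<^bsub>X\<^esub>q\<in>T \<times> E. ?R (\<theta>, q)) \<in> carrier X"
        by (intro X.M.finsum_closed Pi_I Rc) (use th in auto)
      then show "(\<lambda>\<theta>'. if \<theta> = \<theta>' then (\<Oplus>\<^bsub>X\<^esub>q\<in>T \<times> E. ?R (\<theta>, q)) else \<zero>\<^sub>X) \<in> \<Theta> \<rightarrow> carrier X"
        using X.M.zero_closed by (intro Pi_I) presburger
      fix \<theta>' assume th': "\<theta>' \<in> \<Theta>"
      show "(\<Oplus>\<^bsub>X\<^esub>q\<in>T \<times> E. ?R (\<theta>', q)) = (if \<theta> = \<theta>' then (\<Oplus>\<^bsub>X\<^esub>q\<in>T \<times> E. ?R (\<theta>, q)) else \<zero>\<^sub>X)"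
      proof (cases "\<theta> = \<theta>'")
        case False
        have "(\<Oplus>\<^bsub>X\<^esub>q\<in>T \<times> E. ?R (\<theta>', q)) = (\<Oplus>\<^bsub>X\<^esub>q\<in>T \<times> E. \<zero>\<^sub>X)"
        proof (rule X.M.finsum_cong'[OF refl])
          fix q assume q: "q \<in> T \<times> E"
          then have "r \<theta> m (\<theta>', q) = \<zero>\<^sub>A" using False th' by (cases q) (simp add: r_def)
          then show "?R (\<theta>', q) = \<zero>\<^sub>X" using mod_hom_closed[OF F uvP] by simp
        qed simp
        then show ?thesis using False by (simp add: X.M.finsum_zero)
      qed simp
    qed
    also have "\<dots> = (\<Oplus>\<^bsub>X\<^esub>q\<in>T \<times> E. ?R (\<theta>, q))"
    proof -
      have c: "(\<Oplus>\<^bsub>X\<^esub>q\<in>T \<times> E. ?R (\<theta>, q)) \<in> carrier X"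
        by (intro X.M.finsum_closed Pi_I Rc) (use th in auto)
      then show ?thesis
        using X.M.finsum_singleton[of \<theta> \<Theta> "\<lambda>_. \<Oplus>\<^bsub>X\<^esub>q\<in>T \<times> E. ?R (\<theta>, q)"] th \<Theta>(1) by simp
    qed
    also have "\<dots> = (\<Oplus>\<^bsub>X\<^esub>t\<in>T. \<Oplus>\<^bsub>X\<^esub>b\<in>E. ?R (\<theta>, t, b))"
      using T(1) e(1) th by (intro X.M.finsum_Times Rc) auto
    also have "\<dots> = (\<Oplus>\<^bsub>X\<^esub>t\<in>T. t \<odot>\<^sub>X \<gamma> t m \<oplus>\<^sub>X \<ominus>\<^sub>X \<gamma> t (t \<odot>\<^sub>M m))"
    proof (rule X.M.finsum_cong'[OF refl])
      show "(\<lambda>t. t \<odot>\<^sub>X \<gamma> t m \<oplus>\<^sub>X \<ominus>\<^sub>X \<gamma> t (t \<odot>\<^sub>M m)) \<in> T \<rightarrow> carrier X"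
        by (rule Pi_I) (rule inner_c)
      fix t assume t: "t \<in> T"
      have "(\<Oplus>\<^bsub>X\<^esub>b\<in>E. ?R (\<theta>, t, b)) = (\<Oplus>\<^bsub>X\<^esub>b\<in>E. ?g t b \<odot>\<^sub>X y t b)"
      proof (rule X.M.finsum_cong'[OF refl])
        show "(\<lambda>b. ?g t b \<odot>\<^sub>X y t b) \<in> E \<rightarrow> carrier X"
          by (intro Pi_I X.smult_closed gA[OF t] yc)
        show "?R (\<theta>, t, b) = ?g t b \<odot>\<^sub>X y t b" if "b \<in> E" for b
          using th t that by (simp add: r_def y_def)
      qed
      then show "(\<Oplus>\<^bsub>X\<^esub>b\<in>E. ?R (\<theta>, t, b)) = t \<odot>\<^sub>X \<gamma> t m \<oplus>\<^sub>X \<ominus>\<^sub>X \<gamma> t (t \<odot>\<^sub>M m)"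
        using inner[OF t] by simp
    qed
    finally show ?key .
    have "(\<Oplus>\<^bsub>X\<^esub>t\<in>T. t \<odot>\<^sub>X \<gamma> t m \<oplus>\<^sub>X \<ominus>\<^sub>X \<gamma> t (t \<odot>\<^sub>M m)) \<oplus>\<^sub>X
        (comm_sum M X T \<gamma> m) =
      (\<Oplus>\<^bsub>X\<^esub>t\<in>T. (t \<odot>\<^sub>X \<gamma> t m \<oplus>\<^sub>X \<ominus>\<^sub>X \<gamma> t (t \<odot>\<^sub>M m)) \<oplus>\<^sub>X
        (\<gamma> t (t \<odot>\<^sub>M m) \<oplus>\<^sub>X \<ominus>\<^sub>X (t \<odot>\<^sub>X \<gamma> t m)))"
      by (rule X.M.finsum_addf[symmetric]) (rule Pi_I, erule inner_c)+
    also have "\<dots> = (\<Oplus>\<^bsub>X\<^esub>t\<in>T. \<zero>\<^sub>X)"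
    proof (rule X.M.finsum_cong'[OF refl])
      fix t assume t: "t \<in> T"
      have c: "\<gamma> t (t \<odot>\<^sub>M m) \<in> carrier X" "t \<odot>\<^sub>X \<gamma> t m \<in> carrier X"
        using \<gamma>c[OF t m] \<gamma>c[OF t tm[OF t]] tA[OF t] by simp_all
      have "(t \<odot>\<^sub>X \<gamma> t m \<oplus>\<^sub>X \<ominus>\<^sub>X \<gamma> t (t \<odot>\<^sub>M m)) \<oplus>\<^sub>X (\<gamma> t (t \<odot>\<^sub>M m) \<oplus>\<^sub>X \<ominus>\<^sub>X (t \<odot>\<^sub>X \<gamma> t m)) =
        t \<odot>\<^sub>X \<gamma> t m \<oplus>\<^sub>X (\<ominus>\<^sub>X \<gamma> t (t \<odot>\<^sub>M m) \<oplus>\<^sub>X (\<gamma> t (t \<odot>\<^sub>M m) \<oplus>\<^sub>X \<ominus>\<^sub>X (t \<odot>\<^sub>X \<gamma> t m)))"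
        using c by (simp add: X.M.a_assoc)
      also have "\<dots> = \<zero>\<^sub>X" using c by (simp add: X.M.r_neg1 X.M.r_neg)
      finally show "(t \<odot>\<^sub>X \<gamma> t m \<oplus>\<^sub>X \<ominus>\<^sub>X \<gamma> t (t \<odot>\<^sub>M m)) \<oplus>\<^sub>X (\<gamma> t (t \<odot>\<^sub>M m) \<oplus>\<^sub>X \<ominus>\<^sub>X (t \<odot>\<^sub>X \<gamma> t m)) = \<zero>\<^sub>X" .
    qed simp
    finally show ?key_zero by (simp add: X.M.finsum_zero)
    show "\<gamma> t \<in> mod_hom K ?S (scalars A X)" if t: "t \<in> T"
    proof (rule mod_homI)
      show "\<gamma> t \<in> carrier ?S \<rightarrow>\<^sub>E carrier (scalars A X)"
        using \<gamma>c[OF t] by (auto simp: \<gamma>[OF t])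
      fix x x' assume x: "x \<in> carrier ?S" "x' \<in> carrier ?S"
      have "\<gamma> t (x \<oplus>\<^sub>M x') = (\<Oplus>\<^bsub>X\<^esub>b\<in>E. (\<mu> b x \<odot>\<^sub>A \<one>\<^sub>A) \<odot>\<^sub>X y t b \<oplus>\<^sub>X (\<mu> b x' \<odot>\<^sub>A \<one>\<^sub>A) \<odot>\<^sub>X y t b)"
      proof (subst \<gamma>'[OF t], goal_cases)
        case 2
        show ?case
        proof (rule X.M.finsum_cong'[OF refl])
          fix b assume b: "b \<in> E"
          have "\<mu> b x \<in> carrier K" "\<mu> b x' \<in> carrier K" "\<mu> b (x \<oplus>\<^sub>M x') = \<mu> b x \<oplus>\<^sub>K \<mu> b x'"
            using b e(5)[OF b] x mod_hom_add[OF e(3)[OF b], of x x'] by auto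
          then show "(\<mu> b (x \<oplus>\<^sub>M x') \<odot>\<^sub>A \<one>\<^sub>A) \<odot>\<^sub>X y t b =
              (\<mu> b x \<odot>\<^sub>A \<one>\<^sub>A) \<odot>\<^sub>X y t b \<oplus>\<^sub>X (\<mu> b x' \<odot>\<^sub>A \<one>\<^sub>A) \<odot>\<^sub>X y t b"
            using yc by (simp add: smult_l_distr X.smult_add_ring)
        qed (use e(5) x yc in auto)
      qed (use x in simp)
      also have "\<dots> = \<gamma> t x \<oplus>\<^sub>X \<gamma> t x'"
        unfolding \<gamma>'[OF t x(1)[simplified]] \<gamma>'[OF t x(2)[simplified]]
        using x e(5) yc by (intro X.M.finsum_addf) auto
      finally show "\<gamma> t (x \<oplus>\<^bsub>?S\<^esub> x') = \<gamma> t x \<oplus>\<^bsub>scalars A X\<^esub> \<gamma> t x'" by simp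
    next
      fix c x assume c: "c \<in> carrier K" and x: "x \<in> carrier ?S"
      have "\<gamma> t ((c \<odot>\<^sub>A \<one>\<^sub>A) \<odot>\<^sub>M x) = (\<Oplus>\<^bsub>X\<^esub>b\<in>E. (c \<odot>\<^sub>A \<one>\<^sub>A) \<odot>\<^sub>X ((\<mu> b x \<odot>\<^sub>A \<one>\<^sub>A) \<odot>\<^sub>X y t b))"
      proof (subst \<gamma>'[OF t], goal_cases)
        case 2
        show ?case
        proof (rule X.M.finsum_cong'[OF refl])
          fix b assume b: "b \<in> E"
          have \<mu>: "\<mu> b x \<in> carrier K" "\<mu> b ((c \<odot>\<^sub>A \<one>\<^sub>A) \<odot>\<^sub>M x) = \<mu> b x \<otimes>\<^sub>K c"
            using b e(5)[OF b] x S.functional_smult[OF e(3)[OF b] c, of x] by auto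
          have "c \<odot>\<^bsub>scalars A X\<^esub> (\<mu> b x \<odot>\<^bsub>scalars A X\<^esub> y t b) = (\<mu> b x \<otimes>\<^sub>K c) \<odot>\<^bsub>scalars A X\<^esub> y t b"
            using SX.smult_assoc[OF \<mu>(1) c, of "y t b"] yc by simp
          then show "(\<mu> b ((c \<odot>\<^sub>A \<one>\<^sub>A) \<odot>\<^sub>M x) \<odot>\<^sub>A \<one>\<^sub>A) \<odot>\<^sub>X y t b =
              (c \<odot>\<^sub>A \<one>\<^sub>A) \<odot>\<^sub>X ((\<mu> b x \<odot>\<^sub>A \<one>\<^sub>A) \<odot>\<^sub>X y t b)"
            using \<mu>(2) by simp
        qed (use e(5) x yc c in auto)
      qed (use x c in simp)
      also have "\<dots> = (c \<odot>\<^sub>A \<one>\<^sub>A) \<odot>\<^sub>X \<gamma> t x"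
        unfolding \<gamma>'[OF t x[simplified]]
        using x e(1,5) yc c by (intro X.smult_finsum[symmetric]) auto
      finally show "\<gamma> t (c \<odot>\<^bsub>?S\<^esub> x) = c \<odot>\<^bsub>scalars A X\<^esub> \<gamma> t x" by simp
    qed
  qed
  define b where "b = (\<lambda>m\<in>carrier M. p (m, ?z))"
  have zP: "(m, ?z) \<in> carrier ?P" if "m \<in> carrier M" for m using that by simp
  have b: "b \<in> mod_hom A M B"
  proof (rule mod_homI)
    show "b \<in> carrier M \<rightarrow>\<^sub>E carrier B" using mod_hom_closed[OF p(1) zP] by (auto simp: b_def)
    fix x y assume xy: "x \<in> carrier M" "y \<in> carrier M"
    have "(x \<oplus>\<^sub>M y, ?z) = (x, ?z) \<oplus>\<^bsub>?P\<^esub> (y, ?z)" by (auto intro!: restrict_ext)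
    then have "p (x \<oplus>\<^sub>M y, ?z) = p (x, ?z) \<oplus>\<^sub>B p (y, ?z)"
      using mod_hom_add[OF p(1) zP[OF xy(1)] zP[OF xy(2)]] by (simp only:)
    then show "b (x \<oplus>\<^sub>M y) = b x \<oplus>\<^sub>B b y" using xy by (simp add: b_def)
  next
    fix a x assume ax: "a \<in> carrier A" "x \<in> carrier M"
    have "(a \<odot>\<^sub>M x, ?z) = a \<odot>\<^bsub>?P\<^esub> (x, ?z)" using ax by (auto intro!: restrict_ext)
    then have "p (a \<odot>\<^sub>M x, ?z) = a \<odot>\<^sub>B p (x, ?z)"
      using mod_hom_smult[OF p(1) ax(1) zP[OF ax(2)]] by (simp only:)
    then show "b (a \<odot>\<^sub>M x) = a \<odot>\<^sub>B b x" using ax by (simp add: b_def)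
  qed
  \<comment> \<open>The composite of g with the quotient map kills N, so g b \<theta> is a
    commutator sum and has trace zero.\<close>
  have brad: "hom_comp M g b \<in> rad_hom A M M" if g: "g \<in> mod_hom A B M" for g
  proof -
    let ?w = "hom_comp M g b"
    have w: "?w \<in> mod_hom A M M" by (rule hom_comp_in[OF M' b g])
    let ?F = "hom_comp ?P g p"
    have F: "?F \<in> mod_hom A ?P M" by (rule hom_comp_in[OF P' p(1) g])
    have "S.trace (\<lambda>x. ?w (\<theta> x)) = \<zero>\<^sub>K" if th: "\<theta> \<in> \<Theta>" for \<theta>
    proof -
      define \<gamma> where "\<gamma> t = (\<lambda>x\<in>carrier M. \<Oplus>\<^bsub>M\<^esub>e\<in>E. (\<mu> e x \<odot>\<^sub>A \<one>\<^sub>A) \<odot>\<^sub>M ?F (unit_vector M ?J A (\<theta>, t, e)))" for t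
      have \<gamma>: "\<gamma> t \<in> mod_hom K ?S ?S" if "t \<in> T" for t
        by (rule \<gamma>_hom[OF M' F th M.M.zero_closed \<gamma>_def that])
      have \<gamma>c: "\<gamma> t x \<in> carrier M" if "t \<in> T" "x \<in> carrier M" for t x
        using mod_hom_closed[OF \<gamma>[OF that(1)]] that(2) by simp
      have "?w (\<theta> m) = (comm_sum M M T \<gamma> m)" (is "_ = ?S2") if m: "m \<in> carrier M" for m
      proof -
        let ?S1 = "\<Oplus>\<^bsub>M\<^esub>t\<in>T. t \<odot>\<^sub>M \<gamma> t m \<oplus>\<^sub>M \<ominus>\<^sub>M \<gamma> t (t \<odot>\<^sub>M m)"
        have S12: "?S1 \<in> carrier M" "?S2 \<in> carrier M"
          using \<gamma>c tA m by (auto intro!: M.M.finsum_closed)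
        have "p (\<theta> m, r \<theta> m) = \<zero>\<^sub>B" using ker[OF rP[OF th m]] N_in[OF th m] by simp
        then have "?F (\<theta> m, r \<theta> m) = \<zero>\<^sub>M"
          using mod_hom_zero[OF B' M' g] hom_comp_apply[OF rP[OF th m], of g p] by simp
        then have "?F (\<theta> m, ?z) \<oplus>\<^sub>M ?S1 = \<zero>\<^sub>M"
          using key[OF M' F th m \<gamma>_def] by simp
        then have F1: "?F (\<theta> m, ?z) = \<ominus>\<^sub>M ?S1"
          using S12 mod_hom_closed[OF F zP[OF \<theta>c[OF th m]]] by (intro M.M.minus_equality[symmetric])
        have "?S2 \<oplus>\<^sub>M ?S1 = \<zero>\<^sub>M"
          using key_zero[OF M' F th m \<gamma>_def] S12 M.M.a_comm[OF S12] by simp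
        then have "?S2 = \<ominus>\<^sub>M ?S1" using S12 by (intro M.M.minus_equality[symmetric])
        moreover have "?w (\<theta> m) = ?F (\<theta> m, ?z)"
          using \<theta>c[OF th m] zP[OF \<theta>c[OF th m]] by (simp only: hom_comp_apply b_def restrict_apply')
        ultimately show ?thesis using F1 by simp
      qed
      then have "S.trace (\<lambda>x. hom_id M (?w (\<theta> x))) = \<zero>\<^sub>K"
        by (intro trace_commutator[OF M M T(1,3) \<gamma> _ hom_id_in[OF M']])
      moreover have "S.trace (\<lambda>x. hom_id M (?w (\<theta> x))) = S.trace (\<lambda>x. ?w (\<theta> x))"
        using \<theta>c[OF th] mod_hom_closed[OF w] by (intro S.trace_cong[OF fg_scalars[OF M]]) (auto simp: hom_id_def)
      ultimately show ?thesis by simp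
    qed
    then show ?thesis using \<Theta>rad[OF w] by blast
  qed
  have "b \<in> rad_hom A M B"
  proof (rule rad_homI[OF b])
    fix g y assume g: "g \<in> mod_hom A B M" and y: "y \<in> carrier B" "b (g y) = y"
    have gy: "g y \<in> carrier M" by (rule mod_hom_closed[OF g y(1)])
    \<comment> \<open>g maps a fixed point of b g to a fixed point of the radical endomorphism g
      b.\<close>
    have "g y = \<zero>\<^sub>M"
      by (rule rad_homD[OF brad[OF g] hom_id_in[OF M'] gy]) (use gy y in \<open>simp add: hom_id_def hom_comp_apply\<close>)
    then show "y = \<zero>\<^sub>B" using y(2) mod_hom_zero[OF M' B' b] by simp
  qed
  moreover have "\<exists>k \<in> mod_hom A B X. h = hom_comp M k b"
    if X: "fg_right_module A X" and h: "h \<in> rad_hom A M X" for X :: "('a, 'm) module" and h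
  proof -
    interpret X: right_module A X using X by (simp add: fg_right_module_def)
    note X' = X.right_module_axioms
    interpret SX: right_module K "scalars A X" by (rule scalars_module[OF X'])
    note hh = rad_hom_mod_hom[OF h]
    have hc: "h x \<in> carrier X" if "x \<in> carrier M" for x using mod_hom_closed[OF hh that] .
    have "\<exists>\<gamma>. (\<forall>t\<in>T. \<gamma> t \<in> mod_hom K ?S (scalars A X)) \<and>
      (\<forall>x\<in>carrier M. h (\<theta> x) = (comm_sum M X T \<gamma> x))" if th: "\<theta> \<in> \<Theta>" for \<theta>
    proof -
      have "S.trace (\<lambda>x. u (hom_comp ?S h \<theta> x)) = \<zero>\<^sub>K" if u: "u \<in> mod_hom A X M" for u
      proof -
        have uc: "u x \<in> carrier M" if "x \<in> carrier X" for x using mod_hom_closed[OF u that] .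
        have uh: "hom_comp M u h \<in> rad_hom A M M" by (rule rad_hom_comp_left[OF M' X' M' h u])
        have "S.trace (\<lambda>x. u (hom_comp ?S h \<theta> x)) = S.trace (\<lambda>x. hom_comp M u h (\<theta> x))"
          using hc \<theta>c[OF th] uc by (intro S.trace_cong[OF fg_scalars[OF M]]) (auto simp: compose_def)
        also have "\<dots> = \<zero>\<^sub>K" using \<Theta>rad[OF rad_hom_mod_hom[OF uh]] uh th by blast
        finally show ?thesis .
      qed
      moreover have "hom_comp ?S h \<theta> \<in> mod_hom K ?S (scalars A X)"
        by (rule hom_comp_in[OF S.V.right_module_axioms \<theta>[OF th] hom_scalars[OF hh]])
      ultimately obtain \<gamma> where "\<forall>t\<in>T. \<gamma> t \<in> mod_hom K ?S (scalars A X)"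
        "\<forall>x\<in>carrier M. hom_comp ?S h \<theta> x = (comm_sum M X T \<gamma> x)"
        using orthogonal_imp_commutator[OF M X T(1,2)] by blast
      then show ?thesis by (intro exI[of _ \<gamma>]) (simp add: compose_def)
    qed
    then have "\<forall>\<theta>\<in>\<Theta>. \<exists>\<gamma>. (\<forall>t\<in>T. \<gamma> t \<in> mod_hom K ?S (scalars A X)) \<and>
      (\<forall>x\<in>carrier M. h (\<theta> x) = (comm_sum M X T \<gamma> x))" ..
    from bchoice[OF this] obtain \<gamma> where \<gamma>': "\<forall>\<theta>\<in>\<Theta>. (\<forall>t\<in>T. \<gamma> \<theta> t \<in> mod_hom K ?S (scalars A X)) \<and>
      (\<forall>x\<in>carrier M. h (\<theta> x) = (comm_sum M X T (\<gamma> \<theta>) x))" ..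
    then have \<gamma>: "\<And>\<theta> t. \<theta> \<in> \<Theta> \<Longrightarrow> t \<in> T \<Longrightarrow> \<gamma> \<theta> t \<in> mod_hom K ?S (scalars A X)"
      "\<And>\<theta> x. \<theta> \<in> \<Theta> \<Longrightarrow> x \<in> carrier M \<Longrightarrow>
        h (\<theta> x) = (comm_sum M X T (\<gamma> \<theta>) x)"
      by blast+
    have \<gamma>c: "\<gamma> \<theta> t x \<in> carrier X" if "\<theta> \<in> \<Theta>" "t \<in> T" "x \<in> carrier M" for \<theta> t x
      using mod_hom_closed[OF \<gamma>(1)[OF that(1,2)]] that(3) by simp
    \<comment> \<open>The values of the \<gamma>(\<theta>, t) on the frame; the homomorphism F below
      sends the unit vectors to them.\<close>
    define Y where "Y j = (case j of (\<theta>, t, e) \<Rightarrow> \<gamma> \<theta> t e)" for j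
    have Yc: "Y j \<in> carrier X" if "j \<in> ?J" for j using that \<gamma>c e(6) by (auto simp: Y_def)
    define F where "F = (\<lambda>z\<in>carrier ?P. h (fst z) \<oplus>\<^sub>X (\<Oplus>\<^bsub>X\<^esub>j\<in>?J. snd z j \<odot>\<^sub>X Y j))"
    have zc: "fst z \<in> carrier M" "\<And>j. j \<in> ?J \<Longrightarrow> snd z j \<in> carrier A" if "z \<in> carrier ?P" for z
    proof -
      have "fst z \<in> carrier M" "snd z \<in> ?J \<rightarrow>\<^sub>E carrier A" using that by (cases z, simp)+
      then show "fst z \<in> carrier M" "\<And>j. j \<in> ?J \<Longrightarrow> snd z j \<in> carrier A" by auto
    qed
    have sc: "(\<lambda>j. snd z j \<odot>\<^sub>X Y j) \<in> ?J \<rightarrow> carrier X" if "z \<in> carrier ?P" for z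
      by (intro Pi_I X.smult_closed zc(2)[OF that] Yc)
    have F: "F \<in> mod_hom A ?P X"
    proof (rule mod_homI)
      show "F \<in> carrier ?P \<rightarrow>\<^sub>E carrier X"
        unfolding F_def by (rule restrict_PiE_iff[THEN iffD2])
          (intro ballI X.M.a_closed hc zc X.M.finsum_closed sc)
      fix x y assume xy: "x \<in> carrier ?P" "y \<in> carrier ?P"
      note xyc = P.M.a_closed[OF xy]
      have "(\<Oplus>\<^bsub>X\<^esub>j\<in>?J. snd (x \<oplus>\<^bsub>?P\<^esub> y) j \<odot>\<^sub>X Y j) = (\<Oplus>\<^bsub>X\<^esub>j\<in>?J. snd x j \<odot>\<^sub>X Y j \<oplus>\<^sub>X snd y j \<odot>\<^sub>X Y j)"
      proof (rule X.M.finsum_cong'[OF refl])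
        show "(\<lambda>j. snd x j \<odot>\<^sub>X Y j \<oplus>\<^sub>X snd y j \<odot>\<^sub>X Y j) \<in> ?J \<rightarrow> carrier X"
          by (intro Pi_I X.M.a_closed X.smult_closed zc(2) xy Yc)
        fix j assume j: "j \<in> ?J"
        then have "snd (x \<oplus>\<^bsub>?P\<^esub> y) j = snd x j \<oplus>\<^sub>A snd y j" by simp
        then show "snd (x \<oplus>\<^bsub>?P\<^esub> y) j \<odot>\<^sub>X Y j = snd x j \<odot>\<^sub>X Y j \<oplus>\<^sub>X snd y j \<odot>\<^sub>X Y j"
          using X.smult_add_ring[OF zc(2)[OF xy(1) j] zc(2)[OF xy(2) j] Yc[OF j]] by (simp only:)
      qed
      also have "\<dots> = (\<Oplus>\<^bsub>X\<^esub>j\<in>?J. snd x j \<odot>\<^sub>X Y j) \<oplus>\<^sub>X (\<Oplus>\<^bsub>X\<^esub>j\<in>?J. snd y j \<odot>\<^sub>X Y j)"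
        by (rule X.M.finsum_addf[OF sc[OF xy(1)] sc[OF xy(2)]])
      finally have 1: "(\<Oplus>\<^bsub>X\<^esub>j\<in>?J. snd (x \<oplus>\<^bsub>?P\<^esub> y) j \<odot>\<^sub>X Y j) =
        (\<Oplus>\<^bsub>X\<^esub>j\<in>?J. snd x j \<odot>\<^sub>X Y j) \<oplus>\<^sub>X (\<Oplus>\<^bsub>X\<^esub>j\<in>?J. snd y j \<odot>\<^sub>X Y j)" .
      have 2: "h (fst (x \<oplus>\<^bsub>?P\<^esub> y)) = h (fst x) \<oplus>\<^sub>X h (fst y)"
        using mod_hom_add[OF hh zc(1)[OF xy(1)] zc(1)[OF xy(2)]] by simp
      show "F (x \<oplus>\<^bsub>?P\<^esub> y) = F x \<oplus>\<^sub>X F y"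
        unfolding F_def restrict_apply'[OF xyc] restrict_apply'[OF xy(1)] restrict_apply'[OF xy(2)] 1 2
        using X.M.finsum_closed[OF sc[OF xy(1)]] X.M.finsum_closed[OF sc[OF xy(2)]]
          hc[OF zc(1)[OF xy(1)]] hc[OF zc(1)[OF xy(2)]] by (simp add: X.M.a_ac)
    next
      fix a x assume a: "a \<in> carrier A" and x: "x \<in> carrier ?P"
      note ax = P.smult_closed[OF a x]
      have "(\<Oplus>\<^bsub>X\<^esub>j\<in>?J. snd (a \<odot>\<^bsub>?P\<^esub> x) j \<odot>\<^sub>X Y j) = (\<Oplus>\<^bsub>X\<^esub>j\<in>?J. a \<odot>\<^sub>X (snd x j \<odot>\<^sub>X Y j))"
      proof (rule X.M.finsum_cong'[OF refl])
        show "(\<lambda>j. a \<odot>\<^sub>X (snd x j \<odot>\<^sub>X Y j)) \<in> ?J \<rightarrow> carrier X"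
          by (intro Pi_I X.smult_closed zc(2) x a Yc)
        fix j assume j: "j \<in> ?J"
        then have "snd (a \<odot>\<^bsub>?P\<^esub> x) j = snd x j \<otimes>\<^sub>A a" by simp
        then show "snd (a \<odot>\<^bsub>?P\<^esub> x) j \<odot>\<^sub>X Y j = a \<odot>\<^sub>X (snd x j \<odot>\<^sub>X Y j)"
          using X.smult_assoc[OF zc(2)[OF x j] a Yc[OF j]] by (simp only:)
      qed
      also have "\<dots> = a \<odot>\<^sub>X (\<Oplus>\<^bsub>X\<^esub>j\<in>?J. snd x j \<odot>\<^sub>X Y j)"
        by (rule X.smult_finsum[OF a J sc[OF x], symmetric])
      finally have 1: "(\<Oplus>\<^bsub>X\<^esub>j\<in>?J. snd (a \<odot>\<^bsub>?P\<^esub> x) j \<odot>\<^sub>X Y j) = a \<odot>\<^sub>X (\<Oplus>\<^bsub>X\<^esub>j\<in>?J. snd x j \<odot>\<^sub>X Y j)" .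
      have 2: "h (fst (a \<odot>\<^bsub>?P\<^esub> x)) = a \<odot>\<^sub>X h (fst x)"
        using mod_hom_smult[OF hh a zc(1)[OF x]] by simp
      show "F (a \<odot>\<^bsub>?P\<^esub> x) = a \<odot>\<^sub>X F x"
        unfolding F_def restrict_apply'[OF ax] restrict_apply'[OF x] 1 2
        using X.smult_add_module[OF a hc[OF zc(1)[OF x]] X.M.finsum_closed[OF sc[OF x]]] by simp
    qed
    have Fz: "F (m, ?z) = h m" if m: "m \<in> carrier M" for m
    proof -
      have "(\<Oplus>\<^bsub>X\<^esub>j\<in>?J. ?z j \<odot>\<^sub>X Y j) = (\<Oplus>\<^bsub>X\<^esub>j\<in>?J. \<zero>\<^sub>X)"
        using Yc by (intro X.M.finsum_cong') auto
      then show ?thesis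
        unfolding F_def restrict_apply'[OF zP[OF m]] using hc[OF m] by (simp add: X.M.finsum_zero)
    qed
    have Fu: "F (unit_vector M ?J A j) = Y j" if j: "j \<in> ?J" for j
    proof -
      have "(\<Oplus>\<^bsub>X\<^esub>i\<in>?J. snd (unit_vector M ?J A j) i \<odot>\<^sub>X Y i) = (\<Oplus>\<^bsub>X\<^esub>i\<in>?J. if j = i then Y i else \<zero>\<^sub>X)"
        using Yc by (intro X.M.finsum_cong') (auto simp: unit_vector_def X.smult_one)
      also have "\<dots> = Y j" using j J Yc by (intro X.M.finsum_singleton) auto
      finally have "F (unit_vector M ?J A j) = h (fst (unit_vector M ?J A j)) \<oplus>\<^sub>X Y j"
        unfolding F_def restrict_apply'[OF uvP] by simp
      then show ?thesis
        using Yc[OF j] mod_hom_zero[OF M' X' hh] by (simp add: unit_vector_def)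
    qed
    have F0: "F (\<theta> m, r \<theta> m) = \<zero>\<^sub>X" if th: "\<theta> \<in> \<Theta>" and m: "m \<in> carrier M" for \<theta> m
    proof -
      \<comment> \<open>A K-linear map is recovered from its values on the frame, so the maps that
        \<open>key\<close> reconstructs from F are the given ones.\<close>
      have frame: "\<gamma> \<theta> t = (\<lambda>x\<in>carrier M. \<Oplus>\<^bsub>X\<^esub>e\<in>E. (\<mu> e x \<odot>\<^sub>A \<one>\<^sub>A) \<odot>\<^sub>X F (unit_vector M ?J A (\<theta>, t, e)))"
        if t: "t \<in> T" for t
      proof (rule extensionalityI[of _ "carrier M"])
        show "\<gamma> \<theta> t \<in> extensional (carrier M)" using mod_hom_extensional[OF \<gamma>(1)[OF th t]] by simp
        fix x assume x: "x \<in> carrier M"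
        have "\<gamma> \<theta> t x = \<gamma> \<theta> t (\<Oplus>\<^bsub>?S\<^esub>b\<in>E. \<mu> b x \<odot>\<^bsub>?S\<^esub> b)" using e(4)[OF x] by simp
        also have "\<dots> = (\<Oplus>\<^bsub>scalars A X\<^esub>b\<in>E. \<gamma> \<theta> t (\<mu> b x \<odot>\<^bsub>?S\<^esub> b))"
          using e(5,6) x S.smult_closed
          by (intro mod_hom_finsum[OF S.V.right_module_axioms SX.right_module_axioms \<gamma>(1)[OF th t] e(1)]) auto
        also have "\<dots> = (\<Oplus>\<^bsub>scalars A X\<^esub>b\<in>E. (\<mu> b x \<odot>\<^sub>A \<one>\<^sub>A) \<odot>\<^sub>X F (unit_vector M ?J A (\<theta>, t, b)))"
        proof (rule SX.M.finsum_cong'[OF refl])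
          fix b assume b: "b \<in> E"
          show "\<gamma> \<theta> t (\<mu> b x \<odot>\<^bsub>?S\<^esub> b) = (\<mu> b x \<odot>\<^sub>A \<one>\<^sub>A) \<odot>\<^sub>X F (unit_vector M ?J A (\<theta>, t, b))"
            using mod_hom_smult[OF \<gamma>(1)[OF th t] e(5)[OF b x], of b] e(6)[OF b] Fu[of "(\<theta>, t, b)"] th t b
            by (simp add: Y_def)
        qed (use mod_hom_closed[OF F uvP] e(5) x in auto)
        also have "\<dots> = (\<Oplus>\<^bsub>X\<^esub>b\<in>E. (\<mu> b x \<odot>\<^sub>A \<one>\<^sub>A) \<odot>\<^sub>X F (unit_vector M ?J A (\<theta>, t, b)))"
          using mod_hom_closed[OF F uvP] e(5) x by (intro finsum_scalars[OF X']) auto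
        finally show "\<gamma> \<theta> t x = (\<lambda>x\<in>carrier M. \<Oplus>\<^bsub>X\<^esub>e\<in>E. (\<mu> e x \<odot>\<^sub>A \<one>\<^sub>A) \<odot>\<^sub>X F (unit_vector M ?J A (\<theta>, t, e))) x"
          using x by simp
      qed simp
      let ?S1 = "\<Oplus>\<^bsub>X\<^esub>t\<in>T. t \<odot>\<^sub>X \<gamma> \<theta> t m \<oplus>\<^sub>X \<ominus>\<^sub>X \<gamma> \<theta> t (t \<odot>\<^sub>M m)"
      let ?S2 = "comm_sum M X T (\<gamma> \<theta>) m"
      have S12: "?S1 \<in> carrier X" "?S2 \<in> carrier X"
        using \<gamma>c[OF th] tA m by (auto intro!: X.M.finsum_closed)
      have "F (\<theta> m, r \<theta> m) = F (\<theta> m, ?z) \<oplus>\<^sub>X ?S1"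
        by (rule key[OF X' F th m]) (rule frame)
      also have "F (\<theta> m, ?z) = ?S2" using Fz[OF \<theta>c[OF th m]] \<gamma>(2)[OF th m] by simp
      also have "?S2 \<oplus>\<^sub>X ?S1 = ?S1 \<oplus>\<^sub>X ?S2" by (rule X.M.a_comm[OF S12(2,1)])
      also have "\<dots> = \<zero>\<^sub>X" by (rule key_zero[OF X' F th m]) (rule frame)
      finally show ?thesis .
    qed
    have "N \<subseteq> {z \<in> carrier ?P. F z = \<zero>\<^sub>X}"
      by (rule N_least[OF mod_hom_kernel[OF P' X' F]]) (intro CollectI conjI rP F0)
    then have "F z = \<zero>\<^sub>X" if "z \<in> carrier ?P" "p z = \<zero>\<^sub>B" for z
      using ker[OF that(1)] that(2) by blast
    then obtain k where k: "k \<in> mod_hom A B X" "\<And>z. z \<in> carrier ?P \<Longrightarrow> k (p z) = F z"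
      using factor_through_surjection[OF P' B' X' p F] by blast
    have "h = hom_comp M k b"
    proof (rule extensionalityI[OF mod_hom_extensional[OF hh]])
      fix x assume x: "x \<in> carrier M"
      have "hom_comp M k b x = k (p (x, ?z))" using x by (simp add: hom_comp_apply b_def)
      also have "\<dots> = h x" using k(2)[OF zP[OF x]] Fz[OF x] by simp
      finally show "h x = hom_comp M k b x" ..
    qed (simp add: compose_def)
    with k(1) show ?thesis by blast
  qed
  ultimately show ?thesis using Bfg by blast
qed

end

section \<open>Indecomposable modules\<close>

lemma hom_comp_plus_right:
  assumes "k \<in> mod_hom A X B" "k' \<in> mod_hom A X B" "b \<in> mod_hom A B Y"
  shows "hom_comp X b (hom_plus X B k k') = hom_plus X Y (hom_comp X b k) (hom_comp X b k')"
  by (rule ext) (simp add: compose_def hom_plus_def mod_hom_add[OF assms(3)] mod_hom_closed[OF assms(1)]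
    mod_hom_closed[OF assms(2)])

lemma hom_comp_plus_left:
  assumes "g \<in> mod_hom A X Z"
  shows "hom_comp X (hom_plus Z Y f f') g = hom_plus X Y (hom_comp X f g) (hom_comp X f' g)"
  by (rule ext) (simp add: compose_def hom_plus_def mod_hom_closed[OF assms])

lemma hom_comp_zero_right:
  assumes "right_module A B" "right_module A Y" "b \<in> mod_hom A B Y"
  shows "hom_comp X b (hom_zero X B) = hom_zero X Y"
  by (rule ext) (simp add: compose_def hom_zero_def mod_hom_zero[OF assms])

lemma hom_comp_zero_left:
  assumes "g \<in> mod_hom A X Z" shows "hom_comp X (hom_zero Z Y) g = hom_zero X Y"
  by (rule ext) (simp add: compose_def hom_zero_def mod_hom_closed[OF assms])

lemma indecomposable_iso:
  assumes M: "right_module A M" and Z: "right_module A Z"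
    and f: "f \<in> mod_hom A M Z" and g: "g \<in> mod_hom A Z M"
    and gf: "\<And>x. x \<in> carrier M \<Longrightarrow> g (f x) = x" and fg: "\<And>y. y \<in> carrier Z \<Longrightarrow> f (g y) = y"
    and ind: "indecomposable A M"
  shows "indecomposable A Z"
  unfolding indecomposable_def
proof (intro conjI notI)
  interpret M: right_module A M by fact
  interpret Z: right_module A Z by fact
  have g0: "g y = \<zero>\<^sub>M \<longleftrightarrow> y = \<zero>\<^sub>Z" if "y \<in> carrier Z" for y
    using fg[OF that] mod_hom_zero[OF M Z f] mod_hom_zero[OF Z M g] by auto
  have gc: "g y \<in> carrier M" if "y \<in> carrier Z" for y by (rule mod_hom_closed[OF g that])
  have fc: "f y \<in> carrier Z" if "y \<in> carrier M" for y by (rule mod_hom_closed[OF f that])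
  {
    assume *: "carrier Z = {\<zero>\<^sub>Z}"
    have "x = \<zero>\<^sub>M" if "x \<in> carrier M" for x
    proof -
      have "f x = \<zero>\<^sub>Z" using fc[OF that] * by simp
      then show ?thesis using gf[OF that] mod_hom_zero[OF Z M g] by simp
    qed
    then have "carrier M = {\<zero>\<^sub>M}" by auto
    then show False using ind by (simp add: indecomposable_def)
  next
    assume "\<exists>U V. submodule U A Z \<and> submodule V A Z \<and> U \<noteq> {\<zero>\<^sub>Z} \<and> V \<noteq> {\<zero>\<^sub>Z} \<and>
      U \<inter> V = {\<zero>\<^sub>Z} \<and> U <+>\<^bsub>Z\<^esub> V = carrier Z"
    then obtain U V where UV: "submodule U A Z" "submodule V A Z" "U \<noteq> {\<zero>\<^sub>Z}" "V \<noteq> {\<zero>\<^sub>Z}"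
      "U \<inter> V = {\<zero>\<^sub>Z}" "U <+>\<^bsub>Z\<^esub> V = carrier Z" by blast
    have UZ: "U \<subseteq> carrier Z" "V \<subseteq> carrier Z" using UV(1,2) Z.submodule_subset by auto
    have ne: "g ` W \<noteq> {\<zero>\<^sub>M}" if W: "submodule W A Z" "W \<noteq> {\<zero>\<^sub>Z}" for W
    proof
      assume eq: "g ` W = {\<zero>\<^sub>M}"
      have "w = \<zero>\<^sub>Z" if w: "w \<in> W" for w
      proof -
        have "g w = \<zero>\<^sub>M" using eq w by blast
        then show ?thesis using g0 Z.submodule_subset[OF W(1)] w by blast
      qed
      then show False using W(2) Z.submodule_zero[OF W(1)] by blast
    qed
    have "g ` U \<inter> g ` V = {\<zero>\<^sub>M}"
    proof
      show "g ` U \<inter> g ` V \<subseteq> {\<zero>\<^sub>M}"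
      proof
        fix x assume "x \<in> g ` U \<inter> g ` V"
        then obtain u v where uv: "u \<in> U" "v \<in> V" "x = g u" "x = g v" by blast
        then have "u = f (g u)" "v = f (g v)" "g u = g v"
          using fg[OF subsetD[OF UZ(1) uv(1)]] fg[OF subsetD[OF UZ(2) uv(2)]] by simp_all
        then have "u = v" by simp
        then have "u \<in> U \<inter> V" using uv by blast
        then have "u = \<zero>\<^sub>Z" using UV(5) by blast
        then show "x \<in> {\<zero>\<^sub>M}" using uv(3) mod_hom_zero[OF Z M g] by simp
      qed
      show "{\<zero>\<^sub>M} \<subseteq> g ` U \<inter> g ` V"
        using M.submodule_zero[OF mod_hom_image[OF Z M g UV(1)]] M.submodule_zero[OF mod_hom_image[OF Z M g UV(2)]]
        by simp
    qed
    moreover have "g ` U <+>\<^bsub>M\<^esub> g ` V = carrier M"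
    proof
      show "g ` U <+>\<^bsub>M\<^esub> g ` V \<subseteq> carrier M"
        by (intro M.submodule_subset M.submodule_set_add mod_hom_image[OF Z M g] UV)
      show "carrier M \<subseteq> g ` U <+>\<^bsub>M\<^esub> g ` V"
      proof
        fix x assume x: "x \<in> carrier M"
        then have "f x \<in> U <+>\<^bsub>Z\<^esub> V" using fc UV(6) by simp
        then obtain u v where uv: "u \<in> U" "v \<in> V" "f x = u \<oplus>\<^sub>Z v" by (auto simp: set_add_def')
        then have "x = g u \<oplus>\<^sub>M g v"
          using gf[OF x] mod_hom_add[OF g subsetD[OF UZ(1) uv(1)] subsetD[OF UZ(2) uv(2)]] by simp
        then show "x \<in> g ` U <+>\<^bsub>M\<^esub> g ` V" using uv unfolding set_add_def' by blast
      qed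
    qed
    ultimately show False
      using ind ne[OF UV(1,3)] ne[OF UV(2,4)] mod_hom_image[OF Z M g UV(1)] mod_hom_image[OF Z M g UV(2)]
      unfolding indecomposable_def by blast
  }
qed

text \<open>The rank of \<open>U n\<close> plus the corank of \<open>V n\<close> cannot decrease at
  every step. This yields a single index at which both sequences are stationary.\<close>

lemma has_rank_stabilizes:
  assumes "has_rank A M" "\<And>n. submodule (U n) A M" "\<And>n. submodule (V n) A M"
    "\<And>n. U (Suc n) \<subseteq> U n" "\<And>n. V n \<subseteq> V (Suc n)" "\<And>n. V n \<subseteq> carrier M" "submodule (carrier M) A M"
  obtains n where "U (Suc n) = U n" "V (Suc n) = V n"
proof -
  obtain d :: "_ \<Rightarrow> nat" where d: "\<And>U V. submodule U A M \<Longrightarrow> submodule V A M \<Longrightarrow> U \<subset> V \<Longrightarrow> d U < d V"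
    using assms(1) unfolding has_rank_def by blast
  have le: "d X \<le> d Y" if XY: "submodule X A M" "submodule Y A M" "X \<subseteq> Y" for X Y
  proof -
    consider "X = Y" | "X \<subset> Y" using XY(3) by blast
    then show "d X \<le> d Y"
    proof cases
      case 2
      then show ?thesis using d[OF XY(1,2)] by simp
    qed simp
  qed
  have "\<not> (\<forall>n. d (U (Suc n)) + (d (carrier M) - d (V (Suc n))) < d (U n) + (d (carrier M) - d (V n)))"
    using decreasing_nat_sequence[of "\<lambda>n. d (U n) + (d (carrier M) - d (V n))"] .
  then obtain n where n: "\<not> d (U (Suc n)) + (d (carrier M) - d (V (Suc n))) < d (U n) + (d (carrier M) - d (V n))"
    by blast
  have 1: "d (U (Suc n)) \<le> d (U n)" "d (V n) \<le> d (V (Suc n))" "d (V (Suc n)) \<le> d (carrier M)"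
    by (rule le[OF assms(2) assms(2) assms(4)], rule le[OF assms(3) assms(3) assms(5)],
        rule le[OF assms(3) assms(7) assms(6)])
  have "\<not> U (Suc n) \<subset> U n" "\<not> V n \<subset> V (Suc n)"
    using n 1 d[OF assms(2)[of "Suc n"] assms(2)[of n]] d[OF assms(3)[of n] assms(3)[of "Suc n"]] by linarith+
  then show ?thesis using that[of n] assms(4,5)[of n] by blast
qed

section \<open>Fitting's lemma\<close>

context fin_dim_algebra
begin

text \<open>M is the direct sum of the image and the kernel of a power of e. The nonzero fixed point
  lies in the image of every power, so indecomposability makes the kernel vanish and e is
  injective.\<close>

lemma fitting:
  assumes M: "fg_right_module A M" and ind: "indecomposable A M" and e: "e \<in> mod_hom A M M"
    and x0: "x0 \<in> carrier M" "e x0 = x0" "x0 \<noteq> \<zero>\<^sub>M"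
  shows "bij_betw e (carrier M) (carrier M)"
proof -
  interpret M: right_module A M using M by (simp add: fg_right_module_def)
  note M' = M.right_module_axioms
  have pc: "(e ^^ n) x \<in> carrier M" if "x \<in> carrier M" for n x
    using that by (induction n) (auto intro: mod_hom_closed[OF e])
  have p: "(\<lambda>x\<in>carrier M. (e ^^ n) x) \<in> mod_hom A M M" for n
  proof (rule mod_homI)
    fix x y assume "x \<in> carrier M" "y \<in> carrier M"
    then have "(e ^^ n) (x \<oplus>\<^sub>M y) = (e ^^ n) x \<oplus>\<^sub>M (e ^^ n) y"
      by (induction n) (simp_all add: mod_hom_add[OF e] pc)
    then show "(\<lambda>x\<in>carrier M. (e ^^ n) x) (x \<oplus>\<^sub>M y) = (\<lambda>x\<in>carrier M. (e ^^ n) x) x \<oplus>\<^sub>M (\<lambda>x\<in>carrier M. (e ^^ n) x) y"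
      using \<open>x \<in> carrier M\<close> \<open>y \<in> carrier M\<close> by simp
  next
    fix a x assume ax: "a \<in> carrier A" "x \<in> carrier M"
    then have "(e ^^ n) (a \<odot>\<^sub>M x) = a \<odot>\<^sub>M (e ^^ n) x"
      by (induction n) (simp_all add: mod_hom_smult[OF e] pc)
    then show "(\<lambda>x\<in>carrier M. (e ^^ n) x) (a \<odot>\<^sub>M x) = a \<odot>\<^sub>M (\<lambda>x\<in>carrier M. (e ^^ n) x) x"
      using ax by simp
  qed (auto simp: pc)
  have e0: "e \<zero>\<^sub>M = \<zero>\<^sub>M" by (rule mod_hom_zero[OF M' M' e])
  define I where "I n = (e ^^ n) ` carrier M" for n
  define L where "L n = {x \<in> carrier M. (e ^^ n) x = \<zero>\<^sub>M}" for n
  have I: "submodule (I n) A M" for n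
    using mod_hom_image[OF M' M' p[of n] M.submodule_carrier] by (simp add: I_def)
  have L: "submodule (L n) A M" for n
    using mod_hom_kernel[OF M' M' p[of n]] by (simp add: L_def cong: conj_cong)
  have I_Suc: "I (Suc n) = e ` I n" for n by (simp add: I_def image_comp)
  have I_dec: "I (Suc n) \<subseteq> I n" for n
    unfolding I_def funpow_Suc_right by (auto intro: mod_hom_closed[OF e])
  have L_inc: "L n \<subseteq> L (Suc n)" for n by (auto simp: L_def e0)
  obtain n where n: "I (Suc n) = I n" "L (Suc n) = L n"
    using has_rank_stabilizes[of A M I L, OF fg_has_rank[OF M] I L I_dec L_inc M.submodule_subset[OF L] M.submodule_carrier]
    by blast
  \<comment> \<open>One stationary step in the images of the powers makes all later steps
    stationary; the kernels behave in the same way.\<close>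
  have In: "I (n + k) = I n" for k
    by (induction k) (simp_all add: I_Suc n(1)[unfolded I_Suc])
  have Ln: "L (n + k) \<subseteq> L n" for k
  proof (induction k)
    case (Suc k)
    show ?case
    proof
      fix x assume "x \<in> L (n + Suc k)"
      then have x: "x \<in> carrier M" "(e ^^ (n + Suc k)) x = \<zero>\<^sub>M" by (auto simp: L_def)
      have "(e ^^ (n + k)) (e x) = \<zero>\<^sub>M" using x(2) by (simp add: funpow_swap1)
      then have "e x \<in> L (n + k)" using mod_hom_closed[OF e x(1)] by (simp add: L_def)
      then have "(e ^^ n) (e x) = \<zero>\<^sub>M" using Suc by (auto simp: L_def)
      then have "x \<in> L (Suc n)" using x(1) by (simp add: L_def funpow_swap1)
      then show "x \<in> L n" using n(2) by simp
    qed
  qed simp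
  have "I n \<inter> L n \<subseteq> {\<zero>\<^sub>M}"
  proof
    fix x assume "x \<in> I n \<inter> L n"
    then obtain y where y: "y \<in> carrier M" "x = (e ^^ n) y" "(e ^^ n) x = \<zero>\<^sub>M" by (auto simp: I_def L_def)
    then have "y \<in> L (n + n)" by (simp add: L_def funpow_add)
    then have "y \<in> L n" using Ln by blast
    then show "x \<in> {\<zero>\<^sub>M}" using y by (simp add: L_def)
  qed
  then have int: "I n \<inter> L n = {\<zero>\<^sub>M}" using M.submodule_zero[OF I[of n]] M.submodule_zero[OF L[of n]] by blast
  have sum: "I n <+>\<^bsub>M\<^esub> L n = carrier M"
  proof
    show "I n <+>\<^bsub>M\<^esub> L n \<subseteq> carrier M" by (intro M.submodule_subset M.submodule_set_add I L)
    show "carrier M \<subseteq> I n <+>\<^bsub>M\<^esub> L n"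
    proof
      fix x assume x: "x \<in> carrier M"
      then have "(e ^^ n) x \<in> I (n + n)" unfolding In by (simp add: I_def)
      then obtain y where y: "y \<in> carrier M" "(e ^^ n) x = (e ^^ n) ((e ^^ n) y)" by (auto simp: I_def funpow_add)
      let ?u = "(e ^^ n) y"
      have u: "?u \<in> carrier M" "?u \<in> I n" using y(1) pc by (auto simp: I_def)
      have add: "(e ^^ n) (v \<oplus>\<^sub>M w) = (e ^^ n) v \<oplus>\<^sub>M (e ^^ n) w" if "v \<in> carrier M" "w \<in> carrier M" for v w
        using mod_hom_add[OF p[of n] that] that by simp
      have neg: "(e ^^ n) (\<ominus>\<^sub>M v) = \<ominus>\<^sub>M (e ^^ n) v" if "v \<in> carrier M" for v
        using mod_hom_neg[OF M' M' p[of n] that] that by simp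
      have "(e ^^ n) (x \<oplus>\<^sub>M \<ominus>\<^sub>M ?u) = (e ^^ n) x \<oplus>\<^sub>M \<ominus>\<^sub>M (e ^^ n) ?u"
        using add[OF x, of "\<ominus>\<^sub>M ?u"] neg[OF u(1)] u(1) by simp
      also have "\<dots> = \<zero>\<^sub>M" unfolding y(2) using pc[OF u(1)] by (rule M.M.r_neg)
      finally have "x \<oplus>\<^sub>M \<ominus>\<^sub>M ?u \<in> L n" using x u by (simp add: L_def)
      moreover have "x = ?u \<oplus>\<^sub>M (x \<oplus>\<^sub>M \<ominus>\<^sub>M ?u)"
        using M.M.a_comm[OF u(1), of "x \<oplus>\<^sub>M \<ominus>\<^sub>M ?u"] x u(1) by (simp add: M.M.a_assoc M.M.l_neg)
      ultimately show "x \<in> I n <+>\<^bsub>M\<^esub> L n" using u(2) unfolding set_add_def' by blast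
    qed
  qed
  have "(e ^^ n) x0 = x0" by (induction n) (simp_all add: x0(2))
  then have "x0 \<in> I n" using x0(1) unfolding I_def by (intro image_eqI[of _ _ x0]) simp_all
  then have "I n \<noteq> {\<zero>\<^sub>M}" using x0(3) by blast
  then have Lz: "L n = {\<zero>\<^sub>M}"
    using ind I[of n] L[of n] int sum unfolding indecomposable_def by blast
  have "inj_on e (carrier M)"
    unfolding mod_hom_inj_iff[OF M' M' e]
  proof (intro ballI impI)
    fix x assume x: "x \<in> carrier M" "e x = \<zero>\<^sub>M"
    have "(e ^^ n) \<zero>\<^sub>M = \<zero>\<^sub>M" by (induction n) (simp_all add: e0)
    then have "x \<in> L (Suc n)" using x by (simp add: L_def funpow_swap1)
    then show "x = \<zero>\<^sub>M" using n(2) Lz by blast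
  qed
  then show ?thesis
    using injective_imp_surjective[OF M' fg_has_rank[OF M] e] by (simp add: bij_betw_def)
qed

text \<open>If g witnesses that f is not radical, then f g and g f have nonzero fixed points and are
  bijective by Fitting's lemma, so f is an isomorphism.\<close>

lemma nonradical_between_indecomposables:
  assumes M: "fg_right_module A M" "indecomposable A M" and Z: "fg_right_module A Z" "indecomposable A Z"
    and f: "f \<in> mod_hom A M Z" "f \<notin> rad_hom A M Z"
  shows "mod_iso A M Z"
proof -
  have M': "right_module A M" and Z': "right_module A Z" using M Z by (auto simp: fg_right_module_def)
  obtain g y where g: "g \<in> mod_hom A Z M" "y \<in> carrier Z" "f (g y) = y" "y \<noteq> \<zero>\<^sub>Z"
    using f unfolding rad_hom_def by blast
  have gy: "g y \<in> carrier M" by (rule mod_hom_closed[OF g(1,2)])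
  have gy0: "g y \<noteq> \<zero>\<^sub>M" using g(3,4) mod_hom_zero[OF M' Z' f(1)] by auto
  have 1: "bij_betw (hom_comp Z f g) (carrier Z) (carrier Z)"
    using g by (intro fitting[OF Z hom_comp_in[OF Z' g(1) f(1)], of y]) (auto simp: hom_comp_apply)
  have 2: "bij_betw (hom_comp M g f) (carrier M) (carrier M)"
    using gy gy0 g(3) by (intro fitting[OF M hom_comp_in[OF M' f(1) g(1)], of "g y"]) (auto simp: hom_comp_apply)
  have "inj_on f (carrier M)"
  proof (rule inj_onI)
    fix x x' assume x: "x \<in> carrier M" "x' \<in> carrier M" "f x = f x'"
    then have "hom_comp M g f x = hom_comp M g f x'" by (simp add: hom_comp_apply)
    then show "x = x'" using 2 x(1,2) by (auto simp: bij_betw_def dest: inj_onD)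
  qed
  moreover have "f ` carrier M = carrier Z"
  proof
    show "f ` carrier M \<subseteq> carrier Z" using mod_hom_closed[OF f(1)] by blast
    show "carrier Z \<subseteq> f ` carrier M"
    proof
      fix z assume "z \<in> carrier Z"
      then obtain w where w: "w \<in> carrier Z" "z = hom_comp Z f g w" using 1 by (auto simp: bij_betw_def)
      then show "z \<in> f ` carrier M" using mod_hom_closed[OF g(1) w(1)] by (simp add: hom_comp_apply)
    qed
  qed
  ultimately show ?thesis unfolding mod_iso_def bij_betw_def using f(1) by blast
qed

end

text \<open>Finite sums of elements of S, the empty one included. The sets S that occur here are
  stable under composition with minus an identity, so the result is a subgroup.\<close>

inductive_set add_closure :: "('a, 'm, 'y) module_scheme \<Rightarrow> ('a, 'n, 'z) module_scheme \<Rightarrow> ('m \<Rightarrow> 'n) set \<Rightarrow> ('m \<Rightarrow> 'n) set"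
  for X Y S where
  add_closure_zero: "hom_zero X Y \<in> add_closure X Y S"
| add_closure_base: "f \<in> S \<Longrightarrow> f \<in> add_closure X Y S"
| add_closure_plus: "f \<in> add_closure X Y S \<Longrightarrow> g \<in> add_closure X Y S \<Longrightarrow> hom_plus X Y f g \<in> add_closure X Y S"

lemma add_closure_mono: "S \<subseteq> T \<Longrightarrow> add_closure X Y S \<subseteq> add_closure X Y T"
proof
  fix f assume "S \<subseteq> T" "f \<in> add_closure X Y S"
  from this(2) show "f \<in> add_closure X Y T"
    by induction (use \<open>S \<subseteq> T\<close> in \<open>auto intro: add_closure.intros\<close>)
qed

lemma add_closure_mod_hom:
  assumes "right_module A X" "right_module A Y" "S \<subseteq> mod_hom A X Y"
  shows "add_closure X Y S \<subseteq> mod_hom A X Y"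
proof
  fix f assume "f \<in> add_closure X Y S"
  then show "f \<in> mod_hom A X Y"
    by induction (use assms in \<open>auto intro: hom_plus_in\<close>)
qed

section \<open>The skeleton and generators of its radical\<close>

locale mod_skeleton = fin_dim_algebra K A
  for K :: "('k, 'x) ring_scheme" and A :: "('k, 'a, 'y) module_scheme" +
  fixes \<C> :: "('a, 'm) module set"
  assumes skeleton: "is_skeleton A \<C>"
begin

abbreviation "Hom \<equiv> mod_hom A"
abbreviation "Rad \<equiv> rad_hom A"

lemma obj_fg: "X \<in> \<C> \<Longrightarrow> fg_right_module A X"
  and obj_unique: "X \<in> \<C> \<Longrightarrow> Y \<in> \<C> \<Longrightarrow> mod_iso A X Y \<Longrightarrow> X = Y"
  using skeleton unfolding is_skeleton_def by auto

lemma obj: "X \<in> \<C> \<Longrightarrow> right_module A X"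
  using obj_fg by (simp add: fg_right_module_def)

text \<open>The modules built for almost split morphisms have elements of other types than the
  objects of \<C>. \<open>fg_universe\<close> first copies them to the type for which a skeleton has
  to contain representatives.\<close>

lemma representative:
  fixes N :: "('a, 'n) module"
  assumes N: "fg_right_module A N"
  obtains X f g where "X \<in> \<C>" "f \<in> Hom N X" "g \<in> Hom X N"
    "\<And>x. x \<in> carrier N \<Longrightarrow> g (f x) = x" "\<And>y. y \<in> carrier X \<Longrightarrow> f (g y) = y"
proof -
  have N': "right_module A N" using N by (simp add: fg_right_module_def)
  obtain M :: "'a fg_mod" where M: "fg_right_module A M" "mod_iso A N M" using fg_universe[OF N] by blast
  then obtain X where X: "X \<in> \<C>" "mod_iso A M X" using skeleton unfolding is_skeleton_def by blast
  obtain u where u: "u \<in> Hom N M" "bij_betw u (carrier N) (carrier M)" using M(2) unfolding mod_iso_def by blast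
  obtain v where v: "v \<in> Hom M X" "bij_betw v (carrier M) (carrier X)" using X(2) unfolding mod_iso_def by blast
  have b: "bij_betw (hom_comp N v u) (carrier N) (carrier X)"
    using bij_betw_trans[OF u(2) v(2)] by (rule bij_betw_cong[THEN iffD1, rotated]) (simp add: compose_def)
  show ?thesis
    by (rule inverse_in_mod_hom[OF N' hom_comp_in[OF N' u(1) v(1)] b]) (rule that[OF X(1) hom_comp_in[OF N' u(1) v(1)]])
qed

lemma right_generator:
  assumes Y: "Y \<in> \<C>"
  obtains B b where "B \<in> \<C>" "b \<in> Rad B Y" "\<And>X h. X \<in> \<C> \<Longrightarrow> h \<in> Rad X Y \<Longrightarrow> \<exists>k \<in> Hom X B. h = hom_comp X b k"
proof -
  obtain B0 :: "('a, 'm \<times> (('m \<Rightarrow> 'm) \<times> 'a \<Rightarrow> 'a \<Rightarrow> 'm)) module" and b0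
    where B0: "fg_right_module A B0" "b0 \<in> rad_hom A B0 Y"
      "\<forall>X :: ('a, 'm) module. fg_right_module A X \<longrightarrow> (\<forall>h \<in> rad_hom A X Y. \<exists>k \<in> mod_hom A X B0. h = hom_comp X b0 k)"
    using right_almost_split[OF obj_fg[OF Y]] by blast
  have B0': "right_module A B0" using B0(1) by (simp add: fg_right_module_def)
  obtain B f g where B: "B \<in> \<C>" "f \<in> Hom B0 B" "g \<in> Hom B B0"
    "\<And>x. x \<in> carrier B0 \<Longrightarrow> g (f x) = x" "\<And>y. y \<in> carrier B \<Longrightarrow> f (g y) = y"
    by (rule representative[OF B0(1)]) (rule that)
  show ?thesis
  proof (rule that[OF B(1) rad_hom_comp_right[OF obj[OF B(1)] obj[OF Y] B0(2) B(3)]])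
    fix X h assume X: "X \<in> \<C>" and h: "h \<in> Rad X Y"
    obtain k where k: "k \<in> mod_hom A X B0" "h = hom_comp X b0 k" using B0(3) obj_fg[OF X] h by blast
    have "h = hom_comp X (hom_comp B b0 g) (hom_comp X f k)"
      unfolding k(2) by (rule ext)
        (simp add: compose_def B(4) mod_hom_closed[OF k(1)] mod_hom_closed[OF B(2)])
    then show "\<exists>k \<in> Hom X B. h = hom_comp X (hom_comp B b0 g) k"
      using hom_comp_in[OF obj[OF X] k(1) B(2)] by blast
  qed
qed

lemma left_generator:
  assumes X: "X \<in> \<C>"
  obtains B b where "B \<in> \<C>" "b \<in> Rad X B" "\<And>Y h. Y \<in> \<C> \<Longrightarrow> h \<in> Rad X Y \<Longrightarrow> \<exists>k \<in> Hom B Y. h = hom_comp X k b"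
proof -
  obtain B0 :: "('a, ('m \<times> (('m \<Rightarrow> 'm) \<times> 'a \<times> 'm \<Rightarrow> 'a)) set) module" and b0
    where B0: "fg_right_module A B0" "b0 \<in> rad_hom A X B0"
      "\<forall>Y :: ('a, 'm) module. fg_right_module A Y \<longrightarrow> (\<forall>h \<in> rad_hom A X Y. \<exists>k \<in> mod_hom A B0 Y. h = hom_comp X k b0)"
    using left_almost_split[OF obj_fg[OF X]] by blast
  have B0': "right_module A B0" using B0(1) by (simp add: fg_right_module_def)
  obtain B f g where B: "B \<in> \<C>" "f \<in> Hom B0 B" "g \<in> Hom B B0"
    "\<And>x. x \<in> carrier B0 \<Longrightarrow> g (f x) = x" "\<And>y. y \<in> carrier B \<Longrightarrow> f (g y) = y"
    by (rule representative[OF B0(1)]) (rule that)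
  note b0 = rad_hom_mod_hom[OF B0(2)]
  show ?thesis
  proof (rule that[OF B(1) rad_hom_comp_left[OF obj[OF X] B0' obj[OF B(1)] B0(2) B(2)]])
    fix Y h assume Y: "Y \<in> \<C>" and h: "h \<in> Rad X Y"
    obtain k where k: "k \<in> mod_hom A B0 Y" "h = hom_comp X k b0" using B0(3) obj_fg[OF Y] h by blast
    have "h = hom_comp X (hom_comp B k g) (hom_comp X f b0)"
      unfolding k(2) by (rule ext)
        (simp add: compose_def B(4) mod_hom_closed[OF b0] mod_hom_closed[OF B(2)])
    then show "\<exists>k \<in> Hom B Y. h = hom_comp X k (hom_comp X f b0)"
      using hom_comp_in[OF obj[OF B(1)] B(3) k(1)] by blast
  qed
qed

section \<open>Decomposition into indecomposables\<close>

definition "Ind = {X \<in> \<C>. indecomposable A X}"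

definition factoring where
  "factoring F X Y = {hom_comp X i p | i p Z. Z \<in> F \<and> p \<in> Hom X Z \<and> i \<in> Hom Z Y}"

text \<open>The decomposition is expressed by writing the identity as a sum of composites Y
  \<rightarrow> Z \<rightarrow> Y, a form that can be composed with morphisms into or out of
  Y.\<close>

lemma indecomposable_decomposition:
  assumes Y: "Y \<in> \<C>"
  obtains F where "finite F" "F \<subseteq> Ind" "hom_id Y \<in> add_closure Y Y (factoring F Y Y)"
proof -
  interpret Y: right_module A Y by (rule obj[OF Y])
  note Y' = Y.right_module_axioms
  obtain d :: "_ \<Rightarrow> nat" where d: "\<And>U V. submodule U A Y \<Longrightarrow> submodule V A Y \<Longrightarrow> U \<subset> V \<Longrightarrow> d U < d V"
    using fg_has_rank[OF obj_fg[OF Y]] unfolding has_rank_def by blast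
  \<comment> \<open>Generalised to a projection e of Y onto a submodule U, by induction on the rank
    of U. When U splits, e is the sum of the projections to the two parts.\<close>
  have main: "\<exists>F. finite F \<and> F \<subseteq> Ind \<and> e \<in> add_closure Y Y (factoring F Y Y)"
    if "submodule U A Y" "e \<in> Hom Y Y" "\<forall>y \<in> carrier Y. e y \<in> U" "\<forall>u\<in>U. e u = u" for U e
    using that
  proof (induction "d U" arbitrary: U e rule: less_induct)
    case less
    note U = less.prems(1) and e = less.prems(2) and eU = less.prems(3)[rule_format]
      and eid = less.prems(4)[rule_format]
    let ?M = "Y\<lparr>carrier := U\<rparr>"
    have UY: "u \<in> carrier Y" if "u \<in> U" for u using Y.submodule_subset[OF U] that by blast
    have Mfg: "fg_right_module A ?M" by (rule fg_submodule[OF obj_fg[OF Y] U])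
    interpret M: right_module A ?M using Mfg by (simp add: fg_right_module_def)
    show ?case
    proof (cases "U = {\<zero>\<^sub>Y}")
      case True
      have "e = hom_zero Y Y"
        by (rule mod_hom_eqI[OF e hom_zero_in[OF Y' Y']]) (use eU True in \<open>auto simp: hom_zero_def\<close>)
      then show ?thesis using add_closure_zero by (intro exI[of _ "{}"]) simp
    next
      case False
      show ?thesis
      proof (cases "indecomposable A ?M")
        case True
        obtain Z f g where Z: "Z \<in> \<C>" "f \<in> Hom ?M Z" "g \<in> Hom Z ?M"
          "\<And>x. x \<in> carrier ?M \<Longrightarrow> g (f x) = x" "\<And>y. y \<in> carrier Z \<Longrightarrow> f (g y) = y"
          by (rule representative[OF Mfg]) (rule that)
        have "indecomposable A Z"
          by (rule indecomposable_iso[OF M.right_module_axioms obj[OF Z(1)] Z(2,3) Z(4,5) True])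
        then have ZI: "Z \<in> Ind" using Z(1) by (simp add: Ind_def)
        have e': "e \<in> Hom Y ?M"
          using eU mod_hom_PiE[OF e] mod_hom_add[OF e] mod_hom_smult[OF e] by (intro mod_homI) (auto simp: PiE_iff)
        have g': "g \<in> Hom Z Y"
          using mod_hom_PiE[OF Z(3)] mod_hom_add[OF Z(3)] mod_hom_smult[OF Z(3)] UY
          by (intro mod_homI) (auto simp: PiE_iff)
        have "e = hom_comp Y g (hom_comp Y f e)"
          by (rule extensionalityI[OF mod_hom_extensional[OF e]]) (use eU Z(4) in \<open>auto simp: compose_def\<close>)
        then have "e \<in> factoring {Z} Y Y"
          unfolding factoring_def using hom_comp_in[OF Y' e' Z(2)] g' by blast
        then show ?thesis using ZI add_closure_base by (intro exI[of _ "{Z}"]) simp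
      next
        case nind: False
        then obtain U1 U2 where U12: "submodule U1 A ?M" "submodule U2 A ?M" "U1 \<noteq> {\<zero>\<^sub>Y}" "U2 \<noteq> {\<zero>\<^sub>Y}"
          "U1 \<inter> U2 = {\<zero>\<^sub>Y}" "U1 <+>\<^bsub>?M\<^esub> U2 = U"
          using False unfolding indecomposable_def by auto
        have subs: "submodule W A Y" "W \<subseteq> U" if W: "submodule W A ?M" for W
        proof -
          show WU: "W \<subseteq> U" using M.submodule_subset[OF W] by simp
          show "submodule W A Y"
            using M.submodule_zero[OF W] M.submodule_add[OF W] M.submodule_smult[OF W] WU UY
            by (intro Y.right_submoduleI) auto
        qed
        note S1 = subs[OF U12(1)] and S2 = subs[OF U12(2)]
        have UW: "u \<in> carrier Y" if "u \<in> U1 \<or> u \<in> U2" for u using that S1(2) S2(2) UY by blast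
        have lt: "U1 \<subset> U" "U2 \<subset> U"
          using U12(3-5) S1(2) S2(2) by blast+
        have dec: "\<exists>u\<in>U1. \<exists>v\<in>U2. x = u \<oplus>\<^sub>Y v" if "x \<in> U" for x
          using that U12(6) by (auto simp: set_add_def')
        \<comment> \<open>Stated for a general pair of complements because it is applied to the two
          summands in both orders.\<close>
        have proj: "\<exists>e' \<in> Hom Y Y. (\<forall>y\<in>carrier Y. e' y \<in> V \<and> (\<exists>w\<in>W. e y = e' y \<oplus>\<^sub>Y w)) \<and> (\<forall>v\<in>V. e' v = v)"
          if V: "submodule V A Y" and W: "submodule W A Y" and VW: "V \<inter> W = {\<zero>\<^sub>Y}" and VU: "V \<subseteq> U" and WU: "W \<subseteq> U"
            and dec: "\<And>x. x \<in> U \<Longrightarrow> \<exists>v\<in>V. \<exists>w\<in>W. x = v \<oplus>\<^sub>Y w" for V W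
        proof -
          have c: "v \<in> carrier Y" if "v \<in> V \<or> v \<in> W" for v using that VU WU UY by blast
          have uniq: "v = v'" if *: "v \<in> V" "v' \<in> V" "w \<in> W" "w' \<in> W" "v \<oplus>\<^sub>Y w = v' \<oplus>\<^sub>Y w'" for v v' w w'
          proof -
            have cc: "v \<in> carrier Y" "v' \<in> carrier Y" "w \<in> carrier Y" "w' \<in> carrier Y" using * c by auto
            have "v = (v \<oplus>\<^sub>Y w) \<oplus>\<^sub>Y \<ominus>\<^sub>Y w" using cc by (simp add: Y.M.a_assoc Y.M.r_neg)
            also have "\<dots> = (w' \<oplus>\<^sub>Y \<ominus>\<^sub>Y w) \<oplus>\<^sub>Y v'"
              unfolding *(5) using cc by (simp add: Y.M.a_ac)
            finally have "v \<oplus>\<^sub>Y \<ominus>\<^sub>Y v' = (w' \<oplus>\<^sub>Y \<ominus>\<^sub>Y w) \<oplus>\<^sub>Y v' \<oplus>\<^sub>Y \<ominus>\<^sub>Y v'" by simp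
            also have "\<dots> = w' \<oplus>\<^sub>Y \<ominus>\<^sub>Y w" using cc by (simp add: Y.M.a_assoc Y.M.r_neg)
            finally have "v \<oplus>\<^sub>Y \<ominus>\<^sub>Y v' \<in> V \<inter> W"
              using Y.submodule_add[OF V *(1) Y.submodule_neg[OF V *(2)]]
                Y.submodule_add[OF W *(4) Y.submodule_neg[OF W *(3)]] by simp
            then show ?thesis using VW Y.M.diff_eq_zero_iff[of v v'] c * by blast
          qed
          define q where "q x = (THE v. v \<in> V \<and> (\<exists>w\<in>W. x = v \<oplus>\<^sub>Y w))" for x
          have q: "q (v \<oplus>\<^sub>Y w) = v" if "v \<in> V" "w \<in> W" for v w
            unfolding q_def using that uniq by (intro the_equality) blast+
          define e' where "e' = (\<lambda>y\<in>carrier Y. q (e y))"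
          have ee: "\<exists>v\<in>V. \<exists>w\<in>W. e y = v \<oplus>\<^sub>Y w \<and> e' y = v" if y: "y \<in> carrier Y" for y
            using dec[OF eU[OF y]] q y unfolding e'_def by fastforce
          have "e' \<in> Hom Y Y"
          proof (rule mod_homI)
            show "e' \<in> carrier Y \<rightarrow>\<^sub>E carrier Y"
            proof (rule PiE_I)
              show "e' y \<in> carrier Y" if "y \<in> carrier Y" for y using ee[OF that] c by blast
            qed (simp add: e'_def)
            fix x y assume xy: "x \<in> carrier Y" "y \<in> carrier Y"
            obtain v w where 1: "v \<in> V" "w \<in> W" "e x = v \<oplus>\<^sub>Y w" "e' x = v" using ee[OF xy(1)] by blast
            obtain v' w' where 2: "v' \<in> V" "w' \<in> W" "e y = v' \<oplus>\<^sub>Y w'" "e' y = v'" using ee[OF xy(2)] by blast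
            have "e (x \<oplus>\<^sub>Y y) = (v \<oplus>\<^sub>Y v') \<oplus>\<^sub>Y (w \<oplus>\<^sub>Y w')"
              using 1 2 c xy by (simp add: mod_hom_add[OF e] Y.M.a_ac)
            then show "e' (x \<oplus>\<^sub>Y y) = e' x \<oplus>\<^sub>Y e' y"
              using q[OF Y.submodule_add[OF V 1(1) 2(1)] Y.submodule_add[OF W 1(2) 2(2)]] 1(4) 2(4) xy by (simp add: e'_def)
          next
            fix a x assume ax: "a \<in> carrier A" "x \<in> carrier Y"
            obtain v w where 1: "v \<in> V" "w \<in> W" "e x = v \<oplus>\<^sub>Y w" "e' x = v" using ee[OF ax(2)] by blast
            have "e (a \<odot>\<^sub>Y x) = a \<odot>\<^sub>Y v \<oplus>\<^sub>Y a \<odot>\<^sub>Y w"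
              using 1 c ax by (simp add: mod_hom_smult[OF e] Y.smult_add_module)
            then show "e' (a \<odot>\<^sub>Y x) = a \<odot>\<^sub>Y e' x"
              using q[OF Y.submodule_smult[OF V ax(1) 1(1)] Y.submodule_smult[OF W ax(1) 1(2)]] 1(4) ax by (simp add: e'_def)
          qed
          moreover have "\<forall>y\<in>carrier Y. e' y \<in> V \<and> (\<exists>w\<in>W. e y = e' y \<oplus>\<^sub>Y w)" using ee by blast
          moreover have "e' v = v" if v: "v \<in> V" for v
          proof -
            have "e v = v \<oplus>\<^sub>Y \<zero>\<^sub>Y" using eid VU v c by auto
            then show ?thesis using q[OF v Y.submodule_zero[OF W]] c[of v] v by (simp add: e'_def)
          qed
          ultimately show ?thesis by blast
        qed
        obtain e1 where e1: "e1 \<in> Hom Y Y" "\<forall>y\<in>carrier Y. e1 y \<in> U1 \<and> (\<exists>w\<in>U2. e y = e1 y \<oplus>\<^sub>Y w)" "\<forall>v\<in>U1. e1 v = v"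
          using proj[OF S1(1) S2(1) U12(5) S1(2) S2(2) dec] by blast
        have dec': "\<exists>v\<in>U2. \<exists>u\<in>U1. x = v \<oplus>\<^sub>Y u" if x: "x \<in> U" for x
        proof -
          obtain u v where uv: "u \<in> U1" "v \<in> U2" "x = u \<oplus>\<^sub>Y v" using dec[OF x] by blast
          then have "x = v \<oplus>\<^sub>Y u" using UW Y.M.a_comm[of u v] by simp
          then show ?thesis using uv by blast
        qed
        have "U2 \<inter> U1 = {\<zero>\<^sub>Y}" using U12(5) by blast
        then obtain e2 where e2: "e2 \<in> Hom Y Y" "\<forall>y\<in>carrier Y. e2 y \<in> U2 \<and> (\<exists>w\<in>U1. e y = e2 y \<oplus>\<^sub>Y w)" "\<forall>v\<in>U2. e2 v = v"
          using proj[OF S2(1) S1(1) _ S2(2) S1(2) dec'] by blast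
        have sum: "e = hom_plus Y Y e1 e2"
        proof (rule mod_hom_eqI[OF e hom_plus_in[OF Y' Y' e1(1) e2(1)]])
          fix y assume y: "y \<in> carrier Y"
          obtain w where w: "w \<in> U2" "e y = e1 y \<oplus>\<^sub>Y w" "e1 y \<in> U1" using e1(2) y by blast
          obtain w' where w': "w' \<in> U1" "e y = e2 y \<oplus>\<^sub>Y w'" "e2 y \<in> U2" using e2(2) y by blast
          have cc: "e1 y \<in> carrier Y" "w \<in> carrier Y" "e2 y \<in> carrier Y" "w' \<in> carrier Y" using w w' UW by auto
          have eq: "e1 y \<oplus>\<^sub>Y w = w' \<oplus>\<^sub>Y e2 y" using w w' cc Y.M.a_comm by simp
          have "w \<oplus>\<^sub>Y \<ominus>\<^sub>Y e2 y = (\<ominus>\<^sub>Y e1 y \<oplus>\<^sub>Y (e1 y \<oplus>\<^sub>Y w)) \<oplus>\<^sub>Y \<ominus>\<^sub>Y e2 y"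
            using cc by (simp add: Y.M.r_neg1)
          also have "\<dots> = \<ominus>\<^sub>Y e1 y \<oplus>\<^sub>Y w'"
            unfolding eq using cc by (simp add: Y.M.a_assoc Y.M.r_neg)
          finally have "w \<oplus>\<^sub>Y \<ominus>\<^sub>Y e2 y \<in> U1 \<inter> U2"
            using Y.submodule_add[OF S1(1) Y.submodule_neg[OF S1(1) w(3)] w'(1)]
              Y.submodule_add[OF S2(1) w(1) Y.submodule_neg[OF S2(1) w'(3)]] by simp
          then have "w = e2 y" using U12(5) Y.M.diff_eq_zero_iff[OF cc(2,3)] by blast
          then show "e y = hom_plus Y Y e1 e2 y" using w(2) y by (simp add: hom_plus_def)
        qed
        obtain F1 where F1: "finite F1" "F1 \<subseteq> Ind" "e1 \<in> add_closure Y Y (factoring F1 Y Y)"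
          using less.hyps[OF d[OF S1(1) U lt(1)] S1(1) e1(1)] e1(2,3) by blast
        obtain F2 where F2: "finite F2" "F2 \<subseteq> Ind" "e2 \<in> add_closure Y Y (factoring F2 Y Y)"
          using less.hyps[OF d[OF S2(1) U lt(2)] S2(1) e2(1)] e2(2,3) by blast
        have mono: "add_closure Y Y (factoring F' Y Y) \<subseteq> add_closure Y Y (factoring (F1 \<union> F2) Y Y)" if "F' \<subseteq> F1 \<union> F2" for F'
          using that by (intro add_closure_mono) (auto simp: factoring_def)
        have "e \<in> add_closure Y Y (factoring (F1 \<union> F2) Y Y)"
          unfolding sum using F1(3) F2(3) mono[of F1] mono[of F2] by (intro add_closure_plus) auto
        then show ?thesis using F1 F2 by (intro exI[of _ "F1 \<union> F2"]) simp
      qed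
    qed
  qed
  have "\<exists>F. finite F \<and> F \<subseteq> Ind \<and> hom_id Y \<in> add_closure Y Y (factoring F Y Y)"
    by (rule main[OF Y.submodule_carrier hom_id_in[OF Y']]) (simp_all add: hom_id_def)
  then show ?thesis using that by blast
qed

end

section \<open>Powers of the radical\<close>

context mod_skeleton
begin

text \<open>The index \<open>n\<close> stands for \<open>n + 1\<close> factors, so \<open>rad_power n\<close> belongs to the power \<open>n + 1\<close> of the
  radical.\<close>

primrec rad_comp :: "nat \<Rightarrow> ('a, 'm) module \<Rightarrow> ('a, 'm) module \<Rightarrow> ('m \<Rightarrow> 'm) set" where
  "rad_comp 0 X Y = Rad X Y"
| "rad_comp (Suc n) X Y = {hom_comp X f g | f g Z. Z \<in> \<C> \<and> f \<in> rad_comp n Z Y \<and> g \<in> Rad X Z}"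

definition rad_power :: "nat \<Rightarrow> ('a, 'm) module \<Rightarrow> ('a, 'm) module \<Rightarrow> ('m \<Rightarrow> 'm) set" where
  "rad_power n X Y = add_closure X Y (rad_comp n X Y)"

lemma rad_comp_Hom: "X \<in> \<C> \<Longrightarrow> Y \<in> \<C> \<Longrightarrow> f \<in> rad_comp n X Y \<Longrightarrow> f \<in> Hom X Y"
proof (induction n arbitrary: X f)
  case (Suc n)
  then obtain u g Z where "f = hom_comp X u g" "Z \<in> \<C>" "u \<in> rad_comp n Z Y" "g \<in> Rad X Z" by auto
  with Suc show ?case by (auto intro!: hom_comp_in[OF obj] intro: rad_hom_mod_hom)
qed (simp add: rad_hom_mod_hom)

lemma rad_comp_right:
  assumes "X \<in> \<C>" "Y \<in> \<C>" "W \<in> \<C>" "f \<in> rad_comp n X Y" "k \<in> Hom W X"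
  shows "hom_comp W f k \<in> rad_comp n W Y"
proof (cases n)
  case 0
  then show ?thesis using assms rad_hom_comp_right[OF obj obj] by simp
next
  case (Suc m)
  then obtain u g Z where f: "f = hom_comp X u g" "Z \<in> \<C>" "u \<in> rad_comp m Z Y" "g \<in> Rad X Z"
    using assms(4) by auto
  have "hom_comp W g k \<in> Rad W Z" by (rule rad_hom_comp_right[OF obj[OF assms(3)] obj[OF f(2)] f(4) assms(5)])
  moreover have "hom_comp W f k = hom_comp W u (hom_comp W g k)"
    unfolding f(1) by (rule hom_comp_assoc[OF assms(5), symmetric])
  ultimately show ?thesis using f Suc by auto
qed

lemma rad_comp_left:
  assumes "Y \<in> \<C>" "W \<in> \<C>" "h \<in> Hom Y W"
  shows "X \<in> \<C> \<Longrightarrow> f \<in> rad_comp n X Y \<Longrightarrow> hom_comp X h f \<in> rad_comp n X W"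
proof (induction n arbitrary: X f)
  case 0
  then show ?case using assms rad_hom_comp_left[OF obj obj obj] by simp
next
  case (Suc n)
  then obtain u g Z where f: "f = hom_comp X u g" "Z \<in> \<C>" "u \<in> rad_comp n Z Y" "g \<in> Rad X Z" by auto
  have "hom_comp X h f = hom_comp X (hom_comp Z h u) g"
    unfolding f(1) by (rule hom_comp_assoc[OF rad_hom_mod_hom[OF f(4)]])
  with f Suc.IH[OF f(2,3)] show ?case by auto
qed

lemma rad_comp_Suc_le:
  assumes "X \<in> \<C>" "Y \<in> \<C>" shows "rad_comp (Suc n) X Y \<subseteq> rad_comp n X Y"
  using rad_comp_right[OF _ assms(2,1)] rad_hom_mod_hom by fastforce

text \<open>\<open>rad_comp\<close> adds factors at the source. Here one is added at the target, and
  \<open>rad_comp_Suc_left\<close> splits one off there; the arguments for a fixed source depend on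
  this.\<close>

lemma rad_comp_compose:
  assumes "Y \<in> \<C>" "Z \<in> \<C>" "f \<in> Rad Z Y"
  shows "X \<in> \<C> \<Longrightarrow> g \<in> rad_comp n X Z \<Longrightarrow> hom_comp X f g \<in> rad_comp (Suc n) X Y"
proof (induction n arbitrary: X g)
  case 0
  then show ?case using assms by auto
next
  case (Suc n)
  then obtain u v W where g: "g = hom_comp X u v" "W \<in> \<C>" "u \<in> rad_comp n W Z" "v \<in> Rad X W" by auto
  have "hom_comp X f g = hom_comp X (hom_comp W f u) v"
    unfolding g(1) by (rule hom_comp_assoc[OF rad_hom_mod_hom[OF g(4)]])
  with g Suc.IH[OF g(2,3)] show ?case by (simp only: rad_comp.simps(2)[of "Suc n"]) blast
qed

lemma rad_comp_Suc_left:
  "X \<in> \<C> \<Longrightarrow> h \<in> rad_comp (Suc n) X Y \<Longrightarrow>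
    \<exists>Z f g. Z \<in> \<C> \<and> f \<in> Rad Z Y \<and> g \<in> rad_comp n X Z \<and> h = hom_comp X f g"
proof (induction n arbitrary: X h)
  case 0
  then show ?case by auto
next
  case (Suc n)
  from Suc.prems(2) obtain u v W where h: "h = hom_comp X u v" "W \<in> \<C>" "u \<in> rad_comp (Suc n) W Y" "v \<in> Rad X W"
    by (simp only: rad_comp.simps(2)[of "Suc n"]) blast
  obtain Z f g where Z: "Z \<in> \<C>" "f \<in> Rad Z Y" "g \<in> rad_comp n W Z" "u = hom_comp W f g"
    using Suc.IH[OF h(2,3)] by blast
  have "h = hom_comp X f (hom_comp X g v)"
    unfolding h(1) Z(4) by (rule hom_comp_assoc[OF rad_hom_mod_hom[OF h(4)], symmetric])
  moreover have "hom_comp X g v \<in> rad_comp (Suc n) X Z" using h Z by auto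
  ultimately show ?case using Z by blast
qed

lemma rad_power_Hom: "X \<in> \<C> \<Longrightarrow> Y \<in> \<C> \<Longrightarrow> rad_power n X Y \<subseteq> Hom X Y"
  unfolding rad_power_def by (rule add_closure_mod_hom[OF obj obj]) (auto intro: rad_comp_Hom)

lemma rad_power_HomD: "X \<in> \<C> \<Longrightarrow> Y \<in> \<C> \<Longrightarrow> f \<in> rad_power n X Y \<Longrightarrow> f \<in> Hom X Y"
  using rad_power_Hom by blast

lemma rad_power_zero: "hom_zero X Y \<in> rad_power n X Y"
  unfolding rad_power_def by (rule add_closure_zero)

lemma rad_power_base: "f \<in> rad_comp n X Y \<Longrightarrow> f \<in> rad_power n X Y"
  unfolding rad_power_def by (rule add_closure_base)

lemma rad_power_plus: "f \<in> rad_power n X Y \<Longrightarrow> g \<in> rad_power n X Y \<Longrightarrow> hom_plus X Y f g \<in> rad_power n X Y"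
  unfolding rad_power_def by (rule add_closure_plus)

lemma add_closure_comp_right:
  assumes W: "W \<in> \<C>" "k \<in> Hom W X"
    and step: "\<And>f. f \<in> S \<Longrightarrow> hom_comp W f k \<in> add_closure W Y T" and f: "f \<in> add_closure X Y S"
  shows "hom_comp W f k \<in> add_closure W Y T"
  using f
proof induction
  case add_closure_zero
  then show ?case unfolding hom_comp_zero_left[OF W(2)] by (rule add_closure.add_closure_zero)
next
  case (add_closure_plus f g)
  then show ?case unfolding hom_comp_plus_left[OF W(2)] by (intro add_closure.add_closure_plus)
qed (rule step)

lemma add_closure_comp_left:
  assumes "X \<in> \<C>" "Y \<in> \<C>" "W \<in> \<C>" "h \<in> Hom Y W" "S \<subseteq> Hom X Y"
    and step: "\<And>f. f \<in> S \<Longrightarrow> hom_comp X h f \<in> add_closure X W T" and f: "f \<in> add_closure X Y S"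
  shows "hom_comp X h f \<in> add_closure X W T"
  using f
proof induction
  case add_closure_zero
  then show ?case
    unfolding hom_comp_zero_right[OF obj[OF assms(2)] obj[OF assms(3)] assms(4)] by (rule add_closure.add_closure_zero)
next
  case (add_closure_plus f g)
  then have "f \<in> Hom X Y" "g \<in> Hom X Y"
    using add_closure_mod_hom[OF obj[OF assms(1)] obj[OF assms(2)] assms(5)] by blast+
  with add_closure_plus show ?case
    by (simp only: hom_comp_plus_right[OF _ _ assms(4)]) (rule add_closure.add_closure_plus)
qed (rule step)

lemma rad_power_right:
  assumes "X \<in> \<C>" "Y \<in> \<C>" "W \<in> \<C>" "f \<in> rad_power n X Y" "k \<in> Hom W X"
  shows "hom_comp W f k \<in> rad_power n W Y"
  using assms(4) unfolding rad_power_def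
  by (rule add_closure_comp_right[OF assms(3,5), rotated])
    (intro add_closure_base rad_comp_right[OF assms(1-3) _ assms(5)])

lemma rad_power_left:
  assumes "X \<in> \<C>" "Y \<in> \<C>" "W \<in> \<C>" "f \<in> rad_power n X Y" "h \<in> Hom Y W"
  shows "hom_comp X h f \<in> rad_power n X W"
  using assms(4) unfolding rad_power_def
  by (rule add_closure_comp_left[OF assms(1-3,5), rotated 2])
    (auto intro: rad_comp_Hom[OF assms(1,2)] add_closure_base rad_comp_left[OF assms(2,3,5,1)])

lemma rad_power_compose:
  assumes "X \<in> \<C>" "Y \<in> \<C>" "Z \<in> \<C>" "f \<in> Rad Z Y" "g \<in> rad_power n X Z"
  shows "hom_comp X f g \<in> rad_power (Suc n) X Y"
  using assms(5) unfolding rad_power_def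
  by (rule add_closure_comp_left[OF assms(1,3,2) rad_hom_mod_hom[OF assms(4)], rotated 2])
    (auto intro: rad_comp_Hom[OF assms(1,3)] intro!: add_closure_base rad_comp_compose[OF assms(2,3,4,1)]
      simp del: rad_comp.simps)

lemma rad_power_Suc_le:
  assumes "X \<in> \<C>" "Y \<in> \<C>" shows "rad_power (Suc n) X Y \<subseteq> rad_power n X Y"
  unfolding rad_power_def by (rule add_closure_mono[OF rad_comp_Suc_le[OF assms]])

lemma rad_power_antimono:
  assumes "X \<in> \<C>" "Y \<in> \<C>" "m \<le> n" shows "rad_power n X Y \<subseteq> rad_power m X Y"
  using assms(3) by (induction rule: dec_induct) (use rad_power_Suc_le[OF assms(1,2)] in auto)

lemma rad_power_0: "X \<in> \<C> \<Longrightarrow> Y \<in> \<C> \<Longrightarrow> rad_power 0 X Y = Rad X Y"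
proof
  assume *: "X \<in> \<C>" "Y \<in> \<C>"
  show "rad_power 0 X Y \<subseteq> Rad X Y"
  proof
    fix f assume "f \<in> rad_power 0 X Y"
    then have "f \<in> add_closure X Y (Rad X Y)" by (simp add: rad_power_def)
    then show "f \<in> Rad X Y"
      by induction (use * in \<open>auto intro: rad_hom_zero obj rad_hom_plus obj_fg\<close>)
  qed
qed (auto intro: rad_power_base)

text \<open>Composing the generators of successive radicals generates all composites with target Y.
  A single b suffices for the sums too, because a sum of right multiples of b is again one.\<close>

lemma rad_power_generator_right:
  assumes "Y \<in> \<C>"
  shows "\<exists>B\<in>\<C>. \<exists>b \<in> rad_comp n B Y. \<forall>X\<in>\<C>. \<forall>h \<in> rad_power n X Y. \<exists>k \<in> Hom X B. h = hom_comp X b k"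
proof -
  have "\<exists>B\<in>\<C>. \<exists>b \<in> rad_comp n B Y. \<forall>X\<in>\<C>. \<forall>h \<in> rad_comp n X Y. \<exists>k \<in> Hom X B. h = hom_comp X b k"
  proof (induction n)
    case 0
    obtain B b where B: "B \<in> \<C>" "b \<in> Rad B Y" "\<And>X h. X \<in> \<C> \<Longrightarrow> h \<in> Rad X Y \<Longrightarrow> \<exists>k \<in> Hom X B. h = hom_comp X b k"
      using right_generator[OF assms] by blast
    then show ?case by (intro bexI[of _ B] bexI[of _ b]) auto
  next
    case (Suc n)
    then obtain B b where B: "B \<in> \<C>" "b \<in> rad_comp n B Y"
      "\<And>X h. X \<in> \<C> \<Longrightarrow> h \<in> rad_comp n X Y \<Longrightarrow> \<exists>k \<in> Hom X B. h = hom_comp X b k" by blast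
    obtain B' b' where B': "B' \<in> \<C>" "b' \<in> Rad B' B" "\<And>X h. X \<in> \<C> \<Longrightarrow> h \<in> Rad X B \<Longrightarrow> \<exists>k \<in> Hom X B'. h = hom_comp X b' k"
      using right_generator[OF B(1)] by blast
    have "\<exists>k \<in> Hom X B'. h = hom_comp X (hom_comp B' b b') k" if X: "X \<in> \<C>" and "h \<in> rad_comp (Suc n) X Y" for X h
    proof -
      obtain f g Z where h: "h = hom_comp X f g" "Z \<in> \<C>" "f \<in> rad_comp n Z Y" "g \<in> Rad X Z"
        using \<open>h \<in> rad_comp (Suc n) X Y\<close> by auto
      obtain k where k: "k \<in> Hom Z B" "f = hom_comp Z b k" using B(3)[OF h(2,3)] by blast
      obtain k' where k': "k' \<in> Hom X B'" "hom_comp X k g = hom_comp X b' k'"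
        using B'(3)[OF X rad_hom_comp_left[OF obj[OF X] obj[OF h(2)] obj[OF B(1)] h(4) k(1)]] by blast
      have "h = hom_comp X b (hom_comp X k g)"
        unfolding h(1) k(2) by (rule hom_comp_assoc[OF rad_hom_mod_hom[OF h(4)], symmetric])
      also have "\<dots> = hom_comp X (hom_comp B' b b') k'"
        unfolding k'(2) by (rule hom_comp_assoc[OF k'(1)])
      finally show ?thesis using k'(1) by blast
    qed
    moreover have "hom_comp B' b b' \<in> rad_comp (Suc n) B' Y" using B(1,2) B'(2) by auto
    ultimately show ?case using B'(1) by blast
  qed
  then obtain B b where B: "B \<in> \<C>" "b \<in> rad_comp n B Y"
    "\<And>X h. X \<in> \<C> \<Longrightarrow> h \<in> rad_comp n X Y \<Longrightarrow> \<exists>k \<in> Hom X B. h = hom_comp X b k" by blast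
  have b: "b \<in> Hom B Y" by (rule rad_comp_Hom[OF B(1) assms B(2)])
  have "\<exists>k \<in> Hom X B. h = hom_comp X b k" if X: "X \<in> \<C>" and h: "h \<in> rad_power n X Y" for X h
    using h unfolding rad_power_def
  proof induction
    case add_closure_zero
    show ?case
      using hom_comp_zero_right[OF obj[OF B(1)] obj[OF assms] b, of X] hom_zero_in[OF obj[OF X] obj[OF B(1)]]
      by (intro bexI[of _ "hom_zero X B"]) simp_all
  next
    case (add_closure_plus f g)
    then obtain k k' where "k \<in> Hom X B" "k' \<in> Hom X B" "f = hom_comp X b k" "g = hom_comp X b k'" by blast
    then show ?case
      using hom_comp_plus_right[of k A X B k' b Y] b hom_plus_in[OF obj[OF X] obj[OF B(1)], of k k'] by force
  qed (rule B(3)[OF X])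
  with B(1,2) show ?thesis by blast
qed

text \<open>The recursion of \<open>rad_comp\<close> splits off a factor at the source, so the
  induction has to vary X, whereas the target stays fixed in the previous lemma.\<close>

lemma rad_power_generator_left:
  assumes "X \<in> \<C>"
  shows "\<exists>B\<in>\<C>. \<exists>b \<in> rad_comp n X B. \<forall>Y\<in>\<C>. \<forall>h \<in> rad_power n X Y. \<exists>k \<in> Hom B Y. h = hom_comp X k b"
proof -
  have "\<exists>B\<in>\<C>. \<exists>b \<in> rad_comp n X B. \<forall>Y\<in>\<C>. \<forall>h \<in> rad_comp n X Y. \<exists>k \<in> Hom B Y. h = hom_comp X k b"
    using assms
  proof (induction n arbitrary: X)
    case 0
    obtain B b where B: "B \<in> \<C>" "b \<in> Rad X B" "\<And>Y h. Y \<in> \<C> \<Longrightarrow> h \<in> Rad X Y \<Longrightarrow> \<exists>k \<in> Hom B Y. h = hom_comp X k b"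
      using left_generator[OF 0] by blast
    then show ?case by (intro bexI[of _ B] bexI[of _ b]) auto
  next
    case (Suc n)
    note X = Suc.prems
    obtain B b where B: "B \<in> \<C>" "b \<in> Rad X B" "\<And>Y h. Y \<in> \<C> \<Longrightarrow> h \<in> Rad X Y \<Longrightarrow> \<exists>k \<in> Hom B Y. h = hom_comp X k b"
      using left_generator[OF X] by blast
    obtain B' b' where B': "B' \<in> \<C>" "b' \<in> rad_comp n B B'"
      "\<And>Y h. Y \<in> \<C> \<Longrightarrow> h \<in> rad_comp n B Y \<Longrightarrow> \<exists>k \<in> Hom B' Y. h = hom_comp B k b'" using Suc.IH[OF B(1)] by blast
    note bh = rad_hom_mod_hom[OF B(2)]
    have "\<exists>k \<in> Hom B' Y. h = hom_comp X k (hom_comp X b' b)" if Y: "Y \<in> \<C>" and "h \<in> rad_comp (Suc n) X Y" for Y h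
    proof -
      obtain f g Z where h: "h = hom_comp X f g" "Z \<in> \<C>" "f \<in> rad_comp n Z Y" "g \<in> Rad X Z"
        using \<open>h \<in> rad_comp (Suc n) X Y\<close> by auto
      obtain k where k: "k \<in> Hom B Z" "g = hom_comp X k b" using B(3)[OF h(2,4)] by blast
      obtain k' where k': "k' \<in> Hom B' Y" "hom_comp B f k = hom_comp B k' b'"
        using B'(3)[OF Y rad_comp_right[OF h(2) Y B(1) h(3) k(1)]] by blast
      have "h = hom_comp X (hom_comp B f k) b"
        unfolding h(1) k(2) by (rule hom_comp_assoc[OF bh])
      also have "\<dots> = hom_comp X k' (hom_comp X b' b)"
        unfolding k'(2) by (rule hom_comp_assoc[OF bh, symmetric])
      finally show ?thesis using k'(1) by blast
    qed
    moreover have "hom_comp X b' b \<in> rad_comp (Suc n) X B'" using B(1,2) B'(2) by auto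
    ultimately show ?case using B'(1) by blast
  qed
  then obtain B b where B: "B \<in> \<C>" "b \<in> rad_comp n X B"
    "\<And>Y h. Y \<in> \<C> \<Longrightarrow> h \<in> rad_comp n X Y \<Longrightarrow> \<exists>k \<in> Hom B Y. h = hom_comp X k b" by blast
  have b: "b \<in> Hom X B" by (rule rad_comp_Hom[OF assms B(1,2)])
  have "\<exists>k \<in> Hom B Y. h = hom_comp X k b" if Y: "Y \<in> \<C>" and h: "h \<in> rad_power n X Y" for Y h
    using h unfolding rad_power_def
  proof induction
    case add_closure_zero
    show ?case
      using hom_comp_zero_left[OF b, of Y] hom_zero_in[OF obj[OF B(1)] obj[OF Y]]
      by (intro bexI[of _ "hom_zero B Y"]) simp_all
  next
    case (add_closure_plus f g)
    then obtain k k' where "k \<in> Hom B Y" "k' \<in> Hom B Y" "f = hom_comp X k b" "g = hom_comp X k' b" by blast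
    then show ?case
      using hom_comp_plus_left[OF b, of Y k k'] hom_plus_in[OF obj[OF B(1)] obj[OF Y], of k k'] by force
  qed (rule B(3)[OF Y])
  with B(1,2) show ?thesis by blast
qed

text \<open>The generator b of the power lies in the next power, hence b = b r with r radical. As 1
  - r is bijective, b vanishes, and with it all its multiples.\<close>

lemma nakayama_right:
  assumes Y: "Y \<in> \<C>" and stable: "\<And>X. X \<in> \<C> \<Longrightarrow> rad_power n X Y \<subseteq> rad_power (Suc n) X Y" and X: "X \<in> \<C>"
  shows "rad_power n X Y = {hom_zero X Y}"
proof -
  obtain B b where B: "B \<in> \<C>" "b \<in> rad_comp n B Y"
    "\<And>X h. X \<in> \<C> \<Longrightarrow> h \<in> rad_power n X Y \<Longrightarrow> \<exists>k \<in> Hom X B. h = hom_comp X b k"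
    using rad_power_generator_right[OF Y, of n] by blast
  have b: "b \<in> Hom B Y" by (rule rad_comp_Hom[OF B(1) Y B(2)])
  interpret B: right_module A B by (rule obj[OF B(1)])
  interpret Y: right_module A Y by (rule obj[OF Y])
  \<comment> \<open>The additional radical factor of the longer composite is absorbed into the
    multiplier of b, which becomes radical.\<close>
  have "\<exists>r \<in> Rad Z B. h = hom_comp Z b r" if Z: "Z \<in> \<C>" and h: "h \<in> rad_power (Suc n) Z Y" for Z h
    using h unfolding rad_power_def
  proof induction
    case add_closure_zero
    show ?case
      using hom_comp_zero_right[OF obj[OF B(1)] obj[OF Y] b, of Z] rad_hom_zero[OF obj[OF Z] obj[OF B(1)]]
      by (intro bexI[of _ "hom_zero Z B"]) simp_all
  next
    case (add_closure_base h)
    then obtain f g W where h: "h = hom_comp Z f g" "W \<in> \<C>" "f \<in> rad_comp n W Y" "g \<in> Rad Z W" by auto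
    obtain k where k: "k \<in> Hom W B" "f = hom_comp W b k" using B(3)[OF h(2) rad_power_base[OF h(3)]] by blast
    have "h = hom_comp Z b (hom_comp Z k g)"
      unfolding h(1) k(2) by (rule hom_comp_assoc[OF rad_hom_mod_hom[OF h(4)], symmetric])
    then show ?case using rad_hom_comp_left[OF obj[OF Z] obj[OF h(2)] obj[OF B(1)] h(4) k(1)] by blast
  next
    case (add_closure_plus f g)
    then obtain k k' where "k \<in> Rad Z B" "k' \<in> Rad Z B" "f = hom_comp Z b k" "g = hom_comp Z b k'" by blast
    then show ?case
      using hom_comp_plus_right[of k A Z B k' b Y] b rad_hom_plus[OF obj[OF Z] obj_fg[OF B(1)], of k k'] rad_hom_mod_hom by force
  qed
  then obtain r where r: "r \<in> Rad B B" "b = hom_comp B b r"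
    using stable[OF B(1)] rad_power_base[OF B(2)] B(1) by blast
  note rh = rad_hom_mod_hom[OF r(1)]
  let ?v = "\<lambda>x\<in>carrier B. x \<oplus>\<^sub>B \<ominus>\<^sub>B r x"
  have nofix: "x = \<zero>\<^sub>B" if "x \<in> carrier B" "r x = x" for x
    using rad_homD[OF r(1) hom_id_in[OF obj[OF B(1)]] that(1)] that by (simp add: hom_id_def)
  have v: "bij_betw ?v (carrier B) (carrier B)"
    by (rule one_minus_bijective(2)[OF obj_fg[OF B(1)] rh], erule (1) nofix)
  have "b x = \<zero>\<^sub>Y" if x: "x \<in> carrier B" for x
  proof -
    obtain y where y: "y \<in> carrier B" "x = ?v y" using v x by (auto simp: bij_betw_def)
    have ry: "r y \<in> carrier B" by (rule mod_hom_closed[OF rh y(1)])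
    have "b y = hom_comp B b r y" using r(2) by (rule arg_cong)
    then have "b y = b (r y)" using y(1) by (simp add: hom_comp_apply)
    moreover have "b x = b y \<oplus>\<^sub>Y \<ominus>\<^sub>Y b (r y)"
      using y ry by (simp add: mod_hom_add[OF b] mod_hom_neg[OF obj[OF B(1)] obj[OF Y] b])
    ultimately show ?thesis using mod_hom_closed[OF b ry] by (simp add: Y.M.r_neg)
  qed
  then have b0: "b = hom_zero B Y"
    by (intro mod_hom_eqI[OF b hom_zero_in[OF obj[OF B(1)] obj[OF Y]]]) (simp add: hom_zero_def)
  have "h = hom_zero X Y" if h: "h \<in> rad_power n X Y" for h
  proof -
    obtain k where "k \<in> Hom X B" "h = hom_comp X b k" using B(3)[OF X h] by blast
    then show ?thesis unfolding b0 by (simp add: hom_comp_zero_left)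
  qed
  then show ?thesis using rad_power_zero by blast
qed

text \<open>Here b = r b, so every value of b is a fixed point of the radical endomorphism r and
  therefore zero.\<close>

lemma nakayama_left:
  assumes X: "X \<in> \<C>" and stable: "\<And>Y. Y \<in> \<C> \<Longrightarrow> rad_power n X Y \<subseteq> rad_power (Suc n) X Y" and Y: "Y \<in> \<C>"
  shows "rad_power n X Y = {hom_zero X Y}"
proof -
  obtain B b where B: "B \<in> \<C>" "b \<in> rad_comp n X B"
    "\<And>Y h. Y \<in> \<C> \<Longrightarrow> h \<in> rad_power n X Y \<Longrightarrow> \<exists>k \<in> Hom B Y. h = hom_comp X k b"
    using rad_power_generator_left[OF X, of n] by blast
  have b: "b \<in> Hom X B" by (rule rad_comp_Hom[OF X B(1,2)])
  have "\<exists>r \<in> Rad B Z. h = hom_comp X r b" if Z: "Z \<in> \<C>" and h: "h \<in> rad_power (Suc n) X Z" for Z h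
    using h unfolding rad_power_def
  proof induction
    case add_closure_zero
    show ?case
      using hom_comp_zero_left[OF b, of Z] rad_hom_zero[OF obj[OF B(1)] obj[OF Z]]
      by (intro bexI[of _ "hom_zero B Z"]) simp_all
  next
    case (add_closure_base h)
    obtain f g W where h: "W \<in> \<C>" "f \<in> Rad W Z" "g \<in> rad_comp n X W" "h = hom_comp X f g"
      using rad_comp_Suc_left[OF X add_closure_base] by blast
    obtain k where k: "k \<in> Hom B W" "g = hom_comp X k b" using B(3)[OF h(1) rad_power_base[OF h(3)]] by blast
    have "h = hom_comp X (hom_comp B f k) b"
      unfolding h(4) k(2) by (rule hom_comp_assoc[OF b])
    then show ?case using rad_hom_comp_right[OF obj[OF B(1)] obj[OF Z] h(2) k(1)] by blast
  next
    case (add_closure_plus f g)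
    then obtain k k' where "k \<in> Rad B Z" "k' \<in> Rad B Z" "f = hom_comp X k b" "g = hom_comp X k' b" by blast
    then show ?case
      using hom_comp_plus_left[OF b, of Z k k'] rad_hom_plus[OF obj[OF B(1)] obj_fg[OF Z], of k k'] by force
  qed
  then obtain r where r: "r \<in> Rad B B" "b = hom_comp X r b"
    using stable[OF B(1)] rad_power_base[OF B(2)] B(1) by blast
  have "b x = \<zero>\<^sub>B" if x: "x \<in> carrier X" for x
  proof -
    have bx: "b x \<in> carrier B" by (rule mod_hom_closed[OF b x])
    have "b x = hom_comp X r b x" using r(2) by (rule arg_cong)
    then have "r (hom_id B (b x)) = b x" using x bx by (simp add: hom_comp_apply hom_id_def)
    then show ?thesis by (rule rad_homD[OF r(1) hom_id_in[OF obj[OF B(1)]] bx])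
  qed
  then have b0: "b = hom_zero X B"
    by (intro mod_hom_eqI[OF b hom_zero_in[OF obj[OF X] obj[OF B(1)]]]) (simp add: hom_zero_def)
  have "h = hom_zero X Y" if h: "h \<in> rad_power n X Y" for h
  proof -
    obtain k where "k \<in> Hom B Y" "h = hom_comp X k b" using B(3)[OF Y h] by blast
    then show ?thesis unfolding b0 by (simp add: hom_comp_zero_right[OF obj[OF B(1)] obj[OF Y]])
  qed
  then show ?thesis using rad_power_zero by blast
qed

section \<open>Representation finiteness\<close>

lemma Ind_nonradical:
  assumes "M \<in> Ind" "Z \<in> Ind" "f \<in> Hom M Z" "f \<notin> Rad M Z" shows "M = Z"
  using nonradical_between_indecomposables[OF obj_fg _ obj_fg _ assms(3,4)] obj_unique assms(1,2)
  by (auto simp: Ind_def)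

text \<open>If M is outside the indecomposables through which the identity of Y decomposes, all
  morphisms M \<rightarrow> Y are radical. They then factor through the generator b : B
  \<rightarrow> Y, and the induction hypothesis for B excludes only finitely many more M.\<close>

lemma Hom_eq_rad_power:
  assumes "Y \<in> \<C>"
  shows "\<exists>F. finite F \<and> F \<subseteq> Ind \<and> (\<forall>M \<in> Ind - F. Hom M Y \<subseteq> rad_power n M Y)"
  using assms
proof (induction n arbitrary: Y)
  case 0
  obtain F where F: "finite F" "F \<subseteq> Ind" "hom_id Y \<in> add_closure Y Y (factoring F Y Y)"
    using indecomposable_decomposition[OF 0] by blast
  have "g \<in> rad_power 0 M Y" if M: "M \<in> Ind - F" and g: "g \<in> Hom M Y" for M g
  proof -
    have MC: "M \<in> \<C>" using M by (simp add: Ind_def)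
    have "hom_comp M (hom_id Y) g \<in> add_closure M Y (rad_comp 0 M Y)"
    proof (rule add_closure_comp_right[OF MC g _ F(3)])
      fix e assume "e \<in> factoring F Y Y"
      then obtain i p Z where e: "e = hom_comp Y i p" "Z \<in> F" "p \<in> Hom Y Z" "i \<in> Hom Z Y"
        unfolding factoring_def by blast
      have ZC: "Z \<in> \<C>" using e(2) F(2) by (auto simp: Ind_def)
      have pg: "hom_comp M p g \<in> Hom M Z" by (rule hom_comp_in[OF obj[OF MC] g e(3)])
      have "hom_comp M p g \<in> Rad M Z"
        using Ind_nonradical[OF _ _ pg] M e(2) F(2) by blast
      then have "hom_comp M i (hom_comp M p g) \<in> Rad M Y"
        by (rule rad_hom_comp_left[OF obj[OF MC] obj[OF ZC] obj[OF 0] _ e(4)])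
      also have "hom_comp M i (hom_comp M p g) = hom_comp M e g"
        unfolding e(1) by (rule hom_comp_assoc[OF g])
      finally show "hom_comp M e g \<in> add_closure M Y (rad_comp 0 M Y)"
        by (simp add: add_closure_base)
    qed
    then show ?thesis unfolding rad_power_def hom_comp_id_left[OF g] .
  qed
  with F(1,2) show ?case by blast
next
  case (Suc n)
  \<comment> \<open>From the induction hypothesis at Y itself, only the containment in the radical
    is kept.\<close>
  obtain F where F: "finite F" "F \<subseteq> Ind" "\<forall>M \<in> Ind - F. Hom M Y \<subseteq> rad_power 0 M Y"
    using Suc.IH(1)[OF Suc.prems] rad_power_antimono[OF _ Suc.prems, of _ 0 n] by (fastforce simp: Ind_def)
  obtain B b where B: "B \<in> \<C>" "b \<in> Rad B Y" "\<And>X h. X \<in> \<C> \<Longrightarrow> h \<in> Rad X Y \<Longrightarrow> \<exists>k \<in> Hom X B. h = hom_comp X b k"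
    using right_generator[OF Suc.prems] by blast
  obtain F' where F': "finite F'" "F' \<subseteq> Ind" "\<forall>M \<in> Ind - F'. Hom M B \<subseteq> rad_power n M B"
    using Suc.IH[OF B(1)] by blast
  have "g \<in> rad_power (Suc n) M Y" if M: "M \<in> Ind - (F \<union> F')" and g: "g \<in> Hom M Y" for M g
  proof -
    have MC: "M \<in> \<C>" using M by (simp add: Ind_def)
    have "g \<in> Rad M Y" using F(3) M g rad_power_0[OF MC Suc.prems] by blast
    then obtain k where k: "k \<in> Hom M B" "g = hom_comp M b k" using B(3)[OF MC] by blast
    have "k \<in> rad_power n M B" using F'(3) M k(1) by blast
    then show ?thesis unfolding k(2) by (rule rad_power_compose[OF MC Suc.prems B(1,2)])
  qed
  then show ?case using F F' by (intro exI[of _ "F \<union> F'"]) auto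
qed

text \<open>The representatives of the regular module and of the injective cogenerator \<open>Hom\<^sub>K(A, K)\<close>.\<close>

lemma generator_cogenerator:
  obtains P I where "P \<in> \<C>" "I \<in> \<C>"
    "\<And>M. M \<in> \<C> \<Longrightarrow> carrier M \<noteq> {\<zero>\<^sub>M} \<Longrightarrow> \<exists>f \<in> Hom P M. \<exists>g \<in> Hom M I. hom_comp P g f \<noteq> hom_zero P I"
proof -
  have R: "right_module A (regular A)" by (rule regular_module[OF A.ring_axioms])
  have RK: "right_module K (regular K)" by (rule regular_module[OF K.ring_axioms])
  have vK: "vspace K (regular K)" by (intro vspace.intro K.field_axioms RK)
  have "fdim K (regular K)"
    unfolding fdim_def
    by (intro exI[of _ "{hom_id (regular K)}"]) (use hom_id_in[OF RK] in \<open>auto simp: hom_id_def\<close>)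
  then have Dfg: "fg_right_module A (coinduced K A (regular K))" by (rule coinduced_fg[OF vK])
  have D: "right_module A (coinduced K A (regular K))" by (rule coinduced_module[OF RK])
  obtain P u u' where P: "P \<in> \<C>" "u \<in> Hom (regular A) P" "u' \<in> Hom P (regular A)"
    "\<And>x. x \<in> carrier (regular A) \<Longrightarrow> u' (u x) = x"
    by (rule representative[OF regular_fg]) (rule that)
  obtain I v v' where I: "I \<in> \<C>" "v \<in> Hom (coinduced K A (regular K)) I" "v' \<in> Hom I (coinduced K A (regular K))"
    "\<And>x. x \<in> carrier (coinduced K A (regular K)) \<Longrightarrow> v' (v x) = x"
    by (rule representative[OF Dfg]) (rule that)
  have "\<exists>f \<in> Hom P M. \<exists>g \<in> Hom M I. hom_comp P g f \<noteq> hom_zero P I" if M: "M \<in> \<C>" and ne: "carrier M \<noteq> {\<zero>\<^sub>M}" for M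
  proof -
    interpret M: right_module A M by (rule obj[OF M])
    note M' = M.right_module_axioms
    interpret S: vspace K "scalars A M" by (rule scalars_vspace[OF M'])
    obtain x where x: "x \<in> carrier M" "x \<noteq> \<zero>\<^sub>M" using ne M.M.zero_closed by blast
    obtain \<phi> where \<phi>: "\<phi> \<in> mod_hom K (scalars A M) (regular K)" "\<phi> x \<noteq> \<zero>\<^sub>K"
    proof -
      have "\<exists>\<phi>. \<phi> \<in> mod_hom K (scalars A M) (regular K) \<and> \<phi> x \<noteq> \<phi> \<zero>\<^sub>M"
        using S.functionals_separate[of x "\<zero>\<^sub>M"] x by auto
      then show thesis
        using that mod_hom_zero[OF S.V.right_module_axioms RK] by fastforce
    qed
    \<comment> \<open>The map that corresponds to \<phi> under coinduction. With \<open>f0\<close>,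
      which sends 1 to x, the composite takes 1 to a function whose value at 1 is \<phi> x, which is
      nonzero.\<close>
    define g0 where "g0 = (\<lambda>m\<in>carrier M. \<lambda>a\<in>carrier A. \<phi> (a \<odot>\<^sub>M m))"
    have g0c: "(\<lambda>a\<in>carrier A. \<phi> (a \<odot>\<^sub>M m)) \<in> mod_hom K A (regular K)" if m: "m \<in> carrier M" for m
    proof -
      have "hom_comp A \<phi> (\<lambda>a\<in>carrier A. a \<odot>\<^sub>M m) \<in> mod_hom K A (regular K)"
        by (rule hom_comp_in[OF A_right_module orbit_map(2)[OF M' m] \<phi>(1)])
      also have "hom_comp A \<phi> (\<lambda>a\<in>carrier A. a \<odot>\<^sub>M m) = (\<lambda>a\<in>carrier A. \<phi> (a \<odot>\<^sub>M m))"
        by (rule ext) (simp add: compose_def)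
      finally show ?thesis .
    qed
    have \<phi>add: "\<phi> (y \<oplus>\<^sub>M z) = \<phi> y \<oplus>\<^sub>K \<phi> z" if "y \<in> carrier M" "z \<in> carrier M" for y z
      using mod_hom_add[OF \<phi>(1), of y z] that by simp
    have g0: "g0 \<in> Hom M (coinduced K A (regular K))"
    proof (rule mod_homI)
      show "g0 \<in> carrier M \<rightarrow>\<^sub>E carrier (coinduced K A (regular K))" using g0c by (auto simp: g0_def)
      show "g0 (y \<oplus>\<^sub>M z) = g0 y \<oplus>\<^bsub>coinduced K A (regular K)\<^esub> g0 z" if "y \<in> carrier M" "z \<in> carrier M" for y z
        using that by (auto simp: g0_def hom_plus_def M.smult_add_module \<phi>add intro!: restrict_ext)
      show "g0 (b \<odot>\<^sub>M y) = b \<odot>\<^bsub>coinduced K A (regular K)\<^esub> g0 y" if "b \<in> carrier A" "y \<in> carrier M" for b y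
        using that by (auto simp: g0_def M.smult_assoc intro!: restrict_ext)
    qed
    define f0 where "f0 = (\<lambda>a\<in>carrier A. a \<odot>\<^sub>M x)"
    have f0: "f0 \<in> Hom (regular A) M" unfolding f0_def by (rule orbit_map(1)[OF M' x(1)])
    let ?f = "hom_comp P f0 u'" and ?g = "hom_comp M v g0"
    have f: "?f \<in> Hom P M" by (rule hom_comp_in[OF obj[OF P(1)] P(3) f0])
    have g: "?g \<in> Hom M I" by (rule hom_comp_in[OF M' g0 I(2)])
    have "hom_comp P ?g ?f \<noteq> hom_zero P I"
    proof
      assume eq: "hom_comp P ?g ?f = hom_zero P I"
      have u1: "u \<one>\<^sub>A \<in> carrier P" using mod_hom_closed[OF P(2), of "\<one>\<^sub>A"] by simp
      have "f0 (u' (u \<one>\<^sub>A)) = x" using P(4)[of "\<one>\<^sub>A"] x(1) by (simp add: f0_def M.smult_one)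
      then have "v (g0 x) = \<zero>\<^sub>I"
        using fun_cong[OF eq, of "u \<one>\<^sub>A"] u1 x(1) by (simp add: hom_comp_apply hom_zero_def)
      then have "g0 x = hom_zero A (regular K)"
        using I(4)[OF mod_hom_closed[OF g0 x(1)]] mod_hom_zero[OF obj[OF I(1)] D I(3)] by simp
      then have "g0 x \<one>\<^sub>A = \<zero>\<^sub>K" by (simp add: hom_zero_def)
      then show False using \<phi>(2) x(1) by (simp add: g0_def M.smult_one)
    qed
    with f g show ?thesis by blast
  qed
  then show ?thesis by (rule that[OF P(1) I(1)])
qed

text \<open>P and I are fixed before n, so each condition only has to produce one exponent for this
  single pair. If all morphisms M \<rightarrow> I lay in the power, a nonzero composite P
  \<rightarrow> M \<rightarrow> I would lie in a power that vanishes.\<close>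

lemma finite_Ind_if_rad_power_vanishes:
  obtains P I where "P \<in> \<C>" "I \<in> \<C>" "\<And>n. rad_power n P I = {hom_zero P I} \<Longrightarrow> finite Ind"
proof -
  obtain P I where PI: "P \<in> \<C>" "I \<in> \<C>" and
    key: "\<And>M. M \<in> \<C> \<Longrightarrow> carrier M \<noteq> {\<zero>\<^sub>M} \<Longrightarrow> \<exists>f \<in> Hom P M. \<exists>g \<in> Hom M I. hom_comp P g f \<noteq> hom_zero P I"
    by (rule generator_cogenerator) (rule that)
  have "finite Ind" if zero: "rad_power n P I = {hom_zero P I}" for n
  proof -
    obtain F where F: "finite F" "\<forall>M \<in> Ind - F. Hom M I \<subseteq> rad_power n M I"
      using Hom_eq_rad_power[OF PI(2), of n] by blast
    have "Ind \<subseteq> F"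
    proof (rule ccontr)
      assume "\<not> Ind \<subseteq> F"
      then obtain M where M: "M \<in> Ind - F" by blast
      then have MC: "M \<in> \<C>" "carrier M \<noteq> {\<zero>\<^sub>M}" by (auto simp: Ind_def indecomposable_def)
      obtain f g where fg: "f \<in> Hom P M" "g \<in> Hom M I" "hom_comp P g f \<noteq> hom_zero P I"
        using key[OF MC] by blast
      have "g \<in> rad_power n M I" using F(2) M fg(2) by blast
      then have "hom_comp P g f \<in> rad_power n P I"
        by (rule rad_power_right[OF MC(1) PI(2,1) _ fg(1)])
      with zero fg(3) show False by blast
    qed
    then show ?thesis using F(1) finite_subset by blast
  qed
  then show ?thesis by (rule that[OF PI])
qed

section \<open>Subspaces and chains in Hom spaces\<close>

lemma Hom_has_rank:
  assumes "X \<in> \<C>" "Y \<in> \<C>"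
  shows "has_rank K (hom_space K (scalars A X) (scalars A Y))"
proof -
  have vX: "vspace K (scalars A X)" and vY: "vspace K (scalars A Y)" using assms by (auto intro: scalars_vspace obj)
  interpret H: vspace K "hom_space K (scalars A X) (scalars A Y)"
    by (intro vspace.intro K.field_axioms hom_space_module K.cring_axioms scalars_module obj assms)
  show ?thesis
    by (intro H.fdim_has_rank hom_space_fdim vX vY fg_scalars obj_fg assms fg_imp_fdim)
qed

text \<open>Scalar multiplication is composition with a scalar endomorphism at either end. The
  disjunction covers contravariant and covariant subfunctors alike.\<close>

lemma submodule_of_Hom:
  assumes X: "X \<in> \<C>" and Y: "Y \<in> \<C>" and "V \<subseteq> Hom X Y" "hom_zero X Y \<in> V"
    and "\<And>f g. f \<in> V \<Longrightarrow> g \<in> V \<Longrightarrow> hom_plus X Y f g \<in> V"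
    and comp: "(\<forall>f \<in> V. \<forall>e \<in> Hom X X. hom_comp X f e \<in> V) \<or> (\<forall>f \<in> V. \<forall>e \<in> Hom Y Y. hom_comp X e f \<in> V)"
  shows "submodule V K (hom_space K (scalars A X) (scalars A Y))"
proof -
  interpret H: right_module K "hom_space K (scalars A X) (scalars A Y)"
    by (intro hom_space_module K.cring_axioms scalars_module obj X Y)
  show ?thesis
  proof (rule H.right_submoduleI)
    show "V \<subseteq> carrier (hom_space K (scalars A X) (scalars A Y))"
      using assms(3) hom_scalars by fastforce
    show "\<zero>\<^bsub>hom_space K (scalars A X) (scalars A Y)\<^esub> \<in> V" using assms(4) by (simp add: hom_zero_def)
    show "f \<oplus>\<^bsub>hom_space K (scalars A X) (scalars A Y)\<^esub> g \<in> V" if "f \<in> V" "g \<in> V" for f g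
      using assms(5)[OF that] by (simp add: hom_plus_def)
    fix c f assume c: "c \<in> carrier K" and f: "f \<in> V"
    have fh: "f \<in> Hom X Y" using f assms(3) by blast
    have 1: "hom_comp X f (\<lambda>x\<in>carrier X. (c \<odot>\<^sub>A \<one>\<^sub>A) \<odot>\<^sub>X x) = c \<odot>\<^bsub>hom_space K (scalars A X) (scalars A Y)\<^esub> f"
      using c mod_hom_smult[OF fh] by (auto simp: compose_def intro!: restrict_ext)
    have 2: "hom_comp X (\<lambda>x\<in>carrier Y. (c \<odot>\<^sub>A \<one>\<^sub>A) \<odot>\<^sub>Y x) f = c \<odot>\<^bsub>hom_space K (scalars A X) (scalars A Y)\<^esub> f"
      using c mod_hom_closed[OF fh] by (auto simp: compose_def intro!: restrict_ext)
    from comp show "c \<odot>\<^bsub>hom_space K (scalars A X) (scalars A Y)\<^esub> f \<in> V"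
    proof
      assume "\<forall>f \<in> V. \<forall>e \<in> Hom X X. hom_comp X f e \<in> V"
      then show ?thesis unfolding 1[symmetric] using f scalar_endo[OF obj[OF X] c] by blast
    next
      assume "\<forall>f \<in> V. \<forall>e \<in> Hom Y Y. hom_comp X e f \<in> V"
      then show ?thesis unfolding 2[symmetric] using f scalar_endo[OF obj[OF Y] c] by blast
    qed
  qed
qed

lemma rad_power_submodule:
  assumes "X \<in> \<C>" "Y \<in> \<C>"
  shows "submodule (rad_power n X Y) K (hom_space K (scalars A X) (scalars A Y))"
  using rad_power_right[OF assms assms(1)] assms
  by (intro submodule_of_Hom) (auto intro: rad_power_HomD rad_power_zero rad_power_plus)

text \<open>Hom(X, Y) is finite dimensional, so the decreasing powers attain a least rank and are
  constant from there on. The final value is the intersection.\<close>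

lemma rad_power_intersection:
  assumes X: "X \<in> \<C>" and Y: "Y \<in> \<C>" and int: "(\<Inter>n. rad_power n X Y) = {hom_zero X Y}"
  obtains n where "rad_power n X Y = {hom_zero X Y}"
proof -
  obtain d :: "_ \<Rightarrow> nat" where d: "\<And>U V. submodule U K (hom_space K (scalars A X) (scalars A Y)) \<Longrightarrow>
      submodule V K (hom_space K (scalars A X) (scalars A Y)) \<Longrightarrow> U \<subset> V \<Longrightarrow> d U < d V"
    using Hom_has_rank[OF X Y] unfolding has_rank_def by blast
  obtain n where n: "\<And>m. d (rad_power n X Y) \<le> d (rad_power m X Y)"
    using ex_has_least_nat[of "\<lambda>_. True" 0 "\<lambda>n. d (rad_power n X Y)"] by blast
  have eq: "rad_power m X Y = rad_power n X Y" if "n \<le> m" for m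
  proof (rule ccontr)
    assume "rad_power m X Y \<noteq> rad_power n X Y"
    then have "rad_power m X Y \<subset> rad_power n X Y" using rad_power_antimono[OF X Y that] by blast
    then have "d (rad_power m X Y) < d (rad_power n X Y)" by (rule d[OF rad_power_submodule[OF X Y] rad_power_submodule[OF X Y]])
    then show False using n[of m] by simp
  qed
  have "rad_power n X Y \<subseteq> rad_power m X Y" for m
  proof (cases "n \<le> m")
    case True
    then show ?thesis using eq[OF True] by simp
  next
    case False
    then show ?thesis using rad_power_antimono[OF X Y, of m n] by simp
  qed
  then have "rad_power n X Y \<subseteq> (\<Inter>n. rad_power n X Y)" by (intro INT_greatest)
  then have "rad_power n X Y = {hom_zero X Y}" unfolding int using rad_power_zero[of X Y n] by blast
  then show ?thesis by (rule that)
qed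

text \<open>Subfunctors of \<open>Hom(-, Y)\<close> and of \<open>Hom(X, -)\<close>.\<close>

definition right_closed where
  "right_closed Y F \<longleftrightarrow> (\<forall>X\<in>\<C>. F X \<subseteq> Hom X Y \<and> hom_zero X Y \<in> F X \<and>
    (\<forall>f\<in>F X. \<forall>g\<in>F X. hom_plus X Y f g \<in> F X) \<and>
    (\<forall>f\<in>F X. \<forall>W\<in>\<C>. \<forall>k\<in>Hom W X. hom_comp W f k \<in> F W))"

definition left_closed where
  "left_closed X F \<longleftrightarrow> (\<forall>Y\<in>\<C>. F Y \<subseteq> Hom X Y \<and> hom_zero X Y \<in> F Y \<and>
    (\<forall>f\<in>F Y. \<forall>g\<in>F Y. hom_plus X Y f g \<in> F Y) \<and>
    (\<forall>f\<in>F Y. \<forall>W\<in>\<C>. \<forall>k\<in>Hom Y W. hom_comp X k f \<in> F W))"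

text \<open>The ranks are added over the finitely many indecomposables, so that one index is
  stationary for all of them at once. Source and target of the ambient Hom space are left open in
  order to cover both variances.\<close>

lemma finite_Ind_chain:
  assumes fin: "finite Ind"
    and sub: "\<And>X. X \<in> \<C> \<Longrightarrow> \<exists>Y\<in>\<C>. \<exists>Z\<in>\<C>. (\<forall>n. submodule (F n X) K (hom_space K (scalars A Y) (scalars A Z)))"
    and dec: "\<And>n X. X \<in> \<C> \<Longrightarrow> F (Suc n) X \<subseteq> F n X"
  shows "\<exists>n. \<forall>X\<in>Ind. F (Suc n) X = F n X"
proof (rule ccontr)
  assume *: "\<nexists>n. \<forall>X\<in>Ind. F (Suc n) X = F n X"
  have IC: "X \<in> \<C>" if "X \<in> Ind" for X using that by (simp add: Ind_def)
  have "\<exists>d :: _ \<Rightarrow> nat. \<forall>n. F (Suc n) X \<subset> F n X \<longrightarrow> d (F (Suc n) X) < d (F n X)" if X: "X \<in> Ind" for X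
  proof -
    obtain Y Z where YZ: "Y \<in> \<C>" "Z \<in> \<C>" "\<And>n. submodule (F n X) K (hom_space K (scalars A Y) (scalars A Z))"
      using sub[OF IC[OF X]] by blast
    obtain d :: "_ \<Rightarrow> nat" where d: "\<And>U V. submodule U K (hom_space K (scalars A Y) (scalars A Z)) \<Longrightarrow>
        submodule V K (hom_space K (scalars A Y) (scalars A Z)) \<Longrightarrow> U \<subset> V \<Longrightarrow> d U < d V"
      using Hom_has_rank[OF YZ(1,2)] unfolding has_rank_def by blast
    show ?thesis using d[OF YZ(3) YZ(3)] by (intro exI[of _ d]) simp
  qed
  then have "\<forall>X\<in>Ind. \<exists>d :: _ \<Rightarrow> nat. \<forall>n. F (Suc n) X \<subset> F n X \<longrightarrow> d (F (Suc n) X) < d (F n X)" ..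
  from bchoice[OF this] obtain d :: "_ \<Rightarrow> _ \<Rightarrow> nat"
    where d: "\<forall>X\<in>Ind. \<forall>n. F (Suc n) X \<subset> F n X \<longrightarrow> d X (F (Suc n) X) < d X (F n X)" ..
  have "(\<Sum>X\<in>Ind. d X (F (Suc n) X)) < (\<Sum>X\<in>Ind. d X (F n X))" for n
  proof (rule sum_strict_mono_ex1[OF fin])
    have le: "d X (F (Suc n) X) \<le> d X (F n X)" if X: "X \<in> Ind" for X
    proof -
      consider "F (Suc n) X = F n X" | "F (Suc n) X \<subset> F n X" using dec[OF IC[OF X], of n] by blast
      then show ?thesis
      proof cases
        case 2
        then show ?thesis using d X by fastforce
      qed simp
    qed
    then show "\<forall>X\<in>Ind. d X (F (Suc n) X) \<le> d X (F n X)" ..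
    obtain X where X: "X \<in> Ind" "F (Suc n) X \<noteq> F n X" using * by blast
    then have "F (Suc n) X \<subset> F n X" using dec[OF IC[OF X(1)], of n] by blast
    then show "\<exists>X\<in>Ind. d X (F (Suc n) X) < d X (F n X)" using d X(1) by blast
  qed
  then show False using decreasing_nat_sequence[of "\<lambda>n. \<Sum>X\<in>Ind. d X (F n X)"] by blast
qed

section \<open>Subfunctors are determined on the indecomposables\<close>

lemma Ind_decomposition:
  assumes "X \<in> \<C>" shows "hom_id X \<in> add_closure X X (factoring Ind X X)"
proof -
  obtain F where "F \<subseteq> Ind" "hom_id X \<in> add_closure X X (factoring F X X)"
    using indecomposable_decomposition[OF assms] by blast
  moreover from this(1) have "factoring F X X \<subseteq> factoring Ind X X" by (auto simp: factoring_def)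
  ultimately show ?thesis using add_closure_mono by blast
qed

lemma factoring_Hom:
  assumes "X \<in> \<C>" shows "factoring Ind X X \<subseteq> Hom X X"
  unfolding factoring_def by (auto intro: hom_comp_in[OF obj[OF assms]])

text \<open>Writing the identity of X as a sum of composites i p with p : X \<rightarrow> Z and i :
  Z \<rightarrow> X presents f as the sum of the (f i) p, and f i belongs to \<open>F Z\<close> with
  Z indecomposable.\<close>

lemma right_closed_determined:
  assumes Y: "Y \<in> \<C>" and F: "right_closed Y F" and G: "right_closed Y G"
    and eq: "\<And>Z. Z \<in> Ind \<Longrightarrow> F Z \<subseteq> G Z" and X: "X \<in> \<C>"
  shows "F X \<subseteq> G X"
proof
  fix f assume f: "f \<in> F X"
  have fh: "f \<in> Hom X Y" using F X f unfolding right_closed_def by blast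
  note FD = F[unfolded right_closed_def, rule_format] and GD = G[unfolded right_closed_def, rule_format]
  have "hom_comp X f e \<in> G X" if "e \<in> add_closure X X (factoring Ind X X)" for e
    using that
  proof induction
    case add_closure_zero
    show ?case unfolding hom_comp_zero_right[OF obj[OF X] obj[OF Y] fh] using GD[OF X] by blast
  next
    case (add_closure_base e)
    then obtain i p Z where e: "e = hom_comp X i p" "Z \<in> Ind" "p \<in> Hom X Z" "i \<in> Hom Z X"
      unfolding factoring_def by blast
    have Z: "Z \<in> \<C>" using e(2) by (simp add: Ind_def)
    have "hom_comp Z f i \<in> F Z" using FD[OF X] f Z e(4) by blast
    then have "hom_comp Z f i \<in> G Z" using eq[OF e(2)] by blast
    then have "hom_comp X (hom_comp Z f i) p \<in> G X" using GD[OF Z] X e(3) by blast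
    then show ?case unfolding e(1) hom_comp_assoc[OF e(3)] .
  next
    case (add_closure_plus e e')
    then have "e \<in> Hom X X" "e' \<in> Hom X X"
      using add_closure_mod_hom[OF obj[OF X] obj[OF X] factoring_Hom[OF X]] by blast+
    then have "hom_comp X f (hom_plus X X e e') = hom_plus X Y (hom_comp X f e) (hom_comp X f e')"
      by (rule hom_comp_plus_right[OF _ _ fh])
    then show ?case using add_closure_plus GD[OF X] by simp
  qed
  from this[OF Ind_decomposition[OF X]] show "f \<in> G X" by (simp add: hom_comp_id_right[OF fh])
qed

text \<open>Here the identity of Y is decomposed, and f is the sum of the i (p f).\<close>

lemma left_closed_determined:
  assumes X: "X \<in> \<C>" and F: "left_closed X F" and G: "left_closed X G"
    and eq: "\<And>Z. Z \<in> Ind \<Longrightarrow> F Z \<subseteq> G Z" and Y: "Y \<in> \<C>"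
  shows "F Y \<subseteq> G Y"
proof
  fix f assume f: "f \<in> F Y"
  have fh: "f \<in> Hom X Y" using F Y f unfolding left_closed_def by blast
  note FD = F[unfolded left_closed_def, rule_format] and GD = G[unfolded left_closed_def, rule_format]
  have "hom_comp X e f \<in> G Y" if "e \<in> add_closure Y Y (factoring Ind Y Y)" for e
    using that
  proof induction
    case add_closure_zero
    show ?case unfolding hom_comp_zero_left[OF fh] using GD[OF Y] by blast
  next
    case (add_closure_base e)
    then obtain i p Z where e: "e = hom_comp Y i p" "Z \<in> Ind" "p \<in> Hom Y Z" "i \<in> Hom Z Y"
      unfolding factoring_def by blast
    have Z: "Z \<in> \<C>" using e(2) by (simp add: Ind_def)
    have "hom_comp X p f \<in> F Z" using FD[OF Y] f Z e(3) by blast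
    then have "hom_comp X p f \<in> G Z" using eq[OF e(2)] by blast
    then have "hom_comp X i (hom_comp X p f) \<in> G Y" using GD[OF Z] Y e(4) by blast
    then show ?case unfolding e(1) hom_comp_assoc[OF fh] .
  next
    case (add_closure_plus e e')
    have "hom_comp X (hom_plus Y Y e e') f = hom_plus X Y (hom_comp X e f) (hom_comp X e' f)"
      by (rule hom_comp_plus_left[OF fh])
    then show ?case using add_closure_plus GD[OF Y] by simp
  qed
  from this[OF Ind_decomposition[OF Y]] show "f \<in> G Y" by (simp add: hom_comp_id_left[OF fh])
qed

lemma right_chain_stabilizes:
  assumes fin: "finite Ind" and Y: "Y \<in> \<C>" and F: "\<And>n. right_closed Y (F n)"
    and dec: "\<And>n X. X \<in> \<C> \<Longrightarrow> F (Suc n) X \<subseteq> F n X"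
  shows "\<exists>n. \<forall>X\<in>\<C>. F (Suc n) X = F n X"
proof -
  have "\<exists>V\<in>\<C>. \<exists>Z\<in>\<C>. \<forall>n. submodule (F n X) K (hom_space K (scalars A V) (scalars A Z))" if X: "X \<in> \<C>" for X
  proof -
    have "submodule (F n X) K (hom_space K (scalars A X) (scalars A Y))" for n
    proof (rule submodule_of_Hom[OF X Y])
      note c = bspec[OF F[of n, unfolded right_closed_def] X]
      show "F n X \<subseteq> Hom X Y" using c by (rule conjunct1)
      show "hom_zero X Y \<in> F n X" using c by (elim conjE)
      show "hom_plus X Y f g \<in> F n X" if "f \<in> F n X" "g \<in> F n X" for f g using c that by simp
      show "(\<forall>f \<in> F n X. \<forall>e \<in> Hom X X. hom_comp X f e \<in> F n X) \<or> (\<forall>f \<in> F n X. \<forall>e \<in> Hom Y Y. hom_comp X e f \<in> F n X)"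
        using c X by (intro disjI1 ballI) simp
    qed
    then show ?thesis using X Y by blast
  qed
  then have "\<exists>n. \<forall>X\<in>Ind. F (Suc n) X = F n X"
    by (rule finite_Ind_chain[where F = F, OF fin _ dec])
  then obtain n where n: "\<forall>X\<in>Ind. F (Suc n) X = F n X" ..
  have "F n X \<subseteq> F (Suc n) X" if "X \<in> \<C>" for X
    by (rule right_closed_determined[OF Y F F _ that]) (simp add: bspec[OF n])
  then show ?thesis using dec by (intro exI[of _ n] ballI equalityI)
qed

lemma left_chain_stabilizes:
  assumes fin: "finite Ind" and X: "X \<in> \<C>" and F: "\<And>n. left_closed X (F n)"
    and dec: "\<And>n Y. Y \<in> \<C> \<Longrightarrow> F (Suc n) Y \<subseteq> F n Y"
  shows "\<exists>n. \<forall>Y\<in>\<C>. F (Suc n) Y = F n Y"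
proof -
  have "\<exists>V\<in>\<C>. \<exists>Z\<in>\<C>. \<forall>n. submodule (F n Y) K (hom_space K (scalars A V) (scalars A Z))" if Y: "Y \<in> \<C>" for Y
  proof -
    have "submodule (F n Y) K (hom_space K (scalars A X) (scalars A Y))" for n
    proof (rule submodule_of_Hom[OF X Y])
      note c = bspec[OF F[of n, unfolded left_closed_def] Y]
      show "F n Y \<subseteq> Hom X Y" using c by (rule conjunct1)
      show "hom_zero X Y \<in> F n Y" using c by (elim conjE)
      show "hom_plus X Y f g \<in> F n Y" if "f \<in> F n Y" "g \<in> F n Y" for f g using c that by simp
      show "(\<forall>f \<in> F n Y. \<forall>e \<in> Hom X X. hom_comp X f e \<in> F n Y) \<or> (\<forall>f \<in> F n Y. \<forall>e \<in> Hom Y Y. hom_comp X e f \<in> F n Y)"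
        using c Y by (intro disjI2 ballI) simp
    qed
    then show ?thesis using X Y by blast
  qed
  then have "\<exists>n. \<forall>Y\<in>Ind. F (Suc n) Y = F n Y"
    by (rule finite_Ind_chain[where F = F, OF fin _ dec])
  then obtain n where n: "\<forall>Y\<in>Ind. F (Suc n) Y = F n Y" ..
  have "F n Y \<subseteq> F (Suc n) Y" if "Y \<in> \<C>" for Y
    by (rule left_closed_determined[OF X F F _ that]) (simp add: bspec[OF n])
  then show ?thesis using dec by (intro exI[of _ n] ballI equalityI)
qed

lemma right_closed_rad_power: "Y \<in> \<C> \<Longrightarrow> right_closed Y (\<lambda>X. rad_power n X Y)"
  unfolding right_closed_def
  using rad_power_Hom rad_power_zero rad_power_plus rad_power_right by blast

lemma left_closed_rad_power: "X \<in> \<C> \<Longrightarrow> left_closed X (\<lambda>Y. rad_power n X Y)"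
  unfolding left_closed_def
  using rad_power_Hom rad_power_zero rad_power_plus rad_power_left by blast

text \<open>For an indecomposable target the powers become stationary and vanish by Nakayama's
  argument. The largest exponent serves all of the finitely many indecomposable targets, and
  functoriality in the target extends the vanishing to every object.\<close>

lemma finite_Ind_imp_nilpotent:
  assumes fin: "finite Ind"
  obtains n where "\<And>X Y. X \<in> \<C> \<Longrightarrow> Y \<in> \<C> \<Longrightarrow> rad_power n X Y = {hom_zero X Y}"
proof -
  have "\<exists>n. \<forall>X\<in>\<C>. rad_power n X Y = {hom_zero X Y}" if Y: "Y \<in> Ind" for Y
  proof -
    have YC: "Y \<in> \<C>" using Y by (simp add: Ind_def)
    obtain n where n: "\<forall>X\<in>\<C>. rad_power (Suc n) X Y = rad_power n X Y"
      using right_chain_stabilizes[of Y "\<lambda>n X. rad_power n X Y", OF fin YC right_closed_rad_power[OF YC]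
        rad_power_Suc_le[OF _ YC]] by blast
    then show ?thesis using nakayama_right[OF YC, of n] by blast
  qed
  then obtain N where N: "\<And>Y X. Y \<in> Ind \<Longrightarrow> X \<in> \<C> \<Longrightarrow> rad_power (N Y) X Y = {hom_zero X Y}"
    using bchoice[of Ind "\<lambda>Y n. \<forall>X\<in>\<C>. rad_power n X Y = {hom_zero X Y}"] by blast
  define n where "n = Max (insert 0 (N ` Ind))"
  have Nn: "N Y \<le> n" if "Y \<in> Ind" for Y using that fin by (simp add: n_def)
  have "rad_power n X Y = {hom_zero X Y}" if X: "X \<in> \<C>" and Y: "Y \<in> \<C>" for X Y
  proof -
    \<comment> \<open>The zero family is a subfunctor, so a comparison with it on the
      indecomposables carries over to all targets.\<close>
    have "left_closed X (\<lambda>Y. {hom_zero X Y})"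
      unfolding left_closed_def
    proof (intro ballI conjI)
      fix W assume W: "W \<in> \<C>"
      show "{hom_zero X W} \<subseteq> Hom X W" using hom_zero_in[OF obj[OF X] obj[OF W]] by blast
      interpret W: right_module A W by (rule obj[OF W])
      show "hom_plus X W f g \<in> {hom_zero X W}" if "f \<in> {hom_zero X W}" "g \<in> {hom_zero X W}" for f g
        using that by (auto simp: hom_plus_def hom_zero_def intro!: restrict_ext)
      show "hom_comp X k f \<in> {hom_zero X V}" if "f \<in> {hom_zero X W}" "V \<in> \<C>" "k \<in> Hom W V" for f V k
        using hom_comp_zero_right[OF obj[OF W] obj[OF that(2)] that(3), of X] that(1) by simp
    qed simp
    moreover have "rad_power n X Z \<subseteq> {hom_zero X Z}" if Z: "Z \<in> Ind" for Z
      using rad_power_antimono[OF X _ Nn[OF Z]] N[OF Z X] Z by (auto simp: Ind_def)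
    ultimately have "rad_power n X Y \<subseteq> {hom_zero X Y}"
      using left_closed_determined[OF X left_closed_rad_power[OF X]] Y by blast
    then show ?thesis using rad_power_zero by blast
  qed
  then show ?thesis by (rule that)
qed

text \<open>The classes in \<open>representation_finite\<close> consist of modules of a fixed type,
  while the members of \<open>Ind\<close> are objects of \<C>. The map \<open>rep\<close> matches
  them: its fibres are the isomorphism classes and its image is \<open>Ind\<close>.\<close>

lemma representation_finite_iff: "representation_finite A \<longleftrightarrow> finite Ind"
proof -
  let ?r = "{(M, N). M \<in> indecs A \<and> N \<in> indecs A \<and> mod_iso A M N}"
  have ex: "\<exists>X\<in>Ind. mod_iso A M X" if M: "M \<in> indecs A" for M
  proof -
    have Mfg: "fg_right_module A M" and Mind: "indecomposable A M" using M by (auto simp: indecs_def)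
    have M': "right_module A M" using Mfg by (simp add: fg_right_module_def)
    obtain X where X: "X \<in> \<C>" "mod_iso A M X" using skeleton Mfg unfolding is_skeleton_def by blast
    obtain f where f: "f \<in> Hom M X" "bij_betw f (carrier M) (carrier X)" using X(2) unfolding mod_iso_def by blast
    obtain g where g: "g \<in> Hom X M" "\<And>x. x \<in> carrier M \<Longrightarrow> g (f x) = x" "\<And>y. y \<in> carrier X \<Longrightarrow> f (g y) = y"
      by (rule inverse_in_mod_hom[OF M' f]) (rule that)
    have "indecomposable A X" by (rule indecomposable_iso[OF M' obj[OF X(1)] f(1) g(1) g(2,3) Mind])
    then show ?thesis using X by (auto simp: Ind_def)
  qed
  have iso_comp: "mod_iso A M1 M3" if M1: "right_module A M1" and M12: "mod_iso A M1 M2" and M23: "mod_iso A M2 M3"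
    for M1 :: "('a, 'u) module" and M2 :: "('a, 'v) module" and M3 :: "('a, 'w) module"
  proof -
    obtain u where u: "u \<in> Hom M1 M2" "bij_betw u (carrier M1) (carrier M2)" using M12 unfolding mod_iso_def by blast
    obtain v where v: "v \<in> Hom M2 M3" "bij_betw v (carrier M2) (carrier M3)" using M23 unfolding mod_iso_def by blast
    have "bij_betw (hom_comp M1 v u) (carrier M1) (carrier M3)"
      using bij_betw_trans[OF u(2) v(2)] by (rule bij_betw_cong[THEN iffD1, rotated]) (simp add: compose_def)
    then show ?thesis unfolding mod_iso_def using hom_comp_in[OF M1 u(1) v(1)] by blast
  qed
  have iso_sym: "mod_iso A N M" if M: "right_module A M" and MN: "mod_iso A M N" for M :: "('a, 'u) module" and N :: "('a, 'v) module"
  proof -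
    obtain f where f: "f \<in> Hom M N" "bij_betw f (carrier M) (carrier N)" using MN unfolding mod_iso_def by blast
    show ?thesis unfolding mod_iso_def
      by (rule inverse_in_mod_hom[OF M f]) (rule bexI)
  qed
  have im: "right_module A M" if "M \<in> indecs A" for M using that by (auto simp: indecs_def fg_right_module_def)
  define rep where "rep M = (SOME X. X \<in> Ind \<and> mod_iso A M X)" for M :: "'a fg_mod"
  have rep: "rep M \<in> Ind" "mod_iso A M (rep M)" if "M \<in> indecs A" for M
    using someI_ex[of "\<lambda>X. X \<in> Ind \<and> mod_iso A M X"] ex[OF that] unfolding rep_def by blast+
  have rep_eq: "rep M = rep N \<longleftrightarrow> mod_iso A M N" if MN: "M \<in> indecs A" "N \<in> indecs A" for M N
  proof
    assume "rep M = rep N"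
    then have "mod_iso A (rep M) N" using iso_sym[OF im[OF MN(2)] rep(2)[OF MN(2)]] by simp
    then show "mod_iso A M N" by (rule iso_comp[OF im[OF MN(1)] rep(2)[OF MN(1)]])
  next
    assume "mod_iso A M N"
    then have "mod_iso A M (rep N)" by (rule iso_comp[OF im[OF MN(1)] _ rep(2)[OF MN(2)]])
    moreover have "mod_iso A (rep M) M" by (rule iso_sym[OF im[OF MN(1)] rep(2)[OF MN(1)]])
    moreover have R: "rep M \<in> \<C>" "rep N \<in> \<C>" using rep(1) MN by (auto simp: Ind_def)
    ultimately have "mod_iso A (rep M) (rep N)" using iso_comp[OF obj[OF R(1)]] by blast
    then show "rep M = rep N" using obj_unique R by blast
  qed
  have surj: "rep ` indecs A = Ind"
  proof
    show "rep ` indecs A \<subseteq> Ind" using rep(1) by blast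
    show "Ind \<subseteq> rep ` indecs A"
    proof
      fix X assume X: "X \<in> Ind"
      then have XC: "X \<in> \<C>" and Xind: "indecomposable A X" by (auto simp: Ind_def)
      obtain N :: "'a fg_mod" where N: "fg_right_module A N" "mod_iso A X N" using fg_universe[OF obj_fg[OF XC]] by blast
      have N': "right_module A N" using N(1) by (simp add: fg_right_module_def)
      obtain f where f: "f \<in> Hom X N" "bij_betw f (carrier X) (carrier N)" using N(2) unfolding mod_iso_def by blast
      obtain g where g: "g \<in> Hom N X" "\<And>x. x \<in> carrier X \<Longrightarrow> g (f x) = x" "\<And>y. y \<in> carrier N \<Longrightarrow> f (g y) = y"
        by (rule inverse_in_mod_hom[OF obj[OF XC] f]) (rule that)
      have "indecomposable A N" by (rule indecomposable_iso[OF obj[OF XC] N' f(1) g(1) g(2,3) Xind])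
      then have NI: "N \<in> indecs A" using N(1) by (simp add: indecs_def)
      have "mod_iso A X (rep N)" by (rule iso_comp[OF obj[OF XC] N(2) rep(2)[OF NI]])
      then have "X = rep N" using obj_unique XC rep(1)[OF NI] by (auto simp: Ind_def)
      then show "X \<in> rep ` indecs A" using NI by blast
    qed
  qed
  have cls: "?r `` {M} = {N \<in> indecs A. rep N = rep M}" if "M \<in> indecs A" for M
  proof -
    have "rep N = rep M \<longleftrightarrow> mod_iso A M N" if "N \<in> indecs A" for N
      using rep_eq[OF \<open>M \<in> indecs A\<close> that] by (simp add: eq_commute)
    then show ?thesis using \<open>M \<in> indecs A\<close> by auto
  qed
  have "indecs A // ?r = (\<lambda>X. {N \<in> indecs A. rep N = X}) ` Ind"
    unfolding surj[symmetric] quotient_def using cls by (auto simp: image_image)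
  \<comment> \<open>The fibres of \<open>rep\<close> over \<open>Ind\<close> are nonempty, so
    distinct objects have distinct fibres.\<close>
  moreover have "inj_on (\<lambda>X. {N \<in> indecs A. rep N = X}) Ind"
    unfolding surj[symmetric] by (rule inj_onI) blast
  ultimately show ?thesis unfolding representation_finite_def by (simp add: finite_image_iff)
qed

end

section \<open>Graded ideals of the ring of a skeleton\<close>

context mod_skeleton
begin

abbreviation "\<R> \<equiv> skeleton_ring A \<C>"
abbreviation "hg Y X f \<equiv> homogeneous A \<C> (Y, X) f"

lemma hom_group_simps [simp]:
  "carrier (hom_group A X Y) = Hom X Y" "\<one>\<^bsub>hom_group A X Y\<^esub> = hom_zero X Y"
  "f \<otimes>\<^bsub>hom_group A X Y\<^esub> g = hom_plus X Y f g"
  by (simp_all add: hom_group_def hom_zero_def hom_plus_def)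

lemma hom_comm_group: "X \<in> \<C> \<Longrightarrow> Y \<in> \<C> \<Longrightarrow> comm_group (hom_group A X Y)"
  by (rule hom_group_comm_group[OF obj obj])

lemma hom_plus_zero: "X \<in> \<C> \<Longrightarrow> Y \<in> \<C> \<Longrightarrow> f \<in> Hom X Y \<Longrightarrow> hom_plus X Y f (hom_zero X Y) = f"
  "X \<in> \<C> \<Longrightarrow> Y \<in> \<C> \<Longrightarrow> f \<in> Hom X Y \<Longrightarrow> hom_plus X Y (hom_zero X Y) f = f"
  using comm_group.axioms(1)[OF hom_comm_group, THEN comm_monoid.axioms(1), THEN monoid.r_one, of X Y f]
    comm_group.axioms(1)[OF hom_comm_group, THEN comm_monoid.axioms(1), THEN monoid.l_one, of X Y f] by simp_all

lemma ring_group: "group (sum_group (\<C> \<times> \<C>) (\<lambda>(Y, X). hom_group A X Y))"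
  by (rule sum_group) (auto intro: comm_group.axioms(2)[OF hom_comm_group])

lemma ring_carrier: "u \<in> carrier \<R> \<longleftrightarrow> u \<in> extensional (\<C> \<times> \<C>) \<and> (\<forall>X\<in>\<C>. \<forall>Y\<in>\<C>. u (Y, X) \<in> Hom X Y) \<and>
    finite {\<gamma> \<in> \<C> \<times> \<C>. u \<gamma> \<noteq> hom_zero (snd \<gamma>) (fst \<gamma>)}"
proof -
  have "carrier \<R> = {x \<in> \<Pi>\<^sub>E i\<in>\<C> \<times> \<C>. carrier ((\<lambda>(Y, X). hom_group A X Y) i).
      finite {i \<in> \<C> \<times> \<C>. x i \<noteq> \<one>\<^bsub>(\<lambda>(Y, X). hom_group A X Y) i\<^esub>}}"
    unfolding skeleton_ring_def Let_def graded_ring.simps partial_object.simps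
    by (rule trans[OF _ carrier_sum_group]) (auto intro: comm_group.axioms(2)[OF hom_comm_group])
  then show ?thesis by (auto simp: PiE_iff split_beta)
qed

lemma ring_component: "u \<in> carrier \<R> \<Longrightarrow> X \<in> \<C> \<Longrightarrow> Y \<in> \<C> \<Longrightarrow> u (Y, X) \<in> Hom X Y"
  by (simp add: ring_carrier)

lemma ring_add: "X \<in> \<C> \<Longrightarrow> Y \<in> \<C> \<Longrightarrow> (u \<oplus>\<^sub>\<R> v) (Y, X) = hom_plus X Y (u (Y, X)) (v (Y, X))"
  and ring_zero: "X \<in> \<C> \<Longrightarrow> Y \<in> \<C> \<Longrightarrow> \<zero>\<^sub>\<R> (Y, X) = hom_zero X Y"
  by (simp_all add: skeleton_ring_def Let_def)

lemma ring_eqI: "u \<in> extensional (\<C> \<times> \<C>) \<Longrightarrow> v \<in> extensional (\<C> \<times> \<C>) \<Longrightarrow>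
    (\<And>X Y. X \<in> \<C> \<Longrightarrow> Y \<in> \<C> \<Longrightarrow> u (Y, X) = v (Y, X)) \<Longrightarrow> u = v"
  by (rule extensionalityI) auto

lemma ring_ext [simp]: "u \<in> carrier \<R> \<Longrightarrow> u \<in> extensional (\<C> \<times> \<C>)" "hg Y X f \<in> extensional (\<C> \<times> \<C>)"
  "\<zero>\<^sub>\<R> \<in> extensional (\<C> \<times> \<C>)" "u \<oplus>\<^sub>\<R> v \<in> extensional (\<C> \<times> \<C>)" "u \<otimes>\<^sub>\<R> v \<in> extensional (\<C> \<times> \<C>)"
  by (simp add: ring_carrier, simp add: homogeneous_def, simp_all add: skeleton_ring_def Let_def)

lemma ring_abelian_group: "abelian_group \<R>"
proof -
  interpret G: group "sum_group (\<C> \<times> \<C>) (\<lambda>(Y, X). hom_group A X Y)" by (rule ring_group)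
  have eq: "carrier \<R> = carrier (sum_group (\<C> \<times> \<C>) (\<lambda>(Y, X). hom_group A X Y))"
    "\<And>u v. u \<oplus>\<^sub>\<R> v = u \<otimes>\<^bsub>sum_group (\<C> \<times> \<C>) (\<lambda>(Y, X). hom_group A X Y)\<^esub> v"
    "\<zero>\<^sub>\<R> = \<one>\<^bsub>sum_group (\<C> \<times> \<C>) (\<lambda>(Y, X). hom_group A X Y)\<^esub>"
    by (simp_all add: skeleton_ring_def Let_def)
  show ?thesis
  proof (rule abelian_groupI)
    fix u v assume "u \<in> carrier \<R>" "v \<in> carrier \<R>"
    note uv = this[THEN ring_component]
    show "u \<oplus>\<^sub>\<R> v = v \<oplus>\<^sub>\<R> u"
    proof (rule ring_eqI)
      fix X Y assume C: "X \<in> \<C>" "Y \<in> \<C>"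
      interpret H: comm_group "hom_group A X Y" by (rule hom_comm_group[OF C])
      show "(u \<oplus>\<^sub>\<R> v) (Y, X) = (v \<oplus>\<^sub>\<R> u) (Y, X)"
        using H.m_comm[of "u (Y, X)" "v (Y, X)"] uv C by (simp add: ring_add)
    qed simp_all
  qed (unfold eq, auto intro: G.m_assoc G.l_inv_ex simp del: mult_sum_group one_sum_group)
qed

text \<open>The field \<open>one\<close> of this record is undefined, so the additive group is what
  is registered; products are handled through components.\<close>

sublocale R: abelian_group \<R> by (rule ring_abelian_group)

section \<open>Homogeneous elements and products by components\<close>

lemma hg_component: "X' \<in> \<C> \<Longrightarrow> Y' \<in> \<C> \<Longrightarrow>
    hg Y X f (Y', X') = (if Y' = Y \<and> X' = X then f else hom_zero X' Y')"
  by (simp add: homogeneous_def)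

lemma hg_carrier: "X \<in> \<C> \<Longrightarrow> Y \<in> \<C> \<Longrightarrow> f \<in> Hom X Y \<Longrightarrow> hg Y X f \<in> carrier \<R>"
proof -
  assume *: "X \<in> \<C>" "Y \<in> \<C>" "f \<in> Hom X Y"
  have "finite {\<gamma> \<in> \<C> \<times> \<C>. hg Y X f \<gamma> \<noteq> hom_zero (snd \<gamma>) (fst \<gamma>)}"
    by (rule finite_subset[of _ "{(Y, X)}"]) (auto simp: hg_component split: if_splits)
  then show ?thesis using * obj by (auto simp: ring_carrier hg_component)
qed

lemma hg_zero: "hg Y X (hom_zero X Y) = \<zero>\<^sub>\<R>"
  by (rule ring_eqI) (auto simp: hg_component ring_zero)

lemma hg_plus: "X \<in> \<C> \<Longrightarrow> Y \<in> \<C> \<Longrightarrow> hg Y X (hom_plus X Y f g) = hg Y X f \<oplus>\<^sub>\<R> hg Y X g"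
  by (rule ring_eqI) (auto simp: hg_component ring_add hom_plus_zero obj)

lemma hg_mult:
  "X \<in> \<C> \<Longrightarrow> Y \<in> \<C> \<Longrightarrow> Z \<in> \<C> \<Longrightarrow> f \<in> Hom X Y \<Longrightarrow> g \<in> Hom Y Z \<Longrightarrow>
    hg Z Y g \<otimes>\<^sub>\<R> hg Y X f = hg Z X (hom_comp X g f)"
  by (simp add: mult_homogeneous obj)

lemma mult_component: "X \<in> \<C> \<Longrightarrow> Z \<in> \<C> \<Longrightarrow> (u \<otimes>\<^sub>\<R> v) (Z, X) =
    finprod (hom_group A X Z) (\<lambda>Y. hom_comp X (u (Z, Y)) (v (Y, X)))
      {Y \<in> \<C>. u (Z, Y) \<noteq> hom_zero Y Z \<and> v (Y, X) \<noteq> hom_zero X Y}"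
  by (simp add: skeleton_ring_def Let_def)

text \<open>A component of a product is a finite sum of composites, so membership in an additively
  closed set can be checked on the composites. Closure of ideals under multiplication is verified in
  this way.\<close>

lemma mult_component_in:
  assumes C: "X \<in> \<C>" "Z \<in> \<C>" and F: "F \<subseteq> Hom X Z" "hom_zero X Z \<in> F"
    "\<And>f g. f \<in> F \<Longrightarrow> g \<in> F \<Longrightarrow> hom_plus X Z f g \<in> F"
    and t: "\<And>Y. Y \<in> \<C> \<Longrightarrow> hom_comp X (u (Z, Y)) (v (Y, X)) \<in> F"
  shows "(u \<otimes>\<^sub>\<R> v) (Z, X) \<in> F"
proof -
  interpret H: comm_group "hom_group A X Z" by (rule hom_comm_group[OF C])
  have "finprod (hom_group A X Z) (\<lambda>Y. hom_comp X (u (Z, Y)) (v (Y, X))) T \<in> F" if "T \<subseteq> \<C>" for T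
    using that
  proof (induction T rule: infinite_finite_induct)
    case (insert Y T)
    have "(\<lambda>Y. hom_comp X (u (Z, Y)) (v (Y, X))) \<in> insert Y T \<rightarrow> carrier (hom_group A X Z)"
      using t F(1) insert.prems by auto
    then show ?case using insert t F(3) by (simp add: Pi_iff)
  qed (use F(2) in simp_all)
  then show ?thesis unfolding mult_component[OF C] by auto
qed

text \<open>A nonzero component at (Z, X) requires a nonzero component of u with target Z and one of
  v with source X, so the support of the product is finite.\<close>

lemma mult_closed:
  assumes u: "u \<in> carrier \<R>" and v: "v \<in> carrier \<R>" shows "u \<otimes>\<^sub>\<R> v \<in> carrier \<R>"
proof -
  let ?s = "\<lambda>u. {\<gamma> \<in> \<C> \<times> \<C>. u \<gamma> \<noteq> hom_zero (snd \<gamma>) (fst \<gamma>)}"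
  have "(Z, X) \<in> fst ` ?s u \<times> snd ` ?s v" if C: "Z \<in> \<C>" "X \<in> \<C>" and nz: "(u \<otimes>\<^sub>\<R> v) (Z, X) \<noteq> hom_zero X Z" for Z X
  proof (rule ccontr)
    assume "(Z, X) \<notin> fst ` ?s u \<times> snd ` ?s v"
    then have "{Y \<in> \<C>. u (Z, Y) \<noteq> hom_zero Y Z \<and> v (Y, X) \<noteq> hom_zero X Y} = {}"
      using C by (force simp: image_iff)
    note e = this
    interpret H: comm_group "hom_group A X Z" by (rule hom_comm_group[OF C(2,1)])
    show False using e nz unfolding mult_component[OF C(2,1)]
      by (simp only: H.finprod_empty hom_group_simps simp_thms)
  qed
  then have "?s (u \<otimes>\<^sub>\<R> v) \<subseteq> fst ` ?s u \<times> snd ` ?s v" by fastforce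
  moreover have "finite (fst ` ?s u \<times> snd ` ?s v)"
    using u v unfolding ring_carrier by (intro finite_cartesian_product finite_imageI) auto
  ultimately have "finite (?s (u \<otimes>\<^sub>\<R> v))" by (rule finite_subset)
  moreover have "(u \<otimes>\<^sub>\<R> v) (Z, X) \<in> Hom X Z" if "X \<in> \<C>" "Z \<in> \<C>" for X Z
    by (intro mult_component_in[OF that] subset_refl hom_zero_in hom_plus_in obj that
        hom_comp_in[OF obj[OF that(1)] ring_component[OF v that(1)] ring_component[OF u _ that(2)]])
  ultimately show ?thesis by (simp add: ring_carrier)
qed

text \<open>The index set of the product drops Y when a factor vanishes there; the composite is zero
  in that case, so the formula holds either way.\<close>

lemma mult_component_single:
  assumes C: "X \<in> \<C>" "Y \<in> \<C>" "Z \<in> \<C>" and u: "u \<in> carrier \<R>" and v: "v \<in> carrier \<R>"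
    and single: "\<And>W. W \<in> \<C> \<Longrightarrow> W \<noteq> Y \<Longrightarrow> u (Z, W) = hom_zero W Z \<or> v (W, X) = hom_zero X W"
  shows "(u \<otimes>\<^sub>\<R> v) (Z, X) = hom_comp X (u (Z, Y)) (v (Y, X))"
proof -
  interpret H: comm_group "hom_group A X Z" by (rule hom_comm_group[OF C(1,3)])
  let ?T = "{Y \<in> \<C>. u (Z, Y) \<noteq> hom_zero Y Z \<and> v (Y, X) \<noteq> hom_zero X Y}"
  have m: "hom_comp X (u (Z, Y)) (v (Y, X)) \<in> Hom X Z"
    by (rule hom_comp_in[OF obj[OF C(1)] ring_component[OF v C(1,2)] ring_component[OF u C(2,3)]])
  show ?thesis
  proof (cases "Y \<in> ?T")
    case True
    then have "?T = {Y}" using single by auto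
    then show ?thesis unfolding mult_component[OF C(1,3)] using m H.finprod_insert[of "{}" Y]
      by (simp add: Pi_iff del: Collect_empty_eq) (simp add: hom_plus_zero C)
  next
    case False
    then have e: "?T = {}" using single by blast
    have "hom_comp X (u (Z, Y)) (v (Y, X)) = hom_zero X Z"
      using False C hom_comp_zero_left[OF ring_component[OF v C(1,2)]]
        hom_comp_zero_right[OF obj[OF C(2)] obj[OF C(3)] ring_component[OF u C(2,3)]] by auto
    then show ?thesis unfolding mult_component[OF C(1,3)] e by simp
  qed
qed

lemma finsum_component:
  assumes C: "X \<in> \<C>" "Y \<in> \<C>" and S: "finite S" "S \<subseteq> \<C> \<times> \<C>" and h: "\<And>\<gamma>. \<gamma> \<in> S \<Longrightarrow> h \<gamma> \<in> Hom (snd \<gamma>) (fst \<gamma>)"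
  shows "finsum \<R> (\<lambda>\<gamma>. homogeneous A \<C> \<gamma> (h \<gamma>)) S (Y, X) = (if (Y, X) \<in> S then h (Y, X) else hom_zero X Y)"
  using S h
proof (induction S rule: finite_induct)
  case empty
  then show ?case using ring_zero[OF C] by simp
next
  case (insert \<gamma> S)
  have *: "homogeneous A \<C> \<delta> (h \<delta>) \<in> carrier \<R>" if "\<delta> \<in> insert \<gamma> S" for \<delta>
    using insert.prems(2)[OF that] insert.prems(1) that hg_carrier[of "snd \<delta>" "fst \<delta>"] by auto
  have "finsum \<R> (\<lambda>\<gamma>. homogeneous A \<C> \<gamma> (h \<gamma>)) (insert \<gamma> S) =
      homogeneous A \<C> \<gamma> (h \<gamma>) \<oplus>\<^sub>\<R> finsum \<R> (\<lambda>\<gamma>. homogeneous A \<C> \<gamma> (h \<gamma>)) S"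
    using insert.hyps * by (intro R.finsum_insert) auto
  moreover have "homogeneous A \<C> \<gamma> (h \<gamma>) (Y, X) = (if \<gamma> = (Y, X) then h (Y, X) else hom_zero X Y)"
    using hg_component[OF C, of "fst \<gamma>" "snd \<gamma>" "h \<gamma>"] by auto
  moreover have "finsum \<R> (\<lambda>\<gamma>. homogeneous A \<C> \<gamma> (h \<gamma>)) S (Y, X) = (if (Y, X) \<in> S then h (Y, X) else hom_zero X Y)"
    using insert by auto
  ultimately show ?case
    using insert.hyps(2) insert.prems(2)[of "(Y, X)"] by (auto simp: ring_add[OF C] hom_plus_zero[OF C] obj C)
qed

lemma ring_decompose:
  assumes u: "u \<in> carrier \<R>"
  shows "u = finsum \<R> (\<lambda>\<gamma>. homogeneous A \<C> \<gamma> (u \<gamma>)) {\<gamma> \<in> \<C> \<times> \<C>. u \<gamma> \<noteq> hom_zero (snd \<gamma>) (fst \<gamma>)}"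
    (is "_ = finsum _ ?h ?S")
proof -
  have h: "?h \<in> ?S \<rightarrow> carrier \<R>" using ring_component[OF u] by (auto intro: hg_carrier)
  have fin: "finite ?S" using u by (simp add: ring_carrier)
  show ?thesis
  proof (rule ring_eqI)
    show "finsum \<R> ?h ?S \<in> extensional (\<C> \<times> \<C>)" using R.finsum_closed[OF h] by simp
    fix X Y assume C: "X \<in> \<C>" "Y \<in> \<C>"
    have "finsum \<R> ?h ?S (Y, X) = (if (Y, X) \<in> ?S then u (Y, X) else hom_zero X Y)"
      using fin ring_component[OF u] by (intro finsum_component[OF C]) auto
    then show "u (Y, X) = finsum \<R> ?h ?S (Y, X)" using C by auto
  qed (use u in simp)
qed

lemma finsum_in_closed:
  assumes T: "\<zero>\<^sub>\<R> \<in> T" "T \<subseteq> carrier \<R>" "\<And>u v. u \<in> T \<Longrightarrow> v \<in> T \<Longrightarrow> u \<oplus>\<^sub>\<R> v \<in> T"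
    and "finite S" "\<And>s. s \<in> S \<Longrightarrow> w s \<in> T"
  shows "finsum \<R> w S \<in> T"
  using assms(4,5)
proof (induction S rule: finite_induct)
  case (insert s S)
  have "w t \<in> carrier \<R>" if "t \<in> insert s S" for t
    using subsetD[OF T(2) insert.prems[OF that]] .
  then have "finsum \<R> w (insert s S) = w s \<oplus>\<^sub>\<R> finsum \<R> w S"
    using insert.hyps by (intro R.finsum_insert Pi_I) simp_all
  then show ?case using T(3)[OF insert.prems[OF insertI1] insert.IH[OF insert.prems[OF insertI2]]] by (simp only:)
next
  case empty
  show ?case unfolding R.finsum_empty by (rule T(1))
qed

text \<open>An element is the finite sum of its homogeneous components, so additively closed sets
  can be tested on these.\<close>

lemma in_by_components:
  assumes T: "\<zero>\<^sub>\<R> \<in> T" "T \<subseteq> carrier \<R>" "\<And>u v. u \<in> T \<Longrightarrow> v \<in> T \<Longrightarrow> u \<oplus>\<^sub>\<R> v \<in> T"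
    and u: "u \<in> carrier \<R>" and hg: "\<And>X Y. X \<in> \<C> \<Longrightarrow> Y \<in> \<C> \<Longrightarrow> hg Y X (u (Y, X)) \<in> T"
  shows "u \<in> T"
proof (subst ring_decompose[OF u], rule finsum_in_closed[OF T])
  show "finite {\<gamma> \<in> \<C> \<times> \<C>. u \<gamma> \<noteq> hom_zero (snd \<gamma>) (fst \<gamma>)}" using u by (simp add: ring_carrier)
qed (auto intro: hg)

section \<open>Graded ideals as families of subsets of Hom spaces\<close>

lemma graded_subset_iff:
  assumes U: "additive_subgroup U \<R>"
  shows "graded_subset \<R> U \<longleftrightarrow> (\<forall>u\<in>U. \<forall>X\<in>\<C>. \<forall>Y\<in>\<C>. hg Y X (u (Y, X)) \<in> U)" (is "_ \<longleftrightarrow> ?p")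
proof -
  interpret U: additive_subgroup U \<R> by fact
  let ?D = "{finsum \<R> u F | u F. finite F \<and> F \<subseteq> degrees \<R> \<and> (\<forall>\<gamma> \<in> F. u \<gamma> \<in> U \<inter> grade \<R> \<gamma>)}"
  have deg: "degrees \<R> = \<C> \<times> \<C>" and gr: "grade \<R> (Y, X) = {hg Y X f | f. f \<in> Hom X Y}" for X Y
    by (simp_all add: skeleton_ring_def Let_def)
  have DU: "?D \<subseteq> U" by (auto intro!: finsum_in_closed U.a_subset[THEN subsetD])
  show ?thesis
  proof
    assume "graded_subset \<R> U"
    then have UD: "U = ?D" by (simp add: graded_subset_def)
    show ?p
    proof (intro ballI)
      fix u X Y assume u: "u \<in> U" and C: "X \<in> \<C>" "Y \<in> \<C>"
      have "u \<in> ?D" using u unfolding UD[symmetric] .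
      then obtain w F where "u = finsum \<R> w F" "finite F" "F \<subseteq> degrees \<R>" "\<forall>\<gamma>\<in>F. w \<gamma> \<in> U \<inter> grade \<R> \<gamma>"
        by blast
      then have w: "u = finsum \<R> w F" "finite F" "F \<subseteq> \<C> \<times> \<C>" "\<And>\<gamma>. \<gamma> \<in> F \<Longrightarrow> w \<gamma> \<in> U \<inter> grade \<R> \<gamma>"
        unfolding deg by auto
      \<comment> \<open>The morphism underlying each homogeneous summand; through it the components
        of u are read off from the sum.\<close>
      define h where "h \<gamma> = (SOME f. f \<in> Hom (snd \<gamma>) (fst \<gamma>) \<and> w \<gamma> = homogeneous A \<C> \<gamma> f)" for \<gamma>
      have h: "h \<gamma> \<in> Hom (snd \<gamma>) (fst \<gamma>) \<and> w \<gamma> = homogeneous A \<C> \<gamma> (h \<gamma>)" if "\<gamma> \<in> F" for \<gamma>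
      proof -
        have "\<exists>f. f \<in> Hom (snd \<gamma>) (fst \<gamma>) \<and> w \<gamma> = homogeneous A \<C> \<gamma> f"
          using w(4)[OF that] gr[of "fst \<gamma>" "snd \<gamma>"] by auto
        from someI_ex[OF this] show ?thesis unfolding h_def .
      qed
      have "u = finsum \<R> (\<lambda>\<gamma>. homogeneous A \<C> \<gamma> (h \<gamma>)) F"
        unfolding w(1) using h w(4) U.a_subset by (intro R.finsum_cong') auto
      then have "u (Y, X) = (if (Y, X) \<in> F then h (Y, X) else hom_zero X Y)"
        using finsum_component[OF C w(2,3)] h by simp
      then show "hg Y X (u (Y, X)) \<in> U" using h[of "(Y, X)"] w(4)[of "(Y, X)"] by (auto simp: hg_zero)
    qed
  next
    assume p: ?p
    have "u \<in> ?D" if "u \<in> U" for u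
    proof -
      have u: "u \<in> carrier \<R>" using U.a_subset that by blast
      let ?S = "{\<gamma> \<in> \<C> \<times> \<C>. u \<gamma> \<noteq> hom_zero (snd \<gamma>) (fst \<gamma>)}"
      have "finite ?S" using u by (simp add: ring_carrier)
      moreover have "homogeneous A \<C> \<gamma> (u \<gamma>) \<in> U \<inter> grade \<R> \<gamma>" if "\<gamma> \<in> ?S" for \<gamma>
        using that p \<open>u \<in> U\<close> ring_component[OF u] gr by (cases \<gamma>) auto
      ultimately show ?thesis using ring_decompose[OF u] deg by blast
    qed
    then show "graded_subset \<R> U" unfolding graded_subset_def using DU by blast
  qed
qed

text \<open>\<open>comp_ideal\<close> and \<open>part\<close> are the two directions of the
  dictionary between graded subgroups and families in Hom spaces. Families take the source first,
  whereas a morphism X \<rightarrow> Y has degree (Y, X).\<close>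

definition comp_ideal where
  "comp_ideal F = {u \<in> carrier \<R>. \<forall>X\<in>\<C>. \<forall>Y\<in>\<C>. u (Y, X) \<in> F X Y}"

definition part where
  "part U X Y = {f \<in> Hom X Y. hg Y X f \<in> U}"

lemma comp_idealD: "u \<in> comp_ideal F \<Longrightarrow> u \<in> carrier \<R>" "u \<in> comp_ideal F \<Longrightarrow> X \<in> \<C> \<Longrightarrow> Y \<in> \<C> \<Longrightarrow> u (Y, X) \<in> F X Y"
  by (simp_all add: comp_ideal_def)

lemma comp_ideal_hg:
  assumes "X \<in> \<C>" "Y \<in> \<C>" "f \<in> Hom X Y" "f \<in> F X Y" "\<And>X Y. X \<in> \<C> \<Longrightarrow> Y \<in> \<C> \<Longrightarrow> hom_zero X Y \<in> F X Y"
  shows "hg Y X f \<in> comp_ideal F"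
  using assms by (auto simp: comp_ideal_def hg_carrier hg_component)

lemma hom_neg_unique:
  assumes C: "X \<in> \<C>" "Y \<in> \<C>" and "f \<in> Hom X Y" "g \<in> Hom X Y" "h \<in> Hom X Y"
    "hom_plus X Y f g = hom_zero X Y" "hom_plus X Y h f = hom_zero X Y"
  shows "g = h"
proof -
  interpret H: comm_group "hom_group A X Y" by (rule hom_comm_group[OF C])
  show ?thesis using H.inv_unique[of h f g] assms by simp
qed

lemma comp_ideal_graded:
  assumes Hom: "\<And>X Y. X \<in> \<C> \<Longrightarrow> Y \<in> \<C> \<Longrightarrow> F X Y \<subseteq> Hom X Y"
    and zero: "\<And>X Y. X \<in> \<C> \<Longrightarrow> Y \<in> \<C> \<Longrightarrow> hom_zero X Y \<in> F X Y"
    and plus: "\<And>X Y f g. X \<in> \<C> \<Longrightarrow> Y \<in> \<C> \<Longrightarrow> f \<in> F X Y \<Longrightarrow> g \<in> F X Y \<Longrightarrow> hom_plus X Y f g \<in> F X Y"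
    and neg: "\<And>X Y f. X \<in> \<C> \<Longrightarrow> Y \<in> \<C> \<Longrightarrow> f \<in> F X Y \<Longrightarrow> \<exists>g \<in> F X Y. hom_plus X Y f g = hom_zero X Y"
  shows "additive_subgroup (comp_ideal F) \<R> \<and> graded_subset \<R> (comp_ideal F)"
proof -
  have "additive_subgroup (comp_ideal F) \<R>"
  proof (rule additive_subgroupI, rule group.subgroupI[OF R.a_group])
    show "comp_ideal F \<subseteq> carrier (add_monoid \<R>)" by (auto simp: comp_ideal_def)
    show "comp_ideal F \<noteq> {}" using zero R.zero_closed by (auto simp: comp_ideal_def ring_zero intro!: exI[of _ "\<zero>\<^sub>\<R>"])
  next
    fix u assume u: "u \<in> comp_ideal F"
    have "(\<ominus>\<^sub>\<R> u) (Y, X) \<in> F X Y" if C: "X \<in> \<C>" "Y \<in> \<C>" for X Y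
    proof -
      obtain g where g: "g \<in> F X Y" "hom_plus X Y (u (Y, X)) g = hom_zero X Y"
        using neg[OF C comp_idealD(2)[OF u C]] by blast
      have "hom_plus X Y ((\<ominus>\<^sub>\<R> u) (Y, X)) (u (Y, X)) = hom_zero X Y"
        using R.l_neg[OF comp_idealD(1)[OF u]] by (simp flip: ring_add[OF C] ring_zero[OF C])
      then have "g = (\<ominus>\<^sub>\<R> u) (Y, X)"
        using hom_neg_unique[OF C _ _ _ g(2)] Hom[OF C] g(1) ring_component[OF comp_idealD(1)[OF u] C]
          ring_component[OF R.a_inv_closed[OF comp_idealD(1)[OF u]] C] by blast
      with g show ?thesis by simp
    qed
    then show "inv\<^bsub>add_monoid \<R>\<^esub> u \<in> comp_ideal F"
      using R.a_inv_closed[OF comp_idealD(1)[OF u]] by (simp add: comp_ideal_def a_inv_def)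
  next
    fix u v assume "u \<in> comp_ideal F" "v \<in> comp_ideal F"
    then show "u \<otimes>\<^bsub>add_monoid \<R>\<^esub> v \<in> comp_ideal F" using plus by (auto simp: comp_ideal_def ring_add)
  qed
  moreover have "hg Y X (u (Y, X)) \<in> comp_ideal F" if "u \<in> comp_ideal F" "X \<in> \<C>" "Y \<in> \<C>" for u X Y
    using comp_idealD[OF that(1)] ring_component[OF comp_idealD(1)[OF that(1)]] that(2,3) zero
    by (intro comp_ideal_hg) auto
  ultimately show ?thesis using graded_subset_iff by blast
qed

text \<open>Right multiplication is precomposition and leaves the target alone, so a graded right
  ideal is an independent choice of a subfunctor of Hom(-, Y) for each Y.\<close>

definition right_family where
  "right_family F \<longleftrightarrow> (\<forall>Y\<in>\<C>. right_closed Y (\<lambda>X. F X Y))"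

definition left_family where
  "left_family F \<longleftrightarrow> (\<forall>X\<in>\<C>. left_closed X (F X))"

lemma right_familyD:
  assumes "right_family F" "X \<in> \<C>" "Y \<in> \<C>"
  shows "F X Y \<subseteq> Hom X Y" "hom_zero X Y \<in> F X Y" "f \<in> F X Y \<Longrightarrow> g \<in> F X Y \<Longrightarrow> hom_plus X Y f g \<in> F X Y"
    "f \<in> F X Y \<Longrightarrow> W \<in> \<C> \<Longrightarrow> k \<in> Hom W X \<Longrightarrow> hom_comp W f k \<in> F W Y"
  using assms unfolding right_family_def right_closed_def by blast+

lemma left_familyD:
  assumes "left_family F" "X \<in> \<C>" "Y \<in> \<C>"
  shows "F X Y \<subseteq> Hom X Y" "hom_zero X Y \<in> F X Y" "f \<in> F X Y \<Longrightarrow> g \<in> F X Y \<Longrightarrow> hom_plus X Y f g \<in> F X Y"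
    "f \<in> F X Y \<Longrightarrow> W \<in> \<C> \<Longrightarrow> k \<in> Hom Y W \<Longrightarrow> hom_comp X k f \<in> F X W"
  using assms unfolding left_family_def left_closed_def by blast+

text \<open>Supplies negatives: a family that is stable under composition contains minus f as the
  composite of f with minus the identity.\<close>

lemma hom_minus_id:
  assumes "X \<in> \<C>" obtains n where "n \<in> Hom X X" "hom_plus X X (hom_id X) n = hom_zero X X"
proof -
  interpret H: comm_group "hom_group A X X" by (rule hom_comm_group[OF assms assms])
  have "hom_id X \<in> carrier (hom_group A X X)" using hom_id_in[OF obj[OF assms]] by simp
  from H.inv_closed[OF this] H.r_inv[OF this] show ?thesis by (intro that) simp_all
qed

lemma right_family_ideal:
  assumes F: "right_family F" shows "graded_right_ideal \<R> (comp_ideal F)"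
proof -
  note D = right_familyD[OF F]
  have "\<exists>g\<in>F X Y. hom_plus X Y f g = hom_zero X Y" if C: "X \<in> \<C>" "Y \<in> \<C>" and f: "f \<in> F X Y" for X Y f
  proof -
    obtain n where n: "n \<in> Hom X X" "hom_plus X X (hom_id X) n = hom_zero X X" by (rule hom_minus_id[OF C(1)])
    have fH: "f \<in> Hom X Y" using D(1)[OF C] f by blast
    have "hom_plus X Y f (hom_comp X f n) = hom_zero X Y"
      using hom_comp_plus_right[OF hom_id_in[OF obj[OF C(1)]] n(1) fH]
      by (simp add: n(2) hom_comp_id_right[OF fH] hom_comp_zero_right[OF obj[OF C(1)] obj[OF C(2)] fH])
    then show ?thesis using D(4)[OF C f C(1) n(1)] by blast
  qed
  then have "additive_subgroup (comp_ideal F) \<R> \<and> graded_subset \<R> (comp_ideal F)"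
    by (intro comp_ideal_graded D(1-3))
  moreover have "u \<otimes>\<^sub>\<R> r \<in> comp_ideal F" if u: "u \<in> comp_ideal F" and r: "r \<in> carrier \<R>" for u r
  proof -
    have "(u \<otimes>\<^sub>\<R> r) (Z, X) \<in> F X Z" if C: "X \<in> \<C>" "Z \<in> \<C>" for X Z
      by (intro mult_component_in[OF C] D(1-3) C D(4)[OF _ _ comp_idealD(2)[OF u]] ring_component[OF r]) assumption+
    then show ?thesis using mult_closed[OF comp_idealD(1)[OF u] r] by (simp add: comp_ideal_def)
  qed
  ultimately show ?thesis unfolding graded_right_ideal_def by blast
qed

lemma left_family_ideal:
  assumes F: "left_family F" shows "graded_left_ideal \<R> (comp_ideal F)"
proof -
  note D = left_familyD[OF F]
  have "\<exists>g\<in>F X Y. hom_plus X Y f g = hom_zero X Y" if C: "X \<in> \<C>" "Y \<in> \<C>" and f: "f \<in> F X Y" for X Y f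
  proof -
    obtain n where n: "n \<in> Hom Y Y" "hom_plus Y Y (hom_id Y) n = hom_zero Y Y" by (rule hom_minus_id[OF C(2)])
    have fH: "f \<in> Hom X Y" using D(1)[OF C] f by blast
    have "hom_plus X Y f (hom_comp X n f) = hom_zero X Y"
      using hom_comp_plus_left[OF fH, of Y "hom_id Y" n]
      by (simp add: n(2) hom_comp_id_left[OF fH] hom_comp_zero_left[OF fH])
    then show ?thesis using D(4)[OF C f C(2) n(1)] by blast
  qed
  then have "additive_subgroup (comp_ideal F) \<R> \<and> graded_subset \<R> (comp_ideal F)"
    by (intro comp_ideal_graded D(1-3))
  moreover have "r \<otimes>\<^sub>\<R> u \<in> comp_ideal F" if u: "u \<in> comp_ideal F" and r: "r \<in> carrier \<R>" for u r
  proof -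
    have "(r \<otimes>\<^sub>\<R> u) (Z, X) \<in> F X Z" if C: "X \<in> \<C>" "Z \<in> \<C>" for X Z
      by (intro mult_component_in[OF C] D(1-3) C D(4)[OF _ _ comp_idealD(2)[OF u]] ring_component[OF r]) assumption+
    then show ?thesis using mult_closed[OF r comp_idealD(1)[OF u]] by (simp add: comp_ideal_def)
  qed
  ultimately show ?thesis unfolding graded_left_ideal_def by blast
qed

lemma part_add:
  assumes U: "additive_subgroup U \<R>" and C: "X \<in> \<C>" "Y \<in> \<C>"
  shows "part U X Y \<subseteq> Hom X Y" "hom_zero X Y \<in> part U X Y"
    "f \<in> part U X Y \<Longrightarrow> g \<in> part U X Y \<Longrightarrow> hom_plus X Y f g \<in> part U X Y"
proof -
  interpret U: additive_subgroup U \<R> by fact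
  show "part U X Y \<subseteq> Hom X Y" "hom_zero X Y \<in> part U X Y"
    "f \<in> part U X Y \<Longrightarrow> g \<in> part U X Y \<Longrightarrow> hom_plus X Y f g \<in> part U X Y"
    using obj C by (auto simp: part_def hg_zero hg_plus intro: hom_plus_in)
qed

lemma graded_eq_comp_ideal:
  assumes U: "additive_subgroup U \<R>" and g: "graded_subset \<R> U"
  shows "U = comp_ideal (part U)"
proof
  interpret U: additive_subgroup U \<R> by fact
  show "U \<subseteq> comp_ideal (part U)"
    using g[unfolded graded_subset_iff[OF U]] U.a_subset
    by (auto simp: comp_ideal_def part_def ring_component subsetD[OF U.a_subset])
  show "comp_ideal (part U) \<subseteq> U"
    by (rule subsetI, rule in_by_components[OF U.zero_closed U.a_subset U.a_closed])
      (auto simp: comp_ideal_def part_def)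
qed

lemma right_ideal_part:
  assumes U: "graded_right_ideal \<R> U"
  shows "right_family (part U)" "U = comp_ideal (part U)"
proof -
  have *: "additive_subgroup U \<R>" "graded_subset \<R> U"
    "\<And>u r. u \<in> U \<Longrightarrow> r \<in> carrier \<R> \<Longrightarrow> u \<otimes>\<^sub>\<R> r \<in> U"
    using U unfolding graded_right_ideal_def by auto
  show "U = comp_ideal (part U)" by (rule graded_eq_comp_ideal[OF *(1,2)])
  have "hom_comp W f k \<in> part U W Y" if "X \<in> \<C>" "Y \<in> \<C>" "f \<in> part U X Y" "W \<in> \<C>" "k \<in> Hom W X" for W X Y f k
  proof -
    have f: "f \<in> Hom X Y" "hg Y X f \<in> U" using that(3) by (simp_all add: part_def)
    have "hg Y W (hom_comp W f k) \<in> U"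
      using *(3)[OF f(2) hg_carrier[OF that(4,1,5)]] unfolding hg_mult[OF that(4,1,2,5) f(1)] .
    then show ?thesis using hom_comp_in[OF obj[OF that(4)] that(5) f(1)] by (simp add: part_def)
  qed
  then show "right_family (part U)"
    unfolding right_family_def right_closed_def by (intro ballI conjI part_add[OF *(1)])
qed

lemma left_ideal_part:
  assumes U: "graded_left_ideal \<R> U"
  shows "left_family (part U)" "U = comp_ideal (part U)"
proof -
  have *: "additive_subgroup U \<R>" "graded_subset \<R> U"
    "\<And>u r. u \<in> U \<Longrightarrow> r \<in> carrier \<R> \<Longrightarrow> r \<otimes>\<^sub>\<R> u \<in> U"
    using U unfolding graded_left_ideal_def by auto
  show "U = comp_ideal (part U)" by (rule graded_eq_comp_ideal[OF *(1,2)])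
  have "hom_comp X k f \<in> part U X W" if "X \<in> \<C>" "Y \<in> \<C>" "f \<in> part U X Y" "W \<in> \<C>" "k \<in> Hom Y W" for W X Y f k
  proof -
    have f: "f \<in> Hom X Y" "hg Y X f \<in> U" using that(3) by (simp_all add: part_def)
    have "hg W X (hom_comp X k f) \<in> U"
      using *(3)[OF f(2) hg_carrier[OF that(2,4,5)]] unfolding hg_mult[OF that(1,2,4) f(1) that(5)] .
    then show ?thesis using hom_comp_in[OF obj[OF that(1)] f(1) that(5)] by (simp add: part_def)
  qed
  then show "left_family (part U)"
    unfolding left_family_def left_closed_def by (intro ballI conjI part_add[OF *(1)])
qed

lemma comp_ideal_mono: "(\<And>X Y. X \<in> \<C> \<Longrightarrow> Y \<in> \<C> \<Longrightarrow> F X Y \<subseteq> G X Y) \<Longrightarrow> comp_ideal F \<subseteq> comp_ideal G"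
  unfolding comp_ideal_def by blast

lemma comp_ideal_subsetD:
  assumes "comp_ideal F \<subseteq> comp_ideal G" "\<And>X Y. X \<in> \<C> \<Longrightarrow> Y \<in> \<C> \<Longrightarrow> F X Y \<subseteq> Hom X Y"
    "\<And>X Y. X \<in> \<C> \<Longrightarrow> Y \<in> \<C> \<Longrightarrow> hom_zero X Y \<in> F X Y" and C: "X \<in> \<C>" "Y \<in> \<C>"
  shows "F X Y \<subseteq> G X Y"
proof
  fix f assume f: "f \<in> F X Y"
  then have "hg Y X f \<in> comp_ideal G"
    using comp_ideal_hg[where F = F, OF C _ f assms(3)] assms(1) assms(2)[OF C] by blast
  from comp_idealD(2)[OF this C] show "f \<in> G X Y" by (simp add: hg_component C)
qed

lemma comp_ideal_zero: "comp_ideal (\<lambda>X Y. {hom_zero X Y}) = {\<zero>\<^sub>\<R>}"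
  by (auto simp: comp_ideal_def ring_zero intro!: ring_eqI)

lemma comp_ideal_zero_iff:
  assumes "\<And>X Y. X \<in> \<C> \<Longrightarrow> Y \<in> \<C> \<Longrightarrow> F X Y \<subseteq> Hom X Y"
    "\<And>X Y. X \<in> \<C> \<Longrightarrow> Y \<in> \<C> \<Longrightarrow> hom_zero X Y \<in> F X Y"
  shows "comp_ideal F = {\<zero>\<^sub>\<R>} \<longleftrightarrow> (\<forall>X\<in>\<C>. \<forall>Y\<in>\<C>. F X Y = {hom_zero X Y})"
proof
  assume "comp_ideal F = {\<zero>\<^sub>\<R>}"
  then have "comp_ideal F \<subseteq> comp_ideal (\<lambda>X Y. {hom_zero X Y})" unfolding comp_ideal_zero by simp
  from comp_ideal_subsetD[OF this assms] show "\<forall>X\<in>\<C>. \<forall>Y\<in>\<C>. F X Y = {hom_zero X Y}"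
    using assms(2) by blast
next
  assume "\<forall>X\<in>\<C>. \<forall>Y\<in>\<C>. F X Y = {hom_zero X Y}"
  then have "comp_ideal F = comp_ideal (\<lambda>X Y. {hom_zero X Y})" unfolding comp_ideal_def by auto
  then show "comp_ideal F = {\<zero>\<^sub>\<R>}" unfolding comp_ideal_zero .
qed

section \<open>Local units\<close>

lemma local_unit_eq: "local_unit \<R> (E, E) = hg E E (hom_id E)"
  by (simp add: skeleton_ring_def Let_def hom_id_def)

lemma idents_eq: "idents \<R> = {(E, E) | E. E \<in> \<C>}"
  by (simp add: skeleton_ring_def Let_def)

lemma unit_mult:
  assumes E: "E \<in> \<C>" and u: "u \<in> carrier \<R>" and C: "X \<in> \<C>" "Z \<in> \<C>"
  shows "(local_unit \<R> (E, E) \<otimes>\<^sub>\<R> u) (Z, X) = (if Z = E then u (Z, X) else hom_zero X Z)"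
    and "(u \<otimes>\<^sub>\<R> local_unit \<R> (E, E)) (Z, X) = (if X = E then u (Z, X) else hom_zero X Z)"
proof -
  have e: "hg E E (hom_id E) \<in> carrier \<R>" by (rule hg_carrier[OF E E hom_id_in[OF obj[OF E]]])
  have "(hg E E (hom_id E) \<otimes>\<^sub>\<R> u) (Z, X) = hom_comp X (hg E E (hom_id E) (Z, E)) (u (E, X))"
    by (rule mult_component_single[OF C(1) E C(2) e u]) (simp add: hg_component C)
  then show "(local_unit \<R> (E, E) \<otimes>\<^sub>\<R> u) (Z, X) = (if Z = E then u (Z, X) else hom_zero X Z)"
    using ring_component[OF u C(1) E]
    by (simp add: local_unit_eq hg_component C E hom_comp_id_left hom_comp_zero_left)
  have "(u \<otimes>\<^sub>\<R> hg E E (hom_id E)) (Z, X) = hom_comp X (u (Z, E)) (hg E E (hom_id E) (E, X))"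
    by (rule mult_component_single[OF C(1) E C(2) u e]) (simp add: hg_component C)
  then show "(u \<otimes>\<^sub>\<R> local_unit \<R> (E, E)) (Z, X) = (if X = E then u (Z, X) else hom_zero X Z)"
    using hom_comp_zero_right[OF obj[OF E] obj[OF C(2)] ring_component[OF u E C(2)], of X] ring_component[OF u E C(2)]
    by (simp add: local_unit_eq hg_component C E hom_comp_id_right)
qed

text \<open>Multiplication from the left by a local unit keeps the components with target E and
  deletes all others.\<close>

lemma right_unit_ideal:
  assumes E: "E \<in> \<C>" and zero: "\<And>X Y. X \<in> \<C> \<Longrightarrow> Y \<in> \<C> \<Longrightarrow> hom_zero X Y \<in> F X Y"
  shows "{local_unit \<R> (E, E) \<otimes>\<^sub>\<R> u | u. u \<in> comp_ideal F} =
    comp_ideal (\<lambda>X Y. if Y = E then F X Y else {hom_zero X Y})" (is "?l = ?r")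
proof
  have e: "local_unit \<R> (E, E) \<in> carrier \<R>"
    unfolding local_unit_eq by (rule hg_carrier[OF E E hom_id_in[OF obj[OF E]]])
  show "?l \<subseteq> ?r" by (auto simp: comp_ideal_def unit_mult(1)[OF E] mult_closed[OF e])
  show "?r \<subseteq> ?l"
  proof
    fix u assume u: "u \<in> ?r"
    have "u (Y, X) \<in> F X Y" if C: "X \<in> \<C>" "Y \<in> \<C>" for X Y
      using comp_idealD(2)[OF u C] zero[OF C] by (simp split: if_splits)
    then have "u \<in> comp_ideal F" using comp_idealD(1)[OF u] by (simp add: comp_ideal_def)
    moreover have "u = local_unit \<R> (E, E) \<otimes>\<^sub>\<R> u"
    proof (rule ring_eqI)
      fix X Y assume C: "X \<in> \<C>" "Y \<in> \<C>"
      show "u (Y, X) = (local_unit \<R> (E, E) \<otimes>\<^sub>\<R> u) (Y, X)"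
        using comp_idealD(2)[OF u C] unfolding unit_mult(1)[OF E comp_idealD(1)[OF u] C] by (simp split: if_splits)
    qed (simp_all add: comp_idealD(1)[OF u])
    ultimately show "u \<in> ?l" by blast
  qed
qed

lemma left_unit_ideal:
  assumes E: "E \<in> \<C>" and zero: "\<And>X Y. X \<in> \<C> \<Longrightarrow> Y \<in> \<C> \<Longrightarrow> hom_zero X Y \<in> F X Y"
  shows "{u \<otimes>\<^sub>\<R> local_unit \<R> (E, E) | u. u \<in> comp_ideal F} =
    comp_ideal (\<lambda>X Y. if X = E then F X Y else {hom_zero X Y})" (is "?l = ?r")
proof
  have e: "local_unit \<R> (E, E) \<in> carrier \<R>"
    unfolding local_unit_eq by (rule hg_carrier[OF E E hom_id_in[OF obj[OF E]]])
  show "?l \<subseteq> ?r" by (auto simp: comp_ideal_def unit_mult(2)[OF E] mult_closed[OF _ e])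
  show "?r \<subseteq> ?l"
  proof
    fix u assume u: "u \<in> ?r"
    have "u (Y, X) \<in> F X Y" if C: "X \<in> \<C>" "Y \<in> \<C>" for X Y
      using comp_idealD(2)[OF u C] zero[OF C] by (simp split: if_splits)
    then have "u \<in> comp_ideal F" using comp_idealD(1)[OF u] by (simp add: comp_ideal_def)
    moreover have "u = u \<otimes>\<^sub>\<R> local_unit \<R> (E, E)"
    proof (rule ring_eqI)
      fix X Y assume C: "X \<in> \<C>" "Y \<in> \<C>"
      show "u (Y, X) = (u \<otimes>\<^sub>\<R> local_unit \<R> (E, E)) (Y, X)"
        using comp_idealD(2)[OF u C] unfolding unit_mult(2)[OF E comp_idealD(1)[OF u] C] by (simp split: if_splits)
    qed (simp_all add: comp_idealD(1)[OF u])
    ultimately show "u \<in> ?l" by blast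
  qed
qed

section \<open>Gr-maximal right ideals and the graded radical\<close>

lemma carrier_eq_comp_ideal: "carrier \<R> = comp_ideal Hom"
  by (auto simp: comp_ideal_def ring_component)

text \<open>Properness is controlled by one identity morphism: since V contains all morphisms with
  targets other than Y, a graded right ideal above V is proper exactly when it misses the identity
  of Y. This condition passes to unions of chains, so Zorn's lemma applies without a global
  unit.\<close>

lemma gr_maximal_above:
  assumes Y: "Y \<in> \<C>" and V: "graded_right_ideal \<R> V" "hg Y Y (hom_id Y) \<notin> V"
    and top: "\<And>X Z f. X \<in> \<C> \<Longrightarrow> Z \<in> \<C> \<Longrightarrow> Z \<noteq> Y \<Longrightarrow> f \<in> Hom X Z \<Longrightarrow> hg Z X f \<in> V"
  obtains M where "gr_maximal_right_ideal \<R> M" "V \<subseteq> M" "hg Y Y (hom_id Y) \<notin> M"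
proof -
  let ?e = "hg Y Y (hom_id Y)"
  let ?P = "{W. graded_right_ideal \<R> W \<and> V \<subseteq> W \<and> ?e \<notin> W}"
  have "\<exists>M\<in>?P. \<forall>W\<in>?P. M \<subseteq> W \<longrightarrow> W = M"
  proof (rule subset_Zorn_nonempty)
    show "?P \<noteq> {}" using V by blast
    fix \<W> assume ne: "\<W> \<noteq> {}" and chain: "subset.chain ?P \<W>"
    have W: "graded_right_ideal \<R> W" "V \<subseteq> W" "?e \<notin> W" if "W \<in> \<W>" for W
      using chain that unfolding subset_chain_def by blast+
    have tot: "W \<subseteq> W' \<or> W' \<subseteq> W" if "W \<in> \<W>" "W' \<in> \<W>" for W W'
      using chain that unfolding subset_chain_def by blast
    have "additive_subgroup W \<R> \<and> (\<forall>u\<in>W. \<forall>r\<in>carrier \<R>. u \<otimes>\<^sub>\<R> r \<in> W) \<and>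
        (\<forall>u\<in>W. \<forall>X\<in>\<C>. \<forall>Z\<in>\<C>. hg Z X (u (Z, X)) \<in> W)" if "W \<in> \<W>" for W
      using W(1)[OF that] graded_subset_iff[of W] unfolding graded_right_ideal_def by simp
    then have sub: "\<And>W. W \<in> \<W> \<Longrightarrow> additive_subgroup W \<R>"
        "\<And>W u r. W \<in> \<W> \<Longrightarrow> u \<in> W \<Longrightarrow> r \<in> carrier \<R> \<Longrightarrow> u \<otimes>\<^sub>\<R> r \<in> W"
        "\<And>W u X Z. W \<in> \<W> \<Longrightarrow> u \<in> W \<Longrightarrow> X \<in> \<C> \<Longrightarrow> Z \<in> \<C> \<Longrightarrow> hg Z X (u (Z, X)) \<in> W"
      by simp_all
    have add: "additive_subgroup (\<Union>\<W>) \<R>"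
    proof (rule additive_subgroupI, rule group.subgroupI[OF R.a_group])
      show "\<Union>\<W> \<subseteq> carrier (add_monoid \<R>)"
        using additive_subgroup.a_subset[OF sub(1)] by (intro Union_least) simp
      obtain W where "W \<in> \<W>" using ne by blast
      then show "\<Union>\<W> \<noteq> {}" using additive_subgroup.zero_closed[OF sub(1)] by blast
    next
      fix u assume "u \<in> \<Union>\<W>"
      then obtain W where "W \<in> \<W>" "u \<in> W" by (rule UnionE)
      then show "inv\<^bsub>add_monoid \<R>\<^esub> u \<in> \<Union>\<W>"
        by (intro UnionI subgroup.m_inv_closed[OF additive_subgroup.a_subgroup[OF sub(1)]])
    next
      fix u v assume "u \<in> \<Union>\<W>" "v \<in> \<Union>\<W>"
      then obtain W W' where WW: "u \<in> W" "v \<in> W'" "W \<in> \<W>" "W' \<in> \<W>" by blast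
      then obtain W'' where "u \<in> W''" "v \<in> W''" "W'' \<in> \<W>" using tot[OF WW(3,4)] by blast
      then show "u \<otimes>\<^bsub>add_monoid \<R>\<^esub> v \<in> \<Union>\<W>"
        using UnionI[OF _ additive_subgroup.a_closed[OF sub(1)]] by simp
    qed
    have "hg Z X (u (Z, X)) \<in> \<Union>\<W>" if "u \<in> \<Union>\<W>" "X \<in> \<C>" "Z \<in> \<C>" for u X Z
      using that(1) by (rule UnionE) (rule UnionI, assumption, rule sub(3)[OF _ _ that(2,3)])
    then have gr: "graded_subset \<R> (\<Union>\<W>)" unfolding graded_subset_iff[OF add] by (intro ballI)
    have "u \<otimes>\<^sub>\<R> r \<in> \<Union>\<W>" if "u \<in> \<Union>\<W>" "r \<in> carrier \<R>" for u r
      using that(1) by (rule UnionE) (rule UnionI, assumption, rule sub(2)[OF _ _ that(2)])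
    then have "graded_right_ideal \<R> (\<Union>\<W>)" unfolding graded_right_ideal_def using add gr by (intro conjI ballI)
    moreover obtain W where "W \<in> \<W>" using ne by blast
    then have "V \<subseteq> \<Union>\<W>" using W(2) by (intro order_trans[OF W(2) Union_upper])
    moreover have "?e \<notin> \<Union>\<W>" using W(3) by (auto elim!: UnionE)
    ultimately show "\<Union>\<W> \<in> ?P" by simp
  qed
  then obtain M where "M \<in> ?P" and maximal: "\<forall>W\<in>?P. M \<subseteq> W \<longrightarrow> W = M" ..
  then have M: "graded_right_ideal \<R> M" "V \<subseteq> M" "?e \<notin> M" by simp_all
  have max: "W = M" if "graded_right_ideal \<R> W" "V \<subseteq> W" "?e \<notin> W" "M \<subseteq> W" for W
    using bspec[OF maximal, of W] that by simp
  have "W = M" if W: "graded_right_ideal \<R> W" "W \<noteq> carrier \<R>" "M \<subseteq> W" for W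
  proof (rule max[OF W(1) _ _ W(3)])
    show "V \<subseteq> W" using M(2) W(3) by blast
    have sub: "additive_subgroup W \<R>" "\<And>u r. u \<in> W \<Longrightarrow> r \<in> carrier \<R> \<Longrightarrow> u \<otimes>\<^sub>\<R> r \<in> W"
      using W(1) unfolding graded_right_ideal_def by simp_all
    interpret W: additive_subgroup W \<R> by (rule sub(1))
    show "?e \<notin> W"
    proof
      assume e: "?e \<in> W"
      have hg: "hg Z X f \<in> W" if C: "X \<in> \<C>" "Z \<in> \<C>" "f \<in> Hom X Z" for X Z f
      proof (cases "Z = Y")
        case True
        have "?e \<otimes>\<^sub>\<R> hg Y X f \<in> W" by (rule sub(2)[OF e hg_carrier[OF C(1) Y]]) (use C True in simp)
        then show ?thesis using C True hom_id_in[OF obj[OF Y]] by (simp add: hg_mult hom_comp_id_left)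
      next
        case False
        then show ?thesis using top[OF C(1,2) False C(3)] M(2) W(3) by blast
      qed
      have all: "u \<in> W" if u: "u \<in> carrier \<R>" for u
        by (rule in_by_components[OF W.zero_closed W.a_subset W.a_closed u hg]) (use ring_component[OF u] in simp_all)
      have "W = carrier \<R>" by (rule equalityI[OF W.a_subset subsetI[OF all]])
      with W(2) show False ..
    qed
  qed
  moreover have "M \<noteq> carrier \<R>" using M(3) hg_carrier[OF Y Y hom_id_in[OF obj[OF Y]]] by blast
  ultimately have "gr_maximal_right_ideal \<R> M" unfolding gr_maximal_right_ideal_def using M(1) by blast
  then show ?thesis using M(2,3) by (rule that)
qed

text \<open>If f were outside U, then U + f R would be the whole ring by maximality, and the
  identity of Y would be u + f k with u in U. As f is radical, u = 1 - f k is invertible, which puts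
  the identity of Y, and hence f, into U.\<close>

lemma Rad_in_gr_maximal:
  assumes U: "gr_maximal_right_ideal \<R> U" and C: "X \<in> \<C>" "Y \<in> \<C>" and f: "f \<in> Rad X Y"
  shows "hg Y X f \<in> U"
proof (rule ccontr)
  assume nU: "hg Y X f \<notin> U"
  have gU: "graded_right_ideal \<R> U" and max: "\<And>V. graded_right_ideal \<R> V \<Longrightarrow> V \<noteq> carrier \<R> \<Longrightarrow> U \<subseteq> V \<Longrightarrow> V = U"
    using U unfolding gr_maximal_right_ideal_def by blast+
  have fH: "f \<in> Hom X Y" by (rule rad_hom_mod_hom[OF f])
  note F = right_ideal_part[OF gU]
  note D = right_familyD[OF F(1)]
  \<comment> \<open>The family of U + f R. Right multiples of f have target Y, so only the
    subfunctor at Y is enlarged.\<close>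
  define G where "G (W :: ('a, 'm) module) (Z :: ('a, 'm) module) = (if Z = Y then {hom_plus W Y u (hom_comp W f k) | u k. u \<in> part U W Y \<and> k \<in> Hom W X} else part U W Z)" for W Z
  have GY: "hom_plus W Y u (hom_comp W f k) \<in> G W Y" if "u \<in> part U W Y" "k \<in> Hom W X" for W u k
    using that by (auto simp: G_def)
  have "right_closed Z (\<lambda>W. G W Z)" if Z: "Z \<in> \<C>" for Z
  proof (cases "Z = Y")
    case False
    then show ?thesis using F(1) Z by (simp add: G_def right_family_def)
  next
    case True
    have fk: "hom_comp W f k \<in> Hom W Y" if "W \<in> \<C>" "k \<in> Hom W X" for W k
      by (rule hom_comp_in[OF obj[OF that(1)] that(2) fH])
    have 1: "G W Y \<subseteq> Hom W Y" if W: "W \<in> \<C>" for W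
      using D(1)[OF W C(2)] fk[OF W] hom_plus_in[OF obj[OF W] obj[OF C(2)]] by (auto simp: G_def)
    have 2: "hom_zero W Y \<in> G W Y" if W: "W \<in> \<C>" for W
    proof -
      have "hom_plus W Y (hom_zero W Y) (hom_comp W f (hom_zero W X)) = hom_zero W Y"
        by (simp add: hom_comp_zero_right[OF obj[OF C(1)] obj[OF C(2)] fH] hom_plus_zero[OF W C(2)] obj W C)
      then show ?thesis using GY[OF D(2)[OF W C(2)] hom_zero_in[OF obj[OF W] obj[OF C(1)]]] by simp
    qed
    have 3: "hom_plus W Y a b \<in> G W Y" if W: "W \<in> \<C>" and ab: "a \<in> G W Y" "b \<in> G W Y" for W a b
    proof -
      interpret H: comm_group "hom_group A W Y" by (rule hom_comm_group[OF W C(2)])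
      obtain u k where a: "a = hom_plus W Y u (hom_comp W f k)" "u \<in> part U W Y" "k \<in> Hom W X"
        using ab(1) by (auto simp: G_def)
      obtain v l where b: "b = hom_plus W Y v (hom_comp W f l)" "v \<in> part U W Y" "l \<in> Hom W X"
        using ab(2) by (auto simp: G_def)
      have uv: "u \<in> Hom W Y" "v \<in> Hom W Y" using D(1)[OF W C(2)] a(2) b(2) by auto
      have "hom_plus W Y a b = hom_plus W Y (hom_plus W Y u v) (hom_comp W f (hom_plus W X k l))"
        unfolding a(1) b(1) hom_comp_plus_right[OF a(3) b(3) fH]
        using H.m_ac uv fk[OF W a(3)] fk[OF W b(3)] by (simp add: hom_plus_in obj W C)
      then show ?thesis using GY[OF D(3)[OF W C(2) a(2) b(2)] hom_plus_in[OF obj[OF W] obj[OF C(1)] a(3) b(3)]] by simp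
    qed
    have 4: "hom_comp W a l \<in> G W Y" if V: "V \<in> \<C>" and a: "a \<in> G V Y" and W: "W \<in> \<C>" "l \<in> Hom W V" for V W a l
    proof -
      obtain u k where a: "a = hom_plus V Y u (hom_comp V f k)" "u \<in> part U V Y" "k \<in> Hom V X"
        using a by (auto simp: G_def)
      have "hom_comp W a l = hom_plus W Y (hom_comp W u l) (hom_comp W f (hom_comp W k l))"
        unfolding a(1) hom_comp_plus_left[OF W(2)] hom_comp_assoc[OF W(2)] ..
      then show ?thesis using GY[OF D(4)[OF V C(2) a(2) W] hom_comp_in[OF obj[OF W(1)] W(2) a(3)]] by simp
    qed
    show ?thesis unfolding True right_closed_def by (intro ballI conjI 1 2 3 4)
  qed
  then have G: "right_family G" unfolding right_family_def by blast
  have gG: "graded_right_ideal \<R> (comp_ideal G)" by (rule right_family_ideal[OF G])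
  have "part U W Z \<subseteq> G W Z" if W: "W \<in> \<C>" "Z \<in> \<C>" for W Z
  proof (cases "Z = Y")
    case True
    have "u \<in> G W Y" if u: "u \<in> part U W Y" for u
    proof -
      have "u \<in> Hom W Y" using D(1)[OF W(1) C(2)] u by blast
      then have "hom_plus W Y u (hom_comp W f (hom_zero W X)) = u"
        by (simp add: hom_comp_zero_right[OF obj[OF C(1)] obj[OF C(2)] fH] hom_plus_zero[OF W(1) C(2)])
      then show ?thesis using GY[OF u hom_zero_in[OF obj[OF W(1)] obj[OF C(1)]]] by simp
    qed
    then show ?thesis using True by blast
  qed (simp add: G_def)
  then have UG: "U \<subseteq> comp_ideal G" by (subst F(2)) (rule comp_ideal_mono)
  have "f \<in> G X Y"
    using GY[OF D(2)[OF C] hom_id_in[OF obj[OF C(1)]]] by (simp add: hom_comp_id_right[OF fH] hom_plus_zero[OF C fH])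
  then have "hg Y X f \<in> comp_ideal G" by (intro comp_ideal_hg[OF C fH] right_familyD(2)[OF G])
  then have "comp_ideal G \<noteq> U" using nU by blast
  then have "comp_ideal G = carrier \<R>" using max[OF gG _ UG] by blast
  then have "hg Y Y (hom_id Y) \<in> comp_ideal G" using hg_carrier[OF C(2,2) hom_id_in[OF obj[OF C(2)]]] by simp
  from comp_idealD(2)[OF this C(2,2)] have "hom_id Y \<in> G Y Y" by (simp add: hg_component C)
  then obtain u k where u: "u \<in> part U Y Y" and k: "k \<in> Hom Y X" and id: "hom_id Y = hom_plus Y Y u (hom_comp Y f k)"
    by (auto simp: G_def)
  interpret Y: right_module A Y by (rule obj[OF C(2)])
  have uH: "u \<in> Hom Y Y" using D(1)[OF C(2,2)] u by blast
  have fk: "hom_comp Y f k \<in> Hom Y Y" by (rule hom_comp_in[OF obj[OF C(2)] k fH])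
  have "u = (\<lambda>x\<in>carrier Y. x \<oplus>\<^sub>Y \<ominus>\<^sub>Y hom_comp Y f k x)"
  proof (rule extensionalityI[OF mod_hom_extensional[OF uH]])
    fix x assume x: "x \<in> carrier Y"
    have "x = u x \<oplus>\<^sub>Y hom_comp Y f k x" using fun_cong[OF id, of x] x by (simp add: hom_id_def hom_plus_def)
    then have "x \<oplus>\<^sub>Y \<ominus>\<^sub>Y hom_comp Y f k x = (u x \<oplus>\<^sub>Y hom_comp Y f k x) \<oplus>\<^sub>Y \<ominus>\<^sub>Y hom_comp Y f k x" by simp
    also have "\<dots> = u x"
      using mod_hom_closed[OF uH x] mod_hom_closed[OF fk x] by (simp add: Y.M.a_assoc Y.M.r_neg)
    finally show "u x = (\<lambda>x\<in>carrier Y. x \<oplus>\<^sub>Y \<ominus>\<^sub>Y hom_comp Y f k x) x" using x by simp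
  qed simp
  moreover have "bij_betw (\<lambda>x\<in>carrier Y. x \<oplus>\<^sub>Y \<ominus>\<^sub>Y hom_comp Y f k x) (carrier Y) (carrier Y)"
    by (rule one_minus_bijective(2)[OF obj_fg[OF C(2)] fk]) (simp add: rad_homD[OF f k] hom_comp_apply)
  ultimately have "bij_betw u (carrier Y) (carrier Y)" by simp
  then obtain v where v: "v \<in> Hom Y Y" "\<And>y. y \<in> carrier Y \<Longrightarrow> u (v y) = y"
    by (rule inverse_in_mod_hom[OF obj[OF C(2)] uH]) (rule that)
  have "hom_comp Y u v = hom_id Y"
    by (rule mod_hom_eqI[OF hom_comp_in[OF obj[OF C(2)] v(1) uH] hom_id_in[OF obj[OF C(2)]]])
      (simp add: hom_comp_apply v(2) hom_id_def)
  then have "hom_id Y \<in> part U Y Y" using D(4)[OF C(2,2) u C(2) v(1)] by simp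
  from D(4)[OF C(2,2) this C(1) fH] show False using nU by (simp add: hom_comp_id_left[OF fH] part_def)
qed

text \<open>If a component f of u is not radical, some d = 1 - f g kills a nonzero y and has no
  right inverse. It therefore lies in a gr-maximal right ideal that misses the identity of Y. This
  ideal cannot contain u, for it would then contain f g and with it d + f g, the identity.\<close>

lemma gr_radical: "rad_gr \<R> = comp_ideal Rad"
proof
  show "comp_ideal Rad \<subseteq> rad_gr \<R>"
  proof
    fix u assume u: "u \<in> comp_ideal Rad"
    have "u \<in> U" if U: "gr_maximal_right_ideal \<R> U" for U
    proof -
      interpret U: additive_subgroup U \<R>
        using U unfolding gr_maximal_right_ideal_def graded_right_ideal_def by blast
      show ?thesis
        by (rule in_by_components[OF U.zero_closed U.a_subset U.a_closed comp_idealD(1)[OF u]])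
          (simp_all add: Rad_in_gr_maximal[OF U] comp_idealD(2)[OF u])
    qed
    then show "u \<in> rad_gr \<R>" unfolding rad_gr_def using comp_idealD(1)[OF u] by blast
  qed
  show "rad_gr \<R> \<subseteq> comp_ideal Rad"
  proof
    fix u assume u: "u \<in> rad_gr \<R>"
    have uR: "u \<in> carrier \<R>" using u by (simp add: rad_gr_def)
    have "u (Y, X) \<in> Rad X Y" if C: "X \<in> \<C>" "Y \<in> \<C>" for X Y
    proof (rule rad_homI[OF ring_component[OF uR C]], rule ccontr)
      fix g y assume g: "g \<in> Hom Y X" and y: "y \<in> carrier Y" "u (Y, X) (g y) = y" "y \<noteq> \<zero>\<^sub>Y"
      let ?f = "u (Y, X)"
      have fH: "?f \<in> Hom X Y" by (rule ring_component[OF uR C])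
      interpret Y: right_module A Y by (rule obj[OF C(2)])
      note Ym = obj[OF C(2)]
      define c where "c = hom_comp Y ?f g"
      have c: "c \<in> Hom Y Y" unfolding c_def by (rule hom_comp_in[OF Ym g fH])
      have cy: "c y = y" using y by (simp add: c_def hom_comp_apply)
      define d where "d = (\<lambda>x\<in>carrier Y. hom_id Y x \<oplus>\<^sub>Y \<ominus>\<^sub>Y c x)"
      have d: "d \<in> Hom Y Y" unfolding d_def by (rule hom_diff_in[OF Ym Ym hom_id_in[OF Ym] c])
      have dy: "d y = \<zero>\<^sub>Y" using y(1) by (simp add: d_def hom_id_def cy Y.M.r_neg)
      have dc: "hom_plus Y Y d c = hom_id Y"
        by (rule mod_hom_eqI[OF hom_plus_in[OF Ym Ym d c] hom_id_in[OF Ym]])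
          (simp add: hom_plus_def d_def hom_id_def mod_hom_closed[OF c] Y.M.a_assoc Y.M.l_neg)
      \<comment> \<open>At Y the family consists of the right multiples of d; it contains everything
        at the other targets so that \<open>gr_maximal_above\<close> applies.\<close>
      define G where "G (W :: ('a, 'm) module) (Z :: ('a, 'm) module) = (if Z = Y then {hom_comp W d k | k. k \<in> Hom W Y} else Hom W Z)" for W Z
      have "right_closed Z (\<lambda>W. G W Z)" if Z: "Z \<in> \<C>" for Z
      proof (cases "Z = Y")
        case False
        then show ?thesis
          unfolding G_def right_closed_def
          by (simp add: hom_plus_in hom_comp_in[OF obj] hom_zero_in[OF obj obj] obj Z)
      next
        case True
        have "G W Y \<subseteq> Hom W Y" if "W \<in> \<C>" for W
          using hom_comp_in[OF obj[OF that] _ d] by (auto simp: G_def)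
        moreover have "hom_zero W Y \<in> G W Y" if "W \<in> \<C>" for W
          using hom_comp_zero_right[OF Ym Ym d, of W, symmetric] hom_zero_in[OF obj[OF that] Ym] by (auto simp: G_def)
        moreover have "hom_plus W Y a b \<in> G W Y" if W: "W \<in> \<C>" and ab: "a \<in> G W Y" "b \<in> G W Y" for W a b
        proof -
          obtain k l where "a = hom_comp W d k" "k \<in> Hom W Y" "b = hom_comp W d l" "l \<in> Hom W Y"
            using ab by (auto simp: G_def)
          then show ?thesis
            using hom_comp_plus_right[OF _ _ d, of k W l] hom_plus_in[OF obj[OF W] Ym, of k l]
            by (auto simp: G_def intro!: exI[of _ "hom_plus W Y k l"])
        qed
        moreover have "hom_comp W a l \<in> G W Y" if "V \<in> \<C>" "a \<in> G V Y" "W \<in> \<C>" "l \<in> Hom W V" for V W a l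
          using that(2) hom_comp_assoc[OF that(4), of d, symmetric] hom_comp_in[OF obj[OF that(3)] that(4)] by (auto simp: G_def)
        ultimately show ?thesis unfolding True right_closed_def by (intro ballI conjI)
      qed
      then have G: "right_family G" unfolding right_family_def by blast
      note gG = right_family_ideal[OF G]
      have nid: "hg Y Y (hom_id Y) \<notin> comp_ideal G"
      proof
        assume "hg Y Y (hom_id Y) \<in> comp_ideal G"
        from comp_idealD(2)[OF this C(2,2)] have "hom_id Y \<in> G Y Y" by (simp add: hg_component C)
        then obtain k where k: "k \<in> Hom Y Y" "hom_id Y = hom_comp Y d k" by (auto simp: G_def)
        have dk: "d (k x) = x" if "x \<in> carrier Y" for x
          using fun_cong[OF k(2), of x] that by (simp add: hom_id_def hom_comp_apply)
        \<comment> \<open>A right inverse k of d is injective, hence surjective, so d would be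
          injective as well, contrary to d y = 0.\<close>
        have "inj_on k (carrier Y)" by (rule inj_on_inverseI[of _ d]) (rule dk)
        then have "k ` carrier Y = carrier Y" by (rule injective_imp_surjective[OF Ym fg_has_rank[OF obj_fg[OF C(2)]] k(1)])
        then obtain x where x: "x \<in> carrier Y" "y = k x" using y(1) by blast
        then have "x = \<zero>\<^sub>Y" using dk[OF x(1)] dy by simp
        then show False using x(2) y(3) mod_hom_zero[OF Ym Ym k(1)] by simp
      qed
      have top: "hg Z W h \<in> comp_ideal G" if "W \<in> \<C>" "Z \<in> \<C>" "Z \<noteq> Y" "h \<in> Hom W Z" for W Z h
        using that by (intro comp_ideal_hg right_familyD(2)[OF G]) (simp_all add: G_def)
      obtain M where M: "gr_maximal_right_ideal \<R> M" "comp_ideal G \<subseteq> M" "hg Y Y (hom_id Y) \<notin> M"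
        by (rule gr_maximal_above[OF C(2) gG nid top])
      have uM: "u \<in> M" using u M(1) by (simp add: rad_gr_def)
      have gM: "graded_right_ideal \<R> M" using M(1) by (simp add: gr_maximal_right_ideal_def)
      note D = right_familyD[OF right_ideal_part(1)[OF gM] _ C(2)]
      have "u \<in> comp_ideal (part M)" using uM right_ideal_part(2)[OF gM] by simp
      from comp_idealD(2)[OF this C] have "?f \<in> part M X Y" .
      from D(4)[OF C(1) this C(2) g] have cM: "c \<in> part M Y Y" unfolding c_def .
      have "d \<in> G Y Y" using hom_comp_id_right[OF d] hom_id_in[OF Ym] by (auto simp: G_def intro!: exI[of _ "hom_id Y"])
      then have "hg Y Y d \<in> comp_ideal G" by (intro comp_ideal_hg[OF C(2,2) d] right_familyD(2)[OF G])
      then have "d \<in> part M Y Y" using M(2) d by (auto simp: part_def)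
      from D(3)[OF C(2) this cM] show False using M(3) unfolding dc by (simp add: part_def)
    qed
    then show "u \<in> comp_ideal Rad" using uR by (simp add: comp_ideal_def)
  qed
qed

section \<open>Powers of the graded radical and the nilpotency conditions\<close>

lemma rad_power_family: "right_family (rad_power n)" "left_family (rad_power n)"
  unfolding right_family_def left_family_def
  using right_closed_rad_power left_closed_rad_power by auto

lemma rad_power_compose_right:
  assumes "X \<in> \<C>" "Y \<in> \<C>" "Z \<in> \<C>" "f \<in> rad_power n Z Y" "g \<in> Rad X Z"
  shows "hom_comp X f g \<in> rad_power (Suc n) X Y"
  using assms(4) unfolding rad_power_def
  by (rule add_closure_comp_right[OF assms(1) rad_hom_mod_hom[OF assms(5)], rotated])
    (use assms in \<open>auto intro!: add_closure_base\<close>)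

text \<open>The exponents are shifted by one because \<open>rad_power 0\<close> is the radical
  itself. Components of a product of ideals are sums of composites with one more radical factor;
  conversely, each such composite is a product of two homogeneous elements.\<close>

lemma ideal_power_rad: "ideal_power \<R> (rad_gr \<R>) (Suc n) = comp_ideal (rad_power n)"
proof (induction n)
  case 0
  show ?case using rad_power_0 by (simp add: gr_radical comp_ideal_def)
next
  case (Suc n)
  let ?I = "ideal_prod \<R> (comp_ideal (rad_power n)) (comp_ideal Rad)"
  note D = right_familyD[OF rad_power_family(1)]
  have sub: "?I \<subseteq> comp_ideal (rad_power (Suc n))"
  proof
    fix w assume "w \<in> ?I"
    then show "w \<in> comp_ideal (rad_power (Suc n))"
    proof (induction rule: ideal_prod.induct)
      case (prod u v)
      have "(u \<otimes>\<^sub>\<R> v) (Z, X) \<in> rad_power (Suc n) X Z" if C: "X \<in> \<C>" "Z \<in> \<C>" for X Z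
        by (intro mult_component_in[OF C] D(1-3) C rad_power_compose_right[OF C _
            comp_idealD(2)[OF prod(1) _ C(2)] comp_idealD(2)[OF prod(2) C(1)]]) assumption+
      then show ?case using mult_closed[OF comp_idealD(1)[OF prod(1)] comp_idealD(1)[OF prod(2)]] by (simp add: comp_ideal_def)
    next
      case (sum u v)
      then show ?case by (auto simp: comp_ideal_def ring_add rad_power_plus)
    qed
  qed
  have zeroC: "hom_zero X Y \<in> Rad X Y" if "X \<in> \<C>" "Y \<in> \<C>" for X Y
    by (rule rad_hom_zero[OF obj obj]) (rule that)+
  \<comment> \<open>\<open>ideal_prod\<close> contains no empty sum, so zero is obtained as the
    product of zero with itself.\<close>
  have zero: "\<zero>\<^sub>\<R> \<in> ?I"
  proof -
    have z: "\<zero>\<^sub>\<R> \<in> comp_ideal (rad_power n)" "\<zero>\<^sub>\<R> \<in> comp_ideal Rad"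
      by (simp_all add: comp_ideal_def ring_zero rad_power_zero zeroC)
    have "\<zero>\<^sub>\<R> \<otimes>\<^sub>\<R> \<zero>\<^sub>\<R> = \<zero>\<^sub>\<R>"
    proof (rule ring_eqI)
      fix X Y assume C: "X \<in> \<C>" "Y \<in> \<C>"
      have "(\<zero>\<^sub>\<R> \<otimes>\<^sub>\<R> \<zero>\<^sub>\<R>) (Y, X) = hom_comp X (hom_zero X Y) (hom_zero X X)"
        using mult_component_single[OF C(1,1,2) R.zero_closed R.zero_closed] C by (simp add: ring_zero)
      then show "(\<zero>\<^sub>\<R> \<otimes>\<^sub>\<R> \<zero>\<^sub>\<R>) (Y, X) = \<zero>\<^sub>\<R> (Y, X)"
        using hom_comp_zero_left[OF hom_zero_in[OF obj obj]] C by (simp add: ring_zero)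
    qed simp_all
    then show ?thesis using ideal_prod.prod[OF z, of \<R>] by simp
  qed
  have "hg Y X f \<in> ?I" if C: "X \<in> \<C>" "Y \<in> \<C>" and f: "f \<in> rad_power (Suc n) X Y" for X Y f
    using f[unfolded rad_power_def]
  proof (induction rule: add_closure.induct)
    case add_closure_zero
    show ?case unfolding hg_zero by (rule zero)
  next
    case (add_closure_base f)
    then obtain a b Z where f: "f = hom_comp X a b" "Z \<in> \<C>" "a \<in> rad_comp n Z Y" "b \<in> Rad X Z" by auto
    have a: "a \<in> rad_power n Z Y" "a \<in> Hom Z Y" by (rule rad_power_base[OF f(3)], rule rad_comp_Hom[OF f(2) C(2) f(3)])
    have b: "b \<in> Hom X Z" by (rule rad_hom_mod_hom[OF f(4)])
    have "hg Y Z a \<in> comp_ideal (rad_power n)" by (intro comp_ideal_hg f(2) C a rad_power_zero)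
    moreover have "hg Z X b \<in> comp_ideal Rad" by (intro comp_ideal_hg f(2,4) C b zeroC)
    ultimately have "hg Y Z a \<otimes>\<^sub>\<R> hg Z X b \<in> ?I" by (rule ideal_prod.prod)
    then show ?case by (simp only: hg_mult[OF C(1) f(2) C(2) b a(2)] f(1))
  next
    case (add_closure_plus f g)
    then show ?case unfolding hg_plus[OF C] by (intro ideal_prod.sum)
  qed
  note hg = this
  have carrier: "?I \<subseteq> carrier \<R>" using sub comp_idealD(1) by blast
  have "u \<in> ?I" if u: "u \<in> comp_ideal (rad_power (Suc n))" for u
    by (rule in_by_components[OF zero carrier ideal_prod.sum comp_idealD(1)[OF u] hg[OF _ _ comp_idealD(2)[OF u]]])
  then have "comp_ideal (rad_power (Suc n)) \<subseteq> ?I" by (rule subsetI)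
  with sub have "?I = comp_ideal (rad_power (Suc n))" by (rule equalityI)
  then show ?case unfolding ideal_power.simps Suc.IH unfolding gr_radical .
qed

lemma ex_ge_1_iff: "(\<exists>n\<ge>1::nat. P n) \<longleftrightarrow> (\<exists>n. P (Suc n))"
  by (metis Suc_le_D One_nat_def le_add1 plus_1_eq_Suc)

lemma nilpotent_iff: "nilpotent_ideal \<R> (rad_gr \<R>) \<longleftrightarrow>
    (\<exists>n. \<forall>X\<in>\<C>. \<forall>Y\<in>\<C>. rad_power n X Y = {hom_zero X Y})"
  unfolding nilpotent_ideal_def ex_ge_1_iff ideal_power_rad
  using comp_ideal_zero_iff[OF rad_power_Hom rad_power_zero] by simp

text \<open>The local unit on the left selects the target, so the exponent depends on the target
  only.\<close>

lemma right_objectwise_nilpotent_iff: "right_objectwise_nilpotent \<R> (rad_gr \<R>) \<longleftrightarrow>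
    (\<forall>Y\<in>\<C>. \<exists>n. \<forall>X\<in>\<C>. rad_power n X Y = {hom_zero X Y})"
proof -
  have "comp_ideal (\<lambda>X Y. if Y = E then rad_power n X Y else {hom_zero X Y}) = {\<zero>\<^sub>\<R>} \<longleftrightarrow>
      (\<forall>X\<in>\<C>. rad_power n X E = {hom_zero X E})" if "E \<in> \<C>" for n E
    by (subst comp_ideal_zero_iff) (use that rad_power_Hom rad_power_zero hom_zero_in obj in auto)
  then show ?thesis
    unfolding right_objectwise_nilpotent_def ex_ge_1_iff ideal_power_rad idents_eq
    using right_unit_ideal[OF _ rad_power_zero] by auto
qed

text \<open>The local unit on the right selects the source, so the exponent depends on the source
  only.\<close>

lemma left_objectwise_nilpotent_iff: "left_objectwise_nilpotent \<R> (rad_gr \<R>) \<longleftrightarrow>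
    (\<forall>X\<in>\<C>. \<exists>n. \<forall>Y\<in>\<C>. rad_power n X Y = {hom_zero X Y})"
proof -
  have "comp_ideal (\<lambda>X Y. if X = E then rad_power n X Y else {hom_zero X Y}) = {\<zero>\<^sub>\<R>} \<longleftrightarrow>
      (\<forall>Y\<in>\<C>. rad_power n E Y = {hom_zero E Y})" if "E \<in> \<C>" for n E
    by (subst comp_ideal_zero_iff) (use that rad_power_Hom rad_power_zero hom_zero_in obj in auto)
  then show ?thesis
    unfolding left_objectwise_nilpotent_def ex_ge_1_iff ideal_power_rad idents_eq
    using left_unit_ideal[OF _ rad_power_zero] by auto
qed

text \<open>An intersection of componentwise ideals is again componentwise, so the condition
  concerns each Hom space separately.\<close>

lemma intersection_iff: "(\<Inter>n \<in> {1..}. ideal_power \<R> (rad_gr \<R>) n) = {\<zero>\<^sub>\<R>} \<longleftrightarrow>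
    (\<forall>X\<in>\<C>. \<forall>Y\<in>\<C>. (\<Inter>n. rad_power n X Y) = {hom_zero X Y})"
proof -
  have "(\<Inter>n \<in> {1..}. ideal_power \<R> (rad_gr \<R>) n) = (\<Inter>n. ideal_power \<R> (rad_gr \<R>) (Suc n))"
  proof -
    have "{1..} = range Suc" using Suc_le_D by fastforce
    then show ?thesis by (simp add: image_image)
  qed
  also have "\<dots> = comp_ideal (\<lambda>X Y. \<Inter>n. rad_power n X Y)"
    unfolding ideal_power_rad by (auto simp: comp_ideal_def)
  finally have eq: "(\<Inter>n \<in> {1..}. ideal_power \<R> (rad_gr \<R>) n) = comp_ideal (\<lambda>X Y. \<Inter>n. rad_power n X Y)" .
  have "(\<Inter>n. rad_power n X Y) \<subseteq> Hom X Y" if "X \<in> \<C>" "Y \<in> \<C>" for X Y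
    using rad_power_Hom[OF that] by (intro INF_lower2[where i = 0]) simp_all
  then show ?thesis unfolding eq by (intro comp_ideal_zero_iff) (simp_all add: rad_power_zero)
qed

section \<open>The artinian conditions\<close>

lemma artinian_if_finite:
  assumes fin: "finite Ind" shows "right_artinian \<R>" "left_artinian \<R>"
proof -
  have "\<not> ((\<forall>n. graded_right_ideal \<R> (U n) \<and>
      U n \<subseteq> {local_unit \<R> (E, E) \<otimes>\<^sub>\<R> r | r. r \<in> carrier \<R>}) \<and> (\<forall>n. U (Suc n) \<subset> U n))"
    if E: "E \<in> \<C>" for E U
  proof
    assume "(\<forall>n. graded_right_ideal \<R> (U n) \<and>
      U n \<subseteq> {local_unit \<R> (E, E) \<otimes>\<^sub>\<R> r | r. r \<in> carrier \<R>}) \<and> (\<forall>n. U (Suc n) \<subset> U n)"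
    then have U: "\<And>n. graded_right_ideal \<R> (U n)"
      and sub: "\<And>n. U n \<subseteq> {local_unit \<R> (E, E) \<otimes>\<^sub>\<R> r | r. r \<in> carrier \<R>}"
      and dec: "\<And>n. U (Suc n) \<subset> U n" by blast+
    note D = right_familyD[OF right_ideal_part(1)[OF U]]
    have "U n \<subseteq> comp_ideal (\<lambda>X Y. if Y = E then Hom X Y else {hom_zero X Y})" for n
      using sub[of n] unfolding carrier_eq_comp_ideal by (subst (asm) right_unit_ideal[OF E]) (simp_all add: obj)
    then have le: "comp_ideal (part (U n)) \<subseteq> comp_ideal (\<lambda>X Y. if Y = E then Hom X Y else {hom_zero X Y})" for n
      using right_ideal_part(2)[OF U[of n]] by simp
    \<comment> \<open>A graded right ideal inside 1_E R vanishes at all targets other than E and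
      thus amounts to one subfunctor of Hom(-, E).\<close>
    have z: "part (U n) X Y \<subseteq> (if Y = E then Hom X Y else {hom_zero X Y})" if C: "X \<in> \<C>" "Y \<in> \<C>" for n X Y
      by (rule comp_ideal_subsetD[OF le _ _ C]) (rule D; assumption)+
    have mono: "part (U (Suc n)) X Y \<subseteq> part (U n) X Y" for n X Y using dec[of n] by (auto simp: part_def)
    obtain n where n: "\<forall>X\<in>\<C>. part (U (Suc n)) X E = part (U n) X E"
      using right_chain_stabilizes[where F = "\<lambda>n X. part (U n) X E", OF fin E] right_ideal_part(1)[OF U] E mono
      unfolding right_family_def by blast
    have "part (U n) X Y \<subseteq> part (U (Suc n)) X Y" if C: "X \<in> \<C>" "Y \<in> \<C>" for X Y
    proof (cases "Y = E")
      case False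
      then show ?thesis using z[OF C, of n] D(2)[OF C, of "Suc n"] by auto
    qed (use n C in simp)
    then have "comp_ideal (part (U n)) \<subseteq> comp_ideal (part (U (Suc n)))" by (rule comp_ideal_mono)
    then have "U n \<subseteq> U (Suc n)" using right_ideal_part(2)[OF U] by simp
    then show False using dec[of n] by blast
  qed
  then show "right_artinian \<R>" unfolding right_artinian_def idents_eq by blast
  have "\<not> ((\<forall>n. graded_left_ideal \<R> (U n) \<and>
      U n \<subseteq> {r \<otimes>\<^sub>\<R> local_unit \<R> (E, E) | r. r \<in> carrier \<R>}) \<and> (\<forall>n. U (Suc n) \<subset> U n))"
    if E: "E \<in> \<C>" for E U
  proof
    assume "(\<forall>n. graded_left_ideal \<R> (U n) \<and>
      U n \<subseteq> {r \<otimes>\<^sub>\<R> local_unit \<R> (E, E) | r. r \<in> carrier \<R>}) \<and> (\<forall>n. U (Suc n) \<subset> U n)"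
    then have U: "\<And>n. graded_left_ideal \<R> (U n)"
      and sub: "\<And>n. U n \<subseteq> {r \<otimes>\<^sub>\<R> local_unit \<R> (E, E) | r. r \<in> carrier \<R>}"
      and dec: "\<And>n. U (Suc n) \<subset> U n" by blast+
    note D = left_familyD[OF left_ideal_part(1)[OF U]]
    have "U n \<subseteq> comp_ideal (\<lambda>X Y. if X = E then Hom X Y else {hom_zero X Y})" for n
      using sub[of n] unfolding carrier_eq_comp_ideal by (subst (asm) left_unit_ideal[OF E]) (simp_all add: obj)
    then have le: "comp_ideal (part (U n)) \<subseteq> comp_ideal (\<lambda>X Y. if X = E then Hom X Y else {hom_zero X Y})" for n
      using left_ideal_part(2)[OF U[of n]] by simp
    have z: "part (U n) X Y \<subseteq> (if X = E then Hom X Y else {hom_zero X Y})" if C: "X \<in> \<C>" "Y \<in> \<C>" for n X Y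
      by (rule comp_ideal_subsetD[OF le _ _ C]) (rule D; assumption)+
    have mono: "part (U (Suc n)) X Y \<subseteq> part (U n) X Y" for n X Y using dec[of n] by (auto simp: part_def)
    obtain n where n: "\<forall>Y\<in>\<C>. part (U (Suc n)) E Y = part (U n) E Y"
      using left_chain_stabilizes[where F = "\<lambda>n Y. part (U n) E Y", OF fin E] left_ideal_part(1)[OF U] E mono
      unfolding left_family_def by blast
    have "part (U n) X Y \<subseteq> part (U (Suc n)) X Y" if C: "X \<in> \<C>" "Y \<in> \<C>" for X Y
    proof (cases "X = E")
      case False
      then show ?thesis using z[OF C, of n] D(2)[OF C, of "Suc n"] by auto
    qed (use n C in simp)
    then have "comp_ideal (part (U n)) \<subseteq> comp_ideal (part (U (Suc n)))" by (rule comp_ideal_mono)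
    then have "U n \<subseteq> U (Suc n)" using left_ideal_part(2)[OF U] by simp
    then show False using dec[of n] by blast
  qed
  then show "left_artinian \<R>" unfolding left_artinian_def idents_eq by blast
qed

text \<open>The chain condition is applied to the parts of the radical powers with target E. Where
  this chain is stationary, Nakayama's argument makes the power vanish.\<close>

lemma right_artinian_imp:
  assumes art: "right_artinian \<R>" and E: "E \<in> \<C>"
  shows "\<exists>n. \<forall>X\<in>\<C>. rad_power n X E = {hom_zero X E}"
proof -
  \<comment> \<open>The family of 1_E times the power with exponent n + 1 of the graded
    radical.\<close>
  define F where "F n X Y = (if Y = E then rad_power n X Y else {hom_zero X Y})" for n X Y
  have F1: "F n X Y \<subseteq> Hom X Y" "hom_zero X Y \<in> F n X Y" if "X \<in> \<C>" "Y \<in> \<C>" for n X Y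
    using that rad_power_Hom by (auto simp: F_def rad_power_zero obj)
  have "right_closed Y (\<lambda>X. F n X Y)" if Y: "Y \<in> \<C>" for n Y
  proof (cases "Y = E")
    case True
    then show ?thesis using right_closed_rad_power[OF E] by (simp add: F_def)
  next
    case False
    then show ?thesis using Y
      by (simp add: F_def right_closed_def obj hom_plus_zero hom_comp_zero_left)
  qed
  then have fam: "right_family (F n)" for n by (simp add: right_family_def)
  have no: "\<not> (\<exists>U. (\<forall>n. graded_right_ideal \<R> (U n) \<and>
      U n \<subseteq> {local_unit \<R> (E, E) \<otimes>\<^sub>\<R> r | r. r \<in> carrier \<R>}) \<and> (\<forall>n. U (Suc n) \<subset> U n))"
    using art E unfolding right_artinian_def idents_eq by blast
  have below: "comp_ideal (F n) \<subseteq> {local_unit \<R> (E, E) \<otimes>\<^sub>\<R> r | r. r \<in> carrier \<R>}" for n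
    unfolding carrier_eq_comp_ideal
    by (subst right_unit_ideal[OF E], simp add: obj, rule comp_ideal_mono)
      (use rad_power_Hom in \<open>auto simp: F_def\<close>)
  have dec: "comp_ideal (F (Suc n)) \<subseteq> comp_ideal (F n)" for n
    by (rule comp_ideal_mono) (use rad_power_Suc_le in \<open>auto simp: F_def\<close>)
  have "\<exists>n. \<not> comp_ideal (F (Suc n)) \<subset> comp_ideal (F n)"
  proof (rule ccontr)
    assume "\<nexists>n. \<not> comp_ideal (F (Suc n)) \<subset> comp_ideal (F n)"
    then have all: "\<forall>n. comp_ideal (F (Suc n)) \<subset> comp_ideal (F n)" by blast
    show False
      by (rule notE[OF no], intro exI[of _ "\<lambda>n. comp_ideal (F n)"] conjI allI right_family_ideal fam below)
        (rule spec[OF all])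
  qed
  then obtain n where le: "comp_ideal (F n) \<subseteq> comp_ideal (F (Suc n))" using dec by (auto simp: psubset_eq)
  have sub: "F n X Y \<subseteq> F (Suc n) X Y" if "X \<in> \<C>" "Y \<in> \<C>" for X Y
    by (rule comp_ideal_subsetD[OF le _ _ that]) (rule F1; assumption)+
  have "rad_power n X E \<subseteq> rad_power (Suc n) X E" if "X \<in> \<C>" for X
    using sub[OF that E] by (simp add: F_def)
  then show ?thesis using nakayama_right[OF E] by blast
qed

text \<open>The same chain with E as the source, combined with the covariant form of Nakayama's
  argument.\<close>

lemma left_artinian_imp:
  assumes art: "left_artinian \<R>" and E: "E \<in> \<C>"
  shows "\<exists>n. \<forall>Y\<in>\<C>. rad_power n E Y = {hom_zero E Y}"
proof -
  define F where "F n X Y = (if X = E then rad_power n X Y else {hom_zero X Y})" for n X Y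
  have F1: "F n X Y \<subseteq> Hom X Y" "hom_zero X Y \<in> F n X Y" if "X \<in> \<C>" "Y \<in> \<C>" for n X Y
    using that rad_power_Hom by (auto simp: F_def rad_power_zero obj)
  have "left_closed X (F n X)" if X: "X \<in> \<C>" for n X
  proof (cases "X = E")
    case True
    moreover have "F n E = rad_power n E" by (rule ext) (simp add: F_def)
    ultimately show ?thesis using left_closed_rad_power[OF E] by simp
  next
    case False
    then show ?thesis using X
      by (simp add: F_def left_closed_def obj hom_plus_zero hom_comp_zero_right[OF obj obj])
  qed
  then have fam: "left_family (F n)" for n by (simp add: left_family_def)
  have no: "\<not> (\<exists>U. (\<forall>n. graded_left_ideal \<R> (U n) \<and>
      U n \<subseteq> {r \<otimes>\<^sub>\<R> local_unit \<R> (E, E) | r. r \<in> carrier \<R>}) \<and> (\<forall>n. U (Suc n) \<subset> U n))"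
    using art E unfolding left_artinian_def idents_eq by blast
  have below: "comp_ideal (F n) \<subseteq> {r \<otimes>\<^sub>\<R> local_unit \<R> (E, E) | r. r \<in> carrier \<R>}" for n
    unfolding carrier_eq_comp_ideal
    by (subst left_unit_ideal[OF E], simp add: obj, rule comp_ideal_mono)
      (use rad_power_Hom in \<open>auto simp: F_def\<close>)
  have dec: "comp_ideal (F (Suc n)) \<subseteq> comp_ideal (F n)" for n
    by (rule comp_ideal_mono) (use rad_power_Suc_le in \<open>auto simp: F_def\<close>)
  have "\<exists>n. \<not> comp_ideal (F (Suc n)) \<subset> comp_ideal (F n)"
  proof (rule ccontr)
    assume "\<nexists>n. \<not> comp_ideal (F (Suc n)) \<subset> comp_ideal (F n)"
    then have all: "\<forall>n. comp_ideal (F (Suc n)) \<subset> comp_ideal (F n)" by blast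
    show False
      by (rule notE[OF no], intro exI[of _ "\<lambda>n. comp_ideal (F n)"] conjI allI left_family_ideal fam below)
        (rule spec[OF all])
  qed
  then obtain n where le: "comp_ideal (F n) \<subseteq> comp_ideal (F (Suc n))" using dec by (auto simp: psubset_eq)
  have sub: "F n X Y \<subseteq> F (Suc n) X Y" if "X \<in> \<C>" "Y \<in> \<C>" for X Y
    by (rule comp_ideal_subsetD[OF le _ _ that]) (rule F1; assumption)+
  have "rad_power n E Y \<subseteq> rad_power (Suc n) E Y" if "Y \<in> \<C>" for Y
    using sub[OF E that] by (simp add: F_def)
  then show ?thesis using nakayama_left[OF E] by blast
qed

text \<open>Each condition is brought back to a vanishing power on the pair P, I: the right ones are
  used at the target I, the left ones at the source P, and the intersection condition through the
  finite dimension of Hom(P, I). In the other direction, finiteness of \<open>Ind\<close> gives one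
  exponent for all objects.\<close>

lemma equivalences:
  shows "representation_finite A \<longleftrightarrow> right_artinian \<R>"
    and "representation_finite A \<longleftrightarrow> left_artinian \<R>"
    and "representation_finite A \<longleftrightarrow> nilpotent_ideal \<R> (rad_gr \<R>)"
    and "representation_finite A \<longleftrightarrow> right_objectwise_nilpotent \<R> (rad_gr \<R>)"
    and "representation_finite A \<longleftrightarrow> left_objectwise_nilpotent \<R> (rad_gr \<R>)"
    and "representation_finite A \<longleftrightarrow> (\<Inter>n \<in> {1..}. ideal_power \<R> (rad_gr \<R>) n) = {\<zero>\<^sub>\<R>}"
proof -
  obtain P I where PI: "P \<in> \<C>" "I \<in> \<C>" and vanish: "\<And>n. rad_power n P I = {hom_zero P I} \<Longrightarrow> finite Ind"
    by (rule finite_Ind_if_rad_power_vanishes) (rule that)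
  have nil: "\<exists>n. \<forall>X\<in>\<C>. \<forall>Y\<in>\<C>. rad_power n X Y = {hom_zero X Y}" if fin: "finite Ind"
    by (rule finite_Ind_imp_nilpotent[OF fin]) (intro exI ballI, assumption)
  have int: "finite Ind" if "(\<Inter>n. rad_power n P I) = {hom_zero P I}"
    by (rule rad_power_intersection[OF PI that]) (rule vanish)
  have nil_int: "(\<Inter>n. rad_power n X Y) = {hom_zero X Y}"
    if "rad_power m X Y = {hom_zero X Y}" for m X Y
  proof
    show "(\<Inter>n. rad_power n X Y) \<subseteq> {hom_zero X Y}" unfolding that[symmetric] by (rule INF_lower) simp
  qed (simp add: rad_power_zero)
  show "representation_finite A \<longleftrightarrow> right_artinian \<R>"
    unfolding representation_finite_iff using artinian_if_finite(1) right_artinian_imp[OF _ PI(2)] vanish PI(1) by blast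
  show "representation_finite A \<longleftrightarrow> left_artinian \<R>"
    unfolding representation_finite_iff using artinian_if_finite(2) left_artinian_imp[OF _ PI(1)] vanish PI(2) by blast
  show "representation_finite A \<longleftrightarrow> nilpotent_ideal \<R> (rad_gr \<R>)"
    unfolding representation_finite_iff nilpotent_iff using nil vanish PI by blast
  show "representation_finite A \<longleftrightarrow> right_objectwise_nilpotent \<R> (rad_gr \<R>)"
    unfolding representation_finite_iff right_objectwise_nilpotent_iff using nil vanish PI by blast
  show "representation_finite A \<longleftrightarrow> left_objectwise_nilpotent \<R> (rad_gr \<R>)"
    unfolding representation_finite_iff left_objectwise_nilpotent_iff using nil vanish PI by blast
  show "representation_finite A \<longleftrightarrow> (\<Inter>n \<in> {1..}. ideal_power \<R> (rad_gr \<R>) n) = {\<zero>\<^sub>\<R>}"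
    unfolding representation_finite_iff intersection_iff using nil nil_int int PI by blast
qed

end

theorem proposition8p16:
  fixes K :: "('k, 'x) ring_scheme"
    and A :: "('k, 'a, 'y) module_scheme"
    and \<C> :: "('a, 'm) module set"
  assumes "fin_dim_algebra K A"
    and "is_skeleton A \<C>"
  defines "R \<equiv> skeleton_ring A \<C>"
  defines "J \<equiv> rad_gr R"
  shows "(representation_finite A \<longleftrightarrow> right_artinian R) \<and>
         (representation_finite A \<longleftrightarrow> left_artinian R) \<and>
         (representation_finite A \<longleftrightarrow> nilpotent_ideal R J) \<and>
         (representation_finite A \<longleftrightarrow> right_objectwise_nilpotent R J) \<and>
         (representation_finite A \<longleftrightarrow> left_objectwise_nilpotent R J) \<and>
         (representation_finite A \<longleftrightarrow> (\<Inter>n \<in> {1..}. ideal_power R J n) = {\<zero>\<^bsub>R\<^esub>})"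
proof -
  interpret mod_skeleton K A \<C>
    using assms(1,2) by (intro mod_skeleton.intro mod_skeleton_axioms.intro)
  show ?thesis unfolding R_def J_def by (intro conjI equivalences)
qed

end
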